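(* For every integer $d\ge 45$ there exists a (not necessarily invariant) Poisson hard sphere process $\Gamma$ in $\mathbb{R}^d$ which percolates almost surely and which moreover satisfies: (i) if $I$ denotes the (random) union of all unbounded clusters of $\Gamma$, then $\lim_{a\to\infty}\mathbf{E}\,\mathcal{D}(I^{\{a\}})=1$; (ii) there is a constant $K=K(d)<\infty$ such that almost surely $\Gamma(\mathbb{R}^d\times(K,\infty))=0$, i.e. there are no spheres of radius greater than $K$.
   Context: A sphere process is a simple point process $\Lambda$ on $\mathbb{R}^d\times[0,\infty)$; its support is $[\Lambda]=\{(x,r):\Lambda(\{(x,r)\})=1\}$, and $(x,r)\in[\Lambda]$ means there is a sphere (closed ball) of radius $r\ge 0$ centred at $x$. The centre process is $\widetilde\Lambda(\cdot)=\Lambda(\cdot\times[0,\infty))$. $\Lambda$ is a Poisson sphere process if $\widetilde\Lambda$ is a homogeneous Poisson process (of some positive intensity). $\Lambda$ is a hard sphere process if almost surely $\rho(x,y)\ge r+s$ for all distinct $(x,r),(y,s)\in[\Lambda]$, $\rho$ being Euclidean distance. Let $G(\Lambda)=\{y\in\mathbb{R}^d:\rho(y,x)\le r\text{ for some }(x,r)\in[\Lambda]\}$; its connected components are clusters, and $\Lambda$ percolates if some cluster is unbounded. $\mathcal{L}$ is Lebesgue measure on $\mathbb{R}^d$, $B(x,r)=\{y:\rho(x,y)<r\}$. The lower density of $A\subseteq\mathbb{R}^d$ is $\mathcal{D}(A)=\liminf_{r\to\infty}\mathcal{L}(A\cap B(0,r))/\mathcal{L}B(0,r)$. For $s>0$,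 the $s$-neighbourhood of $A$ is $A^{\{s\}}=\bigcup_{x\in A}B(x,s)$. *)

theory Defs
  imports "HOL-Analysis.Analysis" "HOL-Probability.Probability"
begin

(* A realisation of a sphere process is its support [Lambda]: a set of pairs (x,r),
   x the centre in R^d, r >= 0 the radius.  We take as configuration space the sets
   whose centres are locally finite (every bounded region contains finitely many
   centres); simplicity is automatic in the set representation. *)
definition sphere_configs :: "('a::euclidean_space \<times> real) set set" where
  "sphere_configs = {S. (\<forall>p\<in>S. snd p \<ge> 0) \<and> (\<forall>B. bounded B \<longrightarrow> finite {p\<in>S. fst p \<in> B})}"

definition config_count :: "('a \<times> real) set \<Rightarrow> ('a \<times> real) set \<Rightarrow> nat" where
  "config_count S C = card (S \<inter> C)"

definition sphere_config_space :: "('a::euclidean_space \<times> real) set measure" where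
  "sphere_config_space = sigma sphere_configs
     {{S \<in> sphere_configs. config_count S C = k} | C k. C \<in> sets borel \<and> bounded C}"

definition centre_count :: "('a \<times> real) set \<Rightarrow> 'a set \<Rightarrow> nat" where
  "centre_count S A = card {p\<in>S. fst p \<in> A}"

definition poisson_sphere_process :: "('a::euclidean_space \<times> real) set measure \<Rightarrow> bool" where
  "poisson_sphere_process P \<longleftrightarrow>
     (\<exists>lam::real. lam > 0 \<and>
       (\<forall>(n::nat) (A :: nat \<Rightarrow> 'a set).
          (\<forall>i<n. A i \<in> sets lborel \<and> bounded (A i)) \<and> disjoint_family_on A {..<n} \<longrightarrow>
            prob_space.indep_vars P (\<lambda>_. count_space UNIV) (\<lambda>i S. centre_count S (A i)) {..<n} \<and>
            (\<forall>i<n. \<forall>k::nat. measure P {S \<in> space P. centre_count S (A i) = k}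
                 = (lam * measure lborel (A i)) ^ k / fact k * exp (- (lam * measure lborel (A i))))))"

definition hard_sphere_process :: "('a::euclidean_space \<times> real) set measure \<Rightarrow> bool" where
  "hard_sphere_process P \<longleftrightarrow>
     (AE S in P. \<forall>p\<in>S. \<forall>q\<in>S. p \<noteq> q \<longrightarrow> dist (fst p) (fst q) \<ge> snd p + snd q)"

definition occupied :: "('a::euclidean_space \<times> real) set \<Rightarrow> 'a set" where
  "occupied S = (\<Union>p\<in>S. cball (fst p) (snd p))"

definition percolates :: "('a::euclidean_space \<times> real) set \<Rightarrow> bool" where
  "percolates S \<longleftrightarrow> (\<exists>C\<in>components (occupied S). \<not> bounded C)"

definition unbounded_clusters :: "('a::euclidean_space \<times> real) set \<Rightarrow> 'a set" where
  "unbounded_clusters S = \<Union>{C \<in> components (occupied S). \<not> bounded C}"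

definition nbhd :: "'a::metric_space set \<Rightarrow> real \<Rightarrow> 'a set" where
  "nbhd A s = (\<Union>x\<in>A. ball x s)"

definition lower_density :: "'a::euclidean_space set \<Rightarrow> real" where
  "lower_density A = real_of_ereal (Liminf at_top (\<lambda>r::real.
      ereal (measure lebesgue (A \<inter> ball 0 r) / measure lebesgue (ball (0::'a) r))))"

end

theory Submission
  imports Defs
begin

text \<open>
In dimension at least 45, fix a plane and a square cell in it of side about \<open>0.04\<close>. At a suitable distance, the part
of the annulus \<open>{y. 0.98 \<le> dist x y - r \<le> 1.02}\<close> over such a cell is much larger than a ball of radius \<open>1.02\<close>. The
Poisson intensity can therefore be chosen so small that a ball of radius \<open>1.02\<close> rarely contains a point, but
so large that the annulus between neighbouring cells contains one with probability close to 1. Hence a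
sphere of radius about 1 in one cell can be extended by a touching sphere in the next cell, whose radius
again lies in \<open>[0.98, 1.02]\<close>. Following the edges of a hexagonal lattice in the plane, with cross section a
large bounded strip, this explores a random tree in which each attempt fails with small probability
whatever happened before. A hierarchical block argument then shows that a given lattice site is reached,
and that the tree is infinite, with probability at least \<open>1/2\<close>. Space is tiled by translates of the strip
carrying independent copies; all points not used by a tree get radius 0. Hoeffding's inequality and the
Borel--Cantelli lemma, applied to groups of \<open>n\<close> consecutive strips, bound the density of the places
far from all infinite trees by a quantity tending to 0 with \<open>n\<close>.
\<close>

section \<open>Measurability on the configuration space\<close>

text \<open>Hardness dictates the geometry. Two adjacent cells reached along different branches
  could hold overlapping spheres. Degree three puts the neighbours of a vertex at about 120 degrees,
  so that their cells lie at least two maximal radii apart, and every lattice edge carries a node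
  with only two neighbours: adjacent nodes in use are then consecutive on the tree and their spheres
  touch exactly. A second obstacle is dependence: a step reveals points that the next step must
  avoid. So points are sampled block by block, each attempt concerns fresh blocks, and success of a
  step includes that half of every next candidate region stays free. Failure is then unlikely
  conditionally on everything seen before, and all that the block argument needs is the bound
  epsilon ^ n for n given failures. Dimension enters through one ratio: over a planar square the
  annulus compares with the ball of radius 1.02 essentially by the factor (2.3769 / 1.0404) ^ ((d -
  2) / 2), which pays for the small square. Finally, almost sure statements about the image process
  need measurable events, and unboundedness of a cluster must be read off from counts.\<close>

definition unb :: "('a::euclidean_space \<times> real) set \<Rightarrow> 'a \<times> real \<Rightarrow> bool" where
  "unb S p \<longleftrightarrow> \<not> bounded (connected_component_set (occupied S) (fst p))"

lemma space_config: "space sphere_config_space = sphere_configs"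
  unfolding sphere_config_space_def by (rule space_measure_of) auto

lemma count_event:
  assumes "C \<in> sets borel" "bounded C"
  shows "{S\<in>sphere_configs. config_count S C = k} \<in> sets sphere_config_space"
  unfolding sphere_config_space_def using assms by (intro in_measure_of) auto

lemma configsD:
  assumes "S \<in> sphere_configs"
  shows "p \<in> S \<Longrightarrow> 0 \<le> snd p" "bounded B \<Longrightarrow> finite {p\<in>S. fst p \<in> B}" "bounded C \<Longrightarrow> finite (S \<inter> C)"
proof -
  show 1: "p \<in> S \<Longrightarrow> 0 \<le> snd p" "\<And>B. bounded B \<Longrightarrow> finite {p\<in>S. fst p \<in> B}"
    using assms by (auto simp: sphere_configs_def)
  assume "bounded C"
  then have "finite {p\<in>S. fst p \<in> fst ` C}" by (intro 1 bounded_fst)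
  then show "finite (S \<inter> C)" by (rule rev_finite_subset) auto
qed

text \<open>An unbounded \<open>C\<close> may contain infinitely many points, and
  \<open>card\<close> is then 0, so counts are read only on the pieces of \<open>C\<close> inside
  growing balls.\<close>

lemma hit_event:
  assumes "C \<in> sets borel"
  shows "{S\<in>sphere_configs. S \<inter> C \<noteq> {}} \<in> sets sphere_config_space"
proof -
  have eq: "{S\<in>sphere_configs. S \<inter> C \<noteq> {}} =
    (\<Union>n::nat. sphere_configs - {S\<in>sphere_configs. config_count S (C \<inter> cball 0 (real n)) = 0})"
  proof (intro equalityI subsetI)
    fix S assume S: "S \<in> {S\<in>sphere_configs. S \<inter> C \<noteq> {}}"
    then obtain p where p: "p \<in> S" "p \<in> C" by auto
    obtain n :: nat where n: "norm p \<le> n" using real_arch_simple by blast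
    have "finite (S \<inter> (C \<inter> cball 0 (real n)))" by (rule configsD(3)) (use S in \<open>auto intro: bounded_subset[OF bounded_cball]\<close>)
    moreover have "p \<in> S \<inter> (C \<inter> cball 0 (real n))" using p n by auto
    ultimately have "config_count S (C \<inter> cball 0 (real n)) \<noteq> 0" unfolding config_count_def by (metis card_0_eq empty_iff)
    then show "S \<in> (\<Union>n::nat. sphere_configs - {S\<in>sphere_configs. config_count S (C \<inter> cball 0 (real n)) = 0})"
      using S by (intro UN_I[of n]) auto
  next
    fix S assume "S \<in> (\<Union>n::nat. sphere_configs - {S\<in>sphere_configs. config_count S (C \<inter> cball 0 (real n)) = 0})"
    then obtain n :: nat where "S \<in> sphere_configs" "config_count S (C \<inter> cball 0 (real n)) \<noteq> 0" by auto
    moreover have "S \<inter> C = {} \<Longrightarrow> S \<inter> (C \<inter> cball 0 (real n)) = {}" by blast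
    ultimately show "S \<in> {S\<in>sphere_configs. S \<inter> C \<noteq> {}}" by (auto simp: config_count_def)
  qed
  have "C \<inter> cball 0 (real n) \<in> sets borel" "bounded (C \<inter> cball 0 (real n))" for n
    using assms by (auto intro: bounded_subset[OF bounded_cball])
  then show ?thesis unfolding eq using sets.top[of sphere_config_space] unfolding space_config
    by (intro sets.countable_UN sets.Diff count_event image_subsetI)
qed

text \<open>Bounded sets, so that every member is admissible in \<open>count_event\<close>; it is
  still a basis because a neighbourhood may first be shrunk to a ball.\<close>

definition bbasis :: "'b::{second_countable_topology, metric_space} set set" where
  "bbasis = {A \<in> (SOME B. countable B \<and> topological_basis B). bounded A}"

lemma bbasis:
  shows "countable (bbasis :: 'b::{second_countable_topology, metric_space} set set)"
    and "A \<in> bbasis \<Longrightarrow> open A \<and> bounded (A::'b set)"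
    and "open U \<Longrightarrow> x \<in> U \<Longrightarrow> \<exists>A\<in>bbasis. x \<in> A \<and> A \<subseteq> (U::'b set)"
proof -
  define B where "B = (SOME B::'b set set. countable B \<and> topological_basis B)"
  have B: "countable B" "topological_basis B"
    unfolding B_def using someI_ex[OF ex_countable_basis] by auto
  have e: "bbasis = {A\<in>B. bounded A}" unfolding bbasis_def B_def ..
  show "countable (bbasis :: 'b set set)" unfolding e using B(1) by (rule countable_subset[rotated]) auto
  show "A \<in> bbasis \<Longrightarrow> open A \<and> bounded A" unfolding e using topological_basis_open[OF B(2)] by auto
  assume U: "open U" "x \<in> U"
  obtain A where "A \<in> B" "x \<in> A" "A \<subseteq> U \<inter> ball x 1"
    using topological_basisE[OF B(2), of "U \<inter> ball x 1" x] U by auto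
  then show "\<exists>A\<in>bbasis. x \<in> A \<and> A \<subseteq> U" unfolding e by (auto intro!: bexI[of _ A] intro: bounded_subset[OF bounded_ball])
qed

text \<open>An open set of pairs is a countable union of products of basis sets, and a product
  reduces to two hit events. The two points may coincide; where they must differ, the inequality is
  put into \<open>Qo\<close> or into disjoint \<open>V\<close> and \<open>W\<close>.\<close>

lemma pair_event:
  fixes Qo :: "(('a::euclidean_space \<times> real) \<times> ('a \<times> real)) set"
  assumes "V \<in> sets borel" "W \<in> sets borel" "open Qo"
  shows "{S\<in>sphere_configs. \<exists>p\<in>S \<inter> V. \<exists>q\<in>S \<inter> W. (p, q) \<in> Qo} \<in> sets sphere_config_space"
proof -
  let ?I = "{(A, B). A \<in> bbasis \<and> B \<in> bbasis \<and> A \<times> B \<subseteq> Qo}"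
  have eq: "{S\<in>sphere_configs. \<exists>p\<in>S \<inter> V. \<exists>q\<in>S \<inter> W. (p, q) \<in> Qo} =
    (\<Union>(A, B)\<in>?I. {S\<in>sphere_configs. S \<inter> (V \<inter> A) \<noteq> {}} \<inter> {S\<in>sphere_configs. S \<inter> (W \<inter> B) \<noteq> {}})"
    (is "?L = ?R")
  proof (intro equalityI subsetI)
    fix S assume "S \<in> ?L"
    then obtain p q where S: "S \<in> sphere_configs" "p \<in> S" "p \<in> V" "q \<in> S" "q \<in> W" "(p, q) \<in> Qo" by blast
    obtain U U' where U': "open U" "open U'" "(p, q) \<in> U \<times> U'" "U \<times> U' \<subseteq> Qo"
      by (rule open_prod_elim[OF assms(3) S(6)])
    then have U: "open U" "open U'" "p \<in> U" "q \<in> U'" by auto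
    obtain A where A: "A \<in> bbasis" "p \<in> A" "A \<subseteq> U" using bbasis(3)[OF U(1,3)] by blast
    obtain B where B: "B \<in> bbasis" "q \<in> B" "B \<subseteq> U'" using bbasis(3)[OF U(2,4)] by blast
    have "A \<times> B \<subseteq> U \<times> U'" using A(3) B(3) by (rule Sigma_mono)
    then have I: "(A, B) \<in> ?I" using A(1) B(1) U'(4) by simp
    have "S \<inter> (V \<inter> A) \<noteq> {}" "S \<inter> (W \<inter> B) \<noteq> {}" using S A(2) B(2) by auto
    then show "S \<in> ?R" using S(1) by (intro UN_I[OF I]) simp
  next
    fix S assume "S \<in> ?R"
    then obtain A B where AB: "A \<times> B \<subseteq> Qo" "S \<in> sphere_configs" "S \<inter> (V \<inter> A) \<noteq> {}" "S \<inter> (W \<inter> B) \<noteq> {}" by auto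
    obtain p q where "p \<in> S" "p \<in> V" "p \<in> A" "q \<in> S" "q \<in> W" "q \<in> B" using AB(3,4) by auto
    then have "\<exists>p\<in>S \<inter> V. \<exists>q\<in>S \<inter> W. (p, q) \<in> Qo"
      by (intro bexI[of _ p] bexI[of _ q]) (use AB(1) in auto)
    then show "S \<in> ?L" using AB(2) by simp
  qed
  have "?I \<subseteq> bbasis \<times> bbasis" by auto
  then have "countable ?I" using bbasis(1) by (meson countable_SIGMA countable_subset)
  moreover have "{S\<in>sphere_configs. S \<inter> (V \<inter> A) \<noteq> {}} \<inter> {S\<in>sphere_configs. S \<inter> (W \<inter> B) \<noteq> {}} \<in> sets sphere_config_space"
    if "(A, B) \<in> ?I" for A B
    using that bbasis(2)[of A] bbasis(2)[of B] assms by (intro sets.Int hit_event) auto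
  ultimately show ?thesis unfolding eq by (intro sets.countable_UN'') auto
qed

text \<open>Infinitely many balls meeting a bounded region look there like half-spaces; by compactness of the
  sphere of directions, infinitely many of them share a point.\<close>

lemma infinitely_many_common_point:
  fixes c :: "nat \<Rightarrow> 'a::euclidean_space"
  assumes "filterlim (\<lambda>n. norm (c n)) at_top sequentially" "\<And>n. norm (c n) \<le> r n + R" "0 \<le> R"
  shows "\<exists>z (f :: nat \<Rightarrow> nat). strict_mono f \<and> (\<forall>n. z \<in> cball (c (f n)) (r (f n)))"
proof -
  define u where "u n = c n /\<^sub>R norm (c n)" for n
  have "u n \<in> cball 0 1" for n by (cases "c n = 0") (auto simp: u_def)
  then obtain l f where f: "strict_mono f" "(u \<circ> f) \<longlonglongrightarrow> l"
    using compact_cball[of "0::'a" 1] unfolding compact_def by meson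
  have lim: "filterlim (\<lambda>n. norm (c (f n))) at_top sequentially"
    by (rule filterlim_compose[OF assms(1) filterlim_subseq[OF f(1)]])
  have "\<forall>\<^sub>F n in sequentially. norm (c (f n)) > 0"
    using lim unfolding filterlim_at_top_dense by blast
  then have nu: "\<forall>\<^sub>F n in sequentially. norm (u (f n)) = 1"
    by eventually_elim (simp add: u_def)
  have "(\<lambda>n. norm (u (f n))) \<longlonglongrightarrow> norm l" using tendsto_norm[OF f(2)] by (simp add: comp_def)
  then have nl: "norm l = 1" using tendsto_unique[OF _ _ tendsto_eventually[OF nu]] by auto
  have "(\<lambda>n. u (f n) \<bullet> l) \<longlonglongrightarrow> l \<bullet> l" using f(2) by (auto intro!: tendsto_intros simp: comp_def)
  then have "\<forall>\<^sub>F n in sequentially. u (f n) \<bullet> l > 1/2" using nl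
    by (intro order_tendstoD(1)) (auto simp: dot_square_norm)
  \<comment> \<open>Once the direction of \<open>c\<close> has inner product above 1/2 with
    \<open>l\<close>, moving by \<open>s\<close> along \<open>l\<close> shortens the distance to
    \<open>c\<close> by about s/2 = R + 1, up to an error that vanishes for distant
    \<open>c\<close>; this beats \<open>R\<close>.\<close>
  moreover define s where "s = 2 * R + 2"
  have "\<forall>\<^sub>F n in sequentially. norm (c (f n)) > s\<^sup>2 + R"
    using lim unfolding filterlim_at_top_dense by blast
  ultimately have "\<forall>\<^sub>F n in sequentially. s *\<^sub>R l \<in> cball (c (f n)) (r (f n))"
  proof eventually_elim
    case (elim n)
    let ?t = "norm (c (f n))"
    have t: "?t > 0" "?t \<ge> R" using elim assms(3) by (smt (verit) zero_le_power2)+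
    have cu: "c (f n) = ?t *\<^sub>R u (f n)" using t by (simp add: u_def)
    have cl: "c (f n) \<bullet> l = ?t * (u (f n) \<bullet> l)" by (subst cu) simp
    have "(norm (c (f n) - s *\<^sub>R l))\<^sup>2 = ?t\<^sup>2 - 2 * s * (c (f n) \<bullet> l) + s\<^sup>2 * (l \<bullet> l)"
      unfolding power2_norm_eq_inner
      by (simp add: inner_diff_left inner_diff_right inner_commute power2_eq_square algebra_simps)
    also have "\<dots> = ?t\<^sup>2 - 2 * ?t * (s * (u (f n) \<bullet> l)) + s\<^sup>2" using nl by (simp add: cl dot_square_norm)
    also have "\<dots> \<le> ?t\<^sup>2 - 2 * ?t * (s * (1/2)) + s\<^sup>2"
      using elim t assms(3) by (simp add: s_def mult_left_mono)
    also have "\<dots> \<le> (?t - R)\<^sup>2"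
    proof -
      have "s\<^sup>2 \<le> ?t" using elim assms(3) by simp
      moreover have "2 * ?t * (s * (1/2)) = 2 * ?t * R + 2 * ?t" by (simp add: s_def algebra_simps)
      moreover have "(?t - R)\<^sup>2 = ?t\<^sup>2 - 2 * ?t * R + R\<^sup>2" by (simp add: power2_diff)
      ultimately show ?thesis using t(1) zero_le_power2[of R] by linarith
    qed
    finally have "norm (c (f n) - s *\<^sub>R l) \<le> ?t - R" by (rule power2_le_imp_le) (use t in simp)
    then show ?case using assms(2)[of "f n"] by (simp add: dist_norm)
  qed
  then obtain N where N: "\<And>n. n \<ge> N \<Longrightarrow> s *\<^sub>R l \<in> cball (c (f n)) (r (f n))"
    by (auto simp: eventually_sequentially)
  have "strict_mono (\<lambda>n. f (n + N))" using f(1) by (simp add: strict_mono_def)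
  moreover have "\<forall>n. s *\<^sub>R l \<in> cball (c (f (n + N))) (r (f (n + N)))" using N by simp
  ultimately show ?thesis by blast
qed

lemma cballs_meet:
  fixes x y :: "'a::euclidean_space"
  assumes "dist x y \<le> r + s" "0 \<le> r" "0 \<le> s"
  shows "cball x r \<inter> cball y s \<noteq> {}"
proof (cases "r + s = 0")
  case True
  then have "r = 0" "s = 0" "x = y" using assms by auto
  then show ?thesis by simp
next
  case False
  define t where "t = r / (r + s)"
  have t: "0 \<le> t" "1 - t = s / (r + s)" "0 \<le> 1 - t" using False assms by (auto simp: t_def field_simps)
  define z where "z = x + t *\<^sub>R (y - x)"
  have "dist x z = t * dist x y" using t by (simp add: z_def dist_norm norm_minus_commute)
  also have "\<dots> \<le> t * (r + s)" using assms t by (intro mult_left_mono) auto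
  also have "\<dots> = r" using False by (simp add: t_def)
  finally have 1: "dist x z \<le> r" .
  have "y - z = (1 - t) *\<^sub>R (y - x)" by (simp add: z_def algebra_simps)
  then have "dist y z = (1 - t) * dist x y" using t(1,3) by (simp add: dist_norm norm_minus_commute)
  also have "\<dots> \<le> (1 - t) * (r + s)" using assms t by (intro mult_left_mono) auto
  also have "\<dots> = s" using False by (simp add: t(2))
  finally have "z \<in> cball x r \<inter> cball y s" using 1 by simp
  then show ?thesis by (metis empty_iff)
qed

section \<open>Bounded clusters and finite separated sets of points\<close>

lemma cball_in_component:
  assumes "p \<in> S" "q \<in> S" "cball (fst q) (snd q) \<inter> connected_component_set (occupied S) x \<noteq> {}"
  shows "cball (fst q) (snd q) \<subseteq> connected_component_set (occupied S) x"
proof -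
  obtain z where z: "z \<in> cball (fst q) (snd q)" "connected_component (occupied S) x z" using assms(3) by auto
  have "cball (fst q) (snd q) \<subseteq> connected_component_set (occupied S) z"
    by (rule connected_component_maximal) (use z assms(2) in \<open>auto simp: occupied_def\<close>)
  also have "\<dots> = connected_component_set (occupied S) x" using z(2) connected_component_eq by fastforce
  finally show ?thesis .
qed

text \<open>The uniform gap \<open>e\<close> lets both families of balls be fattened by e/2 to
  disjoint open sets, so a connected set cannot leave the finite family.\<close>

lemma bounded_component_if_separated:
  assumes S: "S \<in> sphere_configs" and F: "finite F" "p \<in> F" "F \<subseteq> S" and e: "e > 0"
    and sep: "\<And>q q'. q \<in> F \<Longrightarrow> q' \<in> S - F \<Longrightarrow> snd q + snd q' + e \<le> dist (fst q) (fst q')"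
  shows "bounded (connected_component_set (occupied S) (fst p))"
proof -
  let ?C = "connected_component_set (occupied S) (fst p)"
  define U where "U = (\<Union>q\<in>F. cball (fst q) (snd q))"
  define V where "V = (\<Union>q\<in>S - F. cball (fst q) (snd q))"
  have uv: "dist u v \<ge> e" if "u \<in> U" "v \<in> V" for u v
  proof -
    obtain q q' where q: "q \<in> F" "q' \<in> S - F" "dist (fst q) u \<le> snd q" "dist (fst q') v \<le> snd q'"
      using \<open>u \<in> U\<close> \<open>v \<in> V\<close> unfolding U_def V_def by fastforce
    have "dist (fst q) (fst q') \<le> dist (fst q) u + dist u v + dist (fst q') v"
      using dist_triangle[of "fst q" "fst q'" u] dist_triangle[of u "fst q'" v] by (simp add: dist_commute)
    then show ?thesis using sep[OF q(1,2)] q by linarith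
  qed
  define U' where "U' = (\<Union>u\<in>U. ball u (e/2))"
  define V' where "V' = (\<Union>u\<in>V. ball u (e/2))"
  have disj: "U' \<inter> V' = {}"
  proof (rule ccontr)
    assume "U' \<inter> V' \<noteq> {}"
    then obtain w u v where "u \<in> U" "v \<in> V" "dist u w < e/2" "dist v w < e/2" by (auto simp: U'_def V'_def)
    then show False using uv[of u v] dist_triangle[of u v w] by (simp add: dist_commute)
  qed
  have occ: "occupied S = U \<union> V" using F by (auto simp: occupied_def U_def V_def)
  have sub: "U \<subseteq> U'" "V \<subseteq> V'" using e by (auto simp: U'_def V'_def)
  have p: "fst p \<in> U" using F configsD(1)[OF S, of p] by (auto simp: U_def intro!: bexI[of _ p])
  have "?C \<subseteq> U' \<union> V'" using connected_component_subset[of "occupied S" "fst p"] occ sub by blast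
  moreover have "fst p \<in> ?C" using p occ by (auto simp: connected_component_refl_eq)
  moreover have "open U'" "open V'" by (auto simp: U'_def V'_def)
  ultimately have "V' \<inter> ?C = {}"
    using connectedD[OF connected_connected_component, of U' V' "occupied S" "fst p"] disj p sub by blast
  then have "?C \<subseteq> U" using connected_component_subset[of "occupied S" "fst p"] occ sub by blast
  moreover have "bounded U" using F(1) by (auto simp: U_def)
  ultimately show ?thesis by (rule bounded_subset[rotated])
qed

text \<open>A bounded cluster is a finite union of balls, hence compact, and has a positive gap to
  each other ball. Radii are unbounded here, so infinitely many balls might still come arbitrarily
  close. Such balls have centres going to infinity; infinitely many of them share a point and so
  form one connected set that accumulates at the cluster and would belong to it.\<close>

lemma separated_if_bounded_component:
  fixes p :: "'a::euclidean_space \<times> real"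
  assumes S: "S \<in> sphere_configs" and p: "p \<in> S"
    and bd: "bounded (connected_component_set (occupied S) (fst p))"
  shows "\<exists>F k. finite F \<and> p \<in> F \<and> F \<subseteq> S \<and>
    (\<forall>q\<in>F. \<forall>q'\<in>S - F. snd q + snd q' + 1 / real (Suc k) \<le> dist (fst q) (fst q'))"
proof -
  let ?C = "connected_component_set (occupied S) (fst p)"
  define F where "F = {q\<in>S. fst q \<in> ?C}"
  have fin: "finite F" unfolding F_def by (rule configsD(2)[OF S bd])
  have own: "fst q \<in> cball (fst q) (snd q)" if "q \<in> S" for q using configsD(1)[OF S that] by simp
  have inC: "cball (fst q) (snd q) \<subseteq> ?C" if "q \<in> F" for q
    using cball_in_component[OF p, of q "fst p"] that own[of q] unfolding F_def by blast
  have offC: "cball (fst q) (snd q) \<inter> ?C = {}" if "q \<in> S - F" for q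
    using cball_in_component[OF p, of q "fst p"] that own[of q] unfolding F_def by blast
  have Ceq: "?C = (\<Union>q\<in>F. cball (fst q) (snd q))"
  proof (intro equalityI subsetI)
    fix x assume x: "x \<in> ?C"
    then have "x \<in> occupied S" using connected_component_subset by blast
    then obtain q where q: "q \<in> S" "x \<in> cball (fst q) (snd q)" by (auto simp: occupied_def)
    then show "x \<in> (\<Union>q\<in>F. cball (fst q) (snd q))" using offC x by blast
  qed (use inC in blast)
  have pC: "fst p \<in> ?C" using p own[OF p] by (auto simp: occupied_def connected_component_refl_eq intro!: bexI[of _ p])
  have pF: "p \<in> F" using p pC by (simp add: F_def)
  have compC: "compact ?C" unfolding Ceq using fin by (intro compact_UN) auto
  have gap: "snd q + snd q' < dist (fst q) (fst q')" if "q \<in> F" "q' \<in> S - F" for q q'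
  proof (rule ccontr)
    assume "\<not> ?thesis"
    then have "cball (fst q) (snd q) \<inter> cball (fst q') (snd q') \<noteq> {}"
      using configsD(1)[OF S, of q] configsD(1)[OF S, of q'] that F_def by (intro cballs_meet) auto
    then show False using inC[OF that(1)] offC[OF that(2)] by blast
  qed
  have "\<exists>k. \<forall>q\<in>F. \<forall>q'\<in>S - F. snd q + snd q' + 1 / real (Suc k) \<le> dist (fst q) (fst q')"
  proof (rule ccontr)
    assume "\<not> ?thesis"
    then have "\<forall>k. \<exists>q q'. q \<in> F \<and> q' \<in> S - F \<and> dist (fst q) (fst q') < snd q + snd q' + 1 / real (Suc k)"
      by (meson not_le)
    then obtain a b where ab: "\<And>k. a k \<in> F" "\<And>k. b k \<in> S - F"
      "\<And>k. dist (fst (a k)) (fst (b k)) < snd (a k) + snd (b k) + 1 / real (Suc k)" by metis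
    \<comment> \<open>By local finiteness only finitely many pairs have their outer centre in a
      given ball, and each pair has a positive excess; hence the outer centres \<open>b k\<close>
      escape to infinity.\<close>
    have lim: "filterlim (\<lambda>k. norm (fst (b k))) at_top sequentially"
      unfolding filterlim_at_top
    proof
      fix Z :: real
      have "finite {q\<in>S. fst q \<in> cball 0 Z}" by (rule configsD(2)[OF S bounded_cball])
      then have fZ: "finite (F \<times> {q\<in>S - F. fst q \<in> cball 0 Z})" using fin by (intro finite_cartesian_product) (auto elim: rev_finite_subset)
      have "\<forall>\<^sub>F k in sequentially. 1 / real (Suc k) < dist (fst q) (fst q') - snd q - snd q'" if "q \<in> F" "q' \<in> S - F" for q q'
        using gap[OF that] by (intro order_tendstoD(2)[OF LIMSEQ_inverse_real_of_nat[unfolded inverse_eq_divide]]) simp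
      then have "\<forall>\<^sub>F k in sequentially. \<forall>x\<in>F \<times> {q\<in>S - F. fst q \<in> cball 0 Z}.
         1 / real (Suc k) < dist (fst (fst x)) (fst (snd x)) - snd (fst x) - snd (snd x)"
        by (intro eventually_ball_finite[OF fZ]) auto
      then show "\<forall>\<^sub>F k in sequentially. Z \<le> norm (fst (b k))"
      proof eventually_elim
        case (elim k)
        show ?case
        proof (rule ccontr)
          assume "\<not> ?case"
          then have "(a k, b k) \<in> F \<times> {q\<in>S - F. fst q \<in> cball 0 Z}" using ab[of k] by auto
          from elim[rule_format, OF this] show False using ab(3)[of k] by simp
        qed
      qed
    qed
    obtain R where R: "R > 0" "\<And>x. x \<in> ?C \<Longrightarrow> norm x \<le> R" using bounded_pos bd by metis
    \<comment> \<open>\<open>v\<close> is the point of the ball around \<open>b k\<close> that faces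
      \<open>a k\<close> on the segment of centres; the opposite point \<open>u\<close> lies in the
      cluster.\<close>
    have near: "\<exists>v\<in>cball (fst (b k)) (snd (b k)). infdist v ?C \<le> 1 / real (Suc k)" for k
    proof -
      define D where "D = dist (fst (a k)) (fst (b k))"
      have D: "snd (a k) + snd (b k) < D" "D < snd (a k) + snd (b k) + 1 / real (Suc k)" "0 \<le> snd (a k)" "0 \<le> snd (b k)"
        using gap ab[of k] configsD(1)[OF S] by (auto simp: D_def F_def)
      define w where "w = (fst (b k) - fst (a k)) /\<^sub>R D"
      have "D \<noteq> 0" "D = norm (fst (b k) - fst (a k))" using D by (auto simp: D_def dist_norm norm_minus_commute)
      then have w: "norm w = 1" by (simp add: w_def)
      define u v where "u = fst (a k) + snd (a k) *\<^sub>R w" and "v = fst (b k) - snd (b k) *\<^sub>R w"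
      have "fst (b k) = fst (a k) + D *\<^sub>R w" using D by (simp add: w_def)
      then have vu: "v - u = (D - snd (a k) - snd (b k)) *\<^sub>R w" by (simp add: u_def v_def algebra_simps)
      have "u \<in> ?C" using inC[OF ab(1)[of k]] w D by (auto simp: u_def dist_norm subset_iff)
      then have "infdist v ?C \<le> dist v u" by (rule infdist_le)
      also have "\<dots> \<le> 1 / real (Suc k)" using D w by (simp add: dist_norm vu)
      finally show ?thesis using w D by (intro bexI[of _ v]) (auto simp: v_def dist_norm)
    qed
    then obtain v where v: "\<And>k. v k \<in> cball (fst (b k)) (snd (b k))" "\<And>k. infdist (v k) ?C \<le> 1 / real (Suc k)" by metis
    have nb: "norm (fst (b k)) \<le> snd (b k) + (R + 1)" for k
    proof -
      obtain c where c: "c \<in> ?C" "infdist (v k) ?C = dist (v k) c"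
        using infdist_attains_inf[of ?C "v k"] compact_imp_closed[OF compC] pC by blast
      have le1: "1 / real (Suc k) \<le> 1" by simp
      have "norm (v k) \<le> norm (v k - c) + norm c" using norm_triangle_ineq[of "v k - c" c] by simp
      then have "norm (v k) \<le> R + 1" using R(2)[OF c(1)] v(2)[of k] c(2) le1 unfolding dist_norm by linarith
      then show ?thesis using v(1)[of k] norm_triangle_ineq[of "fst (b k) - v k" "v k"] by (simp add: dist_norm)
    qed
    obtain z and f :: "nat \<Rightarrow> nat" where zf: "strict_mono f" "\<And>n. z \<in> cball (fst (b (f n))) (snd (b (f n)))"
      using infinitely_many_common_point[OF lim nb] R(1) by (metis add_nonneg_nonneg less_imp_le zero_le_one)
    \<comment> \<open>The balls share \<open>z\<close>, so \<open>T\<close> is connected. Its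
      closure meets the compact cluster in a limit point \<open>l\<close>, and adding
      \<open>l\<close> joins the two.\<close>
    define T where "T = (\<Union>n. cball (fst (b (f n))) (snd (b (f n))))"
    have cT: "connected T" unfolding T_def
      by (rule connected_Union) (auto intro!: exI[of _ z] simp: zf(2)[unfolded mem_cball] ex_in_conv[symmetric] simp del: ex_in_conv)
    have "\<forall>n. \<exists>c\<in>?C. infdist (v (f n)) ?C = dist (v (f n)) c"
      using infdist_attains_inf[of ?C] compact_imp_closed[OF compC] pC by blast
    then obtain c where c: "\<And>n. c n \<in> ?C" "\<And>n. infdist (v (f n)) ?C = dist (v (f n)) (c n)" by metis
    then obtain l g where g: "l \<in> ?C" "strict_mono g" "(c \<circ> g) \<longlonglongrightarrow> l"
      using compC unfolding compact_def by blast
    have "(\<lambda>n. 1 / real (Suc (f (g n)))) \<longlonglongrightarrow> 0"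
      using LIMSEQ_subseq_LIMSEQ[OF LIMSEQ_inverse_real_of_nat strict_mono_o[OF zf(1) g(2)]]
      by (simp add: comp_def inverse_eq_divide)
    moreover have "(\<lambda>n. dist (c (g n)) l) \<longlonglongrightarrow> 0" using g(3) by (simp add: tendsto_dist_iff[symmetric] comp_def)
    ultimately have "(\<lambda>n. 1 / real (Suc (f (g n))) + dist (c (g n)) l) \<longlonglongrightarrow> 0" using tendsto_add by fastforce
    moreover have "dist (v (f (g n))) l \<le> 1 / real (Suc (f (g n))) + dist (c (g n)) l" for n
      using v(2)[of "f (g n)"] c(2)[of "g n"] dist_triangle[of "v (f (g n))" l "c (g n)"] by linarith
    ultimately have "(\<lambda>n. dist (v (f (g n))) l) \<longlonglongrightarrow> 0"
      by (intro Lim_null_comparison[of "\<lambda>n. dist (v (f (g n))) l" "\<lambda>n. 1 / real (Suc (f (g n))) + dist (c (g n)) l"]) auto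
    then have "(\<lambda>n. v (f (g n))) \<longlonglongrightarrow> l" by (simp add: tendsto_dist_iff[symmetric])
    moreover have "v (f (g n)) \<in> T" for n using v(1) by (auto simp: T_def)
    ultimately have lT: "l \<in> closure T" unfolding closure_sequential
      by (intro exI[of _ "\<lambda>n. v (f (g n))"] conjI allI)
    have "connected (insert l T)"
      by (rule connected_intermediate_closure[OF cT]) (use lT closure_subset in auto)
    then have "connected (?C \<union> insert l T)" using g(1) by (intro connected_Un) auto
    moreover have "T \<subseteq> occupied S" using ab(2) by (auto simp: T_def occupied_def)
    ultimately have "?C \<union> insert l T \<subseteq> ?C"
      using pC g(1) connected_component_subset[of "occupied S" "fst p"]
      by (intro connected_component_maximal) auto
    moreover have "z \<in> T" using zf(2) by (auto simp: T_def)
    ultimately have "z \<in> ?C" by blast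
    then show False using offC[OF ab(2)[of "f 0"]] zf(2)[of 0] by blast
  qed
  moreover have "F \<subseteq> S" unfolding F_def by blast
  ultimately show ?thesis using fin pF by metis
qed

text \<open>By the two preceding lemmas a point has a bounded cluster iff some finite set of points
  around it is separated from the rest at some scale 1/(k+1). Both the finite sets and the scales
  can be enumerated.\<close>

lemma unb_event:
  fixes V :: "('a::euclidean_space \<times> real) set"
  assumes "V \<in> sets borel"
  shows "{S\<in>sphere_configs. \<exists>p\<in>S \<inter> V. unb S p} \<in> sets sphere_config_space"
proof -
  \<comment> \<open>Finite subsets of a configuration are cut out by finite unions of bounded basis
    sets. \<open>Qo\<close> is the failure of separation, with a strict inequality so that it is
    open.\<close>
  define WW where "WW = {\<Union>\<F> | \<F>. finite \<F> \<and> \<F> \<subseteq> (bbasis :: ('a \<times> real) set set)}"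
  define Qo where "Qo k = {x :: ('a \<times> real) \<times> ('a \<times> real).
     dist (fst (fst x)) (fst (snd x)) < snd (fst x) + snd (snd x) + 1 / real (Suc k)}" for k
  have openQo: "open (Qo k)" for k unfolding Qo_def by (intro open_Collect_less continuous_intros)
  have WW: "countable WW" "\<And>W. W \<in> WW \<Longrightarrow> open W \<and> bounded W"
  proof -
    have "WW = \<Union> ` {\<F>. finite \<F> \<and> \<F> \<subseteq> bbasis}" by (auto simp: WW_def)
    then show "countable WW" using countable_Collect_finite_subset[OF bbasis(1)] by (simp only:) (rule countable_image)
    show "\<And>W. W \<in> WW \<Longrightarrow> open W \<and> bounded W" unfolding WW_def using bbasis(2) by (auto intro!: open_Union bounded_Union)
  qed
  define D where "D W k = {S\<in>sphere_configs. \<exists>q\<in>S \<inter> W. \<exists>q'\<in>S \<inter> - W. (q, q') \<in> Qo k}" for W k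
  \<comment> \<open>\<open>A\<close> isolates one point, which lies in \<open>V\<close>; that point
    is unbounded iff no \<open>W\<close> around \<open>A\<close> separates its points from the
    others at any scale.\<close>
  define E where "E A = {S\<in>sphere_configs. config_count S A = 1} \<inter> {S\<in>sphere_configs. S \<inter> (A \<inter> V) \<noteq> {}} -
    (\<Union>W\<in>{W\<in>WW. A \<subseteq> W}. \<Union>k. sphere_configs - D W k)" for A
  have isolate: "\<exists>A\<in>bbasis. S \<inter> A = {p}" if S: "S \<in> sphere_configs" "p \<in> S" for S and p :: "'a \<times> real"
  proof -
    have "finite (S \<inter> ball p 1 - {p})" using configsD(3)[OF S(1), of "ball p 1"] by auto
    then have "open (ball p 1 - (S \<inter> ball p 1 - {p}))" by (intro open_Diff finite_imp_closed) auto
    from bbasis(3)[OF this, of p] obtain A where "A \<in> bbasis" "p \<in> A" "A \<subseteq> ball p 1 - (S \<inter> ball p 1 - {p})" by auto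
    then show ?thesis using S(2) by (intro bexI[of _ A]) auto
  qed
  have eq: "{S\<in>sphere_configs. \<exists>p\<in>S \<inter> V. unb S p} = (\<Union>A\<in>bbasis. E A)" (is "?L = ?R")
  proof (intro equalityI subsetI)
    fix S assume "S \<in> ?L"
    then obtain p where S: "S \<in> sphere_configs" "p \<in> S" "p \<in> V" "unb S p" by blast
    obtain A where A: "A \<in> bbasis" "S \<inter> A = {p}" using isolate[OF S(1,2)] by blast
    have "\<exists>q\<in>S \<inter> W. \<exists>q'\<in>S \<inter> - W. (q, q') \<in> Qo k" if W: "W \<in> WW" "A \<subseteq> W" for W k
    proof (rule ccontr)
      assume c: "\<not> ?thesis"
      have "finite (S \<inter> W)" using configsD(3)[OF S(1)] WW(2)[OF W(1)] by blast
      moreover have "p \<in> S \<inter> W" using A W by blast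
      moreover have "snd q + snd q' + 1 / real (Suc k) \<le> dist (fst q) (fst q')" if "q \<in> S \<inter> W" "q' \<in> S - (S \<inter> W)" for q q'
      proof -
        have "(q, q') \<notin> Qo k" using c that by blast
        then show ?thesis by (simp add: Qo_def)
      qed
      ultimately have "bounded (connected_component_set (occupied S) (fst p))"
        by (intro bounded_component_if_separated[OF S(1), of "S \<inter> W" p "1 / real (Suc k)"]) auto
      then show False using S(4) by (simp add: unb_def)
    qed
    then have "S \<in> D W k" if "W \<in> WW" "A \<subseteq> W" for W k using S(1) that unfolding D_def by blast
    moreover have "config_count S A = 1" "S \<inter> (A \<inter> V) \<noteq> {}" using A(2) S(2,3) by (auto simp: config_count_def)
    ultimately have "S \<in> E A" using S(1) unfolding E_def by blast
    then show "S \<in> ?R" using A(1) by blast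
  next
    fix S assume "S \<in> ?R"
    then obtain A where A: "A \<in> bbasis" "S \<in> E A" by blast
    have S: "S \<in> sphere_configs" "card (S \<inter> A) = 1" "S \<inter> (A \<inter> V) \<noteq> {}"
      using A(2) unfolding E_def config_count_def by blast+
    obtain p where p: "S \<inter> A = {p}" using card_1_singletonE[OF S(2)] by blast
    obtain x where "x \<in> S" "x \<in> A" "x \<in> V" using S(3) by blast
    then have pV: "p \<in> S" "p \<in> V" using p by auto
    have "unb S p"
    proof (rule ccontr)
      assume "\<not> unb S p"
      then obtain F k where F: "finite F" "p \<in> F" "F \<subseteq> S"
        "\<And>q q'. q \<in> F \<Longrightarrow> q' \<in> S - F \<Longrightarrow> snd q + snd q' + 1 / real (Suc k) \<le> dist (fst q) (fst q')"
        using separated_if_bounded_component[OF S(1) pV(1)] unfolding unb_def by blast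
      have "\<forall>q\<in>F. \<exists>B\<in>bbasis. S \<inter> B = {q}" using isolate[OF S(1)] F(3) by blast
      then obtain B where B: "\<And>q. q \<in> F \<Longrightarrow> B q \<in> bbasis" "\<And>q. q \<in> F \<Longrightarrow> S \<inter> B q = {q}" by metis
      define W where "W = \<Union>(insert A (B ` F))"
      have W: "W \<in> WW" unfolding WW_def W_def using F(1) A(1) B(1) by (intro CollectI exI[of _ "insert A (B ` F)"]) auto
      have "S \<inter> W = (S \<inter> A) \<union> (\<Union>q\<in>F. S \<inter> B q)" unfolding W_def by blast
      also have "\<dots> = {p} \<union> (\<Union>q\<in>F. {q})" using B(2) p by simp
      also have "\<dots> = F" using F(2) by auto
      finally have SW: "S \<inter> W = F" .
      have "A \<subseteq> W" unfolding W_def by blast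
      then have "S \<in> D W k" using A(2) W S(1) unfolding E_def by blast
      then have "\<exists>q\<in>S \<inter> W. \<exists>q'\<in>S \<inter> - W. (q, q') \<in> Qo k" unfolding D_def by blast
      then obtain q q' where "q \<in> F" "q' \<in> S - F" "(q, q') \<in> Qo k" using SW by blast
      then show False using F(4)[of q q'] by (simp add: Qo_def)
    qed
    then show "S \<in> ?L" using S(1) pV by blast
  qed
  have top: "sphere_configs \<in> sets (sphere_config_space :: ('a \<times> real) set measure)" using sets.top[of "sphere_config_space :: ('a \<times> real) set measure"] by (simp add: space_config)
  have Dw: "D W k \<in> sets sphere_config_space" if "W \<in> WW" for W k
    unfolding D_def using WW(2)[OF that] by (intro pair_event openQo) auto
  have "E A \<in> sets sphere_config_space" if "A \<in> bbasis" for A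
  proof -
    have "open A" "bounded A" using bbasis(2)[OF that] by blast+
    moreover have "countable {W\<in>WW. A \<subseteq> W}" using WW(1) by (rule countable_subset[rotated]) auto
    ultimately show ?thesis unfolding E_def using assms Dw top
      by (intro sets.Diff sets.Int count_event hit_event sets.countable_UN'') auto
  qed
  then show ?thesis unfolding eq using bbasis(1) by (intro sets.countable_UN'') auto
qed

text \<open>Each ball is connected and so lies in a single cluster; this turns statements about
  clusters into statements about points of the configuration.\<close>

lemma unbounded_clusters_eq:
  assumes S: "S \<in> sphere_configs"
  shows "unbounded_clusters S = (\<Union>p\<in>{p\<in>S. unb S p}. cball (fst p) (snd p))"
proof (intro equalityI subsetI)
  fix x assume "x \<in> unbounded_clusters S"
  then obtain C where C: "C \<in> components (occupied S)" "\<not> bounded C" "x \<in> C" by (auto simp: unbounded_clusters_def)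
  then have Cx: "C = connected_component_set (occupied S) x" "x \<in> occupied S"
    by (metis componentsE connected_component_eq, meson in_components_subset subsetD)
  then obtain p where p: "p \<in> S" "x \<in> cball (fst p) (snd p)" by (auto simp: occupied_def)
  have "x \<in> C" by fact
  then have "cball (fst p) (snd p) \<subseteq> C" unfolding Cx(1)
    using cball_in_component[OF p(1) p(1), of x] p(2) by blast
  moreover have "fst p \<in> cball (fst p) (snd p)" using configsD(1)[OF S p(1)] by simp
  ultimately have "fst p \<in> connected_component_set (occupied S) x" unfolding Cx(1) by (rule subsetD)
  then have "connected_component_set (occupied S) (fst p) = C"
    using connected_component_eq[of "fst p" "occupied S" x] Cx(1) by simp
  then show "x \<in> (\<Union>p\<in>{p\<in>S. unb S p}. cball (fst p) (snd p))" using p C(2)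
    by (intro UN_I[of p]) (auto simp: unb_def)
next
  fix x assume "x \<in> (\<Union>p\<in>{p\<in>S. unb S p}. cball (fst p) (snd p))"
  then obtain p where p: "p \<in> S" "unb S p" "x \<in> cball (fst p) (snd p)" by auto
  let ?C = "connected_component_set (occupied S) (fst p)"
  have o: "fst p \<in> occupied S" using p(1) configsD(1)[OF S p(1)] by (auto simp: occupied_def intro!: bexI[of _ p])
  then have "fst p \<in> ?C" by (simp add: connected_component_refl_eq)
  then have "cball (fst p) (snd p) \<subseteq> ?C"
    using cball_in_component[OF p(1) p(1), of "fst p"] configsD(1)[OF S p(1)] centre_in_cball[of "fst p" "snd p"]
    by blast
  moreover have "?C \<in> components (occupied S)" using o by (rule componentsI)
  ultimately show "x \<in> unbounded_clusters S" using p unfolding unbounded_clusters_def unb_def by blast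
qed

lemma percolates_iff_unb:
  assumes S: "S \<in> sphere_configs"
  shows "percolates S \<longleftrightarrow> (\<exists>p\<in>S. unb S p)"
proof -
  have "percolates S \<longleftrightarrow> unbounded_clusters S \<noteq> {}"
    unfolding percolates_def unbounded_clusters_def using in_components_nonempty by blast
  also have "\<dots> \<longleftrightarrow> (\<exists>p\<in>S. unb S p)"
    unfolding unbounded_clusters_eq[OF S] using configsD(1)[OF S] by fastforce
  finally show ?thesis .
qed

lemma percolates_event:
  "{S\<in>sphere_configs. percolates S} \<in> sets (sphere_config_space :: ('a::euclidean_space \<times> real) set measure)"
proof -
  have "{S\<in>sphere_configs. percolates S} = {S\<in>sphere_configs. \<exists>p\<in>S \<inter> (UNIV :: ('a \<times> real) set). unb S p}"
    using percolates_iff_unb by auto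
  then show ?thesis using unb_event[of UNIV] by simp
qed

lemma hard_event:
  "{S\<in>sphere_configs. \<forall>p\<in>S. \<forall>q\<in>S. p \<noteq> q \<longrightarrow> dist (fst p) (fst q) \<ge> snd p + snd q} \<in>
     sets (sphere_config_space :: ('a::euclidean_space \<times> real) set measure)"
proof -
  define Q where "Q = {x :: ('a \<times> real) \<times> ('a \<times> real). fst x \<noteq> snd x \<and>
     dist (fst (fst x)) (fst (snd x)) < snd (fst x) + snd (snd x)}"
  have "open Q" unfolding Q_def by (intro open_Collect_conj open_Collect_neq open_Collect_less continuous_intros)
  then have "sphere_configs - {S\<in>sphere_configs. \<exists>p\<in>S \<inter> UNIV. \<exists>q\<in>S \<inter> UNIV. (p, q) \<in> Q} \<in> sets sphere_config_space"
    using sets.top[of "sphere_config_space :: ('a \<times> real) set measure"] unfolding space_config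
    by (intro sets.Diff pair_event) auto
  also have "sphere_configs - {S\<in>sphere_configs. \<exists>p\<in>S \<inter> UNIV. \<exists>q\<in>S \<inter> UNIV. (p, q) \<in> Q} =
    {S\<in>sphere_configs. \<forall>p\<in>S. \<forall>q\<in>S. p \<noteq> q \<longrightarrow> dist (fst p) (fst q) \<ge> snd p + snd q}"
    by (auto simp: Q_def not_less) (smt (verit) fst_conv snd_conv)+
  finally show ?thesis .
qed

lemma radius_event:
  "{S\<in>sphere_configs. \<forall>p\<in>S. snd p \<le> K} \<in> sets (sphere_config_space :: ('a::euclidean_space \<times> real) set measure)"
proof -
  have "open {p :: 'a \<times> real. K < snd p}" by (intro open_Collect_less continuous_intros)
  then have "sphere_configs - {S\<in>sphere_configs. S \<inter> {p. K < snd p} \<noteq> {}} \<in> sets (sphere_config_space :: ('a \<times> real) set measure)"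
    using sets.top[of "sphere_config_space :: ('a \<times> real) set measure"] unfolding space_config
    by (intro sets.Diff hit_event) auto
  also have "sphere_configs - {S\<in>sphere_configs. S \<inter> {p. K < snd p} \<noteq> {}} = {S\<in>sphere_configs. \<forall>p\<in>S. snd p \<le> K}"
    by (auto simp: not_less)
  finally show ?thesis .
qed

section \<open>Lower density of the neighbourhood of the unbounded clusters\<close>

definition halo :: "real \<Rightarrow> ('a::euclidean_space \<times> real) set \<Rightarrow> 'a set" where
  "halo a S = nbhd (unbounded_clusters S) a"

text \<open>The right-hand side is an open condition on the point \<open>p\<close>, which makes
  \<open>unb_event\<close> applicable.\<close>

lemma halo_iff:
  assumes S: "S \<in> sphere_configs" and a: "0 < a"
  shows "y \<in> halo a S \<longleftrightarrow> (\<exists>p\<in>S. unb S p \<and> dist (fst p) y < snd p + a)"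
proof
  assume "y \<in> halo a S"
  then obtain x p where x: "dist x y < a" "p \<in> S" "unb S p" "dist (fst p) x \<le> snd p"
    unfolding halo_def nbhd_def unbounded_clusters_eq[OF S] by auto
  then have "dist (fst p) y < snd p + a" using dist_triangle[of "fst p" y x] by simp
  then show "\<exists>p\<in>S. unb S p \<and> dist (fst p) y < snd p + a" using x by blast
next
  assume "\<exists>p\<in>S. unb S p \<and> dist (fst p) y < snd p + a"
  then obtain p where p: "p \<in> S" "unb S p" "dist (fst p) y < snd p + a" by blast
  define b where "b = max 0 (dist (fst p) y - snd p)"
  have b: "0 \<le> b" "b < a" "dist (fst p) y \<le> snd p + b" using p a by (auto simp: b_def)
  obtain x where x: "x \<in> cball (fst p) (snd p)" "x \<in> cball y b"
    using cballs_meet[OF b(3) configsD(1)[OF S p(1)] b(1)] by blast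
  have "x \<in> unbounded_clusters S" unfolding unbounded_clusters_eq[OF S] using p x by blast
  moreover have "y \<in> ball x a" using x(2) b by (simp add: dist_commute)
  ultimately show "y \<in> halo a S" unfolding halo_def nbhd_def by blast
qed

lemma open_halo: "open (halo a S)"
  unfolding halo_def nbhd_def by auto

text \<open>Joint measurability in the configuration and the position, needed to integrate the
  indicator over space. The position is replaced by a point \<open>z\<close> of a countable dense
  set at the cost of a slack 1/(n+1), which the strict inequality in \<open>halo_iff\<close> leaves
  room for.\<close>

lemma halo_pair_sets:
  assumes a: "0 < a"
  shows "{x\<in>space (sphere_config_space \<Otimes>\<^sub>M lborel). snd x \<in> halo a (fst x)} \<in>
     sets (sphere_config_space \<Otimes>\<^sub>M (lborel :: 'a::euclidean_space measure))"
proof -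
  obtain Z :: "'a set" where Z: "countable Z" "\<And>x e. e > 0 \<Longrightarrow> \<exists>z\<in>Z. dist z x < e"
  proof -
    obtain Z :: "'a set" where Z: "countable Z" "\<And>X. open X \<Longrightarrow> X \<noteq> {} \<Longrightarrow> \<exists>d\<in>Z. d \<in> X"
      using countable_dense_setE by blast
    have "\<exists>z\<in>Z. dist z x < e" if "e > 0" for x e
      using Z(2)[of "ball x e"] that by (auto simp: dist_commute)
    with Z(1) show ?thesis by (rule that)
  qed
  define V where "V z n = {p :: 'a \<times> real. dist (fst p) z < snd p + a - 1 / real (Suc n)}" for z n
  have oV: "open (V z n)" for z n unfolding V_def by (intro open_Collect_less continuous_intros)
  let ?E = "\<lambda>z n. {S\<in>sphere_configs. \<exists>p\<in>S \<inter> V z n. unb S p} \<times> ball z (1 / real (Suc n))"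
  have eq: "{x\<in>space (sphere_config_space \<Otimes>\<^sub>M lborel). snd x \<in> halo a (fst x)} = (\<Union>z\<in>Z. \<Union>n. ?E z n)" (is "?L = ?R")
  proof (intro equalityI subsetI)
    fix x :: "('a \<times> real) set \<times> 'a" assume x: "x \<in> ?L"
    then have S: "fst x \<in> sphere_configs" by (auto simp: space_pair_measure space_config)
    then obtain p where p: "p \<in> fst x" "unb (fst x) p" "dist (fst p) (snd x) < snd p + a" using x halo_iff[OF S a] by auto
    then obtain n where n: "2 / real (Suc n) < snd p + a - dist (fst p) (snd x)"
      using reals_Archimedean[of "(snd p + a - dist (fst p) (snd x)) / 2"] by (auto simp: inverse_eq_divide field_simps)
    obtain z where z: "z \<in> Z" "dist z (snd x) < 1 / real (Suc n)" using Z(2)[of "1 / real (Suc n)" "snd x"] by auto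
    have "dist (fst p) z < snd p + a - 1 / real (Suc n)"
      using dist_triangle[of "fst p" z "snd x"] n z(2) by (simp add: dist_commute)
    then have "p \<in> V z n" by (simp add: V_def)
    then have "x \<in> ?E z n" using p S z(2) by (cases x) auto
    then show "x \<in> ?R" using z(1) by blast
  next
    fix x :: "('a \<times> real) set \<times> 'a" assume "x \<in> ?R"
    then obtain z n where x: "x \<in> ?E z n" by blast
    then have S: "fst x \<in> sphere_configs" by auto
    obtain p where p: "p \<in> fst x" "p \<in> V z n" "unb (fst x) p" and z: "dist z (snd x) < 1 / real (Suc n)" using x by auto
    have "dist (fst p) (snd x) < snd p + a"
      using dist_triangle[of "fst p" "snd x" z] p(2) z by (simp add: V_def)
    then have "snd x \<in> halo a (fst x)" using halo_iff[OF S a] p by blast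
    then show "x \<in> ?L" using S by (cases x) (simp add: space_pair_measure space_config)
  qed
  have "?E z n \<in> sets (sphere_config_space \<Otimes>\<^sub>M lborel)" for z n
    by (rule pair_measureI) (auto intro!: unb_event borel_open oV)
  then show ?thesis unfolding eq using Z(1) by (intro sets.countable_UN'') auto
qed

lemma measure_halo_measurable:
  assumes a: "0 < a"
  shows "(\<lambda>S. measure lebesgue (halo a S \<inter> ball 0 r)) \<in> borel_measurable (sphere_config_space :: ('a::euclidean_space \<times> real) set measure)"
proof -
  let ?Q = "{x\<in>space (sphere_config_space \<Otimes>\<^sub>M lborel). snd x \<in> halo a (fst x)} \<inter>
     (space sphere_config_space \<times> ball (0::'a) r)"
  have "?Q \<in> sets (sphere_config_space \<Otimes>\<^sub>M lborel)"
    by (intro sets.Int halo_pair_sets a pair_measureI) auto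
  then have "(\<lambda>S. emeasure lborel (Pair S -` ?Q)) \<in> borel_measurable (sphere_config_space :: ('a \<times> real) set measure)"
    by (rule lborel.measurable_emeasure_Pair)
  then have "(\<lambda>S. enn2real (emeasure lborel (Pair S -` ?Q))) \<in> borel_measurable (sphere_config_space :: ('a \<times> real) set measure)"
    by measurable
  moreover have "enn2real (emeasure lborel (Pair S -` ?Q)) = measure lebesgue (halo a S \<inter> ball 0 r)"
    if "S \<in> space sphere_config_space" for S :: "('a \<times> real) set"
  proof -
    have "Pair S -` ?Q = halo a S \<inter> ball 0 r" using that by (auto simp: space_pair_measure)
    moreover have "halo a S \<inter> ball 0 r \<in> sets borel" using open_halo[of a S] by auto
    ultimately show ?thesis by (simp add: measure_def)
  qed
  ultimately show ?thesis by (simp cong: measurable_cong)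
qed

text \<open>Makes the lower limit a countable operation. The numerator is only monotone, so
  \<open>r\<close> is approached by rationals from the left: there the numerator is at most
  \<open>f r\<close>, and the limit is taken in the continuous denominator alone.\<close>

lemma Liminf_ratio_rational:
  fixes f g :: "real \<Rightarrow> real"
  assumes mono: "\<And>r s. r \<le> s \<Longrightarrow> f r \<le> f s" and f0: "\<And>r. 0 \<le> f r"
    and g0: "\<And>r. 0 < r \<Longrightarrow> 0 < g r" and cont: "\<And>r. 0 < r \<Longrightarrow> isCont g r"
  shows "Liminf at_top (\<lambda>r. ereal (f r / g r)) = (SUP n::nat. INF r\<in>\<rat> \<inter> {real n<..}. ereal (f r / g r))"
proof (rule antisym)
  show "Liminf at_top (\<lambda>r. ereal (f r / g r)) \<le> (SUP n::nat. INF r\<in>\<rat> \<inter> {real n<..}. ereal (f r / g r))"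
    unfolding Liminf_def
  proof (rule SUP_least)
    fix P :: "real \<Rightarrow> bool" assume "P \<in> {P. eventually P at_top}"
    then obtain N where N: "\<And>r. r \<ge> N \<Longrightarrow> P r" by (auto simp: eventually_at_top_linorder)
    obtain n :: nat where n: "N \<le> real n" using real_arch_simple by blast
    have "(INF r\<in>Collect P. ereal (f r / g r)) \<le> (INF r\<in>\<rat> \<inter> {real n<..}. ereal (f r / g r))"
      by (rule INF_superset_mono) (use N n in auto)
    also have "\<dots> \<le> (SUP n::nat. INF r\<in>\<rat> \<inter> {real n<..}. ereal (f r / g r))" by (rule SUP_upper) simp
    finally show "(INF r\<in>Collect P. ereal (f r / g r)) \<le> (SUP n::nat. INF r\<in>\<rat> \<inter> {real n<..}. ereal (f r / g r))" .
  qed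
  show "(SUP n::nat. INF r\<in>\<rat> \<inter> {real n<..}. ereal (f r / g r)) \<le> Liminf at_top (\<lambda>r. ereal (f r / g r))"
  proof (rule SUP_least)
    fix n :: nat
    let ?I = "INF r\<in>\<rat> \<inter> {real n<..}. ereal (f r / g r)"
    have "?I \<le> ereal (f r / g r)" if r: "r > real n" for r
    proof -
      have "(\<lambda>s. f r / g s) \<midarrow>r\<rightarrow> f r / g r"
        using cont[of r] g0[of r] r by (intro tendsto_intros) (auto simp: isCont_def)
      then have lim: "((\<lambda>s. ereal (f r / g s)) \<longlongrightarrow> ereal (f r / g r)) (at_left r)"
        by (intro tendsto_ereal) (rule filterlim_mono[OF _ order_refl at_le], auto)
      have fr: "\<exists>\<^sub>F s in at_left r. ?I \<le> ereal (f r / g s)"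
        unfolding frequently_def
      proof
        assume "\<forall>\<^sub>F s in at_left r. \<not> ?I \<le> ereal (f r / g s)"
        then obtain b where b: "b < r" "\<And>s. b < s \<Longrightarrow> s < r \<Longrightarrow> \<not> ?I \<le> ereal (f r / g s)"
          by (auto simp: eventually_at_left_field)
        obtain q where q: "q \<in> \<rat>" "max b (real n) < q" "q < r" using Rats_dense_in_real[of "max b (real n)" r] b(1) r by auto
        have "?I \<le> ereal (f q / g q)" by (rule INF_lower) (use q in auto)
        also have "\<dots> \<le> ereal (f r / g q)" using mono[of q r] g0[of q] q by (auto intro!: divide_right_mono)
        finally show False using b(2)[of q] q by auto
      qed
      show ?thesis
      proof (rule ccontr)
        assume "\<not> ?thesis"
        then have "\<forall>\<^sub>F s in at_left r. ereal (f r / g s) < ?I" using order_tendstoD(2)[OF lim] by (simp add: not_le)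
        then show False using fr by (simp add: frequently_def not_le)
      qed
    qed
    then show "?I \<le> Liminf at_top (\<lambda>r. ereal (f r / g r))"
      by (intro Liminf_bounded) (auto simp: eventually_at_top_dense)
  qed
qed

lemma measure_ball_isCont:
  "isCont (\<lambda>r. measure lebesgue (ball (0::'a::euclidean_space) r)) r" if "0 < r"
proof -
  have "isCont (\<lambda>r. unit_ball_vol (real DIM('a)) * r ^ DIM('a)) r" by (intro continuous_intros)
  moreover have "\<forall>\<^sub>F s in nhds r. measure lebesgue (ball (0::'a) s) = unit_ball_vol (real DIM('a)) * s ^ DIM('a)"
    by (rule eventually_mono[OF eventually_nhds_in_open[of "{0<..}"]]) (use that in \<open>auto simp: content_ball\<close>)
  ultimately show ?thesis by (subst isCont_cong)
qed

lemma measurable_lower_density: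
  assumes a: "0 < a"
  shows "(\<lambda>S. lower_density (nbhd (unbounded_clusters S) a)) \<in> borel_measurable (sphere_config_space :: ('a::euclidean_space \<times> real) set measure)"
proof -
  have "lower_density (halo a S) = real_of_ereal (SUP n::nat. INF r\<in>\<rat> \<inter> {real n<..}.
      ereal (measure lebesgue (halo a S \<inter> ball 0 r) / measure lebesgue (ball (0::'a) r)))" for S :: "('a \<times> real) set"
    unfolding lower_density_def
  proof (subst Liminf_ratio_rational)
    fix r s :: real assume "r \<le> s"
    then show "measure lebesgue (halo a S \<inter> ball 0 r) \<le> measure lebesgue (halo a S \<inter> ball 0 s)"
      using open_halo[of a S] by (intro measure_mono_fmeasurable) (auto intro!: bounded_set_imp_lmeasurable bounded_Int)
  next
    fix r :: real assume "0 < r"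
    then show "isCont (\<lambda>r. measure lebesgue (ball (0::'a) r)) r" by (rule measure_ball_isCont)
  qed auto
  then have "(\<lambda>S :: ('a \<times> real) set. lower_density (halo a S)) = (\<lambda>S. real_of_ereal (SUP n::nat. INF r\<in>\<rat> \<inter> {real n<..}.
      ereal (measure lebesgue (halo a S \<inter> ball 0 r) / measure lebesgue (ball (0::'a) r))))" by auto
  moreover have "\<dots> \<in> borel_measurable sphere_config_space"
    by (intro borel_measurable_real_of_ereal borel_measurable_SUP borel_measurable_INF borel_measurable_ereal
       borel_measurable_divide borel_measurable_const measure_halo_measurable a countable_Int1 countable_rat) auto
  ultimately show ?thesis unfolding halo_def by simp
qed

text \<open>The lower limit itself lies between 0 and 1, so \<open>real_of_ereal\<close> never falls
  back to its default value.\<close>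

lemma lower_density_le_1: "lower_density (A :: 'a::euclidean_space set) \<le> 1"
  and lower_density_ge_0: "0 \<le> lower_density A" if "A \<in> sets lebesgue"
proof -
  let ?f = "\<lambda>r. measure lebesgue (A \<inter> ball 0 r) / measure lebesgue (ball (0::'a) r)"
  have 0: "0 \<le> ?f r" for r by simp
  have 1: "?f r \<le> 1" for r
  proof -
    have "measure lebesgue (A \<inter> ball 0 r) \<le> measure lebesgue (ball (0::'a) r)"
      using that by (intro measure_mono_fmeasurable) auto
    then show ?thesis using measure_nonneg[of lebesgue "ball (0::'a) r"] by (simp add: divide_le_eq_1 less_le)
  qed
  have "0 \<le> Liminf at_top (\<lambda>r. ereal (?f r))" by (rule Liminf_bounded) (simp add: 0)
  moreover have "Liminf at_top (\<lambda>r. ereal (?f r)) \<le> ereal 1"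
    using Liminf_le_Limsup[of at_top "\<lambda>r. ereal (?f r)"] Limsup_bounded[of "\<lambda>r. ereal (?f r)" "ereal 1" at_top] 1 by fastforce
  ultimately show "lower_density A \<le> 1" "0 \<le> lower_density A"
    unfolding lower_density_def by (cases "Liminf at_top (\<lambda>r. ereal (?f r))"; simp)+
qed

section \<open>Poisson samples in a block\<close>

text \<open>Resampling one coordinate preserves a product measure. In this form independence is used
  throughout: whatever else depends on the sample, coordinate \<open>k\<close> may be replaced by a
  fresh one.\<close>

lemma nn_integral_PiM_update:
  assumes "\<And>i. i \<in> I \<Longrightarrow> prob_space (M i)" "k \<in> I" "f \<in> borel_measurable (PiM I M)"
  shows "(\<integral>\<^sup>+\<omega>. f \<omega> \<partial>PiM I M) = (\<integral>\<^sup>+\<omega>. (\<integral>\<^sup>+s. f ((fun_upd \<omega> k s)) \<partial>M k) \<partial>PiM I M)"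
proof -
  interpret K: prob_space "M k" by (rule assms(1)[OF assms(2)])
  interpret P: prob_space "PiM I M" by (rule prob_space_PiM) (rule assms(1))
  interpret KP: pair_prob_space "M k" "PiM I M" ..
  have ins: "insert k I = I" using assms(2) by auto
  have meas: "(\<lambda>(x, X). X(k := x)) \<in> M k \<Otimes>\<^sub>M PiM I M \<rightarrow>\<^sub>M PiM I M"
    using measurable_fun_upd[of I I k "\<lambda>p. snd p" "M k \<Otimes>\<^sub>M PiM I M" M fst] ins by (simp add: split_beta')
  have "(\<integral>\<^sup>+\<omega>. f \<omega> \<partial>PiM I M) = (\<integral>\<^sup>+\<omega>. f \<omega> \<partial>distr (M k \<Otimes>\<^sub>M PiM I M) (PiM I M) (\<lambda>(x, X). X(k := x)))"
    using distr_pair_PiM_eq_PiM[of I M k] assms by (simp add: ins)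
  also have "\<dots> = (\<integral>\<^sup>+p. f ((snd p)(k := fst p)) \<partial>(M k \<Otimes>\<^sub>M PiM I M))"
    using meas assms(3) by (subst nn_integral_distr) (auto simp: split_beta')
  also have "\<dots> = (\<integral>\<^sup>+\<omega>. (\<integral>\<^sup>+s. f ((fun_upd \<omega> k s)) \<partial>M k) \<partial>PiM I M)"
    using measurable_compose[OF meas assms(3)]
    by (subst KP.nn_integral_snd[symmetric]) (auto simp: split_beta')
  finally show ?thesis .
qed

text \<open>\<open>poisson_pmf\<close> asks for a positive rate, but blocks of volume zero may
  occur; they contain no points.\<close>

definition pois :: "real \<Rightarrow> nat pmf" where
  "pois m = (if 0 < m then poisson_pmf m else return_pmf 0)"

lemma pmf_pois: "0 \<le> m \<Longrightarrow> pmf (pois m) k = m ^ k / fact k * exp (- m)"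
  by (cases "m = 0") (auto simp: pois_def pmf_return power_0_left)

lemma pois_mean:
  assumes "0 \<le> m"
  shows "(\<integral>\<^sup>+k. of_nat k \<partial>measure_pmf (pois m)) = ennreal m"
proof -
  have s: "(\<lambda>k. m * (m ^ k / fact k * exp (- m))) sums (m * (exp m * exp (- m)))"
    using exp_converges[of m] by (intro sums_mult sums_mult2) (simp add: divide_inverse mult.commute)
  have "(\<lambda>k. real (Suc k) * pmf (pois m) (Suc k)) sums m"
    using s assms by (simp add: pmf_pois exp_minus field_simps del: of_nat_Suc)
  then have s': "(\<lambda>k. real k * pmf (pois m) k) sums m"
    by (subst (asm) sums_Suc_iff) simp
  have "(\<integral>\<^sup>+k. of_nat k \<partial>measure_pmf (pois m)) = (\<Sum>k. ennreal (pmf (pois m) k) * of_nat k)"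
    by (simp add: nn_integral_measure_pmf nn_integral_count_space_nat)
  also have "\<dots> = (\<Sum>k. ennreal (real k * pmf (pois m) k))"
    by (intro suminf_cong) (simp add: ennreal_mult'' ennreal_of_nat_eq_real_of_nat mult.commute)
  also have "\<dots> = ennreal m" using s'
    by (subst suminf_ennreal2) (auto simp: sums_iff)
  finally show ?thesis .
qed

lemma pois_convolution:
  assumes "0 \<le> a" "0 \<le> b"
  shows "pmf (pois (a + b)) k = (\<Sum>i\<le>k. pmf (pois a) i * pmf (pois b) (k - i))"
proof -
  have "(\<Sum>i\<le>k. pmf (pois a) i * pmf (pois b) (k - i)) =
     (\<Sum>i\<le>k. real (k choose i) * a ^ i * b ^ (k - i)) * exp (- a - b) / fact k"
    using assms unfolding sum_distrib_right sum_divide_distrib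
    by (intro sum.cong) (auto simp: pmf_pois binomial_fact exp_diff exp_minus field_simps)
  also have "\<dots> = pmf (pois (a + b)) k" using assms by (simp add: pmf_pois binomial_ring exp_diff exp_minus field_simps exp_add)
  finally show ?thesis ..
qed

lemma counts_event:
  fixes c :: "nat \<Rightarrow> nat"
  assumes "\<And>j. j < n \<Longrightarrow> h j \<in> M \<rightarrow>\<^sub>M count_space UNIV"
  shows "{\<omega>\<in>space M. \<forall>j<n. h j \<omega> = c j} \<in> sets M"
proof -
  have "Measurable.pred M (\<lambda>x. \<forall>j\<in>{..<n}. h j x = c j)"
    using assms by (intro pred_intros_finite) auto
  then have "{x\<in>space M. \<forall>j\<in>{..<n}. h j x = c j} \<in> sets M" by (rule predE)
  also have "{x\<in>space M. \<forall>j\<in>{..<n}. h j x = c j} = {\<omega>\<in>space M. \<forall>j<n. h j \<omega> = c j}" by auto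
  finally show ?thesis .
qed

type_synonym 'a sample = "nat \<times> (nat \<Rightarrow> 'a)"

text \<open>A Poisson number of independent points with law \<open>U\<close>. An infinite sequence
  is drawn whatever the number, which keeps the sample space a product; the points of a sample are
  the first \<open>fst s\<close> entries.\<close>

definition blk :: "real \<Rightarrow> 'a measure \<Rightarrow> 'a sample measure" where
  "blk m U = measure_pmf (pois m) \<Otimes>\<^sub>M PiM UNIV (\<lambda>_::nat. U)"

definition cnt :: "(nat \<Rightarrow> 'a set) \<Rightarrow> nat \<Rightarrow> nat \<Rightarrow> (nat \<Rightarrow> 'a) \<Rightarrow> nat" where
  "cnt A N j x = card {i. i < N \<and> x i \<in> A j}"

locale pblock = U: prob_space U for U :: "'a measure" +
  fixes m :: real
  assumes m0: "0 \<le> m"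
begin

sublocale X: prob_space "PiM UNIV (\<lambda>_::nat. U)"
  by (rule prob_space_PiM) (rule U.prob_space_axioms)

sublocale B: pair_prob_space "measure_pmf (pois m)" "PiM UNIV (\<lambda>_::nat. U)" ..

lemma prob_space_blk: "prob_space (blk m U)"
  unfolding blk_def by (rule B.prob_space_axioms)

lemma measurable_blk_fst [measurable]: "fst \<in> blk m U \<rightarrow>\<^sub>M count_space UNIV"
  unfolding blk_def by (rule measurable_compose[OF measurable_fst]) simp

lemma measurable_blk_snd: "snd \<in> blk m U \<rightarrow>\<^sub>M PiM UNIV (\<lambda>_::nat. U)"
  unfolding blk_def by simp

lemma measurable_blk_pt [measurable]: "(\<lambda>s. snd s i) \<in> blk m U \<rightarrow>\<^sub>M U"
  by (rule measurable_compose[OF measurable_blk_snd]) simp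

lemma nn_integral_blk:
  assumes "f \<in> borel_measurable (blk m U)"
  shows "(\<integral>\<^sup>+s. f s \<partial>blk m U) = (\<integral>\<^sup>+N. (\<integral>\<^sup>+x. f (N, x) \<partial>PiM UNIV (\<lambda>_. U)) \<partial>measure_pmf (pois m))"
  using assms unfolding blk_def by (subst X.nn_integral_fst[symmetric]) auto

lemma nn_integral_component:
  assumes [measurable]: "f \<in> borel_measurable U"
  shows "(\<integral>\<^sup>+x. f (x (i::nat)) \<partial>PiM UNIV (\<lambda>_. U)) = (\<integral>\<^sup>+y. f y \<partial>U)"
proof -
  have "distr (PiM UNIV (\<lambda>_::nat. U)) U (\<lambda>x. x i) = U"
    by (rule distr_PiM_component) (auto intro: U.prob_space_axioms)
  then have "(\<integral>\<^sup>+y. f y \<partial>U) = (\<integral>\<^sup>+y. f y \<partial>distr (PiM UNIV (\<lambda>_::nat. U)) U (\<lambda>x. x i))" by simp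
  also have "\<dots> = (\<integral>\<^sup>+x. f (x i) \<partial>PiM UNIV (\<lambda>_. U))"
    by (rule nn_integral_distr) auto
  finally show ?thesis ..
qed

lemma sum_points_measurable:
  fixes h :: "nat \<Rightarrow> (nat \<Rightarrow> 'a) \<Rightarrow> ennreal"
  assumes [measurable]: "\<And>i. h i \<in> borel_measurable (PiM UNIV (\<lambda>_. U))"
  shows "(\<lambda>s. \<Sum>i<fst s. h i (snd s)) \<in> borel_measurable (blk m U)"
proof -
  note measurable_blk_snd[measurable]
  have "(\<lambda>s. \<Sum>i<N. h i (snd s)) \<in> borel_measurable (blk m U)" for N by measurable
  from measurable_compose_countable[OF this measurable_blk_fst] show ?thesis by simp
qed

text \<open>The functions \<open>h i\<close> do not see the number of points, so given N =
  \<open>fst s\<close> the sum has mean at most N * c, and the mean of N is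
  \<open>m\<close>.\<close>

lemma sum_points_le:
  fixes h :: "nat \<Rightarrow> (nat \<Rightarrow> 'a) \<Rightarrow> ennreal"
  assumes [measurable]: "\<And>i. h i \<in> borel_measurable (PiM UNIV (\<lambda>_. U))"
    and le: "\<And>i. (\<integral>\<^sup>+x. h i x \<partial>PiM UNIV (\<lambda>_. U)) \<le> c"
  shows "(\<integral>\<^sup>+s. (\<Sum>i<fst s. h i (snd s)) \<partial>blk m U) \<le> ennreal m * c"
proof -
  note sum_points_measurable[of h, OF assms(1), measurable]
  have "(\<integral>\<^sup>+s. (\<Sum>i<fst s. h i (snd s)) \<partial>blk m U) =
     (\<integral>\<^sup>+N. (\<Sum>i<N. (\<integral>\<^sup>+x. h i x \<partial>PiM UNIV (\<lambda>_. U))) \<partial>measure_pmf (pois m))"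
    by (subst nn_integral_blk) (auto simp: nn_integral_sum)
  also have "\<dots> \<le> (\<integral>\<^sup>+N. of_nat N * c \<partial>measure_pmf (pois m))"
  proof (rule nn_integral_mono)
    fix N :: nat
    have "(\<Sum>i<N. (\<integral>\<^sup>+x. h i x \<partial>PiM UNIV (\<lambda>_. U))) \<le> (\<Sum>i<N. c)" by (intro sum_mono le)
    then show "(\<Sum>i<N. (\<integral>\<^sup>+x. h i x \<partial>PiM UNIV (\<lambda>_. U))) \<le> of_nat N * c" by simp
  qed
  also have "\<dots> = ennreal m * c" by (simp add: nn_integral_multc pois_mean m0)
  finally show ?thesis .
qed

lemma some_point_le:
  assumes [measurable]: "Measurable.pred U P" and le: "ennreal m * emeasure U {y\<in>space U. P y} \<le> c"
  shows "emeasure (blk m U) {s\<in>space (blk m U). \<exists>i<fst s. P (snd s i)} \<le> c"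
proof -
  let ?h = "\<lambda>(i::nat) x. indicator {y\<in>space U. P y} (x i) :: ennreal"
  have "emeasure (blk m U) {s\<in>space (blk m U). \<exists>i<fst s. P (snd s i)} =
     (\<integral>\<^sup>+s. indicator {s\<in>space (blk m U). \<exists>i<fst s. P (snd s i)} s \<partial>blk m U)"
    by (subst nn_integral_indicator) measurable
  also have "\<dots> \<le> (\<integral>\<^sup>+s. (\<Sum>i<fst s. ?h i (snd s)) \<partial>blk m U)"
  proof (rule nn_integral_mono)
    fix s assume s: "s \<in> space (blk m U)"
    have sp: "snd s i \<in> space U" for i using measurable_space[OF measurable_blk_pt s] .
    show "indicator {s\<in>space (blk m U). \<exists>i<fst s. P (snd s i)} s \<le> (\<Sum>i<fst s. ?h i (snd s))"
    proof (cases "\<exists>i<fst s. P (snd s i)")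
      case True
      then obtain i where i: "i < fst s" "P (snd s i)" by blast
      have "1 = ?h i (snd s)" using i sp by simp
      also have "\<dots> \<le> (\<Sum>i<fst s. ?h i (snd s))" using i by (intro member_le_sum) auto
      finally show ?thesis by (auto simp: indicator_def)
    qed auto
  qed
  also have "\<dots> \<le> ennreal m * emeasure U {y\<in>space U. P y}"
  proof (rule sum_points_le)
    show "?h i \<in> borel_measurable (PiM UNIV (\<lambda>_. U))" for i by measurable
    have "(\<integral>\<^sup>+x. ?h i x \<partial>PiM UNIV (\<lambda>_. U)) = (\<integral>\<^sup>+y. indicator {y\<in>space U. P y} y \<partial>U)" for i
      by (rule nn_integral_component) measurable
    then show "(\<integral>\<^sup>+x. ?h i x \<partial>PiM UNIV (\<lambda>_. U)) \<le> emeasure U {y\<in>space U. P y}" for i by simp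
  qed
  also note le
  finally show ?thesis .
qed

text \<open>Pairs formed by the first point in \<open>C\<close> and a different point: re-sampling the other point does not change
  the first one, provided the latter is computed with the former removed.\<close>

lemma selected_pair_measurable:
  fixes g :: "'a \<Rightarrow> 'a \<Rightarrow> ennreal"
  assumes [measurable]: "(\<lambda>(x, y). g x y) \<in> borel_measurable (U \<Otimes>\<^sub>M U)" "C \<in> sets U"
  shows "(\<lambda>x. if i \<noteq> (LEAST j. x j \<in> C) \<and> x (LEAST j. x j \<in> C) \<in> C then g (x (LEAST j. x j \<in> C)) (x i) else 0)
    \<in> borel_measurable (PiM UNIV (\<lambda>_::nat. U))"
proof -
  let ?PX = "PiM UNIV (\<lambda>_::nat. U)"
  have J[measurable]: "(\<lambda>x. LEAST j. x j \<in> C) \<in> ?PX \<rightarrow>\<^sub>M count_space UNIV"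
    by (rule measurable_Least) measurable
  have XJ[measurable]: "(\<lambda>x. x (LEAST j. x j \<in> C)) \<in> ?PX \<rightarrow>\<^sub>M U"
    by (rule measurable_compose_countable[OF _ J]) measurable
  have gm: "(\<lambda>x. g (x (LEAST j. x j \<in> C)) (x i)) \<in> borel_measurable ?PX"
    using measurable_compose[OF measurable_Pair[OF XJ measurable_component_singleton[of i UNIV "\<lambda>_. U"]] assms(1)] by simp
  then show ?thesis by measurable
qed

lemma selected_pairs_le:
  fixes g :: "'a \<Rightarrow> 'a \<Rightarrow> ennreal"
  assumes [measurable]: "(\<lambda>(x, y). g x y) \<in> borel_measurable (U \<Otimes>\<^sub>M U)" "C \<in> sets U"
    and le: "\<And>x. x \<in> C \<Longrightarrow> (\<integral>\<^sup>+y. g x y \<partial>U) \<le> c"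
  shows "(\<integral>\<^sup>+s. (\<Sum>i<fst s. if i \<noteq> (LEAST j. snd s j \<in> C) \<and> snd s (LEAST j. snd s j \<in> C) \<in> C
      then g (snd s (LEAST j. snd s j \<in> C)) (snd s i) else 0) \<partial>blk m U) \<le> ennreal m * c"
proof (rule sum_points_le)
  let ?PX = "PiM UNIV (\<lambda>_::nat. U)"
  fix i :: nat
  let ?h = "\<lambda>x. if i \<noteq> (LEAST j. x j \<in> C) \<and> x (LEAST j. x j \<in> C) \<in> C then g (x (LEAST j. x j \<in> C)) (x i) else 0"
  show hm: "?h \<in> borel_measurable ?PX"
    by (rule selected_pair_measurable[OF assms(1,2)])
  let ?J = "\<lambda>x. LEAST j. j \<noteq> i \<and> x j \<in> C"
  have upd: "?h (x(i := y)) \<le> (if x (?J x) \<in> C then g (x (?J x)) y else 0)" for x y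
  proof (cases "i \<noteq> (LEAST j. (x(i := y)) j \<in> C) \<and> (x(i := y)) (LEAST j. (x(i := y)) j \<in> C) \<in> C")
    case True
    define L where "L = (LEAST j. (x(i := y)) j \<in> C)"
    have "i \<noteq> L" "(x(i := y)) L \<in> C" using True unfolding L_def by blast+
    then have L: "L \<noteq> i" "x L \<in> C" by auto
    have "?J x = L"
    proof (rule Least_equality)
      show "L \<noteq> i \<and> x L \<in> C" using L by simp
      fix j assume "j \<noteq> i \<and> x j \<in> C"
      then have "(x(i := y)) j \<in> C" by simp
      then show "L \<le> j" unfolding L_def by (rule Least_le)
    qed
    then show ?thesis unfolding L_def[symmetric] \<open>?J x = L\<close> using L by simp
  qed (simp only: if_False zero_le)
  have "(\<integral>\<^sup>+x. ?h x \<partial>?PX) = (\<integral>\<^sup>+x. (\<integral>\<^sup>+y. ?h (x(i := y)) \<partial>U) \<partial>?PX)"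
    by (rule nn_integral_PiM_update[OF _ _ hm]) (auto intro: U.prob_space_axioms)
  also have "\<dots> \<le> (\<integral>\<^sup>+x. (\<integral>\<^sup>+y. (if x (?J x) \<in> C then g (x (?J x)) y else 0) \<partial>U) \<partial>?PX)"
    by (intro nn_integral_mono upd)
  also have "\<dots> \<le> (\<integral>\<^sup>+x. c \<partial>?PX)"
  proof (rule nn_integral_mono)
    fix x :: "nat \<Rightarrow> 'a"
    show "(\<integral>\<^sup>+y. (if x (?J x) \<in> C then g (x (?J x)) y else 0) \<partial>U) \<le> c"
      by (cases "x (?J x) \<in> C") (simp_all add: le)
  qed
  also have "\<dots> = c" by (simp add: X.emeasure_space_1)
  finally show "(\<integral>\<^sup>+x. ?h x \<partial>?PX) \<le> c" .
qed

section \<open>Joint law of the counts in disjoint sets\<close>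

context
  fixes A :: "nat \<Rightarrow> 'a set" and n :: nat
  assumes A [measurable]: "\<And>j. j < n \<Longrightarrow> A j \<in> sets U" and disj: "disjoint_family_on A {..<n}"
begin

lemma cnt_0: "cnt A 0 j x = 0" and cnt_Suc: "cnt A (Suc N) j x = cnt A N j x + of_bool (x N \<in> A j)"
proof -
  show "cnt A 0 j x = 0" by (simp add: cnt_def)
  have "{i. i < Suc N \<and> x i \<in> A j} = {i. i < N \<and> x i \<in> A j} \<union> (if x N \<in> A j then {N} else {})"
    by (auto simp: less_Suc_eq)
  then show "cnt A (Suc N) j x = cnt A N j x + of_bool (x N \<in> A j)"
    by (simp add: cnt_def)
qed

lemma cnt_measurable: "j < n \<Longrightarrow> cnt A N j \<in> PiM UNIV (\<lambda>_. U) \<rightarrow>\<^sub>M count_space UNIV"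
proof (induction N)
  case (Suc N)
  note Suc.IH[OF Suc.prems, measurable] A[OF Suc.prems, measurable]
  show ?case unfolding cnt_Suc by measurable
next
  case 0
  have "cnt A 0 j = (\<lambda>_. 0)" by (simp add: fun_eq_iff cnt_0)
  then show ?case by simp
qed

definition rest :: "'a set" where "rest = space U - (\<Union>j<n. A j)"

text \<open>The multinomial probability of the counts \<open>c\<close> among \<open>N\<close>
  points, with the remaining points in \<open>rest\<close>. The product form is the one that
  factorises once \<open>N\<close> becomes Poisson.\<close>

definition mn :: "nat \<Rightarrow> (nat \<Rightarrow> nat) \<Rightarrow> real" where
  "mn N c = (if sum c {..<n} \<le> N then fact N * (\<Prod>j<n. measure U (A j) ^ c j / fact (c j)) *
     (measure U rest ^ (N - sum c {..<n}) / fact (N - sum c {..<n})) else 0)"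

lemma mn_nonneg: "0 \<le> mn N c"
  by (auto simp: mn_def intro!: mult_nonneg_nonneg prod_nonneg divide_nonneg_nonneg)

text \<open>The recursion for adding one point: it falls into \<open>rest\<close>, or into some
  \<open>A j\<close> whose count was one less before. It is verified algebraically from the closed
  form.\<close>

lemma mn_Suc:
  "mn (Suc N) c = measure U rest * mn N c +
     (\<Sum>j<n. measure U (A j) * (if 0 < c j then mn N (c(j := c j - 1)) else 0))"
proof -
  define W where "W = (\<Prod>j<n. measure U (A j) ^ c j / fact (c j))"
  define q where "q = measure U rest"
  define s where "s = sum c {..<n}"
  have sumj: "sum (c(j := c j - 1)) {..<n} = s - 1 \<and> 1 \<le> s" if "j < n" "0 < c j" for j
  proof -
    have "s = c j + sum c ({..<n} - {j})" unfolding s_def using that by (subst sum.remove[of _ j]) auto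
    moreover have "sum (c(j := c j - 1)) {..<n} = (c j - 1) + sum c ({..<n} - {j})"
      using that by (subst sum.remove[of _ j]) (auto intro!: sum.cong)
    ultimately show ?thesis using that by simp
  qed
  have Wj: "measure U (A j) * (\<Prod>i<n. measure U (A i) ^ (c(j := c j - 1)) i / fact ((c(j := c j - 1)) i)) = real (c j) * W"
    if "j < n" "0 < c j" for j
  proof -
    define T where "T = (\<Prod>i\<in>{..<n} - {j}. measure U (A i) ^ c i / fact (c i))"
    have e1: "(\<Prod>i<n. measure U (A i) ^ (c(j := c j - 1)) i / fact ((c(j := c j - 1)) i)) =
       measure U (A j) ^ (c j - 1) / fact (c j - 1) * T"
      unfolding T_def using that by (subst prod.remove[of _ j]) (auto intro!: prod.cong)
    have e2: "W = measure U (A j) ^ c j / fact (c j) * T"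
      unfolding W_def T_def using that by (subst prod.remove[of _ j]) auto
    have e3: "fact (c j) = real (c j) * fact (c j - 1)" "measure U (A j) ^ c j = measure U (A j) * measure U (A j) ^ (c j - 1)"
      using that by (simp_all add: fact_reduce power_eq_if)
    show ?thesis unfolding e1 e2 e3 using that by simp
  qed
  \<comment> \<open>At \<open>s = Suc N\<close> nothing is left for \<open>rest\<close>:
    \<open>mn N c\<close> is 0, while every reduced vector sums to \<open>N\<close>.\<close>
  consider "s \<le> N" | "s = Suc N" | "s > Suc N" by linarith
  then show ?thesis
  proof cases
    case 1
    define k where "k = N - s"
    have N: "N = s + k" using 1 by (simp add: k_def)
    have trm: "measure U (A j) * (if 0 < c j then mn N (c(j := c j - 1)) else 0) =
       real (c j) * (fact N * W * (q ^ Suc k / fact (Suc k)))" if "j < n" for j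
    proof (cases "0 < c j")
      case True
      note S = sumj[OF that True]
      have "mn N (c(j := c j - 1)) = fact N * (\<Prod>i<n. measure U (A i) ^ (c(j := c j - 1)) i / fact ((c(j := c j - 1)) i)) * (q ^ Suc k / fact (Suc k))"
        using S unfolding mn_def q_def N by (simp add: Suc_diff_le)
      then have "measure U (A j) * mn N (c(j := c j - 1)) = fact N * (measure U (A j) *
          (\<Prod>i<n. measure U (A i) ^ (c(j := c j - 1)) i / fact ((c(j := c j - 1)) i))) * (q ^ Suc k / fact (Suc k))"
        by (simp only: mult_ac)
      also have "\<dots> = real (c j) * (fact N * W * (q ^ Suc k / fact (Suc k)))"
        unfolding Wj[OF that True] by (simp only: mult_ac)
      finally show ?thesis using True by (simp only: if_True)
    qed simp
    have "(\<Sum>j<n. measure U (A j) * (if 0 < c j then mn N (c(j := c j - 1)) else 0)) =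
       (\<Sum>j<n. real (c j) * (fact N * W * (q ^ Suc k / fact (Suc k))))"
      by (intro sum.cong refl trm) simp
    also have "\<dots> = real s * (fact N * W * (q ^ Suc k / fact (Suc k)))"
      unfolding s_def of_nat_sum sum_distrib_right ..
    finally have e: "(\<Sum>j<n. measure U (A j) * (if 0 < c j then mn N (c(j := c j - 1)) else 0)) = \<dots>" .
    have m1: "mn N c = fact N * W * (q ^ k / fact k)" using 1 by (simp add: mn_def W_def q_def s_def k_def)
    have m2: "mn (Suc N) c = fact (Suc N) * W * (q ^ Suc k / fact (Suc k))"
      using 1 by (simp add: mn_def W_def q_def s_def k_def Suc_diff_le del: power_Suc fact_Suc)
    \<comment> \<open>After common factors are removed, the recursion says that the counts,
      including that of the remainder, add up to N + 1.\<close>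
    have "real (Suc N) = real s + real (Suc k)" by (simp add: N)
    then have f1: "fact (Suc N) = (real s + real (Suc k)) * fact N" by (simp del: of_nat_Suc)
    have f2: "q * (q ^ k / fact k) = real (Suc k) * (q ^ Suc k / fact (Suc k))" by simp
    have "q * mn N c = fact N * W * (q * (q ^ k / fact k))" unfolding m1 by (simp only: mult_ac)
    also have "\<dots> = real (Suc k) * (fact N * W * (q ^ Suc k / fact (Suc k)))" unfolding f2 by (simp only: mult_ac)
    finally have f3: "q * mn N c = \<dots>" .
    show ?thesis unfolding e m2 f1 q_def[symmetric] f3 by (simp only: distrib_right distrib_left mult_ac add_ac)
  next
    case 2
    have trm: "measure U (A j) * (if 0 < c j then mn N (c(j := c j - 1)) else 0) = real (c j) * (fact N * W)" if "j < n" for j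
    proof (cases "0 < c j")
      case True
      note S = sumj[OF that True]
      have "mn N (c(j := c j - 1)) = fact N * (\<Prod>i<n. measure U (A i) ^ (c(j := c j - 1)) i / fact ((c(j := c j - 1)) i))"
        using S 2 unfolding mn_def by simp
      then have "measure U (A j) * mn N (c(j := c j - 1)) = fact N * (measure U (A j) *
          (\<Prod>i<n. measure U (A i) ^ (c(j := c j - 1)) i / fact ((c(j := c j - 1)) i)))"
        by (simp only: mult_ac)
      also have "\<dots> = real (c j) * (fact N * W)"
        unfolding Wj[OF that True] by (simp only: mult_ac)
      finally show ?thesis using True by (simp only: if_True)
    qed simp
    have "(\<Sum>j<n. measure U (A j) * (if 0 < c j then mn N (c(j := c j - 1)) else 0)) = (\<Sum>j<n. real (c j) * (fact N * W))"
      by (intro sum.cong refl trm) simp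
    also have "\<dots> = real s * (fact N * W)" by (simp add: s_def sum_distrib_right)
    finally show ?thesis using 2 by (simp add: mn_def s_def[symmetric] W_def[symmetric])
  next
    case 3
    have "(if 0 < c j then mn N (c(j := c j - 1)) else 0) = 0" if "j < n" for j
      using sumj[OF that] 3 by (auto simp: mn_def)
    then show ?thesis using 3 by (simp add: mn_def s_def[symmetric])
  qed
qed

text \<open>Induction on the number of points. Point number \<open>N\<close> is independent of the
  first \<open>N\<close>, by resampling it, and its position gives the terms of
  \<open>mn_Suc\<close>.\<close>

lemma emeasure_mn:
  "emeasure (PiM UNIV (\<lambda>_. U)) {x\<in>space (PiM UNIV (\<lambda>_. U)). \<forall>j<n. cnt A N j x = c j} = ennreal (mn N c)"
proof (induction N arbitrary: c)
  case 0
  have "measure U rest ^ 0 / fact 0 = 1" by simp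
  show ?case
  proof (cases "\<forall>j<n. c j = 0")
    case True
    then have "sum c {..<n} = 0" "(\<Prod>j<n. measure U (A j) ^ c j / fact (c j)) = 1" by auto
    then show ?thesis using True by (simp add: cnt_0 mn_def X.emeasure_space_1)
  next
    case False
    then have "\<not> sum c {..<n} \<le> 0" by auto
    then have z: "mn 0 c = 0" unfolding mn_def by (rule if_not_P)
    have "{x\<in>space (PiM UNIV (\<lambda>_. U)). \<forall>j<n. cnt A 0 j x = c j} = {}" using False by (auto simp: cnt_0)
    then show ?thesis by (simp only: z) simp
  qed
next
  case (Suc N)
  let ?PX = "PiM UNIV (\<lambda>_::nat. U)"
  define E where "E c = {x\<in>space ?PX. \<forall>j<n. cnt A N j x = c j}" for c
  have Em[measurable]: "E c \<in> sets ?PX" for c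
    unfolding E_def by (intro counts_event cnt_measurable)
  have cong: "x(N := y) \<in> E c \<longleftrightarrow> x \<in> E c" if "x \<in> space ?PX" "y \<in> space U" for x y c
  proof -
    have "cnt A N j (x(N := y)) = cnt A N j x" for j unfolding cnt_def by (intro arg_cong[where f=card]) auto
    moreover have "x(N := y) \<in> space ?PX" using that by (auto simp: space_PiM PiE_def)
    ultimately show ?thesis using that by (simp add: E_def)
  qed
  have prod: "emeasure ?PX {x\<in>space ?PX. x \<in> E c' \<and> x N \<in> D} = ennreal (mn N c') * emeasure U D"
    if [measurable]: "D \<in> sets U" for D c'
  proof -
    have m: "{x\<in>space ?PX. x \<in> E c' \<and> x N \<in> D} \<in> sets ?PX" by measurable
    have "emeasure ?PX {x\<in>space ?PX. x \<in> E c' \<and> x N \<in> D} = (\<integral>\<^sup>+x. indicator {x\<in>space ?PX. x \<in> E c' \<and> x N \<in> D} x \<partial>?PX)"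
      using m by simp
    also have "\<dots> = (\<integral>\<^sup>+x. (\<integral>\<^sup>+y. indicator {x\<in>space ?PX. x \<in> E c' \<and> x N \<in> D} (x(N := y)) \<partial>U) \<partial>?PX)"
      by (rule nn_integral_PiM_update) (use m in \<open>auto intro: U.prob_space_axioms\<close>)
    also have "\<dots> = (\<integral>\<^sup>+x. (\<integral>\<^sup>+y. indicator (E c') x * indicator D y \<partial>U) \<partial>?PX)"
    proof (intro nn_integral_cong)
      fix x y assume "x \<in> space ?PX" "y \<in> space U"
      then show "indicator {x\<in>space ?PX. x \<in> E c' \<and> x N \<in> D} (x(N := y)) = (indicator (E c') x * indicator D y :: ennreal)"
        using cong[of x y c'] by (auto simp: indicator_def space_PiM PiE_def)
    qed
    also have "\<dots> = emeasure ?PX (E c') * emeasure U D"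
      by (simp add: nn_integral_cmult nn_integral_multc)
    finally show ?thesis using Suc.IH[of c'] unfolding E_def by simp
  qed
  have restm[measurable]: "rest \<in> sets U" unfolding rest_def using A by (intro sets.Diff sets.top sets.finite_UN) auto
  let ?L = "{x\<in>space ?PX. \<forall>j<n. cnt A (Suc N) j x = c j}" and ?Zr = "{x\<in>space ?PX. x \<in> E c \<and> x N \<in> rest}"
    and ?I = "{j. j < n \<and> 0 < c j}" and ?R = "\<lambda>j. {x\<in>space ?PX. x \<in> E (c(j := c j - 1)) \<and> x N \<in> A j}"
  have split: "?L = ?Zr \<union> (\<Union>j\<in>?I. ?R j)"
  proof (intro equalityI subsetI)
    fix x assume x: "x \<in> ?L"
    then have xs: "x \<in> space ?PX" "x N \<in> space U" by (auto simp: space_PiM)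
    show "x \<in> ?Zr \<union> (\<Union>j\<in>?I. ?R j)"
    proof (cases "x N \<in> rest")
      case True
      then have "x N \<notin> A j" if "j < n" for j using that by (auto simp: rest_def)
      then show ?thesis using x True by (auto simp: E_def cnt_Suc)
    next
      case False
      then obtain j where j: "j < n" "x N \<in> A j" using xs by (auto simp: rest_def)
      have other: "x N \<notin> A i" if "i < n" "i \<noteq> j" for i
        using disj j that unfolding disjoint_family_on_def by blast
      have cj: "c j = cnt A N j x + 1" using x j by (auto simp: cnt_Suc)
      have "x \<in> E (c(j := c j - 1))" unfolding E_def using x other cj by (auto simp: cnt_Suc)
      then show ?thesis using j cj xs by auto
    qed
  next
    fix x assume "x \<in> ?Zr \<union> (\<Union>j\<in>?I. ?R j)"
    then consider "x \<in> ?Zr" | j where "j \<in> ?I" "x \<in> ?R j" by blast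
    then show "x \<in> ?L"
    proof cases
      case 1
      then have "x N \<notin> A j" if "j < n" for j using that by (auto simp: rest_def)
      then show ?thesis using 1 by (auto simp: E_def cnt_Suc)
    next
      case 2
      then have other: "x N \<notin> A i" if "i < n" "i \<noteq> j" for i
        using disj that unfolding disjoint_family_on_def by blast
      have "cnt A (Suc N) i x = c i" if "i < n" for i
        using 2 other[OF that] that by (cases "i = j") (auto simp: E_def cnt_Suc)
      then show ?thesis using 2 by auto
    qed
  qed
  have d: "disjoint_family_on ?R ?I" using disj unfolding disjoint_family_on_def by blast
  have "emeasure ?PX ?L = emeasure ?PX ?Zr + emeasure ?PX (\<Union>j\<in>?I. ?R j)"
    unfolding split using A by (intro plus_emeasure[symmetric] sets.finite_UN) (auto simp: rest_def)
  also have "emeasure ?PX (\<Union>j\<in>?I. ?R j) = (\<Sum>j\<in>?I. emeasure ?PX (?R j))"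
    using A by (intro sum_emeasure[symmetric] d) auto
  also have "\<dots> = (\<Sum>j\<in>?I. ennreal (measure U (A j) * mn N (c(j := c j - 1))))"
    using prod A by (intro sum.cong) (auto simp: U.emeasure_eq_measure ennreal_mult mn_nonneg mult.commute)
  also have "\<dots> = ennreal (\<Sum>j\<in>?I. measure U (A j) * mn N (c(j := c j - 1)))"
    by (intro sum_ennreal) (auto simp: mn_nonneg)
  also have "(\<Sum>j\<in>?I. measure U (A j) * mn N (c(j := c j - 1))) =
     (\<Sum>j<n. measure U (A j) * (if 0 < c j then mn N (c(j := c j - 1)) else 0))"
    by (intro sum.mono_neutral_cong_left) auto
  also have "emeasure ?PX ?Zr = ennreal (measure U rest * mn N c)"
    using prod[OF restm, of c] by (simp add: U.emeasure_eq_measure ennreal_mult mn_nonneg mult.commute)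
  finally show ?case unfolding mn_Suc
    by (subst ennreal_plus) (auto intro!: sum_nonneg mult_nonneg_nonneg simp: mn_nonneg)
qed

lemma cnt_blk_measurable:
  assumes "j < n"
  shows "(\<lambda>s. cnt A (fst s) j (snd s)) \<in> blk m U \<rightarrow>\<^sub>M count_space UNIV"
  using measurable_compose_countable[OF measurable_compose[OF measurable_blk_snd cnt_measurable[OF assms]] measurable_blk_fst] .

text \<open>Averaging the multinomial law over a Poisson number of points leaves a product of
  Poisson weights: the sum over the number of remaining points is an exponential series.\<close>

lemma counts_blk:
  "measure (blk m U) {s\<in>space (blk m U). \<forall>j<n. cnt A (fst s) j (snd s) = c j} =
    (\<Prod>j<n. pmf (pois (m * measure U (A j))) (c j))"
proof -
  let ?PX = "PiM UNIV (\<lambda>_::nat. U)"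
  let ?E = "{s\<in>space (blk m U). \<forall>j<n. cnt A (fst s) j (snd s) = c j}"
  define s where "s = sum c {..<n}"
  define W where "W = (\<Prod>j<n. measure U (A j) ^ c j / fact (c j))"
  define q where "q = measure U rest"
  have q: "q + (\<Sum>j<n. measure U (A j)) = 1"
  proof -
    have "measure U (\<Union>j<n. A j) = (\<Sum>j<n. measure U (A j))"
      by (rule U.finite_measure_finite_Union) (use A disj in auto)
    moreover have "measure U rest = 1 - measure U (\<Union>j<n. A j)"
      unfolding rest_def using A by (intro U.prob_compl sets.finite_UN) auto
    ultimately show ?thesis by (simp add: q_def)
  qed
  have Em[measurable]: "?E \<in> sets (blk m U)"
    by (intro counts_event cnt_blk_measurable)
  have "emeasure (blk m U) ?E = (\<integral>\<^sup>+s. indicator ?E s \<partial>blk m U)"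
    by (rule nn_integral_indicator[symmetric]) (rule Em)
  also have "\<dots> = (\<integral>\<^sup>+N. (\<integral>\<^sup>+x. indicator ?E (N, x) \<partial>?PX) \<partial>measure_pmf (pois m))"
    by (rule nn_integral_blk) (intro borel_measurable_indicator Em)
  also have "\<dots> = (\<integral>\<^sup>+N. ennreal (mn N c) \<partial>measure_pmf (pois m))"
  proof (rule nn_integral_cong)
    fix N :: nat
    have "(\<integral>\<^sup>+x. indicator ?E (N, x) \<partial>?PX) = (\<integral>\<^sup>+x. indicator {x\<in>space ?PX. \<forall>j<n. cnt A N j x = c j} x \<partial>?PX)"
      by (intro nn_integral_cong) (auto simp: indicator_def blk_def space_pair_measure)
    also have "\<dots> = emeasure ?PX {x\<in>space ?PX. \<forall>j<n. cnt A N j x = c j}"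
      by (rule nn_integral_indicator) (intro counts_event cnt_measurable)
    finally show "(\<integral>\<^sup>+x. indicator ?E (N, x) \<partial>?PX) = ennreal (mn N c)" by (simp add: emeasure_mn)
  qed
  also have "\<dots> = (\<Sum>N. ennreal (pmf (pois m) N) * ennreal (mn N c))"
    by (simp add: nn_integral_measure_pmf nn_integral_count_space_nat)
  also have "\<dots> = (\<Sum>N. ennreal (pmf (pois m) N * mn N c))"
    by (intro suminf_cong) (simp add: ennreal_mult mn_nonneg)
  also have "\<dots> = ennreal (m ^ s * W * exp (- m) * exp (m * q))"
  proof -
    \<comment> \<open>The terms with \<open>N < s\<close> vanish; with N = k + s the factorials
      cancel and the series over \<open>k\<close> gives exp (m * q).\<close>
    have "(\<lambda>k. (m * q) ^ k / fact k * (m ^ s * W * exp (- m))) sums (exp (m * q) * (m ^ s * W * exp (- m)))"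
      using exp_converges[of "m * q"] by (intro sums_mult2) (simp add: divide_inverse mult.commute)
    moreover have "pmf (pois m) (k + s) * mn (k + s) c = (m * q) ^ k / fact k * (m ^ s * W * exp (- m))" for k
      using m0 by (simp add: pmf_pois mn_def s_def[symmetric] W_def[symmetric] q_def[symmetric] power_add power_mult_distrib field_simps)
    ultimately have "(\<lambda>k. pmf (pois m) (k + s) * mn (k + s) c) sums (exp (m * q) * (m ^ s * W * exp (- m)))" by simp
    then have "(\<lambda>N. pmf (pois m) N * mn N c) sums (exp (m * q) * (m ^ s * W * exp (- m)) + (\<Sum>i<s. pmf (pois m) i * mn i c))"
      by (subst (asm) sums_iff_shift)
    moreover have "(\<Sum>i<s. pmf (pois m) i * mn i c) = 0" by (intro sum.neutral) (auto simp: mn_def s_def)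
    ultimately have "(\<lambda>N. pmf (pois m) N * mn N c) sums (m ^ s * W * exp (- m) * exp (m * q))" by (simp add: mult_ac)
    then show ?thesis by (subst suminf_ennreal2) (auto simp: sums_iff mn_nonneg)
  qed
  also have "m ^ s * W * exp (- m) * exp (m * q) = (\<Prod>j<n. pmf (pois (m * measure U (A j))) (c j))"
  proof -
    have "exp (- m) * exp (m * q) = exp (- (\<Sum>j<n. m * measure U (A j)))"
    proof -
      have "- m + m * q = - (m * (\<Sum>j<n. measure U (A j)))" using q by (simp add: algebra_simps) (metis distrib_left mult.right_neutral add.commute)
      then show ?thesis by (simp add: exp_add[symmetric] sum_distrib_left)
    qed
    also have "\<dots> = (\<Prod>j<n. exp (- (m * measure U (A j))))" by (simp add: exp_sum sum_negf[symmetric])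
    finally have e: "exp (- m) * exp (m * q) = (\<Prod>j<n. exp (- (m * measure U (A j))))" .
    have "m ^ s * W * (exp (- m) * exp (m * q)) = (\<Prod>j<n. m ^ c j * (measure U (A j) ^ c j / fact (c j)) * exp (- (m * measure U (A j))))"
      unfolding e W_def s_def power_sum by (simp only: prod.distrib)
    also have "\<dots> = (\<Prod>j<n. pmf (pois (m * measure U (A j))) (c j))"
      using m0 by (intro prod.cong) (auto simp: pmf_pois power_mult_distrib)
    finally show ?thesis by (simp add: mult.assoc)
  qed
  finally show ?thesis by (simp add: measure_def prod_nonneg)
qed

end

end

text \<open>Independence of Poisson counts, expressed by point probabilities: this form is stable
  under superposition by mere convolution, and \<open>poisson_counts_indep\<close> turns it into
  independence.\<close>

definition poisson_counts :: "'w measure \<Rightarrow> nat \<Rightarrow> (nat \<Rightarrow> 'w \<Rightarrow> nat) \<Rightarrow> (nat \<Rightarrow> real) \<Rightarrow> bool" where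
  "poisson_counts M n f a \<longleftrightarrow> (\<forall>j<n. 0 \<le> a j \<and> f j \<in> M \<rightarrow>\<^sub>M count_space UNIV) \<and>
     (\<forall>c. measure M {\<omega>\<in>space M. \<forall>j<n. f j \<omega> = c j} = (\<Prod>j<n. pmf (pois (a j)) (c j)))"

text \<open>Coordinate \<open>k\<close> is independent of those in \<open>K\<close>. Summing over
  all ways \<open>d\<close> in which it can share in the counts \<open>c\<close> gives, after
  interchanging product and sum, one Poisson convolution for each \<open>j\<close>.\<close>

lemma poisson_counts_superpose:
  assumes prob: "\<And>k. k \<in> I \<Longrightarrow> prob_space (B k)" and K: "finite K" "K \<subseteq> I"
    and pc: "\<And>k. k \<in> K \<Longrightarrow> poisson_counts (B k) n (f k) (a k)"
  shows "poisson_counts (PiM I B) n (\<lambda>j \<omega>. \<Sum>k\<in>K. f k j (\<omega> k)) (\<lambda>j. \<Sum>k\<in>K. a k j)"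
  using K pc
proof (induction K rule: finite_induct)
  case empty
  interpret P: prob_space "PiM I B" by (rule prob_space_PiM) (rule prob)
  have "measure (PiM I B) {\<omega>\<in>space (PiM I B). \<forall>j<n. 0 = c j} = (\<Prod>j<n. pmf (pois 0) (c j))" for c :: "nat \<Rightarrow> nat"
  proof (cases "\<forall>j<n. c j = 0")
    case True
    then have "{\<omega>\<in>space (PiM I B). \<forall>j<n. 0 = c j} = space (PiM I B)" by auto
    moreover have "(\<Prod>j<n. pmf (pois 0) (c j)) = 1" using True by (intro prod.neutral) (auto simp: pmf_pois)
    ultimately show ?thesis by (simp add: P.prob_space)
  next
    case False
    then obtain j where j: "j < n" "c j \<noteq> 0" by auto
    then have e: "{\<omega>\<in>space (PiM I B). \<forall>j<n. 0 = c j} = {}" by force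
    have "pmf (pois 0) (c j) = 0" using j by (simp add: pmf_pois)
    then have "(\<Prod>j<n. pmf (pois 0) (c j)) = 0" using j by (intro prod_zero) auto
    then show ?thesis unfolding e by simp
  qed
  then show ?case by (simp add: poisson_counts_def)
next
  case (insert k K)
  interpret P: prob_space "PiM I B" by (rule prob_space_PiM) (rule prob)
  have kI: "k \<in> I" "K \<subseteq> I" using insert by auto
  interpret Bk: prob_space "B k" by (rule prob[OF kI(1)])
  let ?P = "PiM I B"
  define g where "g j \<omega> = (\<Sum>k\<in>K. f k j (\<omega> k))" for j \<omega>
  have IH: "poisson_counts ?P n g (\<lambda>j. \<Sum>k\<in>K. a k j)"
    unfolding g_def using insert by auto
  have pk: "poisson_counts (B k) n (f k) (a k)" using insert by auto
  have gm: "g j \<in> ?P \<rightarrow>\<^sub>M count_space UNIV" if "j < n" for j using IH that by (auto simp: poisson_counts_def)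
  have fm: "f k j \<in> B k \<rightarrow>\<^sub>M count_space UNIV" if "j < n" for j using pk that by (auto simp: poisson_counts_def)
  have fm': "(\<lambda>\<omega>. f k j (\<omega> k)) \<in> ?P \<rightarrow>\<^sub>M count_space UNIV" if "j < n" for j
    by (rule measurable_compose[where f="\<lambda>\<omega>. \<omega> k" and g="f k j", OF measurable_component_singleton[OF kI(1), of B] fm[OF that]])
  have main: "measure ?P {\<omega>\<in>space ?P. \<forall>j<n. f k j (\<omega> k) + g j \<omega> = c j} = (\<Prod>j<n. pmf (pois (a k j + (\<Sum>k\<in>K. a k j))) (c j))" for c
  proof -
    let ?D = "PiE {..<n} (\<lambda>j. {..c j})"
    let ?A = "\<lambda>d. {\<omega>\<in>space ?P. \<forall>j<n. f k j (\<omega> k) = d j} \<inter> {\<omega>\<in>space ?P. \<forall>j<n. g j \<omega> = c j - d j}"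
    have Am: "?A d \<in> sets ?P" for d by (intro sets.Int counts_event gm fm')
    have eq: "{\<omega>\<in>space ?P. \<forall>j<n. f k j (\<omega> k) + g j \<omega> = c j} = (\<Union>d\<in>?D. ?A d)"
    proof (intro equalityI subsetI)
      fix \<omega> assume w: "\<omega> \<in> {\<omega>\<in>space ?P. \<forall>j<n. f k j (\<omega> k) + g j \<omega> = c j}"
      let ?d = "restrict (\<lambda>j. f k j (\<omega> k)) {..<n}"
      have "f k j (\<omega> k) \<le> c j" "g j \<omega> = c j - f k j (\<omega> k)" if "j < n" for j
      proof -
        have "f k j (\<omega> k) + g j \<omega> = c j" using w that by simp
        then show "f k j (\<omega> k) \<le> c j" "g j \<omega> = c j - f k j (\<omega> k)" by linarith+
      qed
      then have dD: "?d \<in> ?D" and wA: "\<omega> \<in> ?A ?d" using w by auto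
      show "\<omega> \<in> (\<Union>d\<in>?D. ?A d)"
      proof (rule UN_I)
        show "?d \<in> ?D" by (rule dD)
        show "\<omega> \<in> ?A ?d" by (rule wA)
      qed
    next
      fix \<omega> assume "\<omega> \<in> (\<Union>d\<in>?D. ?A d)"
      then obtain d where "d \<in> ?D" "\<omega> \<in> ?A d" by blast
      then show "\<omega> \<in> {\<omega>\<in>space ?P. \<forall>j<n. f k j (\<omega> k) + g j \<omega> = c j}" by (auto simp: PiE_def Pi_def)
    qed
    have disj: "disjoint_family_on ?A ?D"
      unfolding disjoint_family_on_def
    proof (intro ballI impI)
      fix d d' assume d: "d \<in> ?D" "d' \<in> ?D" "d \<noteq> d'"
      then obtain j where "j < n" "d j \<noteq> d' j" using PiE_ext[OF d(1,2)] by auto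
      then show "?A d \<inter> ?A d' = {}" by auto
    qed
    have ind: "measure ?P (?A d) = (\<Prod>j<n. pmf (pois (a k j)) (d j)) * (\<Prod>j<n. pmf (pois (\<Sum>k\<in>K. a k j)) (c j - d j))" for d
    proof -
      define F where "F = {s\<in>space (B k). \<forall>j<n. f k j s = d j}"
      define H where "H = {\<omega>\<in>space ?P. \<forall>j<n. g j \<omega> = c j - d j}"
      have Fm: "F \<in> sets (B k)" unfolding F_def by (intro counts_event fm)
      have Hm: "H \<in> sets ?P" unfolding H_def by (intro counts_event gm)
      have "emeasure ?P (?A d) = (\<integral>\<^sup>+\<omega>. indicator (?A d) \<omega> \<partial>?P)"
        by (rule nn_integral_indicator[symmetric]) (rule Am)
      also have "\<dots> = (\<integral>\<^sup>+\<omega>. (\<integral>\<^sup>+s. indicator (?A d) (fun_upd \<omega> k s) \<partial>B k) \<partial>?P)"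
        using Am[of d] by (intro nn_integral_PiM_update[OF prob kI(1)] borel_measurable_indicator)
      also have "\<dots> = (\<integral>\<^sup>+\<omega>. (\<integral>\<^sup>+s. indicator F s * indicator H \<omega> \<partial>B k) \<partial>?P)"
      proof (intro nn_integral_cong)
        fix \<omega> s assume ws: "\<omega> \<in> space ?P" "s \<in> space (B k)"
        have "g j ((fun_upd \<omega> k s)) = g j \<omega>" for j unfolding g_def using insert(2) by (intro sum.cong) auto
        moreover have "(fun_upd \<omega> k s) \<in> space ?P" using ws kI(1) by (auto simp: space_PiM PiE_def extensional_def)
        ultimately show "indicator (?A d) ((fun_upd \<omega> k s)) = (indicator F s * indicator H \<omega> :: ennreal)"
          using ws by (auto simp: indicator_def F_def H_def)
      qed
      also have "\<dots> = emeasure (B k) F * emeasure ?P H"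
        using Fm Hm by (simp add: nn_integral_cmult nn_integral_multc)
      finally have "measure ?P (?A d) = measure (B k) F * measure ?P H"
        unfolding measure_def by (simp only: enn2real_mult)
      then show ?thesis using pk IH unfolding F_def H_def poisson_counts_def by simp
    qed
    have "measure ?P (\<Union>d\<in>?D. ?A d) = (\<Sum>d\<in>?D. measure ?P (?A d))"
    proof (rule P.finite_measure_finite_Union)
      show "finite ?D" by (intro finite_PiE) simp_all
      show "?A ` ?D \<subseteq> sets ?P" using Am by (rule image_subsetI)
    qed (rule disj)
    also have "\<dots> = (\<Sum>d\<in>?D. \<Prod>j<n. pmf (pois (a k j)) (d j) * pmf (pois (\<Sum>k\<in>K. a k j)) (c j - d j))"
      by (simp add: ind prod.distrib)
    also have "\<dots> = (\<Prod>j<n. \<Sum>i\<le>c j. pmf (pois (a k j)) i * pmf (pois (\<Sum>k\<in>K. a k j)) (c j - i))"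
      by (subst prod_sum_PiE) auto
    also have "\<dots> = (\<Prod>j<n. pmf (pois (a k j + (\<Sum>k\<in>K. a k j))) (c j))"
      using pk IH by (intro prod.cong refl pois_convolution[symmetric]) (auto simp: poisson_counts_def)
    finally show ?thesis unfolding eq .
  qed
  have s: "(\<Sum>k\<in>insert k K. f k j (\<omega> k)) = f k j (\<omega> k) + g j \<omega>" "(\<Sum>k\<in>insert k K. a k j) = a k j + (\<Sum>k\<in>K. a k j)" for j \<omega>
    using insert by (auto simp: g_def)
  show ?case unfolding poisson_counts_def s using main pk IH gm fm'
    by (auto simp: poisson_counts_def)
qed

text \<open>Vectors of finitely many counts form a countable space, so the point probabilities
  identify the joint law as a product of Poisson laws.\<close>

lemma poisson_counts_indep:
  assumes M: "prob_space M" and pc: "poisson_counts M n f a"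
  shows "prob_space.indep_vars M (\<lambda>_. count_space UNIV) f {..<n}"
    and "j < n \<Longrightarrow> measure M {\<omega>\<in>space M. f j \<omega> = k} = pmf (pois (a j)) k"
proof -
  interpret prob_space M by (rule M)
  have fm: "f j \<in> M \<rightarrow>\<^sub>M count_space UNIV" if "j < n" for j using pc that by (auto simp: poisson_counts_def)
  define T where "T = distr M (PiM {..<n} (\<lambda>_. count_space UNIV)) (\<lambda>\<omega>. \<lambda>j\<in>{..<n}. f j \<omega>)"
  define T' where "T' = PiM {..<n} (\<lambda>j. measure_pmf (pois (a j)))"
  have mT: "(\<lambda>\<omega>. \<lambda>j\<in>{..<n}. f j \<omega>) \<in> M \<rightarrow>\<^sub>M PiM {..<n} (\<lambda>_. count_space UNIV)"
    by (rule measurable_restrict) (use fm in auto)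
  interpret F: finite_product_prob_space "\<lambda>j. measure_pmf (pois (a j))" "{..<n}" by standard simp
  have cs: "PiM {..<n} (\<lambda>_. count_space (UNIV :: nat set)) = count_space (PiE {..<n} (\<lambda>_. UNIV))"
    by (rule count_space_PiM_finite) auto
  have sT': "sets T' = Pow (PiE {..<n} (\<lambda>_. UNIV))"
    unfolding T'_def by (subst sets_PiM_cong[of _ "{..<n}" _ "\<lambda>_. count_space UNIV"]) (simp_all add: cs)
  have sT: "sets T = Pow (PiE {..<n} (\<lambda>_. UNIV))" unfolding T_def by (simp add: cs)
  have eq: "T = T'"
  proof (rule measure_eqI_countable[OF sT sT'])
    show "countable (PiE {..<n} (\<lambda>_. UNIV :: nat set))" by (intro countable_PiE) auto
    fix c :: "nat \<Rightarrow> nat" assume c: "c \<in> PiE {..<n} (\<lambda>_. UNIV)"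
    have "{c} = PiE {..<n} (\<lambda>j. {c j})" using PiE_singleton[of c "{..<n}"] c by (auto simp: PiE_def)
    then have "emeasure T' {c} = (\<Prod>j<n. emeasure (measure_pmf (pois (a j))) {c j})"
      unfolding T'_def by (simp only: F.measure_times[of "\<lambda>j. {c j}"] sets_measure_pmf UNIV_I)
    also have "\<dots> = ennreal (\<Prod>j<n. pmf (pois (a j)) (c j))"
      by (simp add: emeasure_pmf_single prod_ennreal)
    also have "\<dots> = emeasure M {\<omega>\<in>space M. \<forall>j<n. f j \<omega> = c j}"
      using pc by (simp add: poisson_counts_def emeasure_eq_measure)
    also have "{\<omega>\<in>space M. \<forall>j<n. f j \<omega> = c j} = (\<lambda>\<omega>. \<lambda>j\<in>{..<n}. f j \<omega>) -` {c} \<inter> space M"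
      using c by (auto simp: PiE_def extensional_def fun_eq_iff)
    also have "emeasure M \<dots> = emeasure T {c}"
      unfolding T_def using c by (intro emeasure_distr[symmetric] mT) (simp add: cs)
    finally show "emeasure T {c} = emeasure T' {c}" ..
  qed
  have marg: "distr M (count_space UNIV) (f j) = measure_pmf (pois (a j))" if j: "j < n" for j
  proof -
    have "measure_pmf (pois (a j)) = distr T' (measure_pmf (pois (a j))) (\<lambda>x. x j)"
      unfolding T'_def by (rule distr_PiM_component[symmetric]) (use j in \<open>auto intro: prob_space_measure_pmf\<close>)
    also have "\<dots> = distr T (count_space UNIV) (\<lambda>x. x j)" unfolding eq by (rule distr_cong) auto
    also have "\<dots> = distr M (count_space UNIV) ((\<lambda>x. x j) \<circ> (\<lambda>\<omega>. \<lambda>j\<in>{..<n}. f j \<omega>))"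
      unfolding T_def by (rule distr_distr[OF _ mT]) (use j in auto)
    also have "\<dots> = distr M (count_space UNIV) (f j)" using j by (intro distr_cong) auto
    finally show ?thesis ..
  qed
  show "indep_vars (\<lambda>_. count_space UNIV) f {..<n}"
  proof (cases "n = 0")
    case True
    then show ?thesis by (simp add: indep_vars_def indep_sets_def)
  next
    case False
    have "PiM {..<n} (\<lambda>j. distr M (count_space UNIV) (f j)) = T'"
      unfolding T'_def by (rule PiM_cong) (auto simp: marg)
    then show ?thesis using False fm eq
      by (subst indep_vars_iff_distr_eq_PiM') (auto simp: T_def)
  qed
  assume j: "j < n"
  have "measure M {\<omega>\<in>space M. f j \<omega> = k} = measure (distr M (count_space UNIV) (f j)) {k}"
    using fm[OF j] by (subst measure_distr) (auto intro!: arg_cong[where f="measure M"])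
  then show "measure M {\<omega>\<in>space M. f j \<omega> = k} = pmf (pois (a j)) k" by (simp add: marg[OF j] pmf.rep_eq)
qed

section \<open>Exploring a random graph\<close>

text \<open>The vertices attempted so far, most recent first: \<open>Some p\<close> records the path
  by which the vertex was reached, \<open>None\<close> a failed attempt, which is never
  repeated.\<close>

type_synonym 'v hist = "('v \<times> 'v list option) list"

fun vpath :: "('v \<Rightarrow> 'v set) \<Rightarrow> 'v \<Rightarrow> 'v list \<Rightarrow> bool" where
  "vpath nb r [] \<longleftrightarrow> False"
| "vpath nb r [v] \<longleftrightarrow> v = r"
| "vpath nb r (v # u # p) \<longleftrightarrow> v \<in> nb u \<and> v \<notin> set (u # p) \<and> vpath nb r (u # p)"

text \<open>\<open>G v\<close> collects the events that do not depend on the randomness attached to the vertex \<open>v\<close>;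
paths are written backwards, most recent vertex first.\<close>

locale exploration = prob_space M for M :: "'a measure" +
  fixes nb :: "'v::countable \<Rightarrow> 'v set" and root :: 'v and ok :: "'v list \<Rightarrow> 'a \<Rightarrow> bool"
    and G :: "'v \<Rightarrow> 'a set set" and \<epsilon> :: real
  assumes G_sets: "E \<in> G v \<Longrightarrow> E \<in> events"
    and G_Diff: "E \<in> G v \<Longrightarrow> E' \<in> G v \<Longrightarrow> E - E' \<in> G v"
    and G_empty: "{} \<in> G v"
    and ok_G: "vpath nb root p \<Longrightarrow> v \<notin> set p \<Longrightarrow> {\<omega>\<in>space M. ok p \<omega>} \<in> G v"
    and ok_events: "vpath nb root p \<Longrightarrow> {\<omega>\<in>space M. ok p \<omega>} \<in> events"
    and ok_step: "vpath nb root (v # p) \<Longrightarrow> p \<noteq> [] \<Longrightarrow> E \<in> G v \<Longrightarrow> E \<subseteq> {\<omega>\<in>space M. ok p \<omega>} \<Longrightarrow>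
      prob (E \<inter> {\<omega>\<in>space M. \<not> ok (v # p) \<omega>}) \<le> \<epsilon> * prob E"
    and eps: "0 \<le> \<epsilon>" "\<epsilon> \<le> 1"
begin

definition avail :: "'v hist \<Rightarrow> 'v set" where
  "avail h = {v. v \<notin> fst ` set h \<and> (\<exists>u p. (u, Some p) \<in> set h \<and> v \<in> nb u)}"

text \<open>Like \<open>tail\<close>, a function of the history alone, so that only finitely many
  histories are possible after n steps. The least code makes the search fair.\<close>

definition nxt :: "'v hist \<Rightarrow> 'v" where
  "nxt h = arg_min to_nat (\<lambda>v. v \<in> avail h)"

definition tail :: "'v hist \<Rightarrow> 'v list" where
  "tail h = (SOME p. \<exists>u. (u, Some p) \<in> set h \<and> nxt h \<in> nb u)"

definition stp :: "'v hist \<Rightarrow> 'a \<Rightarrow> 'v hist" where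
  "stp h \<omega> = (if avail h = {} then h
     else (nxt h, if ok (nxt h # tail h) \<omega> then Some (nxt h # tail h) else None) # h)"

definition hst :: "nat \<Rightarrow> 'a \<Rightarrow> 'v hist" where
  "hst n \<omega> = ((\<lambda>h. stp h \<omega>) ^^ n) [(root, Some [root])]"

lemma hst_0: "hst 0 \<omega> = [(root, Some [root])]" and hst_Suc: "hst (Suc n) \<omega> = stp (hst n \<omega>) \<omega>"
  by (simp_all add: hst_def)

text \<open>The last clause says that with a path all its shorter initial parts were recorded, so
  the recorded paths form a tree.\<close>

definition wf :: "'v hist \<Rightarrow> bool" where
  "wf h \<longleftrightarrow> distinct (map fst h) \<and> (root, Some [root]) \<in> set h \<and> (\<forall>v p. (v, Some p) \<in> set h \<longrightarrow>
     vpath nb root p \<and> hd p = v \<and> set p \<subseteq> fst ` set h \<and>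
     (tl p \<noteq> [] \<longrightarrow> (hd (tl p), Some (tl p)) \<in> set h))"

lemma nxt_avail: "avail h \<noteq> {} \<Longrightarrow> nxt h \<in> avail h \<and> (\<forall>v\<in>avail h. to_nat (nxt h) \<le> to_nat v)"
  unfolding nxt_def using arg_min_nat_lemma[of "\<lambda>v. v \<in> avail h" _ to_nat] by blast

lemma tail_prop: "avail h \<noteq> {} \<Longrightarrow> \<exists>u. (u, Some (tail h)) \<in> set h \<and> nxt h \<in> nb u"
proof -
  assume "avail h \<noteq> {}"
  then have "nxt h \<in> avail h" using nxt_avail by blast
  then have "\<exists>p. \<exists>u. (u, Some p) \<in> set h \<and> nxt h \<in> nb u" unfolding avail_def by blast
  then show ?thesis unfolding tail_def by (rule someI_ex)
qed

lemma nxt_path: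
  assumes "wf h" "avail h \<noteq> {}"
  shows "vpath nb root (nxt h # tail h)" "tail h \<noteq> []" "nxt h \<notin> fst ` set h" "set (tail h) \<subseteq> fst ` set h"
    "(hd (tail h), Some (tail h)) \<in> set h" "vpath nb root (tail h)"
proof -
  obtain u where u: "(u, Some (tail h)) \<in> set h" "nxt h \<in> nb u" using tail_prop assms by blast
  have w: "vpath nb root (tail h)" "hd (tail h) = u" "set (tail h) \<subseteq> fst ` set h"
    using assms(1) u(1) unfolding wf_def by blast+
  show ne: "tail h \<noteq> []" using w(1) by auto
  have n: "nxt h \<in> avail h" using nxt_avail assms by blast
  then show nn: "nxt h \<notin> fst ` set h" by (auto simp: avail_def)
  show "set (tail h) \<subseteq> fst ` set h" "vpath nb root (tail h)" by fact+
  show "(hd (tail h), Some (tail h)) \<in> set h" using u w by simp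
  obtain a q where "tail h = a # q" using ne by (cases "tail h") auto
  then show "vpath nb root (nxt h # tail h)" using w u nn by auto
qed

lemma wf_Cons:
  assumes "wf h" "avail h \<noteq> {}"
  shows "wf ((nxt h, Some (nxt h # tail h)) # h)" "wf ((nxt h, None) # h)"
proof -
  note P = nxt_path[OF assms]
  have w: "distinct (map fst h)" "(root, Some [root]) \<in> set h"
    using assms(1) unfolding wf_def by blast+
  have old: "vpath nb root p \<and> hd p = v \<and> set p \<subseteq> fst ` set h \<and>
     (tl p \<noteq> [] \<longrightarrow> (hd (tl p), Some (tl p)) \<in> set h)" if "(v, Some p) \<in> set h" for v p
    using assms(1) that unfolding wf_def by blast
  have d: "distinct (map fst ((nxt h, a) # h))" for a using w(1) P(3) by simp
  show "wf ((nxt h, None) # h)" unfolding wf_def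
  proof (intro conjI allI impI d)
    fix v p assume "(v, Some p) \<in> set ((nxt h, None) # h)"
    then have "(v, Some p) \<in> set h" by simp
    note o = old[OF this]
    show "vpath nb root p" "hd p = v" using o by blast+
    show "set p \<subseteq> fst ` set ((nxt h, None) # h)" using o by auto
    show "tl p \<noteq> [] \<Longrightarrow> (hd (tl p), Some (tl p)) \<in> set ((nxt h, None) # h)" using o by simp
  qed (use w in simp)
  show "wf ((nxt h, Some (nxt h # tail h)) # h)" (is "wf ?h") unfolding wf_def
  proof (intro conjI allI impI d)
    fix v p assume vp: "(v, Some p) \<in> set ?h"
    have *: "vpath nb root p \<and> hd p = v \<and> set p \<subseteq> insert (nxt h) (fst ` set h) \<and>
      (tl p \<noteq> [] \<longrightarrow> (hd (tl p), Some (tl p)) \<in> set h)"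
    proof (cases "(v, Some p) \<in> set h")
      case True
      then show ?thesis using old[OF True] by blast
    next
      case False
      then have "v = nxt h" "p = nxt h # tail h" using vp by auto
      then show ?thesis using P(1,4,5) by auto
    qed
    show "vpath nb root p" "hd p = v" using * by blast+
    show "set p \<subseteq> fst ` set ?h" using * by simp
    show "tl p \<noteq> [] \<Longrightarrow> (hd (tl p), Some (tl p)) \<in> set ?h" using * by simp
  qed (use w in simp)
qed

lemma wf_stp: "wf h \<Longrightarrow> wf (stp h \<omega>)"
  using wf_Cons unfolding stp_def by auto

lemma wf_init: "wf [(root, Some [root])]"
  by (auto simp: wf_def)

lemma wf_hst: "wf (hst n \<omega>)"
  by (induction n) (auto simp: hst_0 hst_Suc wf_stp wf_init)

definition live :: "'a \<Rightarrow> 'v \<Rightarrow> 'v list \<Rightarrow> bool" where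
  "live \<omega> v p \<longleftrightarrow> (\<exists>n. (v, Some p) \<in> set (hst n \<omega>))"

definition failed :: "'a \<Rightarrow> 'v set" where
  "failed \<omega> = {v. \<exists>n. (v, None) \<in> set (hst n \<omega>)}"

lemma stp_mono: "set h \<subseteq> set (stp h \<omega>)"
  by (auto simp: stp_def)

lemma hst_mono: "m \<le> n \<Longrightarrow> set (hst m \<omega>) \<subseteq> set (hst n \<omega>)"
  by (rule lift_Suc_mono_le[of "\<lambda>n. set (hst n \<omega>)"]) (simp_all add: hst_Suc stp_mono)

lemma hst_unique:
  assumes "(v, a) \<in> set (hst m \<omega>)" "(v, b) \<in> set (hst n \<omega>)"
  shows "a = b"
proof -
  let ?h = "hst (max m n) \<omega>"
  have "(v, a) \<in> set ?h" "(v, b) \<in> set ?h" using assms hst_mono[of m "max m n"] hst_mono[of n "max m n"] by auto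
  moreover have "distinct (map fst ?h)" using wf_hst unfolding wf_def by blast
  ultimately show ?thesis by (rule eq_key_imp_eq_value[rotated])
qed

lemma live_unique: "live \<omega> v p \<Longrightarrow> live \<omega> v q \<Longrightarrow> p = q"
  unfolding live_def using hst_unique by blast

lemma live_root: "live \<omega> root [root]"
  unfolding live_def by (rule exI[of _ 0]) (simp add: hst_0)

lemma live_path:
  assumes "live \<omega> v p"
  shows "vpath nb root p" "hd p = v" "tl p \<noteq> [] \<Longrightarrow> live \<omega> (hd (tl p)) (tl p)"
  using assms wf_hst unfolding live_def wf_def by metis+

lemma live_ok:
  assumes "live \<omega> v p" "ok [root] \<omega>"
  shows "ok p \<omega>"
proof -
  have "(v, Some p) \<in> set (hst n \<omega>) \<longrightarrow> ok p \<omega>" for n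
    by (induction n) (auto simp: hst_0 hst_Suc stp_def assms(2) split: if_splits)
  then show ?thesis using assms(1) by (auto simp: live_def)
qed

text \<open>Every neighbour of a live vertex is eventually chosen, because the history always picks the
  available vertex with the smallest code and each code is used at most once.\<close>

lemma live_neighbour:
  assumes "live \<omega> u p" "v \<in> nb u"
  shows "v \<in> failed \<omega> \<or> (\<exists>q. live \<omega> v q)"
proof (rule ccontr)
  assume c: "\<not> ?thesis"
  then have nd: "v \<notin> fst ` set (hst n \<omega>)" for n
  proof -
    have "(v, a) \<notin> set (hst n \<omega>)" for a using c unfolding failed_def live_def by (cases a) blast+
    then show ?thesis by auto
  qed
  obtain m where m: "(u, Some p) \<in> set (hst m \<omega>)" using assms(1) by (auto simp: live_def)
  have av: "v \<in> avail (hst n \<omega>)" if "m \<le> n" for n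
    using hst_mono[OF that] m assms(2) nd unfolding avail_def by blast
  define x where "x n = nxt (hst n \<omega>)" for n
  have x_le: "to_nat (x n) \<le> to_nat v" if "m \<le> n" for n
    using nxt_avail[of "hst n \<omega>"] av[OF that] unfolding x_def by blast
  have x_in: "x n \<in> fst ` set (hst n' \<omega>)" if "m \<le> n" "n < n'" for n n'
  proof -
    have "x n \<in> fst ` set (hst (Suc n) \<omega>)" using av[OF that(1)] by (auto simp: hst_Suc stp_def x_def)
    then show ?thesis using hst_mono[of "Suc n" n'] that(2) by (meson Suc_leI image_mono subsetD)
  qed
  have x_new: "x n \<notin> fst ` set (hst n \<omega>)" if "m \<le> n" for n
    using nxt_avail[of "hst n \<omega>"] av[OF that] unfolding x_def avail_def by blast
  have "inj_on (\<lambda>n. to_nat (x n)) {m..}"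
  proof (rule linorder_inj_onI)
    fix a b assume ab: "a < b" "a \<in> {m..}" "b \<in> {m..}"
    then have "x a \<in> fst ` set (hst b \<omega>)" "x b \<notin> fst ` set (hst b \<omega>)" using x_in x_new by auto
    then show "to_nat (x a) \<noteq> to_nat (x b)" by (metis from_nat_to_nat)
  qed auto
  moreover have "(\<lambda>n. to_nat (x n)) ` {m..} \<subseteq> {..to_nat v}" using x_le by auto
  ultimately have "finite {m..}" using finite_imageD finite_subset[OF _ finite_atMost] by blast
  then show False using infinite_Ici by blast
qed

text \<open>A finite set containing all values of \<open>hst n\<close>; it replaces conditioning on
  the history by finite sums.\<close>

primrec hists :: "nat \<Rightarrow> 'v hist set" where
  "hists 0 = {[(root, Some [root])]}"
| "hists (Suc n) = (\<Union>h\<in>hists n. if avail h = {} then {h}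
     else {(nxt h, Some (nxt h # tail h)) # h, (nxt h, None) # h})"

lemma finite_hists: "finite (hists n)"
  by (induction n) auto

lemma wf_hists: "h \<in> hists n \<Longrightarrow> wf h"
proof (induction n arbitrary: h)
  case (Suc n)
  from Suc.prems obtain g where g: "g \<in> hists n" "h \<in> (if avail g = {} then {g}
     else {(nxt g, Some (nxt g # tail g)) # g, (nxt g, None) # g})"
    unfolding hists.simps by (rule UN_E)
  show ?case
    using g(2) Suc.IH[OF g(1)] wf_Cons[OF Suc.IH[OF g(1)]] by (cases "avail g = {}") auto
qed (simp add: wf_init)

lemma hst_hists: "hst n \<omega> \<in> hists n"
proof (induction n)
  case (Suc n)
  then show ?case unfolding hists.simps hst_Suc stp_def by (intro UN_I) auto
qed (simp add: hst_0)

definition R :: "'a set" where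
  "R = {\<omega>\<in>space M. ok [root] \<omega>}"

definition ev :: "nat \<Rightarrow> 'v hist \<Rightarrow> 'a set" where
  "ev n h = {\<omega>\<in>R. hst n \<omega> = h}"

lemma G_Int: "E \<in> G v \<Longrightarrow> E' \<in> G v \<Longrightarrow> E \<inter> E' \<in> G v"
  using G_Diff[of E v "E - E'"] G_Diff[of E v E'] by (simp add: Diff_Diff_Int)

text \<open>\<open>G v\<close> is assumed closed only under differences, so a union is formed as a
  relative complement in a common member \<open>A\<close>; later \<open>A\<close> is
  \<open>R\<close>.\<close>

lemma G_Un:
  assumes "E \<in> G v" "E' \<in> G v" "A \<in> G v" "E \<subseteq> A" "E' \<subseteq> A"
  shows "E \<union> E' \<in> G v"
proof -
  have "E \<union> E' = A - ((A - E) \<inter> (A - E'))" using assms(4,5) by blast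
  then show ?thesis using assms by (simp add: G_Diff G_Int)
qed

lemma R_events: "R \<in> events"
  unfolding R_def by (rule ok_events) simp

lemma R_G: "v \<noteq> root \<Longrightarrow> R \<in> G v"
  unfolding R_def by (rule ok_G) simp_all

lemma ev_Suc:
  "ev (Suc n) h' = (\<Union>h\<in>hists n. {\<omega>\<in>ev n h. stp h \<omega> = h'})"
  unfolding ev_def using hst_hists by (auto simp: hst_Suc)

lemma ev_stp:
  assumes "h \<in> hists n"
  shows "{\<omega>\<in>ev n h. stp h \<omega> = h'} = (if avail h = {} then (if h' = h then ev n h else {})
     else if h' = (nxt h, Some (nxt h # tail h)) # h then ev n h \<inter> {\<omega>\<in>space M. ok (nxt h # tail h) \<omega>}
     else if h' = (nxt h, None) # h then ev n h - {\<omega>\<in>space M. ok (nxt h # tail h) \<omega>} else {})"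
  unfolding stp_def ev_def R_def by auto

text \<open>The key to conditional bounds: a history that has not met \<open>v\<close> was produced
  by attempts along paths avoiding \<open>v\<close>, hence without the randomness attached to
  \<open>v\<close>.\<close>

lemma ev_G:
  assumes "h \<in> hists n" "v \<notin> fst ` set h"
  shows "ev n h \<in> G v"
  using assms
proof (induction n arbitrary: h)
  case 0
  then have "ev 0 h = R" "v \<noteq> root" by (auto simp: ev_def hst_0)
  then show ?case using R_G by simp
next
  case (Suc n)
  have vr: "v \<noteq> root" using wf_hists[OF Suc.prems(1)] Suc.prems(2) unfolding wf_def by force
  have each: "{\<omega>\<in>ev n g. stp g \<omega> = h} \<in> G v" if g: "g \<in> hists n" for g
  proof -
    have ok: "avail g \<noteq> {} \<Longrightarrow> v \<noteq> nxt g \<Longrightarrow> v \<notin> fst ` set g \<Longrightarrow> {\<omega>\<in>space M. ok (nxt g # tail g) \<omega>} \<in> G v"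
      by (rule ok_G) (use nxt_path[OF wf_hists[OF g]] in auto)
    show ?thesis
    proof (cases "avail g = {}")
      case True
      then show ?thesis using Suc.IH[OF g] Suc.prems(2) by (auto simp: ev_stp[OF g] G_empty)
    next
      case False
      then show ?thesis unfolding ev_stp[OF g] using Suc.IH[OF g] Suc.prems(2) ok
        by (auto simp: G_empty intro!: G_Int G_Diff)
    qed
  qed
  have "(\<Union>g\<in>H. {\<omega>\<in>ev n g. stp g \<omega> = h}) \<in> G v" if "finite H" "H \<subseteq> hists n" for H
    using that
  proof (induction H rule: finite_induct)
    case (insert g H)
    then show ?case using each
      by (simp, intro G_Un[OF _ _ R_G[OF vr]]) (auto simp: ev_def)
  qed (simp add: G_empty)
  then show ?case unfolding ev_Suc using finite_hists by blast
qed

lemma ev_events: "h \<in> hists n \<Longrightarrow> ev n h \<in> events"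
proof (induction n arbitrary: h)
  case 0
  then have "ev 0 h = R" by (auto simp: ev_def hst_0)
  then show ?case using R_events by simp
next
  case (Suc n)
  have "{\<omega>\<in>ev n g. stp g \<omega> = h} \<in> events" if g: "g \<in> hists n" for g
    unfolding ev_stp[OF g] using Suc.IH[OF g] nxt_path(1)[OF wf_hists[OF g]]
    by (auto intro!: sets.Int sets.Diff ok_events)
  then show ?case unfolding ev_Suc using finite_hists by (intro sets.finite_UN) auto
qed

text \<open>Bounds the conditional probability, given the history, that all of \<open>W\<close> ends
  up failed: 0 once a member is live, otherwise one factor \<epsilon> for each member not yet
  attempted.\<close>

definition pot :: "'v set \<Rightarrow> 'v hist \<Rightarrow> real" where
  "pot W h = (if \<exists>v\<in>W. \<exists>p. (v, Some p) \<in> set h then 0 else \<epsilon> ^ card (W - fst ` set h))"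

lemma pot_nonneg: "0 \<le> pot W h"
  using eps by (simp add: pot_def)

text \<open>The expected potential does not increase from one step to the next, and it starts at no
  more than \<epsilon> to the number of elements of \<open>W\<close>.\<close>

lemma sum_pot:
  assumes W: "finite W"
  shows "(\<Sum>h\<in>hists n. prob (ev n h) * pot W h) \<le> \<epsilon> ^ card W"
proof (induction n)
  case 0
  have "pot W [(root, Some [root])] \<le> \<epsilon> ^ card W" using eps by (auto simp: pot_def Diff_insert0)
  then have "prob (ev 0 [(root, Some [root])]) * pot W [(root, Some [root])] \<le> 1 * \<epsilon> ^ card W"
    by (intro mult_mono) (auto simp: pot_nonneg eps)
  then show ?case by simp
next
  case (Suc n)
  let ?q = "\<lambda>h h'. prob {\<omega>\<in>ev n h. stp h \<omega> = h'}"
  have m: "{\<omega>\<in>ev n h. stp h \<omega> = h'} \<in> events" if g: "h \<in> hists n" for h h'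
    unfolding ev_stp[OF g] using ev_events[OF g] nxt_path(1)[OF wf_hists[OF g]]
    by (auto intro!: sets.Int sets.Diff ok_events)
  have "(\<Sum>h'\<in>hists (Suc n). prob (ev (Suc n) h') * pot W h')
     \<le> (\<Sum>h'\<in>hists (Suc n). (\<Sum>h\<in>hists n. ?q h h') * pot W h')"
    unfolding ev_Suc using m
    by (intro sum_mono mult_right_mono finite_measure_subadditive_finite finite_hists pot_nonneg) auto
  also have "\<dots> = (\<Sum>h\<in>hists n. \<Sum>h'\<in>hists (Suc n). ?q h h' * pot W h')"
    by (subst sum.swap) (simp add: sum_distrib_right)
  also have "\<dots> \<le> (\<Sum>h\<in>hists n. prob (ev n h) * pot W h)"
  proof (rule sum_mono)
    fix h assume h: "h \<in> hists n"
    note E = ev_stp[OF h]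
    show "(\<Sum>h'\<in>hists (Suc n). ?q h h' * pot W h') \<le> prob (ev n h) * pot W h"
    proof (cases "avail h = {}")
      case True
      have "(\<Sum>h'\<in>hists (Suc n). ?q h h' * pot W h') = (\<Sum>h'\<in>{h}. ?q h h' * pot W h')"
        using h True finite_hists by (intro sum.mono_neutral_right) (auto simp: E)
      then show ?thesis using True by (simp add: E)
    next
      case False
      note P = nxt_path[OF wf_hists[OF h] False]
      let ?a = "(nxt h, Some (nxt h # tail h)) # h" and ?b = "(nxt h, None) # h"
      let ?O = "{\<omega>\<in>space M. ok (nxt h # tail h) \<omega>}"
      have in_h: "?a \<in> hists (Suc n)" "?b \<in> hists (Suc n)" using h False by auto
      have "(\<Sum>h'\<in>hists (Suc n). ?q h h' * pot W h') = (\<Sum>h'\<in>{?a, ?b}. ?q h h' * pot W h')"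
        using in_h finite_hists False by (intro sum.mono_neutral_right) (auto simp: E)
      also have "\<dots> = prob (ev n h \<inter> ?O) * pot W ?a + prob (ev n h - ?O) * pot W ?b"
        using False by (simp add: E)
      also have "\<dots> \<le> prob (ev n h) * pot W h"
      proof (cases "nxt h \<in> W")
        case nW: False
        have "W - insert (nxt h) (fst ` set h) = W - fst ` set h" using nW by auto
        then have pq: "pot W ?a = pot W h" "pot W ?b = pot W h" using nW by (auto simp: pot_def)
        have "prob (ev n h) = prob (ev n h \<inter> ?O) + prob (ev n h - ?O)"
          using ev_events[OF h] ok_events[OF P(1)]
          by (subst finite_measure_Union[symmetric]) (auto intro!: arg_cong[where f=prob])
        then show ?thesis unfolding pq by (simp add: distrib_right)
      next
        \<comment> \<open>Success makes the potential 0. Failure removes one factor \<epsilon>, and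
          has probability at most \<epsilon> given the history, so the two effects cancel.\<close>
        case nW: True
        have a0: "pot W ?a = 0" using nW by (auto simp: pot_def)
        have nn: "nxt h \<in> W - fst ` set h" using nW P(3) by auto
        have "card (W - fst ` set h) = Suc (card (W - fst ` set h - {nxt h}))"
          using card.remove[OF _ nn] W by auto
        moreover have "W - fst ` set ?b = W - fst ` set h - {nxt h}" by auto
        ultimately have b: "\<epsilon> * pot W ?b = pot W h" by (auto simp: pot_def)
        have sub: "ev n h \<subseteq> {\<omega>\<in>space M. ok (tail h) \<omega>}"
        proof
          fix \<omega> assume w: "\<omega> \<in> ev n h"
          then have "live \<omega> (hd (tail h)) (tail h)" using P(5) unfolding live_def ev_def by blast
          then show "\<omega> \<in> {\<omega>\<in>space M. ok (tail h) \<omega>}" using live_ok w by (auto simp: ev_def R_def)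
        qed
        have "ev n h - ?O = ev n h \<inter> {\<omega>\<in>space M. \<not> ok (nxt h # tail h) \<omega>}"
          by (auto simp: ev_def R_def)
        then have "prob (ev n h - ?O) \<le> \<epsilon> * prob (ev n h)"
          using ok_step[OF P(1,2) ev_G[OF h P(3)] sub] by simp
        then have "prob (ev n h - ?O) * pot W ?b \<le> \<epsilon> * prob (ev n h) * pot W ?b"
          by (intro mult_right_mono pot_nonneg)
        also have "\<dots> = prob (ev n h) * pot W h" using b by (simp add: mult_ac)
        finally show ?thesis using a0 by simp
      qed
      finally show ?thesis .
    qed
  qed
  also have "\<dots> \<le> \<epsilon> ^ card W" by (rule Suc)
  finally show ?case .
qed

lemma hst_event: "{\<omega>\<in>R. P (hst n \<omega>)} \<in> events"
proof -
  have "{\<omega>\<in>R. P (hst n \<omega>)} = (\<Union>h\<in>{h\<in>hists n. P h}. ev n h)"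
    using hst_hists by (auto simp: ev_def)
  then show ?thesis using finite_hists ev_events by (auto intro!: sets.finite_UN)
qed

lemma live_event: "{\<omega>\<in>R. live \<omega> v p} \<in> events"
proof -
  have "{\<omega>\<in>R. live \<omega> v p} = (\<Union>n. {\<omega>\<in>R. (v, Some p) \<in> set (hst n \<omega>)})" by (auto simp: live_def)
  then show ?thesis using hst_event by (auto intro!: sets.countable_UN)
qed

lemma failed_event: "{\<omega>\<in>R. v \<in> failed \<omega>} \<in> events"
proof -
  have "{\<omega>\<in>R. v \<in> failed \<omega>} = (\<Union>n. {\<omega>\<in>R. (v, None) \<in> set (hst n \<omega>)})" by (auto simp: failed_def)
  then show ?thesis using hst_event by (auto intro!: sets.countable_UN)
qed

text \<open>On histories in which all of \<open>W\<close> has failed the potential is 1, so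
  \<open>sum_pot\<close> bounds their probability at every time. The bound is the same as for
  independent failures.\<close>

lemma prob_failed_le:
  assumes W: "finite W"
  shows "prob {\<omega>\<in>R. W \<subseteq> failed \<omega>} \<le> \<epsilon> ^ card W"
proof -
  define A where "A n = {\<omega>\<in>R. \<forall>v\<in>W. (v, None) \<in> set (hst n \<omega>)}" for n
  have A: "A n \<in> events" for n unfolding A_def by (rule hst_event)
  have inc: "incseq A" unfolding incseq_def A_def using hst_mono by blast
  have le: "prob (A n) \<le> \<epsilon> ^ card W" for n
  proof -
    let ?H = "{h\<in>hists n. \<forall>v\<in>W. (v, None) \<in> set h}"
    have "A n = (\<Union>h\<in>?H. ev n h)" using hst_hists by (auto simp: A_def ev_def)
    then have "prob (A n) \<le> (\<Sum>h\<in>?H. prob (ev n h))"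
      using finite_hists ev_events by (auto intro!: finite_measure_subadditive_finite)
    also have "\<dots> = (\<Sum>h\<in>?H. prob (ev n h) * pot W h)"
    proof (rule sum.cong)
      fix h assume h: "h \<in> ?H"
      then have d: "distinct (map fst h)" using wf_hists unfolding wf_def by blast
      have "\<not> (\<exists>v\<in>W. \<exists>p. (v, Some p) \<in> set h)" using h eq_key_imp_eq_value[OF d] by blast
      moreover have "W - fst ` set h = {}" using h by force
      ultimately have "pot W h = 1" unfolding pot_def by (metis card.empty power_0)
      then show "prob (ev n h) = prob (ev n h) * pot W h" by simp
    qed simp
    also have "\<dots> \<le> (\<Sum>h\<in>hists n. prob (ev n h) * pot W h)"
      using finite_hists by (intro sum_mono2) (auto simp: pot_nonneg)
    also have "\<dots> \<le> \<epsilon> ^ card W" by (rule sum_pot[OF W])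
    finally show ?thesis .
  qed
  have "{\<omega>\<in>R. W \<subseteq> failed \<omega>} = (\<Union>n. A n)"
  proof (intro equalityI subsetI)
    fix \<omega> assume w: "\<omega> \<in> {\<omega>\<in>R. W \<subseteq> failed \<omega>}"
    then have "\<forall>v\<in>W. \<exists>n. (v, None) \<in> set (hst n \<omega>)" by (auto simp: failed_def)
    then obtain f where f: "\<And>v. v \<in> W \<Longrightarrow> (v, None) \<in> set (hst (f v) \<omega>)" by metis
    have "(v, None) \<in> set (hst (Max (f ` W)) \<omega>)" if "v \<in> W" for v
      using f[OF that] hst_mono[of "f v" "Max (f ` W)"] W that by auto
    then show "\<omega> \<in> (\<Union>n. A n)" using w by (auto simp: A_def)
  qed (auto simp: A_def failed_def)
  moreover have "(\<lambda>n. prob (A n)) \<longlonglongrightarrow> prob (\<Union>n. A n)"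
    using A inc by (intro finite_Lim_measure_incseq) auto
  ultimately show ?thesis using le by (simp add: LIMSEQ_le_const2)
qed

end

section \<open>Volumes of annular cells\<close>

text \<open>\<open>J\<close> translates of the slab by multiples of 2k along \<open>e\<close> are
  disjoint and move by at most 1, so they all fit into a ball of radius 4.\<close>

lemma thin_slab:
  fixes e x :: "'a::euclidean_space"
  assumes e: "norm e = 1" and k: "0 < k" "2 * k * real J \<le> 1"
  shows "of_nat J * emeasure lborel {z. dist x z < 3 \<and> \<bar>(z - x) \<bullet> e\<bar> < k} \<le> emeasure lborel (ball (0::'a) 4)"
proof -
  define A where "A j = {z. dist (x + (2 * k * real j) *\<^sub>R e) z < 3 \<and> \<bar>(z - (x + (2 * k * real j) *\<^sub>R e)) \<bullet> e\<bar> < k}" for j :: nat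
  have A0: "A 0 = {z. dist x z < 3 \<and> \<bar>(z - x) \<bullet> e\<bar> < k}" by (simp add: A_def)
  have oA: "open (A j)" for j
    unfolding A_def by (intro open_Collect_conj open_Collect_less continuous_intros)
  have Am: "A j \<in> sets lborel" for j using oA[of j] by simp
  have shift: "emeasure lborel (A j) = emeasure lborel (A 0)" for j
  proof -
    have "emeasure lborel (A j) = emeasure (distr lborel borel ((+) ((2 * k * real j) *\<^sub>R e))) (A j)"
      by (simp add: lborel_distr_plus)
    also have "\<dots> = emeasure lborel ((+) ((2 * k * real j) *\<^sub>R e) -` A j \<inter> space lborel)"
      using oA[of j] by (intro emeasure_distr) auto
    also have "(+) ((2 * k * real j) *\<^sub>R e) -` A j \<inter> space lborel = A 0"
      by (auto simp: A_def dist_norm algebra_simps inner_diff_left inner_add_left)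
    finally show ?thesis .
  qed
  have disj: "disjoint_family_on A {..<J}"
    unfolding disjoint_family_on_def
  proof (intro ballI impI)
    fix i j assume "i \<in> {..<J}" "j \<in> {..<J}" "i \<noteq> j"
    show "A i \<inter> A j = {}"
    proof (rule ccontr)
      assume "A i \<inter> A j \<noteq> {}"
      then obtain z where z: "z \<in> A i" "z \<in> A j" by auto
      have ee: "e \<bullet> e = 1" using e by (simp add: dot_square_norm)
      have "\<bar>(z - x) \<bullet> e - 2 * k * real i\<bar> < k" "\<bar>(z - x) \<bullet> e - 2 * k * real j\<bar> < k"
        using z ee by (auto simp: A_def inner_diff_left inner_add_left algebra_simps)
      then have "\<bar>2 * k * (real i - real j)\<bar> < 2 * k" by (simp add: algebra_simps)
      then have "\<bar>real i - real j\<bar> < 1" using k(1) by (simp add: abs_mult)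
      then show False using \<open>i \<noteq> j\<close> by linarith
    qed
  qed
  have sub: "A j \<subseteq> ball x 4" if "j < J" for j
  proof
    fix z assume "z \<in> A j"
    then have "dist (x + (2 * k * real j) *\<^sub>R e) z < 3" by (simp add: A_def)
    moreover have "dist x (x + (2 * k * real j) *\<^sub>R e) \<le> 1"
    proof -
      have "2 * k * real j \<le> 2 * k * real J" using that k by (intro mult_left_mono) auto
      then have "2 * k * real j \<le> 1" using k(2) by linarith
      then show ?thesis using k(1) e by (simp add: dist_norm)
    qed
    ultimately show "z \<in> ball x 4" using dist_triangle[of x z "x + (2 * k * real j) *\<^sub>R e"] by simp
  qed
  have "(\<Sum>j<J. emeasure lborel (A j)) = (\<Sum>j<J. emeasure lborel (A 0))" by (intro sum.cong refl shift)
  then have "of_nat J * emeasure lborel (A 0) = (\<Sum>j<J. emeasure lborel (A j))" by simp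
  also have "\<dots> = emeasure lborel (\<Union>j<J. A j)" using Am disj by (intro sum_emeasure) auto
  also have "\<dots> \<le> emeasure lborel (ball x 4)" by (rule emeasure_mono) (use sub in auto)
  also have "\<dots> = emeasure lborel (ball (0::'a) 4)" by (simp add: emeasure_ball)
  finally show ?thesis by (simp add: A0)
qed

lemma pi_le_4: "pi \<le> 4" using pi_less_4 by simp

lemma unit_ball_vol_rec:
  assumes "2 < d"
  shows "unit_ball_vol (real d) = unit_ball_vol (real (d - 2)) * (2 * pi / real d)"
proof -
  have d: "real d / 2 = real (d - 2) / 2 + 1" using assms by (simp add: of_nat_diff field_simps)
  have G: "Gamma (real d / 2 + 1) = real d / 2 * Gamma (real (d - 2) / 2 + 1)"
    using Gamma_plus1[of "real d / 2"] assms d by (metis Gamma_plus1 nonpos_Ints_nonpos not_le of_nat_0_less_iff half_gt_zero gr_implies_not0 less_trans pos2 divide_pos_pos zero_less_numeral)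
  have P: "pi powr (real d / 2) = pi powr (real (d - 2) / 2) * pi"
    unfolding d by (simp add: powr_add)
  show ?thesis unfolding unit_ball_vol_def G P by (simp add: mult_ac)
qed

locale plane =
  fixes b1 b2 :: "'a::euclidean_space"
  assumes b12: "b1 \<in> Basis" "b2 \<in> Basis" "b1 \<noteq> b2" and dim: "45 \<le> DIM('a)"
begin

definition rest :: "'a set" where "rest = Basis - {b1, b2}"

text \<open>The squared norm of the part orthogonal to the plane of \<open>b1\<close> and
  \<open>b2\<close>; \<open>tr\<close> is that part itself.\<close>

definition nT :: "'a \<Rightarrow> real" where "nT y = (\<Sum>b\<in>rest. (y \<bullet> b)\<^sup>2)"

definition tr :: "'a \<Rightarrow> 'a" where "tr y = (\<Sum>b\<in>rest. (y \<bullet> b) *\<^sub>R b)"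

text \<open>Half the side of a planar square. Varying both points within their squares changes the
  planar displacement by at most 2 * 0.042 in the two coordinates together, that is by less than
  0.06 in norm, as \<open>plane_dist\<close> allows.\<close>

definition hs :: real where "hs = 21/1000"

definition cell :: "real \<Rightarrow> 'a \<Rightarrow> 'a set" where
  "cell \<rho> c = {y. \<bar>(y - c) \<bullet> b1\<bar> \<le> hs \<and> \<bar>(y - c) \<bullet> b2\<bar> \<le> hs \<and> nT (y - c) \<le> \<rho>\<^sup>2}"

definition mm :: nat where "mm = card rest"

lemma rest: "finite rest" "b1 \<notin> rest" "b2 \<notin> rest" "Basis = insert b1 (insert b2 rest)" "mm = DIM('a) - 2" "rest \<subseteq> Basis"
proof -
  show "finite rest" "b1 \<notin> rest" "b2 \<notin> rest" "Basis = insert b1 (insert b2 rest)" "rest \<subseteq> Basis"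
    using b12 by (auto simp: rest_def)
  have "card {b1, b2} = 2" using b12 by simp
  then show "mm = DIM('a) - 2" unfolding mm_def rest_def using b12 by (subst card_Diff_subset) auto
qed

lemma sum_Basis: "(\<Sum>b\<in>Basis. f b) = f b1 + f b2 + (\<Sum>b\<in>rest. f b)" for f :: "'a \<Rightarrow> 'b::comm_monoid_add"
  unfolding rest(4) using rest(1-3) b12 by (simp add: add.assoc)

lemma norm_split: "(norm y)\<^sup>2 = (y \<bullet> b1)\<^sup>2 + (y \<bullet> b2)\<^sup>2 + nT y"
proof -
  have "(norm y)\<^sup>2 = (\<Sum>b\<in>Basis. (y \<bullet> b)\<^sup>2)" unfolding norm_conv_dist euclidean_dist_l2[of y 0] L2_set_def by (simp add: sum_nonneg)
  then show ?thesis by (simp add: sum_Basis nT_def)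
qed

lemma nT_nonneg: "0 \<le> nT y" unfolding nT_def by (intro sum_nonneg) auto

lemma tr_inner: "b \<in> Basis \<Longrightarrow> tr y \<bullet> b = (if b \<in> rest then y \<bullet> b else 0)"
  unfolding tr_def inner_sum_left using rest(1,6)
  by (simp add: inner_Basis if_distrib subset_iff cong: if_cong)

lemma tr_norm: "(norm (tr y))\<^sup>2 = nT y"
proof -
  have "nT (tr y) = nT y" unfolding nT_def using rest(6) by (intro sum.cong) (auto simp: tr_inner)
  then show ?thesis using norm_split[of "tr y"] b12 by (simp add: tr_inner rest(2,3))
qed

lemma inner_tr: "(\<Sum>b\<in>rest. (y \<bullet> b) * (z \<bullet> b)) = y \<bullet> tr z"
  by (subst euclidean_inner) (use b12 rest(1-3,6) in \<open>auto simp: sum_Basis tr_inner intro!: sum.cong\<close>)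

lemma nT_add: "nT (y + z) = nT y + 2 * (y \<bullet> tr z) + nT z"
  unfolding inner_tr[symmetric] nT_def by (simp add: inner_add_left power2_sum sum.distrib sum_distrib_left mult_ac)

lemma nT_le: "nT y \<le> (norm y)\<^sup>2" using norm_split[of y] by simp

lemma nT_continuous: "continuous_on UNIV nT" unfolding nT_def by (intro continuous_intros)

lemma cell_closed: "closed (cell \<rho> c)"
proof -
  have "continuous_on UNIV (\<lambda>y. nT (y - c))"
    by (rule continuous_on_compose2[OF nT_continuous]) (auto intro!: continuous_intros)
  then show ?thesis unfolding cell_def by (intro closed_Collect_conj closed_Collect_le continuous_intros)
qed

lemma cell_bounded: "bounded (cell \<rho> c)"
proof (rule boundedI[of _ "norm c + (2 * hs + \<bar>\<rho>\<bar>)"])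
  fix y assume y: "y \<in> cell \<rho> c"
  have "(norm (y - c))\<^sup>2 \<le> hs\<^sup>2 + hs\<^sup>2 + \<rho>\<^sup>2"
    unfolding norm_split using y by (intro add_mono) (auto simp: cell_def abs_le_square_iff[symmetric] hs_def)
  also have "\<dots> \<le> (2 * hs + \<bar>\<rho>\<bar>)\<^sup>2" by (simp add: power2_eq_square algebra_simps hs_def)
  finally have "norm (y - c) \<le> 2 * hs + \<bar>\<rho>\<bar>" by (rule power2_le_imp_le) (simp add: hs_def)
  then show "norm y \<le> norm c + (2 * hs + \<bar>\<rho>\<bar>)" using norm_triangle_ineq[of "y - c" c] by simp
qed

text \<open>Fubini in the two planar coordinates: over each (s, t) the fibre contains a shell
  between radii \<alpha> and \<beta> in the remaining \<open>mm\<close> dimensions, whose volume is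
  \<open>unit_ball_vol\<close> times the difference of the powers.\<close>

lemma shell_volume:
  fixes I1 I2 :: "real set"
  assumes I: "I1 \<in> sets borel" "I2 \<in> sets borel" and vol: "emeasure lborel I1 = ennreal v1" "emeasure lborel I2 = ennreal v2" "0 \<le> v1" "0 \<le> v2"
    and shell: "\<And>s t. s \<in> I1 \<Longrightarrow> t \<in> I2 \<Longrightarrow> \<exists>\<beta> \<alpha>. 0 < \<alpha> \<and> \<alpha> < \<beta> \<and> lw \<le> s\<^sup>2 + t\<^sup>2 + \<alpha>\<^sup>2 \<and> s\<^sup>2 + t\<^sup>2 + \<beta>\<^sup>2 \<le> up \<and> L \<le> \<beta> ^ mm - \<alpha> ^ mm"
    and L: "0 \<le> L"
  shows "ennreal (v1 * v2 * (unit_ball_vol (real mm) * L)) \<le>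
    emeasure lborel {z::'a. z \<bullet> b1 \<in> I1 \<and> z \<bullet> b2 \<in> I2 \<and> lw \<le> (norm z)\<^sup>2 \<and> (norm z)\<^sup>2 \<le> up}"
proof -
  interpret product_sigma_finite "\<lambda>_::'a. lborel :: real measure" by standard
  let ?S = "{z::'a. z \<bullet> b1 \<in> I1 \<and> z \<bullet> b2 \<in> I2 \<and> lw \<le> (norm z)\<^sup>2 \<and> (norm z)\<^sup>2 \<le> up}"
  have S[measurable]: "?S \<in> sets borel"
  proof -
    note I[measurable]
    have "{z\<in>space borel. z \<bullet> b1 \<in> I1 \<and> z \<bullet> b2 \<in> I2 \<and> lw \<le> (norm z)\<^sup>2 \<and> (norm z)\<^sup>2 \<le> up} \<in> sets (borel :: 'a measure)" by measurable
    then show ?thesis by simp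
  qed
  let ?T = "\<lambda>f. \<Sum>b\<in>Basis. f b *\<^sub>R (b::'a)"
  have Tm[measurable]: "?T \<in> PiM Basis (\<lambda>_. lborel) \<rightarrow>\<^sub>M borel" by measurable
  define F where "F f = (indicator ?S (?T f) :: ennreal)" for f
  have Fm: "F \<in> borel_measurable (PiM Basis (\<lambda>_. lborel))" unfolding F_def by measurable
  have "emeasure lborel ?S = emeasure (distr (PiM Basis (\<lambda>_. lborel)) borel ?T) ?S"
    by (simp only: lborel_eq[symmetric])
  also have "\<dots> = (\<integral>\<^sup>+f. F f \<partial>PiM Basis (\<lambda>_. lborel))"
  proof -
    have "emeasure (distr (PiM Basis (\<lambda>_. lborel)) borel ?T) ?S = (\<integral>\<^sup>+z. indicator ?S z \<partial>distr (PiM Basis (\<lambda>_. lborel)) borel ?T)"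
      by (rule nn_integral_indicator[symmetric]) simp
    also have "\<dots> = (\<integral>\<^sup>+f. F f \<partial>PiM Basis (\<lambda>_. lborel))"
      unfolding F_def by (rule nn_integral_distr[OF Tm]) simp
    finally show ?thesis .
  qed
  also have "\<dots> = (\<integral>\<^sup>+s. (\<integral>\<^sup>+g. F (g(b1 := s)) \<partial>PiM (insert b2 rest) (\<lambda>_. lborel)) \<partial>lborel)"
    using Fm unfolding rest(4) by (rule product_nn_integral_insert_rev[rotated 2]) (use rest b12 in auto)
  also have "\<dots> = (\<integral>\<^sup>+s. (\<integral>\<^sup>+t. (\<integral>\<^sup>+g. F (g(b2 := t, b1 := s)) \<partial>PiM rest (\<lambda>_. lborel)) \<partial>lborel) \<partial>lborel)"
  proof (intro nn_integral_cong product_nn_integral_insert_rev)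
    fix s :: real
    have "(\<lambda>g. g(b1 := s)) \<in> PiM (insert b2 rest) (\<lambda>_. lborel) \<rightarrow>\<^sub>M PiM Basis (\<lambda>_. lborel :: real measure)"
      unfolding rest(4) by (rule measurable_fun_upd[where J="insert b2 rest"]) auto
    from measurable_compose[OF this Fm] show "(\<lambda>g. F (g(b1 := s))) \<in> borel_measurable (PiM (insert b2 rest) (\<lambda>_. lborel))" .
  qed (use rest b12 in auto)
  also have "\<dots> \<ge> (\<integral>\<^sup>+s. (\<integral>\<^sup>+t. indicator I1 s * indicator I2 t * ennreal (unit_ball_vol (real mm) * L) \<partial>lborel) \<partial>lborel)"
  proof (intro nn_integral_mono)
    fix s t :: real
    show "indicator I1 s * indicator I2 t * ennreal (unit_ball_vol (real mm) * L) \<le> (\<integral>\<^sup>+g. F (g(b2 := t, b1 := s)) \<partial>PiM rest (\<lambda>_. lborel))"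
    proof (cases "s \<in> I1 \<and> t \<in> I2")
      case True
      then obtain \<beta> \<alpha> where ab: "0 < \<alpha>" "\<alpha> < \<beta>" "lw \<le> s\<^sup>2 + t\<^sup>2 + \<alpha>\<^sup>2" "s\<^sup>2 + t\<^sup>2 + \<beta>\<^sup>2 \<le> up" "L \<le> \<beta> ^ mm - \<alpha> ^ mm"
        using shell by blast
      let ?P = "PiM rest (\<lambda>_. lborel :: real measure)"
      define D where "D r = {f. sqrt (\<Sum>i\<in>rest. (f i)\<^sup>2) \<le> r} \<inter> space ?P" for r
      have Dm: "D r \<in> sets ?P" for r
      proof -
        have "{f\<in>space ?P. sqrt (\<Sum>i\<in>rest. (f i)\<^sup>2) \<le> r} \<in> sets ?P" by measurable
        then show ?thesis by (simp add: D_def Int_def conj_commute)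
      qed
      have De: "emeasure ?P (D r) = ennreal (unit_ball_vol (real mm) * r ^ mm)" if "0 < r" for r
        unfolding D_def using emeasure_cball_aux[OF rest(1) that] by (simp add: mm_def)
      have sub: "D \<alpha> \<subseteq> D \<beta>" using ab by (auto simp: D_def)
      have "ennreal (unit_ball_vol (real mm) * L) \<le> ennreal (unit_ball_vol (real mm) * \<beta> ^ mm) - ennreal (unit_ball_vol (real mm) * \<alpha> ^ mm)"
        using ab(1,5) by (subst ennreal_minus) (auto intro!: ennreal_leI mult_left_mono simp: right_diff_distrib[symmetric])
      also have "\<dots> = emeasure ?P (D \<beta> - D \<alpha>)"
        using ab De[of \<alpha>] De[of \<beta>] Dm sub by (subst emeasure_Diff) auto
      also have "\<dots> = (\<integral>\<^sup>+g. indicator (D \<beta> - D \<alpha>) g \<partial>?P)" using Dm by simp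
      also have "\<dots> \<le> (\<integral>\<^sup>+g. F (g(b2 := t, b1 := s)) \<partial>?P)"
      proof (intro nn_integral_mono)
        fix g
        show "indicator (D \<beta> - D \<alpha>) g \<le> F (g(b2 := t, b1 := s))"
        proof (cases "g \<in> D \<beta> - D \<alpha>")
          case g: True
          define z where "z = ?T (g(b2 := t, b1 := s))"
          have zb: "z \<bullet> b = (g(b2 := t, b1 := s)) b" if "b \<in> Basis" for b unfolding z_def using that by simp
          have zs: "z \<bullet> b1 = s" "z \<bullet> b2 = t" using zb b12 by auto
          have "nT z = (\<Sum>i\<in>rest. (g i)\<^sup>2)" unfolding nT_def using zb rest by (intro sum.cong) auto
          moreover have "sqrt (\<Sum>i\<in>rest. (g i)\<^sup>2) \<le> \<beta>" "\<alpha> < sqrt (\<Sum>i\<in>rest. (g i)\<^sup>2)" using g by (auto simp: D_def)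
          ultimately have "nT z \<le> \<beta>\<^sup>2" "\<alpha>\<^sup>2 \<le> nT z"
            using ab real_sqrt_le_iff real_le_lsqrt sqrt_le_D real_less_rsqrt by (auto intro: less_imp_le) (smt (verit) real_le_lsqrt power2_eq_square)+
          then have "z \<in> ?S" using True ab unfolding norm_split by (auto simp: zs norm_split)
          then show ?thesis using g unfolding F_def z_def by simp
        qed simp
      qed
      finally show ?thesis using True by simp
    qed auto
  qed
  also have "(\<integral>\<^sup>+s. (\<integral>\<^sup>+t. indicator I1 s * indicator I2 t * ennreal (unit_ball_vol (real mm) * L) \<partial>lborel) \<partial>lborel) =
     ennreal v1 * ennreal v2 * ennreal (unit_ball_vol (real mm) * L)"
    using I vol by (simp add: nn_integral_cmult nn_integral_multc mult.assoc)
  finally show ?thesis using vol L by (simp add: ennreal_mult)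
qed

text \<open>Reflects the orthogonal part about that of \<open>x\<close> and keeps the planar
  coordinates. It preserves volume and distance to \<open>x\<close>, so an annulus around
  \<open>x\<close> over a planar square is mapped to itself.\<close>

definition refl :: "'a \<Rightarrow> 'a \<Rightarrow> 'a" where
  "refl x y = y - 2 *\<^sub>R tr (y - x)"

lemma refl_measure:
  assumes "A \<in> sets borel"
  shows "emeasure lborel (refl x -` A) = emeasure lborel A" "refl x -` A \<in> sets borel"
proof -
  define c where "c j = (if j \<in> rest then - 1 else 1 :: real)" for j :: 'a
  define t where "t = 2 *\<^sub>R tr x"
  have T: "t + (\<Sum>j\<in>Basis. (c j * (y \<bullet> j)) *\<^sub>R j) = refl x y" for y
  proof (rule euclidean_eqI)
    fix b :: 'a assume b: "b \<in> Basis"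
    have "(\<Sum>j\<in>Basis. (c j * (y \<bullet> j)) *\<^sub>R j) \<bullet> b = c b * (y \<bullet> b)" using b by simp
    then show "(t + (\<Sum>j\<in>Basis. (c j * (y \<bullet> j)) *\<^sub>R j)) \<bullet> b = refl x y \<bullet> b"
      using b by (simp add: inner_add_left t_def refl_def inner_diff_left tr_inner c_def)
  qed
  have cont: "continuous_on UNIV (refl x)" unfolding refl_def tr_def by (intro continuous_intros)
  then have m[measurable]: "refl x \<in> borel_measurable borel" by (rule borel_measurable_continuous_onI)
  show "refl x -` A \<in> sets borel" using measurable_sets[OF m assms] by simp
  have "(lborel :: 'a measure) = density (distr lborel borel (refl x)) (\<lambda>_. \<Prod>j\<in>Basis. \<bar>c j\<bar>)"
  proof -
    have "c j \<noteq> 0" for j by (simp add: c_def)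
    from lborel_affine_euclidean[of c t, OF this] show ?thesis unfolding T .
  qed
  also have "(\<Prod>j\<in>(Basis::'a set). \<bar>c j\<bar>) = 1" by (intro prod.neutral) (simp add: c_def)
  finally have "(lborel :: 'a measure) = distr lborel borel (refl x)" by (simp add: density_1)
  then have "emeasure lborel A = emeasure (distr lborel borel (refl x)) A" by simp
  also have "\<dots> = emeasure lborel (refl x -` A)" using assms by (subst emeasure_distr) auto
  finally show "emeasure lborel (refl x -` A) = emeasure lborel A" ..
qed

lemma refl_props:
  "(refl x y - x) \<bullet> b1 = (y - x) \<bullet> b1" "(refl x y - x) \<bullet> b2 = (y - x) \<bullet> b2"
  "dist x (refl x y) = dist x y" "tr (refl x y - x) = - tr (y - x)" "nT (refl x y - x) = nT (y - x)"
proof -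
  show 1: "(refl x y - x) \<bullet> b1 = (y - x) \<bullet> b1" "(refl x y - x) \<bullet> b2 = (y - x) \<bullet> b2"
    using b12 rest by (auto simp: refl_def inner_diff_left tr_inner)
  show t: "tr (refl x y - x) = - tr (y - x)"
  proof (rule euclidean_eqI)
    fix b :: 'a assume "b \<in> Basis"
    then show "tr (refl x y - x) \<bullet> b = (- tr (y - x)) \<bullet> b" by (simp add: tr_inner refl_def inner_diff_left)
  qed
  show n: "nT (refl x y - x) = nT (y - x)" using tr_norm[of "refl x y - x"] tr_norm[of "y - x"] t by simp
  have "(norm (refl x y - x))\<^sup>2 = (norm (y - x))\<^sup>2" unfolding norm_split 1 n ..
  then show "dist x (refl x y) = dist x y" by (simp add: dist_norm norm_minus_commute)
qed

lemma tr_add: "tr (y + z) = tr y + tr z"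
  by (simp add: tr_def inner_add_left scaleR_left_distrib sum.distrib)

lemma tr_sym: "y \<bullet> tr z = tr y \<bullet> z"
  using inner_tr[of y z] inner_tr[of z y] by (simp add: mult.commute inner_commute)

text \<open>The least outer radius of the orthogonal shells: the outer radius of the annulus is at
  least 2 and the squared planar distance at most 1.6231, and 4 - 1.6231 = 2.3769.\<close>

definition sg :: real where "sg = sqrt (23769 / 10000)"

definition S_low :: real where
  "S_low = (2 * hs) * (2 * hs) * (unit_ball_vol (real mm) * (7/10 * sg ^ mm))"

lemma mm43: "43 \<le> mm" and mm_dim: "DIM('a) = mm + 2"
  using dim rest(5) by simp_all

lemma sg_pos: "0 < sg" "sg\<^sup>2 = 23769 / 10000" "1 < sg" by (simp_all add: sg_def)

lemma S_low_pos: "0 < S_low"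
  unfolding S_low_def using sg_pos by (intro mult_pos_pos) (auto simp: hs_def)

text \<open>In 43 or more dimensions most of a ball lies near its surface: even this thin shell
  fills at least 7/10 of the ball of radius \<beta>.\<close>

lemma shell_power:
  fixes \<alpha> \<beta> :: real
  assumes "0 < \<alpha>" "0 < \<beta>" "23769 / 10000 \<le> \<beta>\<^sup>2" "\<beta>\<^sup>2 \<le> 28328 / 10000" "\<alpha>\<^sup>2 \<le> \<beta>\<^sup>2 - 1584 / 10000"
  shows "7/10 * sg ^ mm \<le> \<beta> ^ mm - \<alpha> ^ mm"
proof -
  \<comment> \<open>0.9441 exceeds 1 - 0.1584 / 2.8328, the largest possible ratio of the squared
    radii; its power 43/2 is below 3/10.\<close>
  define \<tau> where "\<tau> = sqrt (9441 / 10000)"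
  have t: "0 < \<tau>" "\<tau>\<^sup>2 = 9441 / 10000" "\<tau> \<le> 1" by (simp_all add: \<tau>_def)
  have "\<alpha>\<^sup>2 \<le> (\<tau> * \<beta>)\<^sup>2" unfolding power_mult_distrib t(2) using assms(4,5) by simp
  then have "\<alpha> \<le> \<tau> * \<beta>" by (rule power2_le_imp_le) (use t(1) assms(2) in simp)
  then have "\<alpha> ^ mm \<le> \<tau> ^ mm * \<beta> ^ mm" using assms(1) unfolding power_mult_distrib[symmetric] by (intro power_mono) auto
  moreover have "\<tau> ^ mm \<le> 3/10"
  proof -
    have "\<tau> ^ mm \<le> \<tau> ^ 43" using t(1,3) mm43 by (intro power_decreasing) simp_all
    moreover have "(\<tau> ^ 43)\<^sup>2 \<le> (3/10)\<^sup>2"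
    proof -
      have "(\<tau> ^ 43)\<^sup>2 = (\<tau>\<^sup>2) ^ 43" by (simp only: power_mult[symmetric] mult.commute)
      also have "\<dots> \<le> (3/10)\<^sup>2" unfolding t(2) by (simp add: power_divide)
      finally show ?thesis .
    qed
    ultimately show ?thesis using power2_le_imp_le[of "\<tau> ^ 43" "3/10"] by simp
  qed
  ultimately have "\<alpha> ^ mm \<le> 3/10 * \<beta> ^ mm"
    by (intro order_trans[OF _ mult_right_mono[of "\<tau> ^ mm" "3/10" "\<beta> ^ mm"]]) (use assms(2) in simp_all)
  moreover have "sg ^ mm \<le> \<beta> ^ mm"
  proof (rule power_mono)
    show "sg \<le> \<beta>" by (rule power2_le_imp_le) (use sg_pos(2) assms(2,3) in simp_all)
  qed (use sg_pos in simp)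
  ultimately show ?thesis by linarith
qed

text \<open>The centres are between 1.2128 and 1.214 apart in the plane; varying the points in the
  squares changes this by at most 0.06. The bounds are 1.1528 and 1.274 squared, rounded
  outwards.\<close>

lemma plane_dist:
  fixes D1 D2 a1 a2 :: real
  assumes D: "(12128/10000)\<^sup>2 \<le> D1\<^sup>2 + D2\<^sup>2" "D1\<^sup>2 + D2\<^sup>2 \<le> (1214/1000)\<^sup>2"
    and a: "\<bar>a1 - D1\<bar> \<le> 2 * hs" "\<bar>a2 - D2\<bar> \<le> 2 * hs"
  shows "13289/10000 \<le> a1\<^sup>2 + a2\<^sup>2" "a1\<^sup>2 + a2\<^sup>2 \<le> 16231/10000"
proof -
  have e: "sqrt ((a1 - D1)\<^sup>2 + (a2 - D2)\<^sup>2) \<le> 6/100"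
  proof (rule real_le_lsqrt)
    have "(a1 - D1)\<^sup>2 \<le> (42/1000)\<^sup>2" "(a2 - D2)\<^sup>2 \<le> (42/1000)\<^sup>2"
      using a by (intro abs_le_square_iff[THEN iffD1]; simp add: hs_def)+
    then show "(a1 - D1)\<^sup>2 + (a2 - D2)\<^sup>2 \<le> (6/100)\<^sup>2" by (simp add: power2_eq_square)
  qed auto
  have D': "12128/10000 \<le> sqrt (D1\<^sup>2 + D2\<^sup>2)" "sqrt (D1\<^sup>2 + D2\<^sup>2) \<le> 1214/1000"
    by (rule real_le_rsqrt[OF D(1)], rule real_le_lsqrt[OF _ D(2)]) simp
  have "sqrt (a1\<^sup>2 + a2\<^sup>2) \<le> sqrt (D1\<^sup>2 + D2\<^sup>2) + sqrt ((a1 - D1)\<^sup>2 + (a2 - D2)\<^sup>2)"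
    using real_sqrt_sum_squares_triangle_ineq[of D1 "a1 - D1" D2 "a2 - D2"] by simp
  then have u: "sqrt (a1\<^sup>2 + a2\<^sup>2) \<le> 1274/1000" using e D' by simp
  have "sqrt (D1\<^sup>2 + D2\<^sup>2) \<le> sqrt (a1\<^sup>2 + a2\<^sup>2) + sqrt ((D1 - a1)\<^sup>2 + (D2 - a2)\<^sup>2)"
    using real_sqrt_sum_squares_triangle_ineq[of a1 "D1 - a1" a2 "D2 - a2"] by simp
  then have l: "11528/10000 \<le> sqrt (a1\<^sup>2 + a2\<^sup>2)" using e D' by (simp add: power2_commute)
  have s: "(sqrt (a1\<^sup>2 + a2\<^sup>2))\<^sup>2 = a1\<^sup>2 + a2\<^sup>2" by simp
  show "a1\<^sup>2 + a2\<^sup>2 \<le> 16231/10000"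
    using power_mono[OF u, of 2] unfolding s by (simp add: power2_eq_square)
  show "13289/10000 \<le> a1\<^sup>2 + a2\<^sup>2"
    using power_mono[OF l, of 2] unfolding s by (simp add: power2_eq_square)
qed

lemma annulus_volume:
  fixes x c c' :: 'a and r :: real
  assumes D: "(12128/10000)\<^sup>2 \<le> ((c' - c) \<bullet> b1)\<^sup>2 + ((c' - c) \<bullet> b2)\<^sup>2" "((c' - c) \<bullet> b1)\<^sup>2 + ((c' - c) \<bullet> b2)\<^sup>2 \<le> (1214/1000)\<^sup>2"
    and x: "\<bar>(x - c) \<bullet> b1\<bar> \<le> hs" "\<bar>(x - c) \<bullet> b2\<bar> \<le> hs" and r: "49/50 \<le> r" "r \<le> 51/50"
  shows "ennreal S_low \<le> emeasure lborel {y. \<bar>(y - c') \<bullet> b1\<bar> \<le> hs \<and> \<bar>(y - c') \<bullet> b2\<bar> \<le> hs \<and>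
     49/50 \<le> dist x y - r \<and> dist x y - r \<le> 51/50}" (is "_ \<le> emeasure _ ?S")
proof -
  define e1 e2 where "e1 = (c' - x) \<bullet> b1" and "e2 = (c' - x) \<bullet> b2"
  define I1 I2 where "I1 = {e1 - hs .. e1 + hs}" and "I2 = {e2 - hs .. e2 + hs}"
  have hs: "0 \<le> hs" by (simp add: hs_def)
  let ?Z = "{z::'a. z \<bullet> b1 \<in> I1 \<and> z \<bullet> b2 \<in> I2 \<and> (r + 49/50)\<^sup>2 \<le> (norm z)\<^sup>2 \<and> (norm z)\<^sup>2 \<le> (r + 51/50)\<^sup>2}"
  have "ennreal (2 * hs * (2 * hs) * (unit_ball_vol (real mm) * (7/10 * sg ^ mm))) \<le> emeasure lborel ?Z"
  proof (rule shell_volume)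
    show "emeasure lborel I1 = ennreal (2 * hs)" "emeasure lborel I2 = ennreal (2 * hs)" using hs by (simp_all add: I1_def I2_def)
    show "0 \<le> 7/10 * sg ^ mm" using sg_pos by simp
    fix s t assume st: "s \<in> I1" "t \<in> I2"
    have "\<bar>s - (c' - c) \<bullet> b1\<bar> \<le> 2 * hs" "\<bar>t - (c' - c) \<bullet> b2\<bar> \<le> 2 * hs"
      using st x by (auto simp: I1_def I2_def e1_def e2_def inner_diff_left abs_le_iff)
    note p = plane_dist[OF D this]
    \<comment> \<open>Orthogonal radii belonging to the outer and inner radius of the annulus. The
      constants of \<open>shell_power\<close> arise as 4 - 1.6231, as a bound for 2.04 ^ 2 - 1.3289,
      and as the least value of 0.08 * (r + 1).\<close>
    define \<beta> \<alpha> where "\<beta> = sqrt ((r + 51/50)\<^sup>2 - (s\<^sup>2 + t\<^sup>2))" and "\<alpha> = sqrt ((r + 49/50)\<^sup>2 - (s\<^sup>2 + t\<^sup>2))"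
    have r2: "2\<^sup>2 \<le> (r + 51/50)\<^sup>2" "(r + 51/50)\<^sup>2 \<le> (204/100)\<^sup>2" "(196/100)\<^sup>2 \<le> (r + 49/50)\<^sup>2"
      using r by (intro power_mono; simp)+
    have gap: "(r + 51/50)\<^sup>2 - (r + 49/50)\<^sup>2 = 8/100 * (r + 1)" by (simp add: power2_eq_square algebra_simps)
    have b2': "\<beta>\<^sup>2 = (r + 51/50)\<^sup>2 - (s\<^sup>2 + t\<^sup>2)" unfolding \<beta>_def using r2 p by (intro real_sqrt_pow2) (simp add: power2_eq_square)
    have a2': "\<alpha>\<^sup>2 = (r + 49/50)\<^sup>2 - (s\<^sup>2 + t\<^sup>2)" unfolding \<alpha>_def using r2 p by (intro real_sqrt_pow2) (simp add: power2_eq_square)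
    have ap: "0 < \<alpha>" unfolding \<alpha>_def using r2 p by (intro real_sqrt_gt_zero) (simp add: power2_eq_square)
    have "0 < 8/100 * (r + 1)" using r by simp
    then have lt: "\<alpha> < \<beta>" unfolding \<alpha>_def \<beta>_def using gap by simp
    have "7/10 * sg ^ mm \<le> \<beta> ^ mm - \<alpha> ^ mm"
    proof (rule shell_power)
      show "0 < \<alpha>" "0 < \<beta>" using ap lt by auto
      show "23769 / 10000 \<le> \<beta>\<^sup>2" "\<beta>\<^sup>2 \<le> 28328 / 10000" unfolding b2' using r2 p by (simp_all add: power2_eq_square)
      show "\<alpha>\<^sup>2 \<le> \<beta>\<^sup>2 - 1584 / 10000" unfolding a2' b2' using gap r by simp
    qed
    then show "\<exists>\<beta> \<alpha>. 0 < \<alpha> \<and> \<alpha> < \<beta> \<and> (r + 49/50)\<^sup>2 \<le> s\<^sup>2 + t\<^sup>2 + \<alpha>\<^sup>2 \<and> s\<^sup>2 + t\<^sup>2 + \<beta>\<^sup>2 \<le> (r + 51/50)\<^sup>2 \<and>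
        7/10 * sg ^ mm \<le> \<beta> ^ mm - \<alpha> ^ mm"
      using ap lt a2' b2' by (intro exI[of _ \<beta>] exI[of _ \<alpha>]) auto
  qed (use hs in \<open>auto simp: I1_def I2_def\<close>)
  also have "emeasure lborel ?Z = emeasure (distr lborel borel ((+) (- x))) ?Z" by (simp add: lborel_distr_plus)
  also have "\<dots> = emeasure lborel ((+) (- x) -` ?Z \<inter> space lborel)"
  proof (rule emeasure_distr)
    have [measurable]: "I1 \<in> sets borel" "I2 \<in> sets borel" by (simp_all add: I1_def I2_def)
    have "{z\<in>space borel. z \<bullet> b1 \<in> I1 \<and> z \<bullet> b2 \<in> I2 \<and> (r + 49/50)\<^sup>2 \<le> (norm z)\<^sup>2 \<and> (norm z)\<^sup>2 \<le> (r + 51/50)\<^sup>2} \<in> sets (borel :: 'a measure)" by measurable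
    then show "?Z \<in> sets borel" by simp
  qed simp
  also have "(+) (- x) -` ?Z \<inter> space lborel = ?S"
  proof -
    have d: "((r + 49/50)\<^sup>2 \<le> (norm (y - x))\<^sup>2 \<and> (norm (y - x))\<^sup>2 \<le> (r + 51/50)\<^sup>2) \<longleftrightarrow> (49/50 \<le> dist x y - r \<and> dist x y - r \<le> 51/50)" for y
    proof -
      have "(r + 49/50)\<^sup>2 \<le> (norm (y - x))\<^sup>2 \<longleftrightarrow> r + 49/50 \<le> norm (y - x)" using r by (intro abs_le_square_iff[symmetric, THEN trans]) auto
      moreover have "(norm (y - x))\<^sup>2 \<le> (r + 51/50)\<^sup>2 \<longleftrightarrow> norm (y - x) \<le> r + 51/50" using r by (intro abs_le_square_iff[symmetric, THEN trans]) auto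
      ultimately show ?thesis by (auto simp: dist_norm norm_minus_commute)
    qed
    have i: "(y - x) \<bullet> b1 \<in> I1 \<longleftrightarrow> \<bar>(y - c') \<bullet> b1\<bar> \<le> hs" "(y - x) \<bullet> b2 \<in> I2 \<longleftrightarrow> \<bar>(y - c') \<bullet> b2\<bar> \<le> hs" for y
      by (auto simp: I1_def I2_def e1_def e2_def inner_diff_left abs_le_iff)
    show ?thesis using d i by auto
  qed
  finally show ?thesis by (simp add: S_low_def)
qed

text \<open>If \<open>x\<close> is deep inside the cell, the whole annulus over the square fits.
  Near the lateral boundary, the points of the annulus on the inner side of \<open>x\<close> belong
  to the cell and \<open>refl\<close> carries the outer side to the inner one. Only a thin slab in
  between is lost; it costs at most a tenth of the volume, which leaves (1 - 1/10) / 2 =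
  45/100.\<close>

lemma half_annulus:
  fixes x c c' :: 'a and r \<rho> :: real
  assumes D: "(12128/10000)\<^sup>2 \<le> ((c' - c) \<bullet> b1)\<^sup>2 + ((c' - c) \<bullet> b2)\<^sup>2" "((c' - c) \<bullet> b1)\<^sup>2 + ((c' - c) \<bullet> b2)\<^sup>2 \<le> (1214/1000)\<^sup>2"
    and cc: "nT (c' - c) = 0"
    and x: "x \<in> cell \<rho> c" and r: "49/50 \<le> r" "r \<le> 51/50"
    and J: "0 < J" "emeasure lborel (ball (0::'a) 4) \<le> ennreal (real J * (S_low / 10))" and rho: "\<rho> = 10 * real J + 10"
  shows "45/100 * S_low \<le> measure lborel {y\<in>cell \<rho> c'. 49/50 \<le> dist x y - r \<and> dist x y - r \<le> 51/50}"
proof -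
  define A where "A = {y\<in>cell \<rho> c'. 49/50 \<le> dist x y - r \<and> dist x y - r \<le> 51/50}"
  define S where "S = {y. \<bar>(y - c') \<bullet> b1\<bar> \<le> hs \<and> \<bar>(y - c') \<bullet> b2\<bar> \<le> hs \<and>
     49/50 \<le> dist x y - r \<and> dist x y - r \<le> 51/50}"
  have xc: "\<bar>(x - c) \<bullet> b1\<bar> \<le> hs" "\<bar>(x - c) \<bullet> b2\<bar> \<le> hs" "nT (x - c) \<le> \<rho>\<^sup>2" using x by (auto simp: cell_def)
  have S: "ennreal S_low \<le> emeasure lborel S"
    unfolding S_def by (rule annulus_volume[OF D xc(1,2) r])
  have trcc: "tr (c' - c) = 0" using tr_norm[of "c' - c"] cc by simp
  have nc: "nT (y - c) = nT (y - c')" for y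
    using nT_add[of "y - c'" "c' - c"] trcc cc by simp
  have A_iff: "y \<in> A \<longleftrightarrow> y \<in> S \<and> nT (y - c) \<le> \<rho>\<^sup>2" for y
    unfolding A_def S_def cell_def nc by auto
  have Ab: "A \<in> sets borel"
  proof -
    have "A = cell \<rho> c' \<inter> {y. 49/50 \<le> dist x y - r} \<inter> {y. dist x y - r \<le> 51/50}" by (auto simp: A_def)
    moreover have "closed (\<dots>)" by (intro closed_Int cell_closed closed_Collect_le continuous_intros)
    ultimately show ?thesis by simp
  qed
  have "bounded A" using cell_bounded by (rule bounded_subset) (auto simp: A_def)
  then have "emeasure lborel A < \<infinity>" by (rule emeasure_bounded_finite)
  then have Ae: "emeasure lborel A = ennreal (measure lborel A)" by (intro emeasure_eq_ennreal_measure) simp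
  define t where "t = S_low / 10"
  have t0: "0 < t" using S_low_pos by (simp add: t_def)
  have "ennreal S_low \<le> 2 * emeasure lborel A + ennreal t"
  proof (cases "norm (tr (x - c)) \<le> \<rho> - 3")
    case True
    have "S \<subseteq> A"
    proof
      fix y assume y: "y \<in> S"
      have d: "dist x y \<le> 204/100" using y r unfolding S_def by auto
      have "(norm (tr (y - x)))\<^sup>2 \<le> (norm (y - x))\<^sup>2" unfolding tr_norm by (rule nT_le)
      then have "norm (tr (y - x)) \<le> norm (y - x)" by (rule power2_le_imp_le) simp
      then have "norm (tr (y - x)) \<le> 3" using d by (simp add: dist_norm norm_minus_commute)
      moreover have "tr (y - c) = tr (x - c) + tr (y - x)" unfolding tr_add[symmetric] by simp
      ultimately have "norm (tr (y - c)) \<le> \<rho>" using True norm_triangle_ineq[of "tr (x - c)" "tr (y - x)"] by simp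
      then have "(norm (tr (y - c)))\<^sup>2 \<le> \<rho>\<^sup>2" by (intro power_mono) auto
      then show "y \<in> A" unfolding A_iff using y by (simp add: tr_norm)
    qed
    then have "emeasure lborel S \<le> emeasure lborel A" using Ab by (intro emeasure_mono) auto
    also have "\<dots> \<le> 2 * emeasure lborel A + ennreal t"
      by (simp add: mult_2 add_increasing2 add.assoc)
    finally show ?thesis using S by (rule order_trans[rotated])
  next
    case False
    define u where "u = tr (x - c)"
    define q where "q = norm u"
    have q: "10 * real J + 7 < q" using False rho by (simp add: q_def u_def)
    have q2: "q\<^sup>2 \<le> \<rho>\<^sup>2" unfolding q_def u_def tr_norm by (rule xc(3))
    define e where "e = (1 / q) *\<^sub>R u"
    \<comment> \<open>Moving inward by \<open>k\<close> lowers the squared orthogonal norm by 2 * k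
      * q, at least 10, more than the at most 9 gained from the squared step length. This needs 5 <=
      k * q, whence the choice of \<rho> as 10 * J + 10.\<close>
    define k where "k = 1 / (2 * real J)"
    have k: "0 < k" "2 * k * real J \<le> 1" using J(1) by (simp_all add: k_def)
    have q0: "0 < q" using q by linarith
    have e1: "norm e = 1" using q0 by (simp add: e_def q_def)
    have kq: "5 \<le> k * q" using q J(1) by (simp add: k_def field_simps)
    define Z where "Z = {z. dist x z < 3 \<and> \<bar>(z - x) \<bullet> e\<bar> < k}"
    have ye: "(y - x) \<bullet> u = q * ((y - x) \<bullet> e)" for y using q0 by (simp add: e_def)
    have nTy: "nT (y - c) = q\<^sup>2 + 2 * ((y - x) \<bullet> u) + nT (y - x)" for y
      using nT_add[of "y - x" "x - c"] tr_norm[of "x - c"] by (simp add: u_def q_def)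
    have in_A: "y \<in> A" if y: "y \<in> S" "(y - x) \<bullet> e \<le> - k" for y
    proof -
      have d: "dist x y \<le> 204/100" using y r unfolding S_def by auto
      have "nT (y - x) \<le> (norm (y - x))\<^sup>2" by (rule nT_le)
      also have "\<dots> \<le> 3\<^sup>2" using d by (intro power_mono) (simp_all add: dist_norm norm_minus_commute)
      finally have n: "nT (y - x) \<le> 9" by simp
      have "q * ((y - x) \<bullet> e) \<le> q * (- k)" using y(2) q0 by (intro mult_left_mono) auto
      then have "(y - x) \<bullet> u \<le> - 5" using kq unfolding ye by (simp add: mult.commute)
      then have "nT (y - c) \<le> q\<^sup>2" unfolding nTy using n by simp
      then show ?thesis unfolding A_iff using y(1) q2 by linarith
    qed
    have cover: "S \<subseteq> (A \<union> refl x -` A) \<union> Z"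
    proof
      fix y assume y: "y \<in> S"
      have d: "dist x y \<le> 204/100" using y r unfolding S_def by auto
      consider "(y - x) \<bullet> e \<le> - k" | "k \<le> (y - x) \<bullet> e" | "\<bar>(y - x) \<bullet> e\<bar> < k" by linarith
      then show "y \<in> (A \<union> refl x -` A) \<union> Z"
      proof cases
        case 1
        then show ?thesis using in_A[OF y] by simp
      next
        case 2
        have p: "(refl x y - c') \<bullet> b = (y - c') \<bullet> b" if "(refl x y - x) \<bullet> b = (y - x) \<bullet> b" for b
          using that by (simp add: inner_diff_left)
        have "refl x y \<in> S" using y unfolding S_def by (simp add: p refl_props)
        moreover have "(refl x y - x) \<bullet> u = - ((y - x) \<bullet> u)"
          unfolding u_def tr_sym refl_props(4) by simp
        then have "q * ((refl x y - x) \<bullet> e) = q * (- ((y - x) \<bullet> e))" unfolding ye by simp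
        then have "(refl x y - x) \<bullet> e = - ((y - x) \<bullet> e)" using q0 by (simp only: mult_left_cancel)
        ultimately have "refl x y \<in> A" using in_A[of "refl x y"] 2 by simp
        then show ?thesis by simp
      next
        case 3
        then show ?thesis using d by (simp add: Z_def)
      qed
    qed
    have oZ: "open Z" unfolding Z_def by (intro open_Collect_conj open_Collect_less continuous_intros)
    have rm: "refl x -` A \<in> sets borel" "emeasure lborel (refl x -` A) = emeasure lborel A"
      by (rule refl_measure[OF Ab])+
    have "emeasure lborel S \<le> emeasure lborel ((A \<union> refl x -` A) \<union> Z)"
      using Ab rm(1) oZ by (intro emeasure_mono[OF cover]) auto
    also have "\<dots> \<le> emeasure lborel (A \<union> refl x -` A) + emeasure lborel Z"
      using Ab rm(1) oZ by (intro emeasure_subadditive) auto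
    also have "emeasure lborel (A \<union> refl x -` A) \<le> emeasure lborel A + emeasure lborel (refl x -` A)"
      using Ab rm(1) by (intro emeasure_subadditive) auto
    also have "\<dots> = 2 * emeasure lborel A" unfolding rm(2) by (simp add: mult_2)
    also have "emeasure lborel Z \<le> ennreal t"
    proof -
      have "of_nat J * emeasure lborel Z \<le> emeasure lborel (ball (0::'a) 4)"
        unfolding Z_def by (rule thin_slab[OF e1 k])
      also have "\<dots> \<le> ennreal (real J * t)" unfolding t_def by (rule J(2))
      also have "\<dots> = of_nat J * ennreal t" using t0 by (simp add: ennreal_mult ennreal_of_nat_eq_real_of_nat)
      finally show ?thesis using J(1) by (subst (asm) ennreal_mult_le_mult_iff) auto
    qed
    finally show ?thesis using S by (simp add: add_mono order_trans)
  qed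
  also have "\<dots> = ennreal (2 * measure lborel A + t)"
    unfolding Ae using t0 measure_nonneg[of lborel A] by (simp add: ennreal_plus ennreal_mult del: content_nonneg)
  finally have "S_low \<le> 2 * measure lborel A + t"
    using t0 measure_nonneg[of lborel A] by (subst (asm) ennreal_le_iff) auto
  then show ?thesis unfolding A_def[symmetric] t_def by simp
qed

text \<open>The comparison of volumes. The intensity is fixed by the lower bound for half annuli;
  the mean number of points in a ball of radius 1.02 is then a numerical constant times t ^ mm / (mm
  + 2), small because \<open>mm\<close> is at least 43.\<close>

lemma cell_constants:
  obtains \<rho> lam :: real where "0 < \<rho>" "0 < lam" "lam * measure lborel (ball (0::'a) (51/50)) \<le> 11/100000"
    "\<And>c c' x r. (12128/10000)\<^sup>2 \<le> ((c' - c) \<bullet> b1)\<^sup>2 + ((c' - c) \<bullet> b2)\<^sup>2 \<Longrightarrow>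
      ((c' - c) \<bullet> b1)\<^sup>2 + ((c' - c) \<bullet> b2)\<^sup>2 \<le> (1214/1000)\<^sup>2 \<Longrightarrow> nT (c' - c) = 0 \<Longrightarrow> x \<in> cell \<rho> c \<Longrightarrow>
      49/50 \<le> r \<Longrightarrow> r \<le> 51/50 \<Longrightarrow>
      16 \<le> lam * measure lborel {y\<in>cell \<rho> c'. 49/50 \<le> dist x y - r \<and> dist x y - r \<le> 51/50}"
proof -
  define V where "V = measure lborel (ball (0::'a) 4)"
  have V: "emeasure lborel (ball (0::'a) 4) = ennreal V"
    unfolding V_def by (intro emeasure_eq_ennreal_measure) (simp add: emeasure_ball)
  obtain J0 :: nat where J0: "V / (S_low / 10) \<le> real J0" using real_arch_simple by blast
  define J where "J = Suc J0"
  have "V \<le> real J0 * (S_low / 10)" using J0 S_low_pos by (simp add: field_simps)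
  also have "\<dots> \<le> real J * (S_low / 10)" using S_low_pos unfolding J_def by (intro mult_right_mono) auto
  finally have J: "0 < J" "emeasure lborel (ball (0::'a) 4) \<le> ennreal (real J * (S_low / 10))"
    unfolding V by (simp_all add: J_def ennreal_leI)
  define \<rho> where "\<rho> = 10 * real J + 10"
  \<comment> \<open>A candidate region then holds at least 16 points on average, and 8 when only
    half of it is free, so it is void with probability at most exp (-8).\<close>
  define lam where "lam = 16 / (45/100 * S_low)"
  show thesis
  proof
    show "0 < \<rho>" by (simp add: \<rho>_def)
    show lam0: "0 < lam" using S_low_pos by (simp add: lam_def)
    show "lam * measure lborel (ball (0::'a) (51/50)) \<le> 11/100000"
    proof -
      define uv where "uv = unit_ball_vol (real mm)"
      have uv: "0 < uv" by (simp add: uv_def)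
      define W where "W = uv * sg ^ mm"
      have W: "0 < W" using uv sg_pos by (simp add: W_def)
      \<comment> \<open>The ratio of the ball radius to the least shell radius; t ^ 43 is about
        1.95e-8. Squaring avoids the square root in \<open>sg\<close>.\<close>
      define t where "t = (51/50) / sg"
      have "t\<^sup>2 = (51/50)\<^sup>2 / sg\<^sup>2" by (simp only: t_def power_divide)
      then have t1: "0 < t" "t\<^sup>2 = 10404/23769"
        unfolding sg_pos(2) using sg_pos by (simp_all add: t_def power2_eq_square)
      have t: "t \<le> 1" by (rule power2_le_imp_le) (simp_all add: t1)
      have tm: "t ^ mm \<le> 195 / 10 ^ 10"
      proof -
        have "t ^ mm \<le> t ^ 43" using t t1(1) mm43 by (intro power_decreasing) simp_all
        moreover have "(t ^ 43)\<^sup>2 \<le> (195 / 10 ^ 10)\<^sup>2"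
        proof -
          have "(t ^ 43)\<^sup>2 = (t\<^sup>2) ^ 43" by (simp only: power_mult[symmetric] mult.commute)
          also have "\<dots> \<le> (195 / 10 ^ 10)\<^sup>2" unfolding t1(2) by (simp add: power_divide)
          finally show ?thesis .
        qed
        ultimately show ?thesis using power2_le_imp_le[of "t ^ 43" "195 / 10 ^ 10"] by simp
      qed
      have "measure lborel (ball (0::'a) (51/50)) = unit_ball_vol (real (mm + 2)) * (51/50) ^ (mm + 2)"
        using content_ball[of "51/50" "0::'a"] by (simp add: mm_dim)
      also have "unit_ball_vol (real (mm + 2)) = uv * (2 * pi / real (mm + 2))"
        using unit_ball_vol_rec[of "mm + 2"] mm43 by (simp add: uv_def)
      also have "(51/50 :: real) ^ (mm + 2) = 10404/10000 * (t ^ mm * sg ^ mm)"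
        using sg_pos by (simp add: t_def power_divide power_add power2_eq_square)
      finally have m: "measure lborel (ball (0::'a) (51/50)) = uv * (2 * pi / real (mm + 2)) * (10404/10000 * (t ^ mm * sg ^ mm))" .
      have p: "2 * pi / real (mm + 2) \<le> 8 / 45"
        using pi_le_4 mm43 by (intro frac_le) auto
      have "uv * (2 * pi / real (mm + 2)) * (10404/10000 * (t ^ mm * sg ^ mm)) =
        (2 * pi / real (mm + 2)) * t ^ mm * (10404/10000 * W)" by (simp add: W_def mult_ac)
      also have "\<dots> \<le> (8 / 45) * (195 / 10 ^ 10) * (10404/10000 * W)"
        using p tm t1 W by (intro mult_mono) auto
      finally have "measure lborel (ball (0::'a) (51/50)) \<le> (8 / 45) * (195 / 10 ^ 10) * (10404/10000 * W)" unfolding m .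
      then have "lam * measure lborel (ball (0::'a) (51/50)) \<le> lam * ((8 / 45) * (195 / 10 ^ 10) * (10404/10000 * W))"
        using lam0 by (intro mult_left_mono) auto
      also have laml: "lam = 16 / (45/100 * ((42/1000) * (42/1000) * (7/10))) / W"
        by (simp add: lam_def S_low_def W_def uv_def hs_def)
      also have "16 / (45/100 * ((42/1000) * (42/1000) * (7/10))) / W * ((8 / 45) * (195 / 10 ^ 10) * (10404/10000 * W)) =
        16 / (45/100 * ((42/1000) * (42/1000) * (7/10))) * ((8 / 45) * (195 / 10 ^ 10) * (10404/10000))"
        using W by simp
      also have "\<dots> \<le> 11/100000" by simp
      finally show ?thesis unfolding laml .
    qed
    fix c c' x :: 'a and r :: real
    assume a: "(12128/10000)\<^sup>2 \<le> ((c' - c) \<bullet> b1)\<^sup>2 + ((c' - c) \<bullet> b2)\<^sup>2"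
      "((c' - c) \<bullet> b1)\<^sup>2 + ((c' - c) \<bullet> b2)\<^sup>2 \<le> (1214/1000)\<^sup>2" "nT (c' - c) = 0" "x \<in> cell \<rho> c"
      "49/50 \<le> r" "r \<le> 51/50"
    have "lam * (45/100 * S_low) \<le> lam * measure lborel {y\<in>cell \<rho> c'. 49/50 \<le> dist x y - r \<and> dist x y - r \<le> 51/50}"
      by (rule mult_left_mono[OF half_annulus[OF a J \<rho>_def]]) (use lam0 in simp)
    then show "16 \<le> lam * measure lborel {y\<in>cell \<rho> c'. 49/50 \<le> dist x y - r \<and> dist x y - r \<le> 51/50}"
      unfolding lam_def using S_low_pos by simp
  qed
qed

end

section \<open>Chains of touching spheres\<close>

lemma emeasure_section_measurable:
  assumes "{p\<in>space (Z \<Otimes>\<^sub>M lborel). P (fst p) (snd p)} \<in> sets (Z \<Otimes>\<^sub>M lborel)"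
    and "\<And>z. z \<in> space Z \<Longrightarrow> A z = {y. P z y}"
  shows "(\<lambda>z. emeasure lborel (A z)) \<in> borel_measurable Z"
proof -
  have "Pair z -` {p\<in>space (Z \<Otimes>\<^sub>M lborel). P (fst p) (snd p)} = A z" if "z \<in> space Z" for z
    using assms(2)[OF that] that by (auto simp: space_pair_measure)
  then have e: "emeasure lborel (A z) = emeasure lborel (Pair z -` {p\<in>space (Z \<Otimes>\<^sub>M lborel). P (fst p) (snd p)})"
    if "z \<in> space Z" for z using that by simp
  show ?thesis
    using measurable_cong[of Z "\<lambda>z. emeasure lborel (A z)" _ borel, OF e]
      lborel.measurable_emeasure_Pair[OF assms(1)] by blast
qed

text \<open>For a node \<open>l\<close>, \<open>U l\<close> and \<open>m l\<close> are the law and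
  mean number of points in its block and \<open>Q l\<close> is the cell in which the tree looks for
  a point. Radii stay in [\<open>lo\<close>, \<open>hi\<close>]; \<open>kap\<close> is the least
  mean number of candidates and \<open>mu\<close> bounds the mean number of points in a ball of
  radius \<open>hi\<close>. On subsets of \<open>Q l\<close> the block has the full intensity
  \<open>lam\<close>, elsewhere at most that.\<close>

locale tree_process =
  fixes U :: "'l::countable \<Rightarrow> 'a::euclidean_space measure" and m :: "'l \<Rightarrow> real"
    and nbn :: "'l \<Rightarrow> 'l set" and Q :: "'l \<Rightarrow> 'a set" and root :: 'l
    and lo hi lam kap mu :: real
  assumes U_prob: "prob_space (U l)" and U_sets: "sets (U l) = sets borel" and m0: "0 \<le> m l"
    and U_le: "A \<in> sets borel \<Longrightarrow> ennreal (m l) * emeasure (U l) A \<le> ennreal lam * emeasure lborel A"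
    and U_eq: "A \<in> sets borel \<Longrightarrow> A \<subseteq> Q l \<Longrightarrow> m l * measure (U l) A = lam * measure lborel A"
    and Q_borel: "Q l \<in> sets borel" and Q_bounded: "bounded (Q l)"
    and lam0: "0 \<le> lam" and hi0: "0 < hi" and root_r: "lo \<le> 1" "1 \<le> hi"
    and ball_mu: "lam * measure lborel (ball (0::'a) hi) \<le> mu"
    and kap0: "0 < kap"
    and cand_kap: "v \<in> nbn u \<Longrightarrow> x \<in> Q u \<Longrightarrow> lo \<le> r \<Longrightarrow> r \<le> hi \<Longrightarrow>
      kap \<le> lam * measure lborel {y\<in>Q v. lo \<le> dist x y - r \<and> dist x y - r \<le> hi}"
    and root_kap: "kap \<le> lam * measure lborel (Q root)"
    and nbn_fin: "finite (nbn v)" "card (nbn v) \<le> 3"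
begin

abbreviation B :: "'l \<Rightarrow> 'a sample measure" where "B l \<equiv> blk (m l) (U l)"

definition cd :: "'l \<Rightarrow> 'a \<Rightarrow> real \<Rightarrow> 'a set" where
  "cd v x r = {y\<in>Q v. lo \<le> dist x y - r \<and> dist x y - r \<le> hi}"

text \<open>A point of \<open>cd\<close> can carry a sphere of admissible radius touching that of
  \<open>x\<close>. Removed are the points whose sphere could reach another point of the block just
  seen; index \<open>j\<close> is the centre \<open>x\<close> itself.\<close>

definition cand :: "'l \<Rightarrow> 'a \<Rightarrow> real \<Rightarrow> 'a sample \<Rightarrow> nat \<Rightarrow> 'a set" where
  "cand v x r s j = {y\<in>cd v x r. \<forall>i<fst s. i \<noteq> j \<longrightarrow> hi \<le> dist y (snd s i)}"

definition sel :: "'a set \<Rightarrow> 'a sample \<Rightarrow> nat" where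
  "sel C s = (LEAST i. snd s i \<in> C)"

text \<open>The last condition leaves half of every next candidate region free, so that the next step can be
analysed without knowing which points of the present block were seen.\<close>

definition suc :: "'l \<Rightarrow> 'a \<Rightarrow> 'a set \<Rightarrow> ('a \<Rightarrow> real) \<Rightarrow> 'a sample \<Rightarrow> bool" where
  "suc v x C f s \<longleftrightarrow> (\<exists>i<fst s. snd s i \<in> C) \<and>
     (\<forall>i<fst s. i \<noteq> sel C s \<longrightarrow> hi \<le> dist (snd s (sel C s)) (snd s i)) \<and>
     (\<forall>i<fst s. hi \<le> dist x (snd s i)) \<and>
     (\<forall>w\<in>nbn v. kap / 2 \<le> lam * measure lborel (cand w (snd s (sel C s)) (f (snd s (sel C s))) s (sel C s)))"

lemma pblock: "pblock (U l) (m l)"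
  by (intro pblock.intro pblock_axioms.intro U_prob m0)

lemma B_prob: "prob_space (B l)"
  by (rule pblock.prob_space_blk[OF pblock])

lemma pt_measurable: "(\<lambda>s. snd s i) \<in> B l \<rightarrow>\<^sub>M borel"
  using pblock.measurable_blk_pt[OF pblock[of l], of i] measurable_cong_sets[OF refl U_sets] by blast

lemma N_measurable: "fst \<in> B l \<rightarrow>\<^sub>M count_space UNIV"
  by (rule pblock.measurable_blk_fst[OF pblock])

text \<open>Stated for a candidate region and radius depending on a parameter, since both are random
  when the step occurs along a path.\<close>

lemma suc_measurable:
  assumes s: "s \<in> Z \<rightarrow>\<^sub>M B l" and x[measurable]: "x \<in> borel_measurable Z"
    and C: "Measurable.pred (Z \<Otimes>\<^sub>M borel) (\<lambda>(z, y). y \<in> C z)"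
    and f: "(\<lambda>(z, y). f z y) \<in> borel_measurable (Z \<Otimes>\<^sub>M borel)"
  shows "(\<lambda>z. sel (C z) (s z)) \<in> Z \<rightarrow>\<^sub>M count_space UNIV" (is ?A)
    and "(\<lambda>z. snd (s z) (sel (C z) (s z))) \<in> borel_measurable Z" (is ?B)
    and "(\<lambda>z. f z (snd (s z) (sel (C z) (s z)))) \<in> borel_measurable Z" (is ?C)
    and "Measurable.pred Z (\<lambda>z. suc v (x z) (C z) (f z) (s z))" (is ?D)
    and "(\<lambda>z. measure lborel (cand w (snd (s z) (sel (C z) (s z))) (f z (snd (s z) (sel (C z) (s z)))) (s z) (sel (C z) (s z)))) \<in> borel_measurable Z"
proof -
  have pt[measurable]: "(\<lambda>z. snd (s z) i) \<in> borel_measurable Z" for i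
    by (rule measurable_compose[OF s pt_measurable])
  have N[measurable]: "(\<lambda>z. fst (s z)) \<in> Z \<rightarrow>\<^sub>M count_space UNIV"
    by (rule measurable_compose[OF s N_measurable])
  have inC[measurable]: "Measurable.pred Z (\<lambda>z. snd (s z) i \<in> C z)" for i
    using measurable_compose[OF measurable_Pair[OF measurable_ident pt[of i]] C] by (simp add: comp_def)
  show J[measurable]: ?A unfolding sel_def by (rule measurable_Least) (rule inC)
  show ptJ[measurable]: ?B
    by (rule measurable_compose_countable[OF pt J])
  show fJ[measurable]: ?C
    using measurable_compose[OF measurable_Pair[OF measurable_ident ptJ] f] by (simp add: comp_def)
  note Q_borel[measurable]
  show m: "(\<lambda>z. measure lborel (cand w (snd (s z) (sel (C z) (s z))) (f z (snd (s z) (sel (C z) (s z)))) (s z) (sel (C z) (s z)))) \<in> borel_measurable Z" for w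
  proof -
    have [measurable]: "(\<lambda>z. emeasure lborel (cand w (snd (s z) (sel (C z) (s z))) (f z (snd (s z) (sel (C z) (s z)))) (s z) (sel (C z) (s z)))) \<in> borel_measurable Z"
    proof (rule emeasure_section_measurable)
      show "{p\<in>space (Z \<Otimes>\<^sub>M lborel). snd p \<in> Q w \<and>
       lo \<le> dist (snd (s (fst p)) (sel (C (fst p)) (s (fst p)))) (snd p) - f (fst p) (snd (s (fst p)) (sel (C (fst p)) (s (fst p)))) \<and>
       dist (snd (s (fst p)) (sel (C (fst p)) (s (fst p)))) (snd p) - f (fst p) (snd (s (fst p)) (sel (C (fst p)) (s (fst p)))) \<le> hi \<and>
       (\<forall>i. i < fst (s (fst p)) \<longrightarrow> i \<noteq> sel (C (fst p)) (s (fst p)) \<longrightarrow> hi \<le> dist (snd p) (snd (s (fst p)) i))} \<in> sets (Z \<Otimes>\<^sub>M lborel)"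
        by measurable
    qed (auto simp: cand_def cd_def)
    show ?thesis unfolding measure_def by measurable
  qed
  note m[measurable]
  have "Measurable.pred Z (\<lambda>z. \<forall>w\<in>nbn v. kap / 2 \<le> lam * measure lborel (cand w (snd (s z) (sel (C z) (s z))) (f z (snd (s z) (sel (C z) (s z)))) (s z) (sel (C z) (s z))))"
    by (intro pred_intros_finite nbn_fin) measurable
  note this[measurable]
  show ?D unfolding suc_def by measurable
qed

lemma blk_void:
  assumes C: "C \<in> sets borel"
  shows "measure (B l) {s\<in>space (B l). \<not> (\<exists>i<fst s. snd s i \<in> C)} = exp (- (m l * measure (U l) C))"
proof -
  interpret pblock "U l" "m l" by (rule pblock)
  have d: "disjoint_family_on (\<lambda>_::nat. C) {..<1}" by (simp add: disjoint_family_on_def)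
  have "{s\<in>space (B l). \<not> (\<exists>i<fst s. snd s i \<in> C)} = {s\<in>space (B l). \<forall>j<1. cnt (\<lambda>_::nat. C) (fst s) j (snd s) = (\<lambda>_. 0) j}"
    by (auto simp: cnt_def)
  then have "measure (B l) {s\<in>space (B l). \<not> (\<exists>i<fst s. snd s i \<in> C)} = (\<Prod>j<1::nat. pmf (pois (m l * measure (U l) C)) 0)"
    using counts_blk[OF _ d, of "\<lambda>_. 0"] C U_sets by simp
  also have "\<dots> = exp (- (m l * measure (U l) C))" using m0 by (simp add: pmf_pois)
  finally show ?thesis .
qed

lemma emeasure_ball_le: "ennreal lam * emeasure lborel (ball (x::'a) hi) \<le> ennreal mu"
proof -
  have "emeasure lborel (ball x hi) = ennreal (measure lborel (ball (0::'a) hi))"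
    using hi0 by (simp add: emeasure_ball content_ball)
  then show ?thesis using ball_mu lam0 by (simp add: ennreal_mult[symmetric] ennreal_leI)
qed

lemma mu0: "0 \<le> mu"
  using ball_mu lam0 by (meson measure_nonneg mult_nonneg_nonneg order_trans)

lemma cd_borel [measurable]: "cd v x r \<in> sets borel"
proof -
  have "cd v x r = Q v \<inter> {y. lo \<le> dist x y - r} \<inter> {y. dist x y - r \<le> hi}" by (auto simp: cd_def)
  then show ?thesis using Q_borel by simp
qed

lemma cand_borel: "cand v x r s j \<in> sets borel"
proof -
  have "cand v x r s j = cd v x r \<inter> (\<Inter>i\<in>{..<fst s} - {j}. {y. hi \<le> dist y (snd s i)}) \<or> {..<fst s} - {j} = {} \<and> cand v x r s j = cd v x r"
    by (auto simp: cand_def)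
  then show ?thesis by (cases "{..<fst s} - {j} = {}") (auto intro!: sets.Int sets.finite_INT)
qed

lemma cd_finite: "emeasure lborel (cd v x r) < \<infinity>" "emeasure lborel (cd v x r \<inter> A) < \<infinity>" "emeasure lborel (cand v x r s j) < \<infinity>"
proof -
  have b: "bounded (cd v x r)" using Q_bounded by (rule bounded_subset) (auto simp: cd_def)
  show "emeasure lborel (cd v x r) < \<infinity>" using b by (rule emeasure_bounded_finite)
  show "emeasure lborel (cd v x r \<inter> A) < \<infinity>" using b by (intro emeasure_bounded_finite) auto
  show "emeasure lborel (cand v x r s j) < \<infinity>"
    by (intro emeasure_bounded_finite bounded_subset[OF b]) (auto simp: cand_def)
qed

text \<open>The next step is spoilt only if balls around the other points cover half of the next candidate region;
by Markov's inequality this has probability at most twice the expected covered proportion.\<close>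

lemma spoilt_pairs:
  assumes C: "C \<in> sets borel" "C \<subseteq> Q v" and f: "f \<in> borel_measurable borel" "\<And>y. y \<in> C \<Longrightarrow> lo \<le> f y \<and> f y \<le> hi"
    and w: "w \<in> nbn v" and m: "0 < m v"
  shows "emeasure (B v) {s\<in>space (B v). snd s (sel C s) \<in> C \<and>
     \<not> kap / 2 \<le> lam * measure lborel (cand w (snd s (sel C s)) (f (snd s (sel C s))) s (sel C s))} \<le> ennreal (2 * mu)"
    (is "emeasure _ ?F \<le> _")
proof -
  interpret pblock "U v" "m v" by (rule pblock)
  note f(1)[measurable] C(1)[measurable] Q_borel[measurable]
  have sU[measurable_cong]: "sets (U v) = sets borel" by (rule U_sets)
  define D where "D x = cd w x (f x)" for x
  have Dk: "kap \<le> lam * measure lborel (D x)" if "x \<in> C" for x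
    unfolding D_def cd_def using cand_kap[OF w, of x "f x"] C(2) f(2)[OF that] that by auto
  \<comment> \<open>Twice the proportion of the next region covered by the ball around
    \<open>y\<close>: summed over the other points of the block it is at least 1 whenever less than
    \<open>kap / 2\<close> is left free.\<close>
  define g where "g x y = 2 * emeasure lborel (D x \<inter> ball y hi) / emeasure lborel (D x)" for x y
  have Dm: "(\<lambda>x. emeasure lborel (D x)) \<in> borel_measurable borel"
  proof (rule emeasure_section_measurable)
    show "{p\<in>space (borel \<Otimes>\<^sub>M lborel). snd p \<in> Q w \<and> lo \<le> dist (fst p) (snd p) - f (fst p) \<and>
        dist (fst p) (snd p) - f (fst p) \<le> hi} \<in> sets (borel \<Otimes>\<^sub>M lborel)" by measurable
  qed (auto simp: D_def cd_def)
  have gm: "(\<lambda>(x, y). g x y) \<in> borel_measurable (borel \<Otimes>\<^sub>M borel)"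
  proof -
    have [measurable]: "(\<lambda>z. emeasure lborel (D (fst z) \<inter> ball (snd z) hi)) \<in> borel_measurable (borel \<Otimes>\<^sub>M borel)"
    proof (rule emeasure_section_measurable)
      show "{p\<in>space ((borel \<Otimes>\<^sub>M borel) \<Otimes>\<^sub>M lborel). snd p \<in> Q w \<and> lo \<le> dist (fst (fst p)) (snd p) - f (fst (fst p)) \<and>
        dist (fst (fst p)) (snd p) - f (fst (fst p)) \<le> hi \<and> dist (snd (fst p)) (snd p) < hi} \<in> sets ((borel \<Otimes>\<^sub>M borel) \<Otimes>\<^sub>M lborel)" by measurable
    qed (auto simp: D_def cd_def)
    note Dm[measurable]
    show ?thesis unfolding g_def split_beta' by measurable
  qed
  have int: "(\<integral>\<^sup>+y. g x y \<partial>U v) \<le> ennreal (2 * mu / m v)" if x: "x \<in> C" for x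
  proof -
    have Db: "D x \<in> sets borel" unfolding D_def by (rule cd_borel)
    have pos: "0 < emeasure lborel (D x)" "emeasure lborel (D x) < \<infinity>"
    proof -
      have "measure lborel (D x) \<noteq> 0" using Dk[OF x] kap0 by auto
      then show "0 < emeasure lborel (D x)" by (auto simp: measure_def zero_less_iff_neq_zero)
      show "emeasure lborel (D x) < \<infinity>" unfolding D_def by (rule cd_finite)
    qed
    \<comment> \<open>By Fubini the mean covered volume is the volume of \<open>D x\<close> times at
      most the mean number of points in one ball of radius \<open>hi\<close>.\<close>
    have "ennreal (m v) * (\<integral>\<^sup>+y. emeasure lborel (D x \<inter> ball y hi) \<partial>U v) =
      ennreal (m v) * (\<integral>\<^sup>+y. (\<integral>\<^sup>+z. indicator (D x) z * indicator (ball z hi) y \<partial>lborel) \<partial>U v)"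
    proof (intro arg_cong[where f="(*) _"] nn_integral_cong)
      fix y
      have "emeasure lborel (D x \<inter> ball y hi) = (\<integral>\<^sup>+z. indicator (D x \<inter> ball y hi) z \<partial>lborel)" using Db by simp
      also have "\<dots> = (\<integral>\<^sup>+z. indicator (D x) z * indicator (ball z hi) y \<partial>lborel)"
        by (intro nn_integral_cong) (auto simp: indicator_def dist_commute)
      finally show "emeasure lborel (D x \<inter> ball y hi) = (\<integral>\<^sup>+z. indicator (D x) z * indicator (ball z hi) y \<partial>lborel)" .
    qed
    also have "\<dots> = ennreal (m v) * (\<integral>\<^sup>+z. (\<integral>\<^sup>+y. indicator (D x) z * indicator (ball z hi) y \<partial>U v) \<partial>lborel)"
    proof -
      interpret pair_sigma_finite "U v" lborel ..
      have [measurable]: "D x \<in> sets borel" by (rule Db)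
      have [measurable]: "Measurable.pred (U v \<Otimes>\<^sub>M lborel) (\<lambda>p. fst p \<in> ball (snd p) hi)"
        unfolding mem_ball by measurable
      have "(\<lambda>(y, z). indicator (D x) z * indicator (ball z hi) y :: ennreal) \<in> borel_measurable (U v \<Otimes>\<^sub>M lborel)"
        unfolding split_beta' by measurable
      from Fubini'[OF this] show ?thesis by simp
    qed
    also have "\<dots> = (\<integral>\<^sup>+z. indicator (D x) z * (ennreal (m v) * emeasure (U v) (ball z hi)) \<partial>lborel)"
    proof -
      have e: "(\<integral>\<^sup>+y. indicator (D x) z * indicator (ball z hi) y \<partial>U v) = indicator (D x) z * emeasure (U v) (ball z hi)" for z
      proof -
        have [measurable]: "ball z hi \<in> sets (U v)" by (simp add: U_sets)
        show ?thesis by (simp add: nn_integral_cmult)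
      qed
      have "(\<lambda>z. emeasure (U v) (ball z hi)) \<in> borel_measurable borel"
      proof -
        have [measurable]: "Measurable.pred (borel \<Otimes>\<^sub>M U v) (\<lambda>p. snd p \<in> ball (fst p) hi)"
          unfolding mem_ball by measurable
        have "{p\<in>space (borel \<Otimes>\<^sub>M U v). snd p \<in> ball (fst p) hi} \<in> sets (borel \<Otimes>\<^sub>M U v)" by measurable
        from U.measurable_emeasure_Pair[OF this] show ?thesis
        proof (rule measurable_cong[THEN iffD1, rotated])
          fix z :: 'a
          have "Pair z -` {p\<in>space (borel \<Otimes>\<^sub>M U v). snd p \<in> ball (fst p) hi} = ball z hi"
            by (auto simp: space_pair_measure sets_eq_imp_space_eq[OF U_sets])
          then show "emeasure (U v) (Pair z -` {p\<in>space (borel \<Otimes>\<^sub>M U v). snd p \<in> ball (fst p) hi}) = emeasure (U v) (ball z hi)" by simp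
        qed
      qed
      then have [measurable]: "(\<lambda>z. emeasure (U v) (ball z hi)) \<in> borel_measurable lborel" by simp
      have [measurable]: "D x \<in> sets lborel" using Db by simp
      show ?thesis unfolding e by (subst nn_integral_cmult[symmetric]) (auto intro!: nn_integral_cong simp: mult_ac)
    qed
    also have "\<dots> \<le> (\<integral>\<^sup>+z. indicator (D x) z * ennreal mu \<partial>lborel)"
    proof (intro nn_integral_mono mult_left_mono)
      fix z
      have "ennreal (m v) * emeasure (U v) (ball z hi) \<le> ennreal lam * emeasure lborel (ball z hi)" by (rule U_le) simp
      also have "\<dots> \<le> ennreal mu" by (rule emeasure_ball_le)
      finally show "ennreal (m v) * emeasure (U v) (ball z hi) \<le> ennreal mu" .
    qed simp
    also have "\<dots> = emeasure lborel (D x) * ennreal mu" using Db by (simp add: nn_integral_multc)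
    finally have le: "ennreal (m v) * (\<integral>\<^sup>+y. emeasure lborel (D x \<inter> ball y hi) \<partial>U v) \<le> emeasure lborel (D x) * ennreal mu" .
    define I where "I = (\<integral>\<^sup>+y. emeasure lborel (D x \<inter> ball y hi) \<partial>U v)"
    define d where "d = measure lborel (D x)"
    have d1: "emeasure lborel (D x) = ennreal d"
      unfolding d_def using pos(2) by (intro emeasure_eq_ennreal_measure) simp
    have "kap \<le> lam * d" using Dk[OF x] unfolding d_def .
    then have "d \<noteq> 0" using kap0 by auto
    moreover have "0 \<le> d" unfolding d_def by (rule measure_nonneg)
    ultimately have d2: "0 < d" by simp
    note d = d1 d2
    have Ifin: "I < \<infinity>"
    proof -
      have "ennreal (m v) * I < \<infinity>" using le unfolding I_def[symmetric] d(1) by (rule le_less_trans) (simp add: ennreal_mult_less_top)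
      then show ?thesis using m by (auto simp: ennreal_mult_less_top)
    qed
    have Im: "(\<lambda>y. emeasure lborel (D x \<inter> ball y hi)) \<in> borel_measurable (U v)"
    proof (rule emeasure_section_measurable)
      have [measurable]: "D x \<in> sets borel" by (rule Db)
      show "{p\<in>space (U v \<Otimes>\<^sub>M lborel). snd p \<in> D x \<and> dist (fst p) (snd p) < hi} \<in> sets (U v \<Otimes>\<^sub>M lborel)" by measurable
    qed auto
    have "(\<integral>\<^sup>+y. g x y \<partial>U v) = 2 * I / ennreal d"
      unfolding g_def I_def d(1) using Im by (simp add: nn_integral_divide nn_integral_cmult)
    also have "\<dots> \<le> ennreal (2 * mu / m v)"
    proof -
      obtain i where i: "I = ennreal i" "0 \<le> i" using Ifin by (cases I) auto
      have "m v * i \<le> d * mu" using le m d mu0 i unfolding I_def[symmetric] d(1)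
        by (simp add: ennreal_mult[symmetric])
      then have "2 * i / d \<le> 2 * mu / m v" using m d(2) by (simp add: field_simps)
      moreover have "2 * I / ennreal d = ennreal (2 * i / d)"
        using i d(2) by (simp add: divide_ennreal[symmetric] ennreal_mult)
      ultimately show ?thesis by (simp add: ennreal_leI)
    qed
    finally show ?thesis .
  qed
  define H where "H s = (\<Sum>i<fst s. if i \<noteq> (LEAST j. snd s j \<in> C) \<and> snd s (LEAST j. snd s j \<in> C) \<in> C
      then g (snd s (LEAST j. snd s j \<in> C)) (snd s i) else 0)" for s :: "'a sample"
  have Hle: "(\<integral>\<^sup>+s. H s \<partial>B v) \<le> ennreal (m v) * ennreal (2 * mu / m v)"
    unfolding H_def by (rule selected_pairs_le) (use gm int C(1) in \<open>auto simp: U_sets cong: measurable_cong_sets\<close>)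
  also have "\<dots> = ennreal (2 * mu)" using m mu0 by (simp add: ennreal_mult[symmetric])
  finally have Hle: "(\<integral>\<^sup>+s. H s \<partial>B v) \<le> ennreal (2 * mu)" .
  have sub: "1 \<le> H s" if s: "snd s (sel C s) \<in> C" "\<not> kap / 2 \<le> lam * measure lborel (cand w (snd s (sel C s)) (f (snd s (sel C s))) s (sel C s))" for s
  proof -
    define j where "j = sel C s"
    define x where "x = snd s j"
    define d where "d = measure lborel (D x)"
    have xC: "x \<in> C" using s(1) by (simp add: x_def j_def)
    have Df: "emeasure lborel (D x) = ennreal d" unfolding d_def D_def
      using cd_finite(1)[of w x "f x"] by (simp add: emeasure_eq_ennreal_measure)
    have d3: "kap \<le> lam * d" using Dk[OF xC] unfolding d_def .
    then have "d \<noteq> 0" using kap0 by auto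
    moreover have "0 \<le> d" unfolding d_def by (rule measure_nonneg)
    ultimately have "0 < d" by simp
    note dpos = this d3
    define I where "I = {..<fst s} - {j}"
    define K where "K = cand w x (f x) s j"
    have cover: "D x \<subseteq> K \<union> (\<Union>i\<in>I. D x \<inter> ball (snd s i) hi)"
      unfolding K_def D_def I_def cand_def by (auto simp: dist_commute not_le)
    have Kb: "K \<in> sets lborel" "emeasure lborel K = ennreal (measure lborel K)"
      unfolding K_def using cand_borel cd_finite(3)[of w x "f x" s j] by (auto simp: emeasure_eq_ennreal_measure)
    have Db: "D x \<in> sets lborel" unfolding D_def using cd_borel by simp
    have "emeasure lborel (D x) \<le> emeasure lborel (K \<union> (\<Union>i\<in>I. D x \<inter> ball (snd s i) hi))"
      by (rule emeasure_mono[OF cover]) (use Kb Db in \<open>auto simp: I_def\<close>)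
    also have "\<dots> \<le> emeasure lborel K + emeasure lborel (\<Union>i\<in>I. D x \<inter> ball (snd s i) hi)"
      by (rule emeasure_subadditive) (use Kb Db in \<open>auto simp: I_def\<close>)
    also have "emeasure lborel (\<Union>i\<in>I. D x \<inter> ball (snd s i) hi) \<le> (\<Sum>i\<in>I. emeasure lborel (D x \<inter> ball (snd s i) hi))"
      by (rule emeasure_subadditive_finite) (use Db in \<open>auto simp: I_def\<close>)
    finally have 1: "ennreal d \<le> ennreal (measure lborel K) + (\<Sum>i\<in>I. emeasure lborel (D x \<inter> ball (snd s i) hi))"
      using Kb Df by (simp add: add_left_mono)
    define e where "e i = measure lborel (D x \<inter> ball (snd s i) hi)" for i
    have e: "emeasure lborel (D x \<inter> ball (snd s i) hi) = ennreal (e i)" "0 \<le> e i" for i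
      unfolding e_def D_def using cd_finite(2)[of w x "f x" "ball (snd s i) hi"]
      by (intro emeasure_eq_ennreal_measure; simp) (rule measure_nonneg)
    have 2: "d \<le> measure lborel K + (\<Sum>i\<in>I. e i)"
      using 1 unfolding e(1) by (simp add: sum_ennreal e(2) ennreal_plus[symmetric] sum_nonneg del: ennreal_plus)
    have "lam * measure lborel K < kap / 2" using s(2) by (simp add: K_def x_def j_def not_le)
    then have "lam * measure lborel K < lam * (d / 2)" using dpos by simp
    then have "measure lborel K < d / 2" by (rule mult_left_less_imp_less[OF _ lam0])
    then have "d \<le> 2 * (\<Sum>i\<in>I. e i)" using 2 by simp
    then have "1 \<le> 2 * (\<Sum>i\<in>I. e i) / d" using dpos(1) by simp
    also have "\<dots> = (\<Sum>i\<in>I. 2 * e i / d)" by (simp add: sum_distrib_left sum_divide_distrib)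
    finally have 3: "1 \<le> (\<Sum>i\<in>I. 2 * e i / d)" .
    have "H s = (\<Sum>i\<in>I. g x (snd s i))"
      unfolding H_def sel_def[symmetric] j_def[symmetric] x_def[symmetric] I_def
      using xC by (subst sum.inter_filter[symmetric]) (auto intro!: sum.cong simp: x_def)
    also have "\<dots> = (\<Sum>i\<in>I. ennreal (2 * e i / d))"
      unfolding g_def e(1) Df using dpos e(2) by (intro sum.cong) (auto simp: divide_ennreal[symmetric] ennreal_mult)
    also have "\<dots> = ennreal (\<Sum>i\<in>I. 2 * e i / d)" using dpos e(2) by (intro sum_ennreal) auto
    finally show ?thesis using 3 by (simp add: ennreal_leI)
  qed
  have Hm: "H \<in> borel_measurable (B v)"
    unfolding H_def by (intro sum_points_measurable selected_pair_measurable) (use gm in measurable)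
  have "emeasure (B v) ?F \<le> emeasure (B v) {s\<in>space (B v). 1 \<le> 1 * H s}"
    by (rule emeasure_mono) (use sub Hm in auto)
  also have "\<dots> \<le> 1 * (\<integral>\<^sup>+s. H s * indicator (space (B v)) s \<partial>B v)"
    by (rule nn_integral_Markov_inequality) (use Hm in auto)
  also have "\<dots> = (\<integral>\<^sup>+s. H s \<partial>B v)" by (simp cong: nn_integral_cong)
  also note Hle
  finally show ?thesis .
qed

text \<open>The failure bound of one step: a void half region, \<open>mu\<close> for a point near
  the previous centre, \<open>mu\<close> for a second point near the chosen one, and 2 * mu for each
  of at most three next regions.\<close>

definition epsn :: real where "epsn = exp (- (kap / 2)) + 8 * mu"

lemma suc_fail:
  assumes C: "C \<in> sets borel" "C \<subseteq> Q v" and f: "f \<in> borel_measurable borel" "\<And>y. y \<in> C \<Longrightarrow> lo \<le> f y \<and> f y \<le> hi"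
    and kC: "kap / 2 \<le> lam * measure lborel C"
  shows "emeasure (B v) {s\<in>space (B v). \<not> suc v x C f s} \<le> ennreal epsn"
proof -
  interpret pblock "U v" "m v" by (rule pblock)
  interpret Bv: prob_space "B v" by (rule B_prob)
  have sU[measurable_cong]: "sets (U v) = sets borel" by (rule U_sets)
  have mU: "m v * measure (U v) C = lam * measure lborel C" by (rule U_eq[OF C])
  have mv: "0 < m v"
  proof (rule ccontr)
    assume "\<not> 0 < m v"
    then have "m v = 0" using m0 by simp
    then have "lam * measure lborel C = 0" unfolding mU[symmetric] by simp
    then show False using kC kap0 by linarith
  qed
  have Cp: "Measurable.pred (B v \<Otimes>\<^sub>M borel) (\<lambda>(z, y). y \<in> C)" using C(1) by measurable
  have fp: "(\<lambda>(z, y). f y) \<in> borel_measurable (B v \<Otimes>\<^sub>M borel)" using f(1) by measurable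
  note M = suc_measurable[of "\<lambda>s. s" "B v" v "\<lambda>_. x" "\<lambda>_. C" "\<lambda>_. f", OF measurable_ident[unfolded id_def] measurable_const Cp fp]
  have selm[measurable]: "sel C \<in> B v \<rightarrow>\<^sub>M count_space UNIV" using M(1) by simp
  note M(2)[measurable] pt_measurable[of _ v, measurable] N_measurable[of v, measurable] C(1)[measurable] f(1)[measurable]
  define F1 where "F1 = {s\<in>space (B v). \<not> (\<exists>i<fst s. snd s i \<in> C)}"
  define F2 where "F2 = {s\<in>space (B v). \<exists>i<fst s. dist x (snd s i) < hi}"
  define F3 where "F3 = {s\<in>space (B v). snd s (sel C s) \<in> C \<and> (\<exists>i<fst s. i \<noteq> sel C s \<and> dist (snd s (sel C s)) (snd s i) < hi)}"
  define F4 where "F4 w = {s\<in>space (B v). snd s (sel C s) \<in> C \<and>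
     \<not> kap / 2 \<le> lam * measure lborel (cand w (snd s (sel C s)) (f (snd s (sel C s))) s (sel C s))}" for w
  have [measurable]: "F1 \<in> sets (B v)" "F2 \<in> sets (B v)" "F3 \<in> sets (B v)"
    unfolding F1_def F2_def F3_def by measurable
  have F4m: "F4 w \<in> sets (B v)" for w
    unfolding F4_def using M(5)[of w] by measurable
  have F1: "emeasure (B v) F1 \<le> ennreal (exp (- (kap / 2)))"
    unfolding F1_def Bv.emeasure_eq_measure blk_void[OF C(1)] mU using kC by (intro ennreal_leI) simp
  have ballU: "ennreal (m v) * emeasure (U v) (ball z hi) \<le> ennreal mu" for z
  proof -
    have "ennreal (m v) * emeasure (U v) (ball z hi) \<le> ennreal lam * emeasure lborel (ball z hi)" by (rule U_le) simp
    also have "\<dots> \<le> ennreal mu" by (rule emeasure_ball_le)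
    finally show ?thesis .
  qed
  have F2: "emeasure (B v) F2 \<le> ennreal mu"
    unfolding F2_def
  proof (rule some_point_le)
    show "Measurable.pred (U v) (\<lambda>y. dist x y < hi)" by measurable
    have "{y\<in>space (U v). dist x y < hi} = ball x hi" using sets_eq_imp_space_eq[OF U_sets, of v] by auto
    then show "ennreal (m v) * emeasure (U v) {y\<in>space (U v). dist x y < hi} \<le> ennreal mu" using ballU[of x] by simp
  qed
  have F3: "emeasure (B v) F3 \<le> ennreal mu"
  proof -
    define g where "g z y = (indicator (ball z hi) y :: ennreal)" for z y :: 'a
    have gm: "(\<lambda>(z, y). g z y) \<in> borel_measurable (U v \<Otimes>\<^sub>M U v)"
    proof -
      have [measurable]: "Measurable.pred (U v \<Otimes>\<^sub>M U v) (\<lambda>p. dist (fst p) (snd p) < hi)" by measurable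
      have "(\<lambda>p. if dist (fst p) (snd p) < hi then 1 else 0 :: ennreal) \<in> borel_measurable (U v \<Otimes>\<^sub>M U v)" by measurable
      moreover have "(\<lambda>(z, y). g z y) = (\<lambda>p. if dist (fst p) (snd p) < hi then 1 else 0)"
        by (auto simp: g_def indicator_def fun_eq_iff)
      ultimately show ?thesis by simp
    qed
    have CU: "C \<in> sets (U v)" using C(1) by (simp add: U_sets)
    define H where "H s = (\<Sum>i<fst s. if i \<noteq> (LEAST j. snd s j \<in> C) \<and> snd s (LEAST j. snd s j \<in> C) \<in> C
      then g (snd s (LEAST j. snd s j \<in> C)) (snd s i) else 0)" for s :: "'a sample"
    have Hm: "H \<in> borel_measurable (B v)"
      unfolding H_def by (intro sum_points_measurable selected_pair_measurable gm CU)
    have "(\<integral>\<^sup>+y. g z y \<partial>U v) \<le> ennreal (mu / m v)" for z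
    proof -
      have "(\<integral>\<^sup>+y. g z y \<partial>U v) = ennreal (measure (U v) (ball z hi))"
        unfolding g_def by (simp add: U_sets U.emeasure_eq_measure)
      moreover have "m v * measure (U v) (ball z hi) \<le> mu"
        using ballU[of z] mv mu0 by (simp add: U.emeasure_eq_measure ennreal_mult[symmetric])
      ultimately show ?thesis using mv by (simp add: field_simps ennreal_leI)
    qed
    then have "(\<integral>\<^sup>+s. H s \<partial>B v) \<le> ennreal (m v) * ennreal (mu / m v)"
      unfolding H_def by (intro selected_pairs_le gm CU)
    also have "\<dots> = ennreal mu" using mv mu0 by (simp add: ennreal_mult[symmetric])
    finally have Hle: "(\<integral>\<^sup>+s. H s \<partial>B v) \<le> ennreal mu" .
    have sub: "1 \<le> H s" if sF: "s \<in> F3" for s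
    proof -
      obtain i where i: "snd s (sel C s) \<in> C" "i < fst s" "i \<noteq> sel C s" "dist (snd s (sel C s)) (snd s i) < hi"
        using sF unfolding F3_def by blast
      have "1 = (if i \<noteq> sel C s \<and> snd s (sel C s) \<in> C then g (snd s (sel C s)) (snd s i) else 0)"
        using i by (simp add: g_def)
      also have "\<dots> \<le> (\<Sum>i<fst s. if i \<noteq> sel C s \<and> snd s (sel C s) \<in> C then g (snd s (sel C s)) (snd s i) else 0)"
        using i by (intro member_le_sum) auto
      finally show ?thesis unfolding H_def sel_def[symmetric] .
    qed
    have "emeasure (B v) F3 \<le> emeasure (B v) {s\<in>space (B v). 1 \<le> 1 * H s}"
      by (rule emeasure_mono) (use sub Hm in \<open>auto simp: F3_def\<close>)
    also have "\<dots> \<le> 1 * (\<integral>\<^sup>+s. H s * indicator (space (B v)) s \<partial>B v)"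
      by (rule nn_integral_Markov_inequality) (use Hm in auto)
    also have "\<dots> = (\<integral>\<^sup>+s. H s \<partial>B v)" by (simp cong: nn_integral_cong)
    also note Hle
    finally show ?thesis .
  qed
  have F4: "emeasure (B v) (F4 w) \<le> ennreal (2 * mu)" if "w \<in> nbn v" for w
    unfolding F4_def by (rule spoilt_pairs[OF C f that mv])
  have "{s\<in>space (B v). \<not> suc v x C f s} \<subseteq> (F1 \<union> F2 \<union> F3) \<union> (\<Union>w\<in>nbn v. F4 w)"
  proof
    fix s assume s: "s \<in> {s\<in>space (B v). \<not> suc v x C f s}"
    show "s \<in> (F1 \<union> F2 \<union> F3) \<union> (\<Union>w\<in>nbn v. F4 w)"
    proof (rule ccontr)
      assume n: "\<not> ?thesis"
      then obtain i where i: "i < fst s" "snd s i \<in> C" using s unfolding F1_def by blast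
      have J: "snd s (sel C s) \<in> C" unfolding sel_def by (rule LeastI[of "\<lambda>i. snd s i \<in> C", OF i(2)])
      have "suc v x C f s" unfolding suc_def
      proof (intro conjI allI impI ballI)
        show "\<exists>i<fst s. snd s i \<in> C" using i by blast
        show "hi \<le> dist (snd s (sel C s)) (snd s i)" if "i < fst s" "i \<noteq> sel C s" for i
          using n s J that unfolding F3_def by (force simp: not_less)
        show "hi \<le> dist x (snd s i)" if "i < fst s" for i
          using n s that unfolding F2_def by (force simp: not_less)
        show "kap / 2 \<le> lam * measure lborel (cand w (snd s (sel C s)) (f (snd s (sel C s))) s (sel C s))" if "w \<in> nbn v" for w
          using n s J that unfolding F4_def by blast
      qed
      then show False using s by simp
    qed
  qed
  then have "emeasure (B v) {s\<in>space (B v). \<not> suc v x C f s} \<le> emeasure (B v) ((F1 \<union> F2 \<union> F3) \<union> (\<Union>w\<in>nbn v. F4 w))"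
    using F4m nbn_fin by (intro emeasure_mono) (auto intro!: sets.finite_UN)
  also have "\<dots> \<le> emeasure (B v) (F1 \<union> F2 \<union> F3) + emeasure (B v) (\<Union>w\<in>nbn v. F4 w)"
    using F4m nbn_fin by (intro emeasure_subadditive) (auto intro!: sets.finite_UN)
  also have "emeasure (B v) (F1 \<union> F2 \<union> F3) \<le> emeasure (B v) (F1 \<union> F2) + emeasure (B v) F3" by (intro emeasure_subadditive) auto
  also have "emeasure (B v) (F1 \<union> F2) \<le> emeasure (B v) F1 + emeasure (B v) F2" by (intro emeasure_subadditive) auto
  also have "emeasure (B v) (\<Union>w\<in>nbn v. F4 w) \<le> (\<Sum>w\<in>nbn v. emeasure (B v) (F4 w))"
    using F4m nbn_fin by (intro emeasure_subadditive_finite) auto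
  also have "\<dots> \<le> (\<Sum>w\<in>nbn v. ennreal (2 * mu))" by (intro sum_mono F4)
  also have "\<dots> = ennreal (real (card (nbn v)) * (2 * mu))" using mu0 by (simp add: ennreal_of_nat_eq_real_of_nat ennreal_mult)
  also have "\<dots> \<le> ennreal (6 * mu)"
  proof (rule ennreal_leI)
    have "real (card (nbn v)) \<le> 3" using nbn_fin(2)[of v] by simp
    then have "real (card (nbn v)) * (2 * mu) \<le> 3 * (2 * mu)" using mu0 by (intro mult_right_mono) auto
    then show "real (card (nbn v)) * (2 * mu) \<le> 6 * mu" by simp
  qed
  finally have "emeasure (B v) {s\<in>space (B v). \<not> suc v x C f s} \<le> emeasure (B v) F1 + emeasure (B v) F2 + emeasure (B v) F3 + ennreal (6 * mu)"
    by (simp add: add_mono)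
  also have "\<dots> \<le> ennreal (exp (- (kap / 2))) + ennreal mu + ennreal mu + ennreal (6 * mu)"
    by (intro add_mono F1 F2 F3 order_refl)
  also have "\<dots> = ennreal epsn" using mu0 by (simp add: epsn_def ennreal_plus[symmetric] del: ennreal_plus)
  finally show ?thesis .
qed

text \<open>Along a path (most recent node first): success so far, the index of the point chosen in the block of the
head, and the radius of the sphere around it.\<close>

fun st :: "'l list \<Rightarrow> ('l \<Rightarrow> 'a sample) \<Rightarrow> bool \<times> nat \<times> real" where
  "st [] w = (False, 0, 0)"
| "st [v] w = (suc v 0 (Q v) (\<lambda>_. 1) (w v), sel (Q v) (w v), 1)"
| "st (v # u # p) w = (let x = snd (w u) (fst (snd (st (u # p) w))); r = snd (snd (st (u # p) w));
     C = cand v x r (w u) (fst (snd (st (u # p) w)))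
     in (fst (st (u # p) w) \<and> suc v x C (\<lambda>y. dist x y - r) (w v), sel C (w v), dist x (snd (w v) (sel C (w v))) - r))"

definition okn :: "'l list \<Rightarrow> ('l \<Rightarrow> 'a sample) \<Rightarrow> bool" where "okn p w = fst (st p w)"
definition idx :: "'l list \<Rightarrow> ('l \<Rightarrow> 'a sample) \<Rightarrow> nat" where "idx p w = fst (snd (st p w))"
definition rad :: "'l list \<Rightarrow> ('l \<Rightarrow> 'a sample) \<Rightarrow> real" where "rad p w = snd (snd (st p w))"
definition pos :: "'l list \<Rightarrow> ('l \<Rightarrow> 'a sample) \<Rightarrow> 'a" where "pos p w = snd (w (hd p)) (idx p w)"
definition nxc :: "'l \<Rightarrow> 'l list \<Rightarrow> ('l \<Rightarrow> 'a sample) \<Rightarrow> 'a set" where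
  "nxc v p w = cand v (pos p w) (rad p w) (w (hd p)) (idx p w)"

text \<open>The root has no predecessor: the origin stands in for the previous centre, the whole
  cell for the candidate region, and the radius is 1.\<close>

lemma st_root: "okn [v] w = suc v 0 (Q v) (\<lambda>_. 1) (w v)" "idx [v] w = sel (Q v) (w v)" "rad [v] w = 1"
  by (simp_all add: okn_def idx_def rad_def)

lemma st_Cons:
  assumes "p \<noteq> []"
  shows "okn (v # p) w \<longleftrightarrow> okn p w \<and> suc v (pos p w) (nxc v p w) (\<lambda>y. dist (pos p w) y - rad p w) (w v)"
    "idx (v # p) w = sel (nxc v p w) (w v)" "rad (v # p) w = dist (pos p w) (pos (v # p) w) - rad p w"
proof -
  obtain u q where p: "p = u # q" using assms by (cases p) auto
  show "okn (v # p) w \<longleftrightarrow> okn p w \<and> suc v (pos p w) (nxc v p w) (\<lambda>y. dist (pos p w) y - rad p w) (w v)"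
    "idx (v # p) w = sel (nxc v p w) (w v)" "rad (v # p) w = dist (pos p w) (pos (v # p) w) - rad p w"
    by (simp_all add: okn_def idx_def rad_def pos_def nxc_def p Let_def)
qed

text \<open>A path reads only the blocks of its own nodes, so resampling any other block leaves its
  state unchanged.\<close>

lemma st_agree: "(\<And>l. l \<in> set p \<Longrightarrow> w l = w' l) \<Longrightarrow> st p w = st p w'"
proof (induction p rule: induct_list012)
  case (2 v)
  have "w v = w' v" by (rule 2) simp
  then show ?case by (simp only: st.simps)
next
  case (3 v u p)
  have "st (u # p) w = st (u # p) w'" by (rule 3(2)) (rule 3(3), simp)
  moreover have "w v = w' v" "w u = w' u" by (rule 3(3), simp)+
  ultimately show ?case by (simp only: st.simps)
qed simp

abbreviation Om :: "('l \<Rightarrow> 'a sample) measure" where "Om \<equiv> PiM UNIV B"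

lemma nxc_pred:
  assumes "idx p \<in> Om \<rightarrow>\<^sub>M count_space UNIV" "rad p \<in> borel_measurable Om" "pos p \<in> borel_measurable Om"
  shows "Measurable.pred (Om \<Otimes>\<^sub>M borel) (\<lambda>(w, y). y \<in> nxc v p w)"
proof -
  note assms[measurable] Q_borel[measurable]
  have c: "(\<lambda>w. w (hd p)) \<in> Om \<rightarrow>\<^sub>M B (hd p)" by simp
  have [measurable]: "(\<lambda>w. snd (w (hd p)) i) \<in> borel_measurable Om" for i
    by (rule measurable_compose[OF c pt_measurable])
  have [measurable]: "(\<lambda>w. fst (w (hd p))) \<in> Om \<rightarrow>\<^sub>M count_space UNIV"
    by (rule measurable_compose[OF c N_measurable])
  have "Measurable.pred (Om \<Otimes>\<^sub>M borel) (\<lambda>z. snd z \<in> Q v \<and> lo \<le> dist (pos p (fst z)) (snd z) - rad p (fst z) \<and>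
      dist (pos p (fst z)) (snd z) - rad p (fst z) \<le> hi \<and>
      (\<forall>i. i < fst (fst z (hd p)) \<longrightarrow> i \<noteq> idx p (fst z) \<longrightarrow> hi \<le> dist (snd z) (snd (fst z (hd p)) i)))"
    by measurable
  then show ?thesis by (simp add: nxc_def cand_def cd_def split_beta' conj_assoc)
qed

lemma st_measurable:
  "p \<noteq> [] \<Longrightarrow> Measurable.pred Om (okn p) \<and> idx p \<in> Om \<rightarrow>\<^sub>M count_space UNIV \<and> rad p \<in> borel_measurable Om \<and> pos p \<in> borel_measurable Om"
proof (induction p)
  case (Cons v p)
  have c: "(\<lambda>w. w v) \<in> Om \<rightarrow>\<^sub>M B v" by simp
  note Q_borel[measurable]
  show ?case
  proof (cases "p = []")
    case True
    have Cp: "Measurable.pred (Om \<Otimes>\<^sub>M borel) (\<lambda>(z, y). y \<in> Q v)" by measurable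
    have fp: "(\<lambda>(z, y). 1 :: real) \<in> borel_measurable (Om \<Otimes>\<^sub>M borel)" by simp
    note M = suc_measurable[of "\<lambda>w. w v" Om v "\<lambda>_. 0" "\<lambda>_. Q v" "\<lambda>_ _. 1", OF c measurable_const Cp fp]
    have "pos [v] = (\<lambda>w. snd (w v) (sel (Q v) (w v)))" by (simp add: fun_eq_iff pos_def st_root)
    moreover have "rad [v] = (\<lambda>w. 1)" "okn [v] = (\<lambda>w. suc v 0 (Q v) (\<lambda>_. 1) (w v))" "idx [v] = (\<lambda>w. sel (Q v) (w v))"
      by (simp_all add: fun_eq_iff st_root)
    ultimately show ?thesis using True M(1,2,4) by simp
  next
    case False
    note IH = Cons.IH[OF False]
    have im: "idx p \<in> Om \<rightarrow>\<^sub>M count_space UNIV" and rm: "rad p \<in> borel_measurable Om" and pm: "pos p \<in> borel_measurable Om"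
      and okm: "Measurable.pred Om (okn p)" using IH by auto
    note rm[measurable] pm[measurable] okm[measurable]
    have fp: "(\<lambda>(w, y). dist (pos p w) y - rad p w) \<in> borel_measurable (Om \<Otimes>\<^sub>M borel)" by measurable
    note M = suc_measurable[of "\<lambda>w. w v" Om v "pos p" "nxc v p" "\<lambda>w y. dist (pos p w) y - rad p w", OF c pm nxc_pred[OF im rm pm] fp]
    have e: "pos (v # p) = (\<lambda>w. snd (w v) (sel (nxc v p w) (w v)))" by (simp add: fun_eq_iff pos_def st_Cons[OF False])
    have e': "rad (v # p) = (\<lambda>w. dist (pos p w) (snd (w v) (sel (nxc v p w) (w v))) - rad p w)"
      using e by (simp add: fun_eq_iff st_Cons[OF False])
    have e'': "okn (v # p) = (\<lambda>w. okn p w \<and> suc v (pos p w) (nxc v p w) (\<lambda>y. dist (pos p w) y - rad p w) (w v))"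
      "idx (v # p) = (\<lambda>w. sel (nxc v p w) (w v))" by (simp_all add: fun_eq_iff st_Cons[OF False])
    show ?thesis unfolding e e' e''
      by (intro conjI pred_intros_logic okm M(4) M(1) M(2) M(3)[unfolded case_prod_conv])
  qed
qed simp

lemma sel_in: "i < fst s \<Longrightarrow> snd s i \<in> C \<Longrightarrow> sel C s < fst s \<and> snd s (sel C s) \<in> C"
  unfolding sel_def by (metis LeastI Least_le le_less_trans)

lemma okn_Cons_props:
  assumes "p \<noteq> []" "okn (v # p) w"
  shows "okn p w" "idx (v # p) w < fst (w v)" "pos (v # p) w \<in> Q v" "lo \<le> rad (v # p) w" "rad (v # p) w \<le> hi"
    "dist (pos p w) (pos (v # p) w) = rad p w + rad (v # p) w"
    "\<And>i. i < fst (w v) \<Longrightarrow> i \<noteq> idx (v # p) w \<Longrightarrow> hi \<le> dist (pos (v # p) w) (snd (w v) i)"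
    "\<And>i. i < fst (w (hd p)) \<Longrightarrow> i \<noteq> idx p w \<Longrightarrow> hi \<le> dist (pos (v # p) w) (snd (w (hd p)) i)"
    "\<And>i. i < fst (w v) \<Longrightarrow> hi \<le> dist (pos p w) (snd (w v) i)"
    "\<And>u. u \<in> nbn v \<Longrightarrow> kap / 2 \<le> lam * measure lborel (nxc u (v # p) w)"
proof -
  note S = st_Cons[OF assms(1), of v w]
  have o: "okn p w" and s: "suc v (pos p w) (nxc v p w) (\<lambda>y. dist (pos p w) y - rad p w) (w v)"
    using assms(2) S(1) by auto
  have pe: "pos (v # p) w = snd (w v) (sel (nxc v p w) (w v))" by (simp add: pos_def S(2))
  obtain i where i: "i < fst (w v)" "snd (w v) i \<in> nxc v p w" using s by (auto simp: suc_def)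
  note J = sel_in[OF i]
  show "okn p w" by (rule o)
  show "idx (v # p) w < fst (w v)" using J S(2) by simp
  have inC: "pos (v # p) w \<in> nxc v p w" using J pe by simp
  then show "pos (v # p) w \<in> Q v" "lo \<le> rad (v # p) w" "rad (v # p) w \<le> hi"
    unfolding S(3) by (auto simp: nxc_def cand_def cd_def)
  show "dist (pos p w) (pos (v # p) w) = rad p w + rad (v # p) w" unfolding S(3) by simp
  show "hi \<le> dist (pos (v # p) w) (snd (w v) i)" if "i < fst (w v)" "i \<noteq> idx (v # p) w" for i
    using s that unfolding suc_def pe S(2) by blast
  show "hi \<le> dist (pos (v # p) w) (snd (w (hd p)) i)" if "i < fst (w (hd p))" "i \<noteq> idx p w" for i
    using inC that by (auto simp: nxc_def cand_def)
  show "hi \<le> dist (pos p w) (snd (w v) i)" if "i < fst (w v)" for i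
    using s that unfolding suc_def by blast
  show "kap / 2 \<le> lam * measure lborel (nxc u (v # p) w)" if "u \<in> nbn v" for u
  proof -
    have "nxc u (v # p) w = cand u (snd (w v) (sel (nxc v p w) (w v))) (dist (pos p w) (snd (w v) (sel (nxc v p w) (w v))) - rad p w) (w v) (sel (nxc v p w) (w v))"
      unfolding nxc_def[of u] S(2,3) pe by simp
    then show ?thesis using s that unfolding suc_def by simp
  qed
qed

lemma okn_root_props:
  assumes "okn [v] w"
  shows "idx [v] w < fst (w v)" "pos [v] w \<in> Q v"
    "\<And>i. i < fst (w v) \<Longrightarrow> i \<noteq> idx [v] w \<Longrightarrow> hi \<le> dist (pos [v] w) (snd (w v) i)"
    "\<And>u. u \<in> nbn v \<Longrightarrow> kap / 2 \<le> lam * measure lborel (nxc u [v] w)"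
proof -
  have s: "suc v 0 (Q v) (\<lambda>_. 1) (w v)" using assms by (simp add: st_root)
  obtain i where i: "i < fst (w v)" "snd (w v) i \<in> Q v" using s by (auto simp: suc_def)
  note J = sel_in[OF i]
  show "idx [v] w < fst (w v)" "pos [v] w \<in> Q v" using J by (simp_all add: st_root pos_def)
  show "hi \<le> dist (pos [v] w) (snd (w v) i)" if "i < fst (w v)" "i \<noteq> idx [v] w" for i
    using s that unfolding suc_def pos_def st_root by simp
  show "kap / 2 \<le> lam * measure lborel (nxc u [v] w)" if "u \<in> nbn v" for u
    using s that unfolding suc_def nxc_def pos_def st_root by simp
qed

lemma okn_props:
  assumes "p \<noteq> []" "okn p w"
  shows "idx p w < fst (w (hd p))" "pos p w \<in> Q (hd p)" "lo \<le> rad p w" "rad p w \<le> hi"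
    "\<And>i. i < fst (w (hd p)) \<Longrightarrow> i \<noteq> idx p w \<Longrightarrow> hi \<le> dist (pos p w) (snd (w (hd p)) i)"
    "\<And>u. u \<in> nbn (hd p) \<Longrightarrow> kap / 2 \<le> lam * measure lborel (nxc u p w)"
proof -
  obtain v q where p: "p = v # q" using assms by (cases p) auto
  have "idx p w < fst (w (hd p)) \<and> pos p w \<in> Q (hd p) \<and> lo \<le> rad p w \<and> rad p w \<le> hi \<and>
    (\<forall>i. i < fst (w (hd p)) \<longrightarrow> i \<noteq> idx p w \<longrightarrow> hi \<le> dist (pos p w) (snd (w (hd p)) i)) \<and>
    (\<forall>u. u \<in> nbn (hd p) \<longrightarrow> kap / 2 \<le> lam * measure lborel (nxc u p w))"
  proof (cases "q = []")
    case True
    then show ?thesis using okn_root_props[of v w] assms(2) root_r unfolding p by (simp add: st_root)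
  next
    case False
    then show ?thesis using okn_Cons_props[of q v w] assms(2) unfolding p by simp
  qed
  then show "idx p w < fst (w (hd p))" "pos p w \<in> Q (hd p)" "lo \<le> rad p w" "rad p w \<le> hi"
    "\<And>i. i < fst (w (hd p)) \<Longrightarrow> i \<noteq> idx p w \<Longrightarrow> hi \<le> dist (pos p w) (snd (w (hd p)) i)"
    "\<And>u. u \<in> nbn (hd p) \<Longrightarrow> kap / 2 \<le> lam * measure lborel (nxc u p w)" by blast+
qed

sublocale Om: prob_space Om
  by (rule prob_space_PiM) (rule B_prob)

lemma epsn0: "0 \<le> epsn" unfolding epsn_def using mu0 by simp

lemma root_step: "Om.prob {w\<in>space Om. \<not> okn [root] w} \<le> epsn"
proof -
  have "emeasure (B root) {s\<in>space (B root). \<not> suc root 0 (Q root) (\<lambda>_. 1) s} \<le> ennreal epsn"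
    by (rule suc_fail) (use Q_borel root_r root_kap kap0 in auto)
  moreover have "emeasure Om {w\<in>space Om. \<not> okn [root] w} = emeasure (B root) {s\<in>space (B root). \<not> suc root 0 (Q root) (\<lambda>_. 1) s}"
  proof -
    have d: "distr Om (B root) (\<lambda>w. w root) = B root" by (rule distr_PiM_component) (auto intro: B_prob)
    have Cp: "Measurable.pred (B root \<Otimes>\<^sub>M borel) (\<lambda>(z, y). y \<in> Q root)" using Q_borel by measurable
    have fp: "(\<lambda>(z, y). 1 :: real) \<in> borel_measurable (B root \<Otimes>\<^sub>M borel)" by simp
    note M = suc_measurable(4)[of "\<lambda>s. s" "B root" root "\<lambda>_. 0" "\<lambda>_. Q root" "\<lambda>_ _. 1", OF measurable_ident[unfolded id_def] measurable_const Cp fp]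
    have [measurable]: "{s\<in>space (B root). \<not> suc root 0 (Q root) (\<lambda>_. 1) s} \<in> sets (B root)" using M by measurable
    have "emeasure (B root) {s\<in>space (B root). \<not> suc root 0 (Q root) (\<lambda>_. 1) s} =
      emeasure (distr Om (B root) (\<lambda>w. w root)) {s\<in>space (B root). \<not> suc root 0 (Q root) (\<lambda>_. 1) s}" by (simp only: d)
    also have "\<dots> = emeasure Om {w\<in>space Om. \<not> okn [root] w}"
      by (subst emeasure_distr) (auto intro!: arg_cong[where f="emeasure Om"] simp: st_root space_PiM)
    finally show ?thesis ..
  qed
  ultimately have "ennreal (Om.prob {w\<in>space Om. \<not> okn [root] w}) \<le> ennreal epsn"
    by (simp only: Om.emeasure_eq_measure[symmetric])
  then show ?thesis by (simp only: ennreal_le_iff[OF epsn0])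
qed

text \<open>Resample the block of \<open>v\<close>. Neither \<open>E\<close> nor the data of
  \<open>p\<close> change, so \<open>suc_fail\<close> applies with a fixed region, and success of
  \<open>p\<close> guarantees that at least half of that region is free.\<close>

lemma node_step:
  assumes E: "E \<in> sets Om" "E \<subseteq> {w\<in>space Om. okn p w}" and p: "p \<noteq> []" "v \<notin> set p" "v \<in> nbn (hd p)"
    and free: "\<And>w s. w \<in> space Om \<Longrightarrow> s \<in> space (B v) \<Longrightarrow> fun_upd w v s \<in> E \<longleftrightarrow> w \<in> E"
  shows "Om.prob (E \<inter> {w\<in>space Om. \<not> okn (v # p) w}) \<le> epsn * Om.prob E"
proof -
  have m: "Measurable.pred Om (okn (v # p))" using st_measurable[of "v # p"] by simp
  have Em: "E \<inter> {w\<in>space Om. \<not> okn (v # p) w} \<in> sets Om" using E(1) m by measurable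
  have agree: "okn p (fun_upd w v s) = okn p w" "idx p (fun_upd w v s) = idx p w" "rad p (fun_upd w v s) = rad p w"
    "pos p (fun_upd w v s) = pos p w" "nxc v p (fun_upd w v s) = nxc v p w" for w s
  proof -
    have "st p (fun_upd w v s) = st p w" by (rule st_agree) (use p(2) in auto)
    then show 1: "okn p (fun_upd w v s) = okn p w" "idx p (fun_upd w v s) = idx p w" "rad p (fun_upd w v s) = rad p w"
      by (simp_all add: okn_def idx_def rad_def)
    have h: "hd p \<noteq> v" using p(1,2) by (metis hd_in_set)
    then show 2: "pos p (fun_upd w v s) = pos p w" by (simp add: pos_def 1)
    show "nxc v p (fun_upd w v s) = nxc v p w" using h by (simp add: nxc_def 1 2)
  qed
  have "emeasure Om (E \<inter> {w\<in>space Om. \<not> okn (v # p) w}) = (\<integral>\<^sup>+w. indicator (E \<inter> {w\<in>space Om. \<not> okn (v # p) w}) w \<partial>Om)"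
    by (rule nn_integral_indicator[symmetric]) (rule Em)
  also have "\<dots> = (\<integral>\<^sup>+w. (\<integral>\<^sup>+s. indicator (E \<inter> {w\<in>space Om. \<not> okn (v # p) w}) (fun_upd w v s) \<partial>B v) \<partial>Om)"
    using Em by (intro nn_integral_PiM_update B_prob borel_measurable_indicator) auto
  also have "\<dots> \<le> (\<integral>\<^sup>+w. ennreal epsn * indicator E w \<partial>Om)"
  proof (rule nn_integral_mono)
    fix w assume w: "w \<in> space Om"
    let ?F = "{s\<in>space (B v). \<not> suc v (pos p w) (nxc v p w) (\<lambda>y. dist (pos p w) y - rad p w) s}"
    show "(\<integral>\<^sup>+s. indicator (E \<inter> {w\<in>space Om. \<not> okn (v # p) w}) (fun_upd w v s) \<partial>B v) \<le> ennreal epsn * indicator E w"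
    proof (cases "w \<in> E")
      case True
      then have o: "okn p w" using E(2) by auto
      have Cb: "nxc v p w \<in> sets borel" unfolding nxc_def by (rule cand_borel)
      have CQ: "nxc v p w \<subseteq> Q v" by (auto simp: nxc_def cand_def cd_def)
      have fb: "(\<lambda>y. dist (pos p w) y - rad p w) \<in> borel_measurable borel" by measurable
      have Cp: "Measurable.pred (B v \<Otimes>\<^sub>M borel) (\<lambda>(z, y). y \<in> nxc v p w)" using Cb by measurable
      have fp: "(\<lambda>(z, y). dist (pos p w) y - rad p w) \<in> borel_measurable (B v \<Otimes>\<^sub>M borel)" by measurable
      note M = suc_measurable(4)[of "\<lambda>s. s" "B v" v "\<lambda>_. pos p w" "\<lambda>_. nxc v p w" "\<lambda>_ y. dist (pos p w) y - rad p w", OF measurable_ident[unfolded id_def] measurable_const Cp fp]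
      have Fm: "?F \<in> sets (B v)" using M by measurable
      have "(\<integral>\<^sup>+s. indicator (E \<inter> {w\<in>space Om. \<not> okn (v # p) w}) (fun_upd w v s) \<partial>B v) \<le> (\<integral>\<^sup>+s. indicator ?F s \<partial>B v)"
      proof (rule nn_integral_mono)
        fix s assume "s \<in> space (B v)"
        then show "indicator (E \<inter> {w\<in>space Om. \<not> okn (v # p) w}) (fun_upd w v s) \<le> (indicator ?F s :: ennreal)"
          using o by (auto simp: indicator_def st_Cons[OF p(1)] agree)
      qed
      also have "\<dots> = emeasure (B v) ?F" using Fm by simp
      also have "\<dots> \<le> ennreal epsn"
      proof (rule suc_fail[OF Cb CQ fb])
        show "lo \<le> dist (pos p w) y - rad p w \<and> dist (pos p w) y - rad p w \<le> hi" if "y \<in> nxc v p w" for y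
          using that by (simp add: nxc_def cand_def cd_def)
        show "kap / 2 \<le> lam * measure lborel (nxc v p w)" by (rule okn_props(6)[OF p(1) o p(3)])
      qed
      finally show ?thesis using True by simp
    next
      case False
      have "(\<integral>\<^sup>+s. indicator (E \<inter> {w\<in>space Om. \<not> okn (v # p) w}) (fun_upd w v s) \<partial>B v) = (\<integral>\<^sup>+s. 0 \<partial>B v)"
        using False free[OF w] by (intro nn_integral_cong) (auto simp: indicator_def)
      then show ?thesis by simp
    qed
  qed
  also have "\<dots> = ennreal epsn * emeasure Om E" using E(1) by (simp add: nn_integral_cmult)
  finally show ?thesis using epsn0 by (simp add: Om.emeasure_eq_measure ennreal_mult[symmetric])
qed

end

declare split_paired_All [simp del] split_paired_Ex [simp del]

section \<open>Hierarchical bad blocks\<close>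

type_synonym site = "int \<times> int"

text \<open>The 3 x 3 block containing a site. Blocks are centred, so (0, 0) is its own parent and
  every site ends up in block (0, 0) after enough levels.\<close>

definition par :: "site \<Rightarrow> site" where
  "par s = ((fst s + 1) div 3, (snd s + 1) div 3)"

definition adj4 :: "site \<Rightarrow> site \<Rightarrow> bool" where
  "adj4 s t \<longleftrightarrow> \<bar>fst s - fst t\<bar> + \<bar>snd s - snd t\<bar> = 1"

text \<open>One bad child out of nine is tolerated, as it cannot disconnect the others. Two are
  needed for failure, so the probability is essentially squared from level to level.\<close>

primrec badblk :: "site set \<Rightarrow> nat \<Rightarrow> site \<Rightarrow> bool" where
  "badblk D 0 c \<longleftrightarrow> c \<in> D"
| "badblk D (Suc k) c \<longleftrightarrow>
     (\<exists>s t. s \<noteq> t \<and> par s = c \<and> par t = c \<and> badblk D k s \<and> badblk D k t)"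

primrec core :: "site set \<Rightarrow> nat \<Rightarrow> site \<Rightarrow> site set" where
  "core D 0 c = {c}"
| "core D (Suc k) c = (\<Union>s\<in>{s. par s = c \<and> \<not> badblk D k s}. core D k s)"

definition good_link :: "site set \<Rightarrow> (site \<times> site) set" where
  "good_link D = {(s, t). adj4 s t \<and> s \<notin> D \<and> t \<notin> D}\<^sup>*"

lemma par_eq_iff: "par s = c \<longleftrightarrow> 3 * fst c - 1 \<le> fst s \<and> fst s \<le> 3 * fst c + 1 \<and>
    3 * snd c - 1 \<le> snd s \<and> snd s \<le> 3 * snd c + 1"
  unfolding par_def by (cases c; cases s; simp) linarith

lemma par_fiber: "{s. par s = c} = {3 * fst c - 1 .. 3 * fst c + 1} \<times> {3 * snd c - 1 .. 3 * snd c + 1}"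
  by (auto simp: par_eq_iff)

lemma finite_par_fiber: "finite {s. par s = c}" and card_par_fiber: "card {s. par s = c} = 9"
  unfolding par_fiber by (simp_all add: card_cartesian_product)

lemma core_par: "x \<in> core D k c \<Longrightarrow> (par ^^ k) x = c"
proof (induction k arbitrary: x c)
  case (Suc k)
  then obtain s where "par s = c" "x \<in> core D k s" by auto
  then show ?case using Suc.IH[of x s] by simp
qed simp

lemma good_link_sym: "(x, y) \<in> good_link D \<Longrightarrow> (y, x) \<in> good_link D"
proof -
  have "sym {(s, t). adj4 s t \<and> s \<notin> D \<and> t \<notin> D}"
    by (auto simp: sym_def adj4_def abs_minus_commute)
  then show "(x, y) \<in> good_link D \<Longrightarrow> (y, x) \<in> good_link D"
    unfolding good_link_def by (meson symD sym_rtrancl)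
qed

lemma good_link_trans: "(x, y) \<in> good_link D \<Longrightarrow> (y, z) \<in> good_link D \<Longrightarrow> (x, z) \<in> good_link D"
  unfolding good_link_def by (rule rtrancl_trans)

text \<open>A 3 x 3 grid with at most one cell removed is connected. Labels, constant along edges
  between good cells, express this without paths, and later stand for classes of linked
  cores.\<close>

lemma grid_label_const:
  fixes g :: "int \<Rightarrow> int \<Rightarrow> bool" and l :: "int \<Rightarrow> int \<Rightarrow> 'b"
  assumes h: "\<And>i j. g i j \<Longrightarrow> g (i+1) j \<Longrightarrow> l i j = l (i+1) j"
    and v: "\<And>i j. g i j \<Longrightarrow> g i (j+1) \<Longrightarrow> l i j = l i (j+1)"
    and one: "\<And>i j i' j'. \<lbrakk>\<bar>i\<bar> \<le> 1; \<bar>j\<bar> \<le> 1; \<bar>i'\<bar> \<le> 1; \<bar>j'\<bar> \<le> 1; \<not> g i j; \<not> g i' j'\<rbrakk> \<Longrightarrow> i = i' \<and> j = j'"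
    and p: "\<bar>i\<bar> \<le> 1" "\<bar>j\<bar> \<le> 1" "g i j" and q: "\<bar>i'\<bar> \<le> 1" "\<bar>j'\<bar> \<le> 1" "g i' j'"
  shows "l i j = l i' j'"
proof -
  let ?G = "{-1,0,1} :: int set"
  obtain a0 b0 where ab0: "a0 \<in> ?G" "b0 \<in> ?G"
    and all: "\<And>a b. a \<in> ?G \<Longrightarrow> b \<in> ?G \<Longrightarrow> a \<noteq> a0 \<or> b \<noteq> b0 \<Longrightarrow> g a b"
  proof (cases "\<exists>a0 b0. a0 \<in> ?G \<and> b0 \<in> ?G \<and> \<not> g a0 b0")
    case True
    then obtain a0 b0 where ab: "a0 \<in> ?G" "b0 \<in> ?G" "\<not> g a0 b0" by auto
    have "g a b" if "a \<in> ?G" "b \<in> ?G" "a \<noteq> a0 \<or> b \<noteq> b0" for a b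
      using one[of a b a0 b0] ab that by fastforce
    then show ?thesis using that[OF ab(1,2)] by simp
  next
    case False
    then have "g a b" if "a \<in> ?G" "b \<in> ?G" for a b using that by blast
    then show ?thesis by (intro that[of 0 0]) auto
  qed
  have row: "l a b = l a' b" if "b \<noteq> b0" "a \<in> ?G" "a' \<in> ?G" "b \<in> ?G" for a a' b
  proof -
    have "g (-1) b" "g 0 b" "g 1 b" using that by (auto intro!: all)
    then have "l (-1) b = l 0 b" "l 0 b = l 1 b" using h[of "-1" b] h[of 0 b] by auto
    then show ?thesis using that by auto
  qed
  have col: "l a b = l a b'" if "a \<noteq> a0" "a \<in> ?G" "b \<in> ?G" "b' \<in> ?G" for a b b'
  proof -
    have "g a (-1)" "g a 0" "g a 1" using that by (auto intro!: all)
    then have "l a (-1) = l a 0" "l a 0 = l a 1" using v[of a "-1"] v[of a 0] by auto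
    then show ?thesis using that by auto
  qed
  have ex: "\<exists>r\<in>?G. r \<noteq> x" for x by (cases "x = 0") auto
  obtain r where r: "r \<in> ?G" "r \<noteq> b0" using ex by blast
  obtain c where c: "c \<in> ?G" "c \<noteq> a0" using ex by blast
  \<comment> \<open>(c, r) avoids both the row and the column of the exceptional cell, so its row
    and column are intact. A good cell in the same row and column as the exceptional one can only be
    that cell itself, and then nothing is missing.\<close>
  have hub: "l a b = l c r" if "g a b" "a \<in> ?G" "b \<in> ?G" for a b
  proof (cases "b = b0")
    case False
    then show ?thesis using row[of b a c] col[of c b r] that r c by auto
  next
    case True
    show ?thesis
    proof (cases "a = a0")
      case False
      then show ?thesis using col[of a b r] row[of r a c] that r c by auto
    next
      case t: True
      have g: "g a' b" if "a' \<in> ?G" for a'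
        using all[of a' b] that \<open>g a b\<close> \<open>b \<in> ?G\<close> True t by (cases "a' = a0") auto
      have "l (-1) b = l 0 b" "l 0 b = l 1 b" using h[of "-1" b] h[of 0 b] g by auto
      then have "l a b = l c b" using that(2) c(1) by auto
      then show ?thesis using col[of c b r] that r c by auto
    qed
  qed
  have "i \<in> ?G" "j \<in> ?G" "i' \<in> ?G" "j' \<in> ?G" using p q by auto
  then show ?thesis using hub[of i j] hub[of i' j'] p q by simp
qed

lemma core_nonempty: "\<not> badblk D k c \<Longrightarrow> core D k c \<noteq> {}"
proof (induction k arbitrary: c)
  case (Suc k)
  define s t where "s = (3 * fst c, 3 * snd c)" and "t = (3 * fst c, 3 * snd c + 1)"
  have "par s = c" "par t = c" "s \<noteq> t" by (auto simp: par_eq_iff s_def t_def)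
  then have "\<not> badblk D k s \<or> \<not> badblk D k t" using Suc.prems by (metis badblk.simps(2))
  then obtain u where "par u = c" "\<not> badblk D k u" using \<open>par s = c\<close> \<open>par t = c\<close> by blast
  then show ?case using Suc.IH[of u] by auto
qed simp

text \<open>Induction over the levels: adjacent good children have linked cores, the good children
  of one good block are connected by \<open>grid_label_const\<close>, and two adjacent good blocks
  have a good pair of facing children.\<close>

lemma core_linked:
  assumes "\<not> badblk D k c" "\<not> badblk D k c'" "c = c' \<or> adj4 c c'" "x \<in> core D k c" "y \<in> core D k c'"
  shows "(x, y) \<in> good_link D"
  using assms
proof (induction k arbitrary: c c' x y)
  case 0
  then show ?case by (auto simp: good_link_def)
next
  case (Suc k)
  define cls where "cls s = {z. \<exists>w\<in>core D k s. (w, z) \<in> good_link D}" for s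
  have cls_adj: "cls s = cls t" if "\<not> badblk D k s" "\<not> badblk D k t" "adj4 s t" for s t
  proof -
    have sub: "cls s \<subseteq> cls t" if h: "\<not> badblk D k s" "\<not> badblk D k t" "adj4 s t" for s t
    proof
      fix z assume "z \<in> cls s"
      then obtain w where w: "w \<in> core D k s" "(w, z) \<in> good_link D" by (auto simp: cls_def)
      obtain u where u: "u \<in> core D k t" using core_nonempty[OF h(2)] by auto
      have "(w, u) \<in> good_link D" using Suc.IH[OF h(1,2) _ w(1) u] h(3) by simp
      then show "z \<in> cls t" using u w(2) by (auto simp: cls_def intro: good_link_sym good_link_trans)
    qed
    show ?thesis using sub[of s t] sub[of t s] that by (auto simp: adj4_def abs_minus_commute)
  qed
  have cls_in: "cls s = cls t" if h: "\<not> badblk D (Suc k) c" "par s = c" "par t = c"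
    "\<not> badblk D k s" "\<not> badblk D k t" for s t c
  proof -
    obtain a b where c: "c = (a, b)" by (cases c)
    define g where "g i j \<longleftrightarrow> \<not> badblk D k (3*a+i, 3*b+j)" for i j
    define l where "l i j = cls (3*a+i, 3*b+j)" for i j
    have "l (fst s - 3*a) (snd s - 3*b) = l (fst t - 3*a) (snd t - 3*b)"
    proof (rule grid_label_const[where g=g])
      fix i j assume "g i j" "g (i+1) j"
      then show "l i j = l (i+1) j" unfolding l_def g_def by (intro cls_adj) (auto simp: adj4_def)
    next
      fix i j assume "g i j" "g i (j+1)"
      then show "l i j = l i (j+1)" unfolding l_def g_def by (intro cls_adj) (auto simp: adj4_def)
    next
      fix i j i' j' :: int
      assume "\<bar>i\<bar> \<le> 1" "\<bar>j\<bar> \<le> 1" "\<bar>i'\<bar> \<le> 1" "\<bar>j'\<bar> \<le> 1" "\<not> g i j" "\<not> g i' j'"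
      then have "par (3*a+i, 3*b+j) = c" "par (3*a+i', 3*b+j') = c"
        "badblk D k (3*a+i, 3*b+j)" "badblk D k (3*a+i', 3*b+j')"
        by (auto simp: par_eq_iff c g_def)
      then show "i = i' \<and> j = j'" using h(1) by fastforce
    qed (use h(2-5) in \<open>auto simp: par_eq_iff c g_def\<close>)
    then show ?thesis by (simp add: l_def)
  qed
  from Suc.prems obtain s t where st: "par s = c" "\<not> badblk D k s" "x \<in> core D k s"
    "par t = c'" "\<not> badblk D k t" "y \<in> core D k t" by auto
  have "cls s = cls t"
  proof (cases "c = c'")
    case True then show ?thesis using cls_in st Suc.prems by blast
  next
    case False
    then have adj: "adj4 c c'" using Suc.prems by simp
    obtain a b a' b' where c: "c = (a, b)" "c' = (a', b')" by (cases c, cases c')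
    \<comment> \<open>Three pairs of children face each other along the common side, and each of the
      two blocks spoils at most one pair.\<close>
    have *: "\<exists>u v. par u = c \<and> par v = c' \<and> adj4 u v \<and> \<not> badblk D k u \<and> \<not> badblk D k v"
    proof -
      define u where "u j = (if a = a' then (3*a+j, if b' > b then 3*b+1 else 3*b-1)
          else (if a' > a then 3*a+1 else 3*a-1, 3*b+j))" for j :: int
      define v where "v j = (if a = a' then (3*a+j, if b' > b then 3*b+2 else 3*b-2)
          else (if a' > a then 3*a+2 else 3*a-2, 3*b+j))" for j :: int
      have p: "par (u j) = c" "par (v j) = c'" "adj4 (u j) (v j)" if "j \<in> {-1,0,1}" for j
        using adj that by (auto simp: u_def v_def par_eq_iff c adj4_def split: if_splits)
      have ne: "u i \<noteq> u j" "v i \<noteq> v j" if "i \<noteq> j" for i j using that by (auto simp: u_def v_def)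
      have "badblk D k (u i) \<Longrightarrow> badblk D k (u j) \<Longrightarrow> i = j" if "i \<in> {-1,0,1}" "j \<in> {-1,0,1}" for i j
        using Suc.prems(1) p(1)[OF that(1)] p(1)[OF that(2)] ne(1)[of i j] by (metis badblk.simps(2))
      moreover have "badblk D k (v i) \<Longrightarrow> badblk D k (v j) \<Longrightarrow> i = j" if "i \<in> {-1,0,1}" "j \<in> {-1,0,1}" for i j
        using Suc.prems(2) p(2)[OF that(1)] p(2)[OF that(2)] ne(2)[of i j] by (metis badblk.simps(2))
      ultimately have "\<exists>j\<in>{-1,0,1}. \<not> badblk D k (u j) \<and> \<not> badblk D k (v j)"
        by (metis insertCI zero_neq_neg_one zero_neq_one one_neq_neg_one)
      then show ?thesis using p by blast
    qed
    then obtain u v where uv: "par u = c" "par v = c'" "adj4 u v" "\<not> badblk D k u" "\<not> badblk D k v" by blast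
    have "cls s = cls u" using cls_in[OF Suc.prems(1)] st uv by blast
    also have "cls u = cls v" using cls_adj uv by blast
    also have "cls v = cls t" using cls_in[OF Suc.prems(2)] st uv by blast
    finally show ?thesis .
  qed
  moreover have "y \<in> cls t" using st by (auto simp: cls_def good_link_def)
  ultimately have "y \<in> cls s" by simp
  then obtain w where w: "w \<in> core D k s" "(w, y) \<in> good_link D" unfolding cls_def by blast
  have "(x, w) \<in> good_link D" using Suc.IH[OF st(2) st(2) _ st(3) w(1)] by simp
  then show ?case using w(2) by (rule good_link_trans)
qed

text \<open>Of the three children in the middle row at most one is bad, so the core at least doubles
  with each level.\<close>

lemma card_core: "\<not> badblk D k c \<Longrightarrow> finite (core D k c) \<and> card (core D k c) \<ge> 2 ^ k"
proof (induction k arbitrary: c)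
  case (Suc k)
  define u where "u j = (3 * fst c + j, 3 * snd c)" for j :: int
  have p: "par (u j) = c" if "j \<in> {-1,0,1}" for j using that by (auto simp: par_eq_iff u_def)
  have inju: "u i \<noteq> u j" if "i \<noteq> j" for i j using that by (auto simp: u_def)
  have "badblk D k (u i) \<Longrightarrow> badblk D k (u j) \<Longrightarrow> i = j" if "i \<in> {-1,0,1}" "j \<in> {-1,0,1}" for i j
    using Suc.prems p[OF that(1)] p[OF that(2)] inju[of i j] by (metis badblk.simps(2))
  then have "\<exists>i\<in>{-1,0,1}. \<exists>j\<in>{-1,0,1}. i \<noteq> j \<and> \<not> badblk D k (u i) \<and> \<not> badblk D k (u j)"
    by (metis insertCI zero_neq_neg_one zero_neq_one one_neq_neg_one)
  then obtain s t where st: "s \<noteq> t" "par s = c" "par t = c" "\<not> badblk D k s" "\<not> badblk D k t"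
    using p inju by metis
  have fin: "finite (core D (Suc k) c)"
    using Suc.IH finite_par_fiber[of c] by auto
  have disj: "core D k s \<inter> core D k t = {}" using core_par st(1) by blast
  have "2 ^ Suc k \<le> card (core D k s) + card (core D k t)" using Suc.IH[OF st(4)] Suc.IH[OF st(5)] by simp
  also have "\<dots> = card (core D k s \<union> core D k t)"
    using Suc.IH[OF st(4)] Suc.IH[OF st(5)] disj by (simp add: card_Un_disjoint)
  also have "\<dots> \<le> card (core D (Suc k) c)" by (rule card_mono[OF fin]) (use st in auto)
  finally show ?case using fin by simp
qed simp

lemma core_mem:
  assumes "\<And>j. \<not> badblk D j ((par ^^ j) z)"
  shows "z \<in> core D k ((par ^^ k) z)"
proof (induction k)
  case (Suc k)
  then show ?case using assms[of k] unfolding core.simps by (intro UN_I[of "(par ^^ k) z"]) auto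
qed simp

lemma par_iterate_zero: "\<exists>k0. \<forall>k\<ge>k0. (par ^^ k) z = (0, 0)"
proof -
  have *: "\<forall>k\<ge>n. (par ^^ k) z = (0, 0)" if "\<bar>fst z\<bar> \<le> int n" "\<bar>snd z\<bar> \<le> int n" for n z
    using that
  proof (induction n arbitrary: z)
    case 0
    then have z: "z = (0,0)" by (cases z) auto
    have "(par ^^ k) (0,0) = (0,0)" for k by (induction k) (auto simp: par_def)
    then show ?case using z by auto
  next
    case (Suc n)
    have "\<bar>fst (par z)\<bar> \<le> int n" "\<bar>snd (par z)\<bar> \<le> int n"
      using Suc.prems unfolding par_def fst_conv snd_conv by linarith+
    note IH = Suc.IH[OF this]
    show ?case
    proof (intro allI impI)
      fix k assume "Suc n \<le> k"
      then obtain k' where "k = Suc k'" "n \<le> k'" by (cases k) auto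
      then show "(par ^^ k) z = (0,0)" using IH by (simp add: funpow_Suc_right del: funpow.simps)
    qed
  qed
  show ?thesis by (rule exI, rule *[of z "nat (max \<bar>fst z\<bar> \<bar>snd z\<bar>)"]) auto
qed

text \<open>A bad block of level \<open>k\<close> contains \<open>2 ^ k\<close> bad vertices; there are few candidate sets.\<close>

primrec wit :: "(site \<Rightarrow> 'v set) \<Rightarrow> nat \<Rightarrow> site \<Rightarrow> 'v set set" where
  "wit V 0 c = (\<lambda>v. {v}) ` V c"
| "wit V (Suc k) c = (\<Union>(s, t)\<in>{s. par s = c} \<times> {t. par t = c} \<inter> {(s, t). s \<noteq> t}.
     (\<lambda>(W, W'). W \<union> W') ` (wit V k s \<times> wit V k t))"

lemma badblk_wit:
  assumes "\<And>c. c \<in> D \<longleftrightarrow> V c \<inter> F \<noteq> {}" "badblk D k c"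
  shows "\<exists>W\<in>wit V k c. W \<subseteq> F"
  using assms(2)
proof (induction k arbitrary: c)
  case 0
  then show ?case using assms(1) by auto
next
  case (Suc k)
  then obtain s t where st: "s \<noteq> t" "par s = c" "par t = c" "badblk D k s" "badblk D k t"
    unfolding badblk.simps by blast
  obtain W W' where W: "W \<in> wit V k s" "W \<subseteq> F" "W' \<in> wit V k t" "W' \<subseteq> F"
    using Suc.IH[OF st(4)] Suc.IH[OF st(5)] by blast
  have "W \<union> W' \<in> wit V (Suc k) c" unfolding wit.simps
    using st W by (intro UN_I[of "(s, t)"]) (auto intro!: image_eqI[of _ _ "(W, W')"])
  moreover have "W \<union> W' \<subseteq> F" using W by blast
  ultimately show ?case by blast
qed

text \<open>There are at most 81 pairs of children, so the number of candidate sets satisfies a(k+1)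
  <= 81 * a(k) ^ 2. The factor 81 turns this into pure squaring, starting from 81 * 2 = 162.\<close>

lemma wit_finite_card:
  assumes "\<And>c. finite (V c) \<and> card (V c) \<le> 2"
  shows "finite (wit V k c) \<and> 81 * card (wit V k c) \<le> 162 ^ (2 ^ k)"
proof (induction k arbitrary: c)
  case 0
  have "card (wit V 0 c) \<le> card (V c)" using assms[of c] by (simp add: card_image_le)
  then show ?case using assms[of c] by simp
next
  case (Suc k)
  let ?I = "{s. par s = c} \<times> {t. par t = c} \<inter> {(s, t). s \<noteq> t}"
  have fI: "finite ?I" using finite_par_fiber by auto
  have "card ?I \<le> card ({s. par s = c} \<times> {t. par t = c})"
    by (rule card_mono) (use finite_par_fiber in auto)
  then have cI: "card ?I \<le> 81" by (simp add: card_cartesian_product card_par_fiber)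
  let ?w = "\<lambda>s t. (\<lambda>(W, W'). W \<union> W') ` (wit V k s \<times> wit V k t)"
  have fin: "finite (wit V (Suc k) c)" using Suc fI by auto
  have each: "81 * (81 * card (?w s t)) \<le> 162 ^ 2 ^ Suc k" for s t
  proof -
    have "card (?w s t) \<le> card (wit V k s) * card (wit V k t)"
      using card_image_le[of "wit V k s \<times> wit V k t"] Suc by (simp add: card_cartesian_product)
    then have "81 * (81 * card (?w s t)) \<le> (81 * card (wit V k s)) * (81 * card (wit V k t))" by simp
    also have "\<dots> \<le> 162 ^ 2 ^ k * 162 ^ 2 ^ k" by (intro mult_mono) (use Suc in auto)
    also have "\<dots> = 162 ^ 2 ^ Suc k" by (simp flip: power_add add: mult_2)
    finally show ?thesis .
  qed
  have "card (wit V (Suc k) c) \<le> (\<Sum>p\<in>?I. card (?w (fst p) (snd p)))"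
    using card_UN_le[OF fI, of "\<lambda>p. ?w (fst p) (snd p)"] by (simp add: case_prod_beta')
  then have "81 * (81 * card (wit V (Suc k) c)) \<le> (\<Sum>p\<in>?I. 81 * (81 * card (?w (fst p) (snd p))))"
    by (simp add: sum_distrib_left[symmetric])
  also have "\<dots> \<le> (\<Sum>p\<in>?I. 162 ^ 2 ^ Suc k)" by (intro sum_mono each)
  also have "\<dots> \<le> 81 * 162 ^ 2 ^ Suc k" using cI by simp
  finally show ?case using fin by simp
qed

text \<open>The sets coming from different children are disjoint, as their vertices lie over
  different blocks; hence the size is exactly 2 ^ k.\<close>

lemma wit_sets:
  assumes "\<And>c v. v \<in> V c \<Longrightarrow> st v = c" "W \<in> wit V k c"
  shows "finite W \<and> card W = 2 ^ k \<and> (\<forall>v\<in>W. (par ^^ k) (st v) = c)"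
  using assms(2)
proof (induction k arbitrary: c W)
  case 0
  then obtain v where "v \<in> V c" "W = {v}" by auto
  then show ?case using assms(1)[of v c] by simp
next
  case (Suc k)
  then obtain s t W1 W2 where h: "s \<noteq> t" "par s = c" "par t = c" "W1 \<in> wit V k s" "W2 \<in> wit V k t"
    "W = W1 \<union> W2" unfolding wit.simps by blast
  have "W1 \<inter> W2 = {}" using Suc.IH[OF h(4)] Suc.IH[OF h(5)] h(1) by (metis disjoint_iff)
  then show ?case using Suc.IH[OF h(4)] Suc.IH[OF h(5)] h by (auto simp: card_Un_disjoint)
qed

text \<open>Union bound over the candidate sets, each entirely failed with probability at most
  \<epsilon> to the power 2 ^ k.\<close>

lemma (in prob_space) prob_badblk_le:
  fixes F :: "'a \<Rightarrow> 'v set" and V :: "site \<Rightarrow> 'v set"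
  assumes V: "\<And>c. finite (V c) \<and> card (V c) \<le> 2" "\<And>c v. v \<in> V c \<Longrightarrow> st v = c"
    and D: "\<And>\<omega> c. c \<in> D \<omega> \<longleftrightarrow> V c \<inter> F \<omega> \<noteq> {}"
    and R: "R \<in> events"
    and F: "\<And>v. {\<omega>\<in>space M. v \<in> F \<omega>} \<in> events"
    and W: "\<And>W. finite W \<Longrightarrow> prob {\<omega>\<in>R. W \<subseteq> F \<omega>} \<le> \<epsilon> ^ card W"
    and eps: "0 \<le> \<epsilon>"
  shows "prob {\<omega>\<in>R. badblk (D \<omega>) k c} \<le> (162 * \<epsilon>) ^ (2 ^ k) / 81"
    and "{\<omega>\<in>space M. badblk (D \<omega>) k c} \<in> events"
proof -
  have Fm: "{\<omega>\<in>R. W \<subseteq> F \<omega>} \<in> events" if "finite W" for W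
  proof -
    have "{\<omega>\<in>R. W \<subseteq> F \<omega>} = R \<inter> (\<Inter>v\<in>W. {\<omega>\<in>space M. v \<in> F \<omega>}) \<or> W = {}"
      using sets.sets_into_space[OF R] by auto
    then show ?thesis using that R F
      by (cases "W = {}") (auto intro!: sets.Int sets.finite_INT)
  qed
  have wf: "finite (wit V k c)" using wit_finite_card[of V k c] V(1) by blast
  have ws: "finite W \<and> card W = 2 ^ k" if "W \<in> wit V k c" for W
    using wit_sets[of V st W k c, OF V(2) that] by blast
  have "{\<omega>\<in>R. badblk (D \<omega>) k c} \<subseteq> (\<Union>W\<in>wit V k c. {\<omega>\<in>R. W \<subseteq> F \<omega>})"
  proof
    fix \<omega> assume "\<omega> \<in> {\<omega>\<in>R. badblk (D \<omega>) k c}"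
    then show "\<omega> \<in> (\<Union>W\<in>wit V k c. {\<omega>\<in>R. W \<subseteq> F \<omega>})"
      using badblk_wit[where V=V and D="D \<omega>" and F="F \<omega>" and k=k and c=c, OF D] by auto
  qed
  then have "prob {\<omega>\<in>R. badblk (D \<omega>) k c} \<le> prob (\<Union>W\<in>wit V k c. {\<omega>\<in>R. W \<subseteq> F \<omega>})"
    using wf Fm ws
    by (intro finite_measure_mono sets.finite_UN) blast+
  also have "\<dots> \<le> (\<Sum>W\<in>wit V k c. prob {\<omega>\<in>R. W \<subseteq> F \<omega>})"
    using wf Fm ws
    by (intro finite_measure_subadditive_finite) blast+
  also have "\<dots> \<le> (\<Sum>W\<in>wit V k c. \<epsilon> ^ (2 ^ k))"
    using W ws by (intro sum_mono) metis
  also have "\<dots> = real (81 * card (wit V k c)) * \<epsilon> ^ (2 ^ k) / 81" by simp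
  also have "\<dots> \<le> real (162 ^ (2 ^ k)) * \<epsilon> ^ (2 ^ k) / 81"
    using wit_finite_card[of V k c, OF V(1)] eps
    by (intro divide_right_mono mult_right_mono) (auto simp del: of_nat_mult of_nat_power)
  also have "\<dots> = (162 * \<epsilon>) ^ (2 ^ k) / 81" by (simp add: power_mult_distrib)
  finally show "prob {\<omega>\<in>R. badblk (D \<omega>) k c} \<le> (162 * \<epsilon>) ^ (2 ^ k) / 81" .
  have D0: "{\<omega>\<in>space M. c \<in> D \<omega>} \<in> events" for c
  proof -
    have "{\<omega>\<in>space M. c \<in> D \<omega>} = (\<Union>v\<in>V c. {\<omega>\<in>space M. v \<in> F \<omega>})" using D by auto
    moreover have "\<dots> \<in> events" by (rule sets.finite_UN) (use V(1)[of c] F in auto)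
    ultimately show ?thesis by (rule ssubst)
  qed
  show "{\<omega>\<in>space M. badblk (D \<omega>) k c} \<in> events"
  proof (induction k arbitrary: c)
    case 0 then show ?case using D0 by simp
  next
    case (Suc k)
    let ?I = "{s. par s = c} \<times> {t. par t = c} \<inter> {(s, t). s \<noteq> t}"
    have fI: "finite ?I" using finite_par_fiber by auto
    have "{\<omega>\<in>space M. badblk (D \<omega>) (Suc k) c} =
      (\<Union>p\<in>?I. {\<omega>\<in>space M. badblk (D \<omega>) k (fst p)} \<inter> {\<omega>\<in>space M. badblk (D \<omega>) k (snd p)})"
      (is "?L = ?R")
    proof (intro equalityI subsetI)
      fix \<omega> assume "\<omega> \<in> ?L"
      then obtain s t where "\<omega> \<in> space M" "s \<noteq> t" "par s = c" "par t = c" "badblk (D \<omega>) k s" "badblk (D \<omega>) k t"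
        by auto
      then show "\<omega> \<in> ?R" by (intro UN_I[of "(s, t)"]) auto
    next
      fix \<omega> assume "\<omega> \<in> ?R"
      then show "\<omega> \<in> ?L" by fastforce
    qed
    moreover have "\<dots> \<in> events"
      by (rule sets.finite_UN[OF fI]) (rule sets.Int[OF Suc Suc])
    ultimately show ?case by simp
  qed
qed

section \<open>A hexagonal lattice and its slab\<close>

type_synonym label = "int \<times> int \<times> nat"

text \<open>A label \<open>(i, j, k)\<close> with \<open>k < 5\<close> is a node of the hexagonal lattice with subdivided edges: \<open>k = 0, 1\<close> are
the two classes of vertices, \<open>k = 2, 3, 4\<close> the three edges at the vertex \<open>(i, j, 0)\<close>. The labels with
\<open>k = 5\<close> are the unit squares that divide up the rest of the plane.\<close>

fun nbn :: "label \<Rightarrow> label set" where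
  "nbn (i, j, k) = (if k = 0 then {(i, j, 2), (i, j, 3), (i, j, 4)}
    else if k = 1 then {(i, j, 2), (i - 1, j, 3), (i, j - 1, 4)}
    else if k = 2 then {(i, j, 0), (i, j, 1)}
    else if k = 3 then {(i, j, 0), (i + 1, j, 1)}
    else if k = 4 then {(i, j, 0), (i, j + 1, 1)} else {})"

fun nbv :: "label \<Rightarrow> label set" where
  "nbv (i, j, k) = (if k = 0 then {(i, j, 1), (i + 1, j, 1), (i, j + 1, 1)}
    else if k = 1 then {(i, j, 0), (i - 1, j, 0), (i, j - 1, 0)} else {})"

text \<open>The edge is named after its end of class 0; its type records which coordinate of the
  other end differs, if any.\<close>

definition edg :: "label \<Rightarrow> label \<Rightarrow> label" where
  "edg u v = (let a = (if snd (snd u) = 0 then u else v); b = (if snd (snd u) = 0 then v else u)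
     in (fst a, fst (snd a), if fst b \<noteq> fst a then 3 else if fst (snd b) \<noteq> fst (snd a) then 4 else 2))"

definition isnode :: "label \<Rightarrow> bool" where "isnode l \<longleftrightarrow> snd (snd l) < 5"
definition isvert :: "label \<Rightarrow> bool" where "isvert l \<longleftrightarrow> snd (snd l) < 2"

text \<open>\<open>na\<close> and \<open>nb\<close> are integer planar coordinates of a node: the
  lattice has periods (2, -6) and (-2, -6), and \<open>oa\<close>, \<open>ob\<close> are the
  positions of the five nodes within a period.\<close>

definition oa :: "nat \<Rightarrow> int" where "oa k = (if k = 3 then 1 else if k = 4 then - 1 else 0)"
definition ob :: "nat \<Rightarrow> int" where "ob k = (if k = 1 then 4 else if k = 2 then 2 else if k = 3 \<or> k = 4 then - 1 else 0)"
fun na :: "label \<Rightarrow> int" where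
  "na (i, j, k) = 2 * (i - j) + oa k"
fun nb :: "label \<Rightarrow> int" where
  "nb (i, j, k) = - 6 * (i + j) + ob k"
lemma nbn_kind:
  assumes "l' \<in> nbn (i, j, k)" shows "k = 0 \<or> k = 1 \<or> k = 2 \<or> k = 3 \<or> k = 4"
  using assms by (simp split: if_split_asm)

lemma nbn_isnode:
  assumes "l' \<in> nbn l" shows "isnode l \<and> isnode l' \<and> l \<noteq> l' \<and> isvert l \<noteq> isvert l'"
proof -
  obtain i j k where l: "l = (i, j, k)" by (cases l)
  have a: "l' \<in> nbn (i, j, k)" using assms l by simp
  show ?thesis using nbn_kind[OF a] a unfolding l
    by (elim disjE) (auto simp: isnode_def isvert_def)
qed

lemma nbn_card: "finite (nbn l)" "card (nbn l) \<le> 3"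
  by (cases l; simp add: card_insert_if)+

lemma nbn_sym:
  assumes "l' \<in> nbn l" shows "l \<in> nbn l'"
proof -
  obtain i j k where l: "l = (i, j, k)" by (cases l)
  have a: "l' \<in> nbn (i, j, k)" using assms l by simp
  show ?thesis using nbn_kind[OF a] a unfolding l by (elim disjE) auto
qed

lemma nbv_cases:
  assumes "v \<in> nbv u"
  obtains i j where "u = (i, j, 0)" "v = (i, j, 1) \<or> v = (i + 1, j, 1) \<or> v = (i, j + 1, 1)"
  | i j where "v = (i, j, 0)" "u = (i, j, 1) \<or> u = (i + 1, j, 1) \<or> u = (i, j + 1, 1)"
proof -
  obtain i j k where u: "u = (i, j, k)" by (cases u)
  have k: "k = 0 \<or> k = 1" using assms unfolding u by (simp split: if_split_asm)
  then show thesis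
  proof
    assume "k = 0"
    then show thesis using that(1)[of i j] assms unfolding u by simp
  next
    assume k: "k = 1"
    then have "v = (i, j, 0) \<or> v = (i - 1, j, 0) \<or> v = (i, j - 1, 0)" using assms unfolding u by simp
    then show thesis using that(2)[of i j] that(2)[of "i - 1" j] that(2)[of i "j - 1"] k unfolding u by auto
  qed
qed

lemma nbv_props: assumes "v \<in> nbv u"
  shows "isvert u \<and> isvert v \<and> u \<noteq> v \<and> \<not> isvert (edg u v) \<and> isnode (edg u v) \<and> nbn (edg u v) = {u, v}
    \<and> edg u v = edg v u \<and> u \<in> nbv v"
  using assms
proof (cases rule: nbv_cases)
  case (1 i j)
  then show ?thesis
    by (elim disjE) (simp_all add: isvert_def isnode_def edg_def insert_commute)
next
  case (2 i j)
  then show ?thesis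
    by (elim disjE) (simp_all add: isvert_def isnode_def edg_def insert_commute)
qed

lemma nbv_edge: assumes "v \<in> nbv u"
  shows "edg u v \<in> nbn u" "edg u v \<in> nbn v" "v \<in> nbn (edg u v)" "u \<in> nbn (edg u v)"
proof -
  have n: "nbn (edg u v) = {u, v}" using nbv_props[OF assms] by blast
  show 1: "v \<in> nbn (edg u v)" "u \<in> nbn (edg u v)" unfolding n by simp_all
  show "edg u v \<in> nbn u" "edg u v \<in> nbn v" by (rule nbn_sym[OF 1(2)], rule nbn_sym[OF 1(1)])
qed

lemma lt5: "k < 5 \<Longrightarrow> k = 0 \<or> k = 1 \<or> k = 2 \<or> k = 3 \<or> k = (4::nat)"
  by linarith

text \<open>Nodes with close coordinates lie in the same or in an adjacent period, which leaves
  finitely many relative positions to be checked in \<open>far_coords\<close>.\<close>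

lemma close_coords: fixes p q c d :: int
  assumes "\<not> (2 \<le> \<bar>2*(p-q)+c\<bar> \<or> \<bar>2*(p-q)+c\<bar> = 1 \<and> 3 \<le> \<bar>d - 6*(p+q)\<bar> \<or> 2*(p-q)+c = 0 \<and> 4 \<le> \<bar>d - 6*(p+q)\<bar>)"
   and "\<bar>c\<bar> \<le> 2" "\<bar>d\<bar> \<le> 5"
 shows "(p,q) \<in> {(0,0),(0,1),(1,0),(0,-1),(-1,0)}"
proof -
  have 1: "\<bar>2*(p-q)+c\<bar> \<le> 1" "\<bar>d - 6*(p+q)\<bar> \<le> 3" using assms(1) by linarith+
  have "-1 \<le> p - q" "p - q \<le> 1" "-1 \<le> p+q" "p+q \<le> 1"
  proof -
    have "2*(p-q)+c \<le> 1" "- (2*(p-q)+c) \<le> 1" "d - 6*(p+q) \<le> 3" "- (d - 6*(p+q)) \<le> 3" "c \<le> 2" "- c \<le> 2" "d \<le> 5" "- d \<le> 5"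
      using 1 assms(2,3) by (simp_all only: abs_le_iff)
    then show "-1 \<le> p - q" "p - q \<le> 1" "-1 \<le> p+q" "p+q \<le> 1" by presburger+
  qed
  then have "-1 \<le> p" "p \<le> 1" "-1 \<le> q" "q \<le> 1" by linarith+
  then have "p = -1 \<or> p = 0 \<or> p = 1" "q = -1 \<or> q = 0 \<or> q = 1" by linarith+
  then show ?thesis using \<open>-1 \<le> p - q\<close> \<open>p - q \<le> 1\<close> \<open>-1 \<le> p+q\<close> \<open>p+q \<le> 1\<close> by auto
qed
lemma far_coords:
  assumes "isnode l" "isnode l'" "l \<noteq> l'" "l' \<notin> nbn l"
  shows "2 \<le> \<bar>na l - na l'\<bar> \<or> \<bar>na l - na l'\<bar> = 1 \<and> 3 \<le> \<bar>nb l - nb l'\<bar> \<or> na l = na l' \<and> 4 \<le> \<bar>nb l - nb l'\<bar>"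
proof (rule ccontr)
  assume n: "\<not> ?thesis"
  obtain i j k i' j' k' where l: "l = (i, j, k)" "l' = (i', j', k')" by (cases l; cases l')
  have k: "k = 0 \<or> k = 1 \<or> k = 2 \<or> k = 3 \<or> k = 4" "k' = 0 \<or> k' = 1 \<or> k' = 2 \<or> k' = 3 \<or> k' = 4"
    using assms(1,2) lt5[of k] lt5[of k'] by (auto simp: isnode_def l)
  define p q where "p = i - i'" and "q = j - j'"
  have ij: "i = i' + p" "j = j' + q" by (simp_all add: p_def q_def)
  have e: "na l - na l' = 2 * (p - q) + (oa k - oa k')" "nb l - nb l' = (ob k - ob k') - 6 * (p + q)"
    unfolding l by (simp_all add: ij)
  have n': "\<not> (2 \<le> \<bar>2 * (p - q) + (oa k - oa k')\<bar> \<or> \<bar>2 * (p - q) + (oa k - oa k')\<bar> = 1 \<and> 3 \<le> \<bar>(ob k - ob k') - 6 * (p + q)\<bar> \<or>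
      2 * (p - q) + (oa k - oa k') = 0 \<and> 4 \<le> \<bar>(ob k - ob k') - 6 * (p + q)\<bar>)"
    using n unfolding e[symmetric] by auto
  have "(p, q) \<in> {(0,0),(0,1),(1,0),(0,-1),(-1,0)}"
  proof (rule close_coords[OF n'])
    have "\<bar>oa k\<bar> \<le> 1" "\<bar>oa k'\<bar> \<le> 1" "- 1 \<le> ob k" "ob k \<le> 4" "- 1 \<le> ob k'" "ob k' \<le> 4" by (simp_all add: oa_def ob_def)
    then show "\<bar>oa k - oa k'\<bar> \<le> 2" "\<bar>ob k - ob k'\<bar> \<le> 5" by linarith+
  qed
  then have pq: "p = 0 \<and> q = 0 \<or> p = 0 \<and> q = 1 \<or> p = 1 \<and> q = 0 \<or> p = 0 \<and> q = -1 \<or> p = -1 \<and> q = 0" by simp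
  define X where "X = (2 * (p - q) + (oa k - oa k'), (ob k - ob k') - 6 * (p + q))"
  have X: "\<not> (2 \<le> \<bar>fst X\<bar> \<or> \<bar>fst X\<bar> = 1 \<and> 3 \<le> \<bar>snd X\<bar> \<or> fst X = 0 \<and> 4 \<le> \<bar>snd X\<bar>)"
    using n' unfolding X_def fst_conv snd_conv .
  have l': "l = (i' + p, j' + q, k)" unfolding l ij ..
  have "l = l' \<or> l' \<in> nbn l"
    using pq
  proof (elim disjE conjE)
    assume p: "p = 0" "q = 0"
    from k show ?thesis unfolding l' l(2) p by (elim disjE; use X in \<open>simp add: X_def p oa_def ob_def\<close>)
  next
    assume p: "p = 0" "q = 1"
    from k show ?thesis unfolding l' l(2) p by (elim disjE; use X in \<open>simp add: X_def p oa_def ob_def\<close>)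
  next
    assume p: "p = 1" "q = 0"
    from k show ?thesis unfolding l' l(2) p by (elim disjE; use X in \<open>simp add: X_def p oa_def ob_def\<close>)
  next
    assume p: "p = 0" "q = - 1"
    from k show ?thesis unfolding l' l(2) p by (elim disjE; use X in \<open>simp add: X_def p oa_def ob_def\<close>)
  next
    assume p: "p = - 1" "q = 0"
    from k show ?thesis unfolding l' l(2) p by (elim disjE; use X in \<open>simp add: X_def p oa_def ob_def\<close>)
  qed
  then show False using assms(3,4) by blast
qed

lemma near_coords:
  assumes "l' \<in> nbn l"
  shows "\<bar>na l - na l'\<bar> = 1 \<and> \<bar>nb l - nb l'\<bar> = 1 \<or> na l = na l' \<and> \<bar>nb l - nb l'\<bar> = 2"
proof -
  obtain i j k where l: "l = (i, j, k)" by (cases l)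
  have a: "l' \<in> nbn (i, j, k)" using assms l by simp
  show ?thesis using nbn_kind[OF a] a unfolding l
    by (elim disjE) (auto simp: oa_def ob_def)
qed

text \<open>The scales make all neighbours nearly equidistant: sqrt (1.05 ^ 2 + 0.607 ^ 2) is just
  above 1.2128 and 2 * 0.607 = 1.214. Other nodes are at least 2.1 apart, which is two maximal
  radii, 2.04, plus 0.06 for the positions in the squares.\<close>

definition cc :: "label \<Rightarrow> complex" where
  "cc l = Complex (105/100 * real_of_int (na l)) (607/1000 * real_of_int (nb l))"

lemma dist_cc: "(dist (cc l) (cc l'))\<^sup>2 = (105/100 * real_of_int (na l - na l'))\<^sup>2 + (607/1000 * real_of_int (nb l - nb l'))\<^sup>2"
  unfolding dist_norm cmod_power2 cc_def by (simp only: minus_complex.sel complex.sel of_int_diff right_diff_distrib)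

lemma far_cc:
  assumes "isnode l" "isnode l'" "l \<noteq> l'" "l' \<notin> nbn l"
  shows "21/10 \<le> dist (cc l) (cc l')"
proof -
  define s t where "s = real_of_int \<bar>na l - na l'\<bar>" and "t = real_of_int \<bar>nb l - nb l'\<bar>"
  have d: "(dist (cc l) (cc l'))\<^sup>2 = (105/100)\<^sup>2 * s\<^sup>2 + (607/1000)\<^sup>2 * t\<^sup>2"
    unfolding dist_cc s_def t_def power_mult_distrib by simp
  have c: "2 \<le> s \<or> s = 1 \<and> 3 \<le> t \<or> 4 \<le> t"
    using far_coords[OF assms] unfolding s_def t_def by linarith
  have nn: "0 \<le> s * s" "0 \<le> t * t" by simp_all
  have d': "(dist (cc l) (cc l'))\<^sup>2 = 11025/10000 * (s * s) + 368449/1000000 * (t * t)"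
    unfolding d by (simp add: power2_eq_square)
  have "441/100 \<le> (dist (cc l) (cc l'))\<^sup>2"
  proof -
    consider "2 \<le> s" | "s = 1" "3 \<le> t" | "4 \<le> t" using c by blast
    then show ?thesis
    proof cases
      case 1
      then have "2 * 2 \<le> s * s" by (intro mult_mono) auto
      then show ?thesis unfolding d' using nn by linarith
    next
      case 2
      then have "3 * 3 \<le> t * t" by (intro mult_mono) auto
      moreover have "s * s = 1" using 2 by simp
      ultimately show ?thesis unfolding d' by linarith
    next
      case 3
      then have "4 * 4 \<le> t * t" by (intro mult_mono) auto
      then show ?thesis unfolding d' using nn by linarith
    qed
  qed
  then have "(21/10)\<^sup>2 \<le> (dist (cc l) (cc l'))\<^sup>2" by (simp add: power2_eq_square)
  then show ?thesis by (rule power2_le_imp_le) simp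
qed

lemma near_cc:
  assumes "l' \<in> nbn l"
  shows "(12128/10000)\<^sup>2 \<le> (dist (cc l) (cc l'))\<^sup>2" "(dist (cc l) (cc l'))\<^sup>2 \<le> (1214/1000)\<^sup>2"
proof -
  define s t where "s = real_of_int \<bar>na l - na l'\<bar>" and "t = real_of_int \<bar>nb l - nb l'\<bar>"
  have d: "(dist (cc l) (cc l'))\<^sup>2 = (105/100)\<^sup>2 * s\<^sup>2 + (607/1000)\<^sup>2 * t\<^sup>2"
    unfolding dist_cc s_def t_def power_mult_distrib by simp
  have "s = 1 \<and> t = 1 \<or> s = 0 \<and> t = 2"
    using near_coords[OF assms] unfolding s_def t_def by auto
  then show "(12128/10000)\<^sup>2 \<le> (dist (cc l) (cc l'))\<^sup>2" "(dist (cc l) (cc l'))\<^sup>2 \<le> (1214/1000)\<^sup>2"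
    unfolding d by (auto simp: power2_eq_square)
qed

lemma far_or_near_cc: "isnode l \<Longrightarrow> isnode l' \<Longrightarrow> l \<noteq> l' \<Longrightarrow> 12128/10000 \<le> dist (cc l) (cc l')"
  using far_cc[of l l'] power2_le_imp_le[OF near_cc(1)[of l' l]] by fastforce

locale slab = plane b1 b2 for b1 b2 :: "'a::euclidean_space" +
  fixes \<rho> lam :: real
  assumes rho0: "0 < \<rho>" and lam0: "0 < lam"
    and lam_ball: "lam * measure lborel (ball (0::'a) (51/50)) \<le> 11/100000"
    and lam_cell: "\<And>c c' x r. (12128/10000)\<^sup>2 \<le> ((c' - c) \<bullet> b1)\<^sup>2 + ((c' - c) \<bullet> b2)\<^sup>2 \<Longrightarrow>
      ((c' - c) \<bullet> b1)\<^sup>2 + ((c' - c) \<bullet> b2)\<^sup>2 \<le> (1214/1000)\<^sup>2 \<Longrightarrow> nT (c' - c) = 0 \<Longrightarrow> x \<in> cell \<rho> c \<Longrightarrow>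
      49/50 \<le> r \<Longrightarrow> r \<le> 51/50 \<Longrightarrow>
      16 \<le> lam * measure lborel {y\<in>cell \<rho> c'. 49/50 \<le> dist x y - r \<and> dist x y - r \<le> 51/50}"
begin

definition Pr :: "'a \<Rightarrow> complex" where "Pr y = Complex (y \<bullet> b1) (y \<bullet> b2)"

definition ctr :: "label \<Rightarrow> 'a" where
  "ctr l = (105/100 * real_of_int (na l)) *\<^sub>R b1 + (607/1000 * real_of_int (nb l)) *\<^sub>R b2"

definition Qn :: "label \<Rightarrow> 'a set" where "Qn l = (if isnode l then cell \<rho> (ctr l) else {})"

text \<open>The margin 3 beyond the cells exceeds two maximal radii, so that spheres in different
  translates stay apart. Half-open sides make the translates tile space.\<close>

definition strip :: "'a set" where "strip = {y. \<forall>b\<in>rest. - (\<rho> + 3) \<le> y \<bullet> b \<and> y \<bullet> b < \<rho> + 3}"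

definition near :: "label \<Rightarrow> 'a \<Rightarrow> bool" where "near l y \<longleftrightarrow> dist (Pr y) (cc l) < 105/100"

text \<open>A partition of the strip with priority to vertices. Since 1.05 = 1.02 + 0.03, everything
  in the strip that a sphere at a vertex can reach lies in the block of that vertex; a sphere at an
  edge node can reach only its own block and those of its two ends, because discs of radius 1.05
  around non-neighbours are disjoint.\<close>

definition Yb :: "label \<Rightarrow> 'a set" where
  "Yb l = {y\<in>strip. if isvert l then near l y
     else if isnode l then near l y \<and> (\<forall>v. isvert v \<longrightarrow> \<not> near v y)
     else snd (snd l) = 5 \<and> fst l = \<lfloor>y \<bullet> b1\<rfloor> \<and> fst (snd l) = \<lfloor>y \<bullet> b2\<rfloor> \<and> (\<forall>v. isnode v \<longrightarrow> \<not> near v y)}"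

lemma b_inner [simp]: "b1 \<bullet> b1 = 1" "b2 \<bullet> b2 = 1" "b1 \<bullet> b2 = 0" "b2 \<bullet> b1 = 0"
  using b12 by (simp_all add: inner_Basis)

lemma Pr_ctr [simp]: "Pr (ctr l) = cc l"
  by (simp add: Pr_def ctr_def cc_def inner_add_left)

lemma ctr_rest: "b \<in> rest \<Longrightarrow> ctr l \<bullet> b = 0"
  using b12 rest(2,3,6) by (auto simp: ctr_def inner_add_left inner_Basis subset_iff)

lemma Pr_dist2: "(dist (Pr x) (Pr y))\<^sup>2 = ((x - y) \<bullet> b1)\<^sup>2 + ((x - y) \<bullet> b2)\<^sup>2"
  unfolding dist_norm cmod_power2 Pr_def by (simp add: inner_diff_left)

lemma Pr_dist: "dist (Pr x) (Pr y) \<le> dist x y"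
proof (rule power2_le_imp_le)
  show "(dist (Pr x) (Pr y))\<^sup>2 \<le> (dist x y)\<^sup>2"
    unfolding Pr_dist2 using norm_split[of "x - y"] nT_nonneg[of "x - y"] by (simp add: dist_norm)
qed simp

lemma Qn_near: "x \<in> Qn l \<Longrightarrow> dist (Pr x) (cc l) \<le> 3/100"
proof (rule power2_le_imp_le)
  assume "x \<in> Qn l"
  then have "\<bar>(x - ctr l) \<bullet> b1\<bar> \<le> hs" "\<bar>(x - ctr l) \<bullet> b2\<bar> \<le> hs" by (auto simp: Qn_def cell_def split: if_splits)
  then have "((x - ctr l) \<bullet> b1)\<^sup>2 \<le> hs\<^sup>2" "((x - ctr l) \<bullet> b2)\<^sup>2 \<le> hs\<^sup>2"
    by (simp_all add: abs_le_square_iff[symmetric] hs_def)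
  then show "(dist (Pr x) (cc l))\<^sup>2 \<le> (3/100)\<^sup>2"
    unfolding Pr_ctr[symmetric] Pr_dist2 by (simp add: hs_def power2_eq_square)
qed simp

lemma Qn_rest: assumes "x \<in> Qn l" "b \<in> rest" shows "\<bar>x \<bullet> b\<bar> \<le> \<rho>"
proof -
  have "nT (x - ctr l) \<le> \<rho>\<^sup>2" using assms(1) by (auto simp: Qn_def cell_def split: if_splits)
  moreover have "((x - ctr l) \<bullet> b)\<^sup>2 \<le> nT (x - ctr l)"
    unfolding nT_def using assms(2) rest(1) by (intro member_le_sum) auto
  ultimately have "(x \<bullet> b)\<^sup>2 \<le> \<rho>\<^sup>2" using ctr_rest[OF assms(2)] by (simp add: inner_diff_left)
  then show ?thesis using rho0 abs_le_square_iff[of "x \<bullet> b" \<rho>] by simp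
qed

lemma Qn_node: "x \<in> Qn l \<Longrightarrow> isnode l" by (simp add: Qn_def split: if_splits)

lemma near_unique:
  assumes "near l y" "near l' y" "isnode l" "isnode l'" "l \<noteq> l'"
  shows "l' \<in> nbn l"
proof (rule ccontr)
  assume "l' \<notin> nbn l"
  from far_cc[OF assms(3,4,5) this] show False
    using assms(1,2) dist_triangle[of "cc l" "cc l'" "Pr y"] by (simp add: near_def dist_commute)
qed

lemma Qn_Yb: "Qn l \<subseteq> Yb l"
proof
  fix x assume x: "x \<in> Qn l"
  have n: "isnode l" by (rule Qn_node[OF x])
  have d: "dist (Pr x) (cc l) \<le> 3/100" by (rule Qn_near[OF x])
  have s: "x \<in> strip" unfolding strip_def using Qn_rest[OF x] by force
  have "\<not> near v x" if "isvert v" "\<not> isvert l" for v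
  proof -
    have "12128/10000 \<le> dist (cc l) (cc v)"
      using that n by (intro far_or_near_cc) (auto simp: isvert_def isnode_def)
    then show ?thesis using d dist_triangle[of "cc l" "cc v" "Pr x"] by (simp add: near_def dist_commute)
  qed
  then show "x \<in> Yb l" using s d n by (auto simp: Yb_def near_def)
qed

lemma Yb_disjoint:
  assumes "y \<in> Yb l" "y \<in> Yb l'" shows "l = l'"
proof (rule ccontr)
  assume ne: "l \<noteq> l'"
  have vn: "isvert v \<Longrightarrow> isnode v" for v by (simp add: isvert_def isnode_def)
  consider "isnode l" "isnode l'" | "isnode l" "\<not> isnode l'" | "\<not> isnode l" "isnode l'" | "\<not> isnode l" "\<not> isnode l'" by blast
  then show False
  proof cases
    case 1
    have n: "near l y" "near l' y" using assms 1 by (auto simp: Yb_def split: if_splits)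
    have "isvert l \<noteq> isvert l'" using near_unique[OF n 1 ne] nbn_isnode by blast
    then show False using assms n 1 by (auto simp: Yb_def split: if_splits)
  next
    case 4
    then have "l = (\<lfloor>y \<bullet> b1\<rfloor>, \<lfloor>y \<bullet> b2\<rfloor>, 5)" "l' = (\<lfloor>y \<bullet> b1\<rfloor>, \<lfloor>y \<bullet> b2\<rfloor>, 5)"
      using assms vn by (auto simp: Yb_def prod_eq_iff split: if_splits)
    then show False using ne by simp
  next
    case 2
    have "near l y" using assms(1) 2(1) by (auto simp: Yb_def split: if_splits)
    moreover have "\<forall>v. isnode v \<longrightarrow> \<not> near v y" using assms(2) 2(2) vn[of l'] by (auto simp: Yb_def split: if_splits)
    ultimately show False using 2(1) by blast
  next
    case 3
    have "near l' y" using assms(2) 3(2) by (auto simp: Yb_def split: if_splits)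
    moreover have "\<forall>v. isnode v \<longrightarrow> \<not> near v y" using assms(1) 3(1) vn[of l] by (auto simp: Yb_def split: if_splits)
    ultimately show False using 3(2) by blast
  qed
qed

lemma Yb_cover: assumes "y \<in> strip" shows "\<exists>l. y \<in> Yb l"
proof -
  have vn: "isvert v \<Longrightarrow> isnode v" for v by (simp add: isvert_def isnode_def)
  consider v where "isvert v" "near v y" | v where "isnode v" "near v y" "\<not> (\<exists>v. isvert v \<and> near v y)" | "\<not> (\<exists>v. isnode v \<and> near v y)"
    using vn by blast
  then show ?thesis
  proof cases
    case 1 then show ?thesis using assms by (intro exI[of _ v]) (simp add: Yb_def)
  next
    case 2 then show ?thesis using assms by (intro exI[of _ v]) (auto simp: Yb_def)
  next
    case 3 then show ?thesis using assms vn
      by (intro exI[of _ "(\<lfloor>y \<bullet> b1\<rfloor>, \<lfloor>y \<bullet> b2\<rfloor>, 5)"]) (auto simp: Yb_def isnode_def isvert_def)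
  qed
qed

lemma Yb_strip: "Yb l \<subseteq> strip" by (auto simp: Yb_def)

lemma near_vertex:
  assumes x: "x \<in> Qn v" "isvert v" and y: "y \<in> strip" "dist x y < 51/50"
  shows "y \<in> Yb v"
proof -
  have "dist (Pr y) (cc v) < 105/100"
    using Qn_near[OF x(1)] Pr_dist[of x y] y(2) dist_triangle[of "Pr y" "cc v" "Pr x"] by (simp add: dist_commute)
  then show ?thesis using x(2) y(1) by (simp add: Yb_def near_def)
qed

lemma near_edge:
  assumes x: "x \<in> Qn e" "\<not> isvert e" and y: "y \<in> strip" "dist x y < 51/50" "y \<in> Yb l"
  shows "l = e \<or> l \<in> nbn e"
proof -
  have n: "near e y"
    using Qn_near[OF x(1)] Pr_dist[of x y] y(2) dist_triangle[of "Pr y" "cc e" "Pr x"] by (simp add: dist_commute near_def)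
  have en: "isnode e" by (rule Qn_node[OF x(1)])
  have "isnode l \<and> near l y" using y(3) n en by (auto simp: Yb_def isvert_def isnode_def split: if_splits)
  then show ?thesis using near_unique[OF n _ en, of l] by auto
qed

lemma Qn_far:
  assumes "x \<in> Qn l" "y \<in> Qn l'" "l \<noteq> l'" "l' \<notin> nbn l"
  shows "204/100 \<le> dist x y"
proof -
  have "21/10 \<le> dist (cc l) (cc l')" by (rule far_cc[OF Qn_node[OF assms(1)] Qn_node[OF assms(2)] assms(3,4)])
  moreover have "dist (cc l) (cc l') \<le> dist (cc l) (Pr x) + dist (Pr x) (Pr y) + dist (Pr y) (cc l')"
    using dist_triangle[of "cc l" "cc l'" "Pr x"] dist_triangle[of "Pr x" "cc l'" "Pr y"] by simp
  ultimately show ?thesis using Qn_near[OF assms(1)] Qn_near[OF assms(2)] Pr_dist[of x y] by (simp add: dist_commute)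
qed

lemma Pr_measurable [measurable]: "Pr \<in> borel_measurable borel"
proof (rule borel_measurable_continuous_onI)
  have "Pr = (\<lambda>y. complex_of_real (y \<bullet> b1) + \<i> * complex_of_real (y \<bullet> b2))"
    by (simp add: Pr_def fun_eq_iff Complex_eq)
  then show "continuous_on UNIV Pr" by (simp add: continuous_intros)
qed

lemma near_borel [measurable]: "Measurable.pred borel (near l)"
  unfolding near_def by measurable

lemma strip_borel [measurable]: "strip \<in> sets borel"
proof -
  have "Measurable.pred borel (\<lambda>y. \<forall>b\<in>rest. - (\<rho> + 3) \<le> y \<bullet> b \<and> y \<bullet> b < \<rho> + 3)"
    by (intro pred_intros_finite rest) measurable
  then show ?thesis by (simp add: strip_def pred_def)
qed

lemma Yb_borel [measurable]: "Yb l \<in> sets borel"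
proof -
  have "Measurable.pred borel (\<lambda>y. y \<in> Yb l)"
    unfolding Yb_def mem_Collect_eq by measurable
  then show ?thesis by (simp add: pred_def)
qed

lemma strip_bounded: "bounded (strip \<inter> {y. \<bar>y \<bullet> b1\<bar> \<le> K \<and> \<bar>y \<bullet> b2\<bar> \<le> K})"
proof (rule boundedI[of _ "\<Sum>b\<in>(Basis::'a set). \<bar>\<rho>\<bar> + 3 + \<bar>K\<bar>"])
  fix y assume y: "y \<in> strip \<inter> {y. \<bar>y \<bullet> b1\<bar> \<le> K \<and> \<bar>y \<bullet> b2\<bar> \<le> K}"
  have "norm y \<le> (\<Sum>b\<in>Basis. \<bar>y \<bullet> b\<bar>)" by (rule norm_le_l1)
  also have "\<dots> \<le> (\<Sum>b\<in>(Basis::'a set). \<bar>\<rho>\<bar> + 3 + \<bar>K\<bar>)"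
  proof (rule sum_mono)
    fix b :: 'a assume "b \<in> Basis"
    then consider "b = b1" | "b = b2" | "b \<in> rest" unfolding rest_def by blast
    then show "\<bar>y \<bullet> b\<bar> \<le> \<bar>\<rho>\<bar> + 3 + \<bar>K\<bar>"
    proof cases
      case 3
      then have "- (\<rho> + 3) \<le> y \<bullet> b \<and> y \<bullet> b < \<rho> + 3" using y by (simp add: strip_def)
      then show ?thesis by linarith
    qed (use y in \<open>auto\<close>)
  qed
  finally show "norm y \<le> (\<Sum>b\<in>(Basis::'a set). \<bar>\<rho>\<bar> + 3 + \<bar>K\<bar>)" .
qed

lemma Yb_Pr:
  assumes "y \<in> Yb l"
  shows "isnode l \<Longrightarrow> dist (Pr y) (cc l) < 105/100"
    and "\<not> isnode l \<Longrightarrow> l = (\<lfloor>y \<bullet> b1\<rfloor>, \<lfloor>y \<bullet> b2\<rfloor>, 5)"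
  using assms by (auto simp: Yb_def near_def prod_eq_iff isvert_def isnode_def split: if_splits)

definition lbox :: "nat \<Rightarrow> label set" where
  "lbox n = {- int n..int n} \<times> {- int n..int n} \<times> {0..5}"

lemma lbox_finite: "finite (lbox n)" by (simp add: lbox_def)

lemma node_coord_bound:
  assumes "isnode (i, j, k)" "\<bar>na (i, j, k)\<bar> \<le> M" "\<bar>nb (i, j, k)\<bar> \<le> M"
  shows "\<bar>i\<bar> \<le> M + 2" "\<bar>j\<bar> \<le> M + 2"
  using assms by (auto simp: isnode_def oa_def ob_def abs_le_iff split: if_splits)

lemma Yb_lbox:
  assumes y: "y \<in> Yb l" "norm y \<le> real n"
  shows "l \<in> lbox (4 * n + 12)"
proof (cases "isnode l")
  case True
  have b: "\<bar>y \<bullet> b1\<bar> \<le> real n" "\<bar>y \<bullet> b2\<bar> \<le> real n" using b12 Basis_le_norm y(2) order_trans by blast+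
  have d: "cmod (Pr y - cc l) < 105/100" using Yb_Pr(1)[OF y(1) True] by (simp add: dist_norm)
  have "\<bar>y \<bullet> b1 - 105/100 * real_of_int (na l)\<bar> < 105/100" "\<bar>y \<bullet> b2 - 607/1000 * real_of_int (nb l)\<bar> < 105/100"
    using abs_Re_le_cmod[of "Pr y - cc l"] abs_Im_le_cmod[of "Pr y - cc l"] d by (simp_all add: Pr_def cc_def)
  then have "\<bar>real_of_int (na l)\<bar> \<le> real n + 2" "\<bar>real_of_int (nb l)\<bar> \<le> 2 * real n + 2" using b by linarith+
  then have c: "\<bar>na l\<bar> \<le> 2 * int n + 2" "\<bar>nb l\<bar> \<le> 2 * int n + 2" by linarith+
  obtain i j k where l: "l = (i, j, k)" by (cases l)
  have "\<bar>i\<bar> \<le> 2 * int n + 2 + 2" "\<bar>j\<bar> \<le> 2 * int n + 2 + 2" using node_coord_bound[of i j k "2 * int n + 2"] True c unfolding l by blast+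
  then show ?thesis using True unfolding l by (auto simp: lbox_def isnode_def)
next
  case False
  have b: "\<bar>y \<bullet> b1\<bar> \<le> real n" "\<bar>y \<bullet> b2\<bar> \<le> real n" using b12 Basis_le_norm y(2) order_trans by blast+
  then have "\<bar>\<lfloor>y \<bullet> b1\<rfloor>\<bar> \<le> int n + 1" "\<bar>\<lfloor>y \<bullet> b2\<rfloor>\<bar> \<le> int n + 1" by linarith+
  then show ?thesis unfolding Yb_Pr(2)[OF y(1) False] by (auto simp: lbox_def)
qed

lemma Yb_bounded: "bounded (Yb l)"
proof (rule bounded_subset[OF strip_bounded])
  define K where "K = norm (cc l) + 105/100 + \<bar>real_of_int (fst l)\<bar> + \<bar>real_of_int (fst (snd l))\<bar> + 1"
  show "Yb l \<subseteq> strip \<inter> {y. \<bar>y \<bullet> b1\<bar> \<le> K \<and> \<bar>y \<bullet> b2\<bar> \<le> K}"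
  proof
    fix y assume y: "y \<in> Yb l"
    have "\<bar>y \<bullet> b1\<bar> \<le> K \<and> \<bar>y \<bullet> b2\<bar> \<le> K"
    proof (cases "isnode l")
      case True
      have "cmod (Pr y) \<le> cmod (cc l) + dist (Pr y) (cc l)" using norm_triangle_ineq[of "cc l" "Pr y - cc l"] by (simp add: dist_norm)
      moreover have "\<bar>y \<bullet> b1\<bar> \<le> cmod (Pr y)" "\<bar>y \<bullet> b2\<bar> \<le> cmod (Pr y)"
        using abs_Re_le_cmod[of "Pr y"] abs_Im_le_cmod[of "Pr y"] by (simp_all add: Pr_def)
      ultimately show ?thesis using Yb_Pr(1)[OF y True] unfolding K_def by linarith
    next
      case False
      have "fst l = \<lfloor>y \<bullet> b1\<rfloor>" "fst (snd l) = \<lfloor>y \<bullet> b2\<rfloor>" using Yb_Pr(2)[OF y False] by simp_all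
      then have "\<bar>y \<bullet> b1\<bar> \<le> \<bar>real_of_int (fst l)\<bar> + 1" "\<bar>y \<bullet> b2\<bar> \<le> \<bar>real_of_int (fst (snd l))\<bar> + 1" by linarith+
      then show ?thesis unfolding K_def using norm_ge_zero[of "cc l"] by linarith
    qed
    then show "y \<in> strip \<inter> {y. \<bar>y \<bullet> b1\<bar> \<le> K \<and> \<bar>y \<bullet> b2\<bar> \<le> K}" using y subsetD[OF Yb_strip y] by simp
  qed
qed

text \<open>The point mass is a dummy law for null blocks; their mean number of points
  \<open>mb\<close> is 0.\<close>

definition Ub :: "label \<Rightarrow> 'a measure" where
  "Ub l = (if emeasure lborel (Yb l) = 0 then return borel 0 else uniform_measure lborel (Yb l))"

definition mb :: "label \<Rightarrow> real" where "mb l = lam * measure lborel (Yb l)"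

lemma Yb_finite: "emeasure lborel (Yb l) < \<infinity>" by (rule emeasure_bounded_finite[OF Yb_bounded])

lemma Ub_sets: "sets (Ub l) = sets borel" by (simp add: Ub_def)

lemma Ub_prob: "prob_space (Ub l)"
  unfolding Ub_def using Yb_finite[of l] by (auto intro!: prob_space_return prob_space_uniform_measure)

lemma Ub_emeasure:
  assumes "A \<in> sets borel"
  shows "ennreal (mb l) * emeasure (Ub l) A = ennreal lam * emeasure lborel (A \<inter> Yb l)"
proof (cases "emeasure lborel (Yb l) = 0")
  case True
  have "emeasure lborel (A \<inter> Yb l) \<le> emeasure lborel (Yb l)" by (intro emeasure_mono) auto
  then show ?thesis using True by (simp add: mb_def measure_def)
next
  case False
  have "ennreal (mb l) = ennreal lam * emeasure lborel (Yb l)"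
    using lam0 Yb_finite[of l] measure_nonneg[of lborel "Yb l"] unfolding mb_def
    by (subst emeasure_eq_ennreal_measure) (auto simp: ennreal_mult)
  moreover have "emeasure (Ub l) A = emeasure lborel (Yb l \<inter> A) / emeasure lborel (Yb l)"
    unfolding Ub_def using False assms by simp
  moreover have "emeasure lborel (Yb l) * (emeasure lborel (Yb l \<inter> A) / emeasure lborel (Yb l)) = emeasure lborel (Yb l \<inter> A)"
    using False Yb_finite[of l] by (simp add: ennreal_times_divide mult.commute[of "emeasure lborel (Yb l)"] mult_divide_eq_ennreal)
  ultimately show ?thesis by (simp add: mult.assoc Int_commute)
qed

lemma mb_nonneg: "0 \<le> mb l"
  unfolding mb_def using lam0 measure_nonneg[of lborel "Yb l"] by (intro mult_nonneg_nonneg) auto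

lemma Ub_measure:
  assumes "A \<in> sets borel"
  shows "mb l * measure (Ub l) A = lam * measure lborel (A \<inter> Yb l)"
proof -
  interpret prob_space "Ub l" by (rule Ub_prob)
  have f: "emeasure lborel (A \<inter> Yb l) = ennreal (measure lborel (A \<inter> Yb l))"
    using emeasure_bounded_finite[OF bounded_subset[OF Yb_bounded[of l] Int_lower2[of A]]]
    by (intro emeasure_eq_ennreal_measure) simp
  have "ennreal (mb l * prob A) = ennreal (lam * measure lborel (A \<inter> Yb l))"
    using Ub_emeasure[OF assms, of l] lam0 mb_nonneg[of l] measure_nonneg[of "Ub l" A] measure_nonneg[of lborel "A \<inter> Yb l"]
    unfolding f emeasure_eq_measure by (simp add: ennreal_mult)
  moreover have "0 \<le> lam * measure lborel (A \<inter> Yb l)" "0 \<le> mb l * prob A"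
    using lam0 mb_nonneg measure_nonneg[of lborel "A \<inter> Yb l"] by (intro mult_nonneg_nonneg; simp)+
  ultimately show ?thesis by (metis ennreal_inj)
qed

lemma Qn_borel: "Qn l \<in> sets borel" and Qn_bounded: "bounded (Qn l)"
  using cell_closed cell_bounded by (auto simp: Qn_def)

lemma cand16:
  assumes "v \<in> nbn u" "x \<in> Qn u" "49/50 \<le> r" "r \<le> 51/50"
  shows "16 \<le> lam * measure lborel {y\<in>Qn v. 49/50 \<le> dist x y - r \<and> dist x y - r \<le> 51/50}"
proof -
  have n: "isnode u" "isnode v" using nbn_isnode[OF assms(1)] by auto
  have d: "((ctr v - ctr u) \<bullet> b1)\<^sup>2 + ((ctr v - ctr u) \<bullet> b2)\<^sup>2 = (dist (cc u) (cc v))\<^sup>2"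
    using Pr_dist2[of "ctr v" "ctr u"] by (simp add: dist_commute)
  have "nT (ctr v - ctr u) = 0" unfolding nT_def by (intro sum.neutral) (simp add: inner_diff_left ctr_rest)
  then show ?thesis
    using lam_cell[of "ctr v" "ctr u" x r] near_cc[OF assms(1)] assms(2-4) n unfolding d Qn_def by simp
qed

sublocale tp: tree_process Ub mb nbn Qn "(0, 0, 0)" "49/50" "51/50" lam 16 "11/100000"
proof (rule tree_process.intro, goal_cases)
  case (1 l) show ?case by (rule Ub_prob)
next
  case (2 l) show ?case by (rule Ub_sets)
next
  case (3 l) show ?case by (rule mb_nonneg)
next
  case (4 A l)
  then show ?case unfolding Ub_emeasure[OF 4] by (intro mult_left_mono emeasure_mono) auto
next
  case (5 A l)
  then have "A \<inter> Yb l = A" using Qn_Yb by blast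
  then show ?case using Ub_measure[OF 5(1), of l] by simp
next
  case (6 l) show ?case by (rule Qn_borel)
next
  case (7 l) show ?case by (rule Qn_bounded)
next
  case 12 show ?case by (rule lam_ball)
next
  case (14 v u x r) then show ?case by (rule cand16)
next
  case 15
  \<comment> \<open>The root cell contains the candidate region seen from the neighbouring node (0,
    0, 2), so its mass is bounded by \<open>cand16\<close>.\<close>
  define x where "x = ctr (0, 0, 2)"
  have x: "x \<in> Qn (0, 0, 2)" unfolding x_def Qn_def cell_def by (simp add: isnode_def hs_def nT_def)
  have n: "(0, 0, 0) \<in> nbn (0, 0, 2)" by simp
  have "16 \<le> lam * measure lborel {y\<in>Qn (0, 0, 0). 49/50 \<le> dist x y - 1 \<and> dist x y - 1 \<le> 51/50}"
    by (rule cand16[OF n x]) auto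
  also have "\<dots> \<le> lam * measure lborel (Qn (0, 0, 0))"
  proof (intro mult_left_mono measure_mono_fmeasurable)
    show "Qn (0, 0, 0) \<in> fmeasurable lborel"
      using Qn_borel emeasure_bounded_finite[OF Qn_bounded] by (simp add: fmeasurable_def)
    have "{y\<in>Qn (0, 0, 0). 49/50 \<le> dist x y - 1 \<and> dist x y - 1 \<le> 51/50} \<in> sets borel"
    proof -
      have "{y\<in>Qn (0, 0, 0). 49/50 \<le> dist x y - 1 \<and> dist x y - 1 \<le> 51/50} =
        Qn (0, 0, 0) \<inter> {y. 49/50 \<le> dist x y - 1} \<inter> {y. dist x y - 1 \<le> 51/50}" by auto
      then show ?thesis using Qn_borel by simp
    qed
    then show "{y\<in>Qn (0, 0, 0). 49/50 \<le> dist x y - 1 \<and> dist x y - 1 \<le> 51/50} \<in> sets lborel" by simp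
  qed (use lam0 in auto)
  finally show ?case .
qed (use lam0 nbn_card in auto)

end

declare split_paired_All [simp] split_paired_Ex [simp]

section \<open>Percolation in one slab\<close>

text \<open>Passes from a path of vertices to the path of all nodes, most recent first: the
  exploration decides about vertices, each of which costs two node steps.\<close>

fun ex :: "label list \<Rightarrow> label list" where
  "ex [] = []"
| "ex [v] = [v]"
| "ex (v # u # p) = v # edg u v # ex (u # p)"

lemma ex_ne: "p \<noteq> [] \<Longrightarrow> ex p \<noteq> [] \<and> hd (ex p) = hd p"
  by (cases p rule: ex.cases) auto

lemma vpath_isvert: "vpath nbv (0, 0, 0) p \<Longrightarrow> v \<in> set p \<Longrightarrow> isvert v"
proof (induction p arbitrary: v rule: induct_list012)
  case (2 x)
  then show ?case by (simp add: isvert_def)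
next
  case (3 x y zs)
  have "vpath nbv (0, 0, 0) (y # zs)" "x \<in> nbv y" using 3(3) by auto
  then show ?case using 3(2)[of v] 3(4) nbv_props[of x y] by auto
qed simp

lemma set_ex:
  assumes "vpath nbv (0, 0, 0) p" "l \<in> set (ex p)"
  shows "l \<in> set p \<or> (\<exists>u v. u \<in> set p \<and> v \<in> set p \<and> v \<in> nbv u \<and> l = edg u v)"
  using assms
proof (induction p rule: induct_list012)
  case (3 x y zs)
  have p: "vpath nbv (0, 0, 0) (y # zs)" "x \<in> nbv y" using 3(3) by auto
  have "l = x \<or> l = edg y x \<or> l \<in> set (ex (y # zs))" using 3(4) by simp
  then show ?case
  proof (elim disjE)
    assume "l = edg y x"
    then show ?thesis using p(2) by (intro disjI2 exI[of _ y] exI[of _ x]) simp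
  next
    assume "l \<in> set (ex (y # zs))"
    from 3(2)[OF p(1) this] show ?thesis
    proof
      assume "\<exists>u v. u \<in> set (y # zs) \<and> v \<in> set (y # zs) \<and> v \<in> nbv u \<and> l = edg u v"
      then obtain u v where "u \<in> set (y # zs)" "v \<in> set (y # zs)" "v \<in> nbv u" "l = edg u v" by blast
      then show ?thesis by (intro disjI2 exI[of _ u] exI[of _ v]) simp
    qed simp
  qed simp
qed auto

text \<open>An edge node is read only when both its ends are on the path, so a new vertex comes with
  its incident edge nodes unread.\<close>

lemma fresh_ex:
  assumes "vpath nbv (0, 0, 0) p" "isvert v" "v \<notin> set p"
  shows "v \<notin> set (ex p)" "e \<in> nbn v \<Longrightarrow> e \<notin> set (ex p)"
proof -
  have edge: "\<not> isvert l \<and> nbn l \<subseteq> set p" if l: "l \<in> set (ex p)" "l \<notin> set p" for l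
  proof -
    obtain u v where e: "u \<in> set p" "v \<in> set p" "v \<in> nbv u" "l = edg u v" using set_ex[OF assms(1) l(1)] l(2) by blast
    have "\<not> isvert (edg u v)" "nbn (edg u v) = {u, v}" using nbv_props[OF e(3)] by blast+
    then show ?thesis using e(1,2) unfolding e(4) by simp
  qed
  show "v \<notin> set (ex p)" using edge[of v] assms(2,3) by blast
  assume e: "e \<in> nbn v"
  show "e \<notin> set (ex p)"
  proof
    assume "e \<in> set (ex p)"
    moreover have "e \<notin> set p" using vpath_isvert[OF assms(1), of e] nbn_isnode[OF e] assms(2) by blast
    ultimately have "nbn e \<subseteq> set p" using edge by blast
    then show False using nbn_sym[OF e] assms(3) by blast
  qed
qed

context slab
begin

text \<open>The randomness attached to a vertex consists of its block and those of its edge nodes;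
  not seeing it means invariance under resampling these blocks. Labels that are not vertices never
  occur on a path and carry no condition.\<close>

definition Gv :: "label \<Rightarrow> (label \<Rightarrow> 'a sample) set set" where
  "Gv v = {E\<in>sets tp.Om. isvert v \<longrightarrow> (\<forall>l\<in>insert v (nbn v). \<forall>w\<in>space tp.Om. \<forall>s\<in>space (tp.B l). fun_upd w l s \<in> E \<longleftrightarrow> w \<in> E)}"

lemma upd_space: "w \<in> space tp.Om \<Longrightarrow> s \<in> space (tp.B l) \<Longrightarrow> fun_upd w l s \<in> space tp.Om"
  by (auto simp: space_PiM PiE_def)

lemma okn_event: "p \<noteq> [] \<Longrightarrow> {w\<in>space tp.Om. tp.okn p w} \<in> sets tp.Om"
  using tp.st_measurable[of p] by (simp add: pred_def)

lemma okn_upd: "l \<notin> set p \<Longrightarrow> tp.okn p (fun_upd w l s) = tp.okn p w"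
  unfolding tp.okn_def using tp.st_agree[of p "fun_upd w l s" w] by (metis fun_upd_other)

lemma vpath_ne: "vpath nbv r p \<Longrightarrow> p \<noteq> []" by auto

text \<open>Uses e >= 5/2, and 2.5 ^ -8 + 8 * 11/100000 < 0.001536. This meets the threshold 162 *
  (2 * epsn) <= 1/2 of the block argument.\<close>

lemma epsn_le: "tp.epsn \<le> 1536 / 1000000"
proof -
  have "(5/2) ^ 8 \<le> (exp 1 :: real) ^ 8"
    using exp_lower_Taylor_quadratic[of 1] by (intro power_mono) auto
  also have "\<dots> = exp 8" by (simp add: exp_of_nat_mult[symmetric])
  finally have "exp (- 8 :: real) \<le> 1 / (5/2) ^ 8" by (simp add: exp_minus field_simps)
  then show ?thesis by (simp add: tp.epsn_def power_divide)
qed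

lemma eps2: "0 \<le> 2 * tp.epsn" by (rule mult_nonneg_nonneg[OF _ tp.epsn0]) simp

text \<open>Reaching the next vertex takes the edge node and then the vertex, the latter on the
  event that the edge succeeded; the two failure bounds add up to 2 * epsn.\<close>

sublocale xp: exploration tp.Om nbv "(0, 0, 0)" "\<lambda>p. tp.okn (ex p)" Gv "2 * tp.epsn"
proof (unfold_locales, goal_cases)
  case (1 E v) then show ?case by (simp add: Gv_def)
next
  case (2 E v E') then show ?case using upd_space by (auto simp: Gv_def)
next
  case (3 v) show ?case by (simp add: Gv_def)
next
  case (4 p v)
  have "ex p \<noteq> []" using ex_ne vpath_ne[OF 4(1)] by blast
  moreover have "tp.okn (ex p) (fun_upd w l s) = tp.okn (ex p) w" if "isvert v" "l \<in> insert v (nbn v)" for w l s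
    by (rule okn_upd) (use that fresh_ex[OF 4(1) that(1) 4(2)] in blast)
  ultimately show ?case using okn_event[of "ex p"] upd_space by (auto simp: Gv_def)
next
  case (5 p)
  have "ex p \<noteq> []" using ex_ne vpath_ne[OF 5] by blast
  then show ?case by (rule okn_event)
next
  case (6 v p E)
  obtain u q where p: "p = u # q" using 6(2) by (cases p) auto
  have vp: "vpath nbv (0, 0, 0) (u # q)" "v \<in> nbv u" "v \<notin> set (u # q)" using 6(1) unfolding p by auto
  define e where "e = edg u v"
  define p' where "p' = ex (u # q)"
  have pe: "ex (v # p) = v # e # p'" "ex p = p'" by (simp_all add: p e_def p'_def)
  have p': "p' \<noteq> []" "hd p' = u" using ex_ne[of "u # q"] by (simp_all add: p'_def)
  have iv: "isvert v" using nbv_props[OF vp(2)] by blast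
  have en: "e \<in> nbn u" "e \<in> nbn v" "v \<in> nbn e" unfolding e_def using nbv_edge[OF vp(2)] by blast+
  have fr: "v \<notin> set p'" "e \<notin> set p'" unfolding p'_def using fresh_ex[OF vp(1) iv vp(3)] en(2) by blast+
  have ve: "v \<noteq> e" using nbn_isnode[OF en(2)] by blast
  have Es: "E \<in> sets tp.Om" and Eok: "E \<subseteq> {w\<in>space tp.Om. tp.okn p' w}" using 6(3,4) unfolding pe by (auto simp: Gv_def)
  have Efree: "fun_upd w l s \<in> E \<longleftrightarrow> w \<in> E" if "l = v \<or> l = e" "w \<in> space tp.Om" "s \<in> space (tp.B l)" for l w s
    using 6(3) iv en(2) that unfolding Gv_def by blast
  have m1: "{w\<in>space tp.Om. tp.okn (e # p') w} \<in> sets tp.Om" "{w\<in>space tp.Om. \<not> tp.okn (e # p') w} \<in> sets tp.Om"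
    "{w\<in>space tp.Om. \<not> tp.okn (v # e # p') w} \<in> sets tp.Om"
    using tp.st_measurable[of "e # p'"] tp.st_measurable[of "v # e # p'"] by (auto simp: pred_def)
  define E2 where "E2 = E \<inter> {w\<in>space tp.Om. tp.okn (e # p') w}"
  have E2s: "E2 \<in> sets tp.Om" unfolding E2_def using Es m1 by auto
  have 1: "tp.Om.prob (E \<inter> {w\<in>space tp.Om. \<not> tp.okn (e # p') w}) \<le> tp.epsn * tp.Om.prob E"
    by (rule tp.node_step[OF Es Eok p'(1) fr(2)]) (use en(1) p'(2) Efree in auto)
  have 2: "tp.Om.prob (E2 \<inter> {w\<in>space tp.Om. \<not> tp.okn (v # e # p') w}) \<le> tp.epsn * tp.Om.prob E2"
  proof (rule tp.node_step[OF E2s])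
    show "E2 \<subseteq> {w\<in>space tp.Om. tp.okn (e # p') w}" by (auto simp: E2_def)
    show "v \<notin> set (e # p')" using fr(1) ve by simp
    show "v \<in> nbn (hd (e # p'))" using en(3) by simp
    fix w s assume ws: "w \<in> space tp.Om" "s \<in> space (tp.B v)"
    have "tp.okn (e # p') (fun_upd w v s) = tp.okn (e # p') w" by (rule okn_upd) (use fr(1) ve in simp)
    then show "fun_upd w v s \<in> E2 \<longleftrightarrow> w \<in> E2"
      unfolding E2_def using Efree[of v w s] ws upd_space[OF ws] by simp
  qed simp
  have 3: "tp.Om.prob E2 \<le> tp.Om.prob E" unfolding E2_def by (intro tp.Om.finite_measure_mono Es) auto
  have 4: "tp.epsn * tp.Om.prob E2 \<le> tp.epsn * tp.Om.prob E" by (rule mult_left_mono[OF 3 tp.epsn0])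
  have "tp.Om.prob (E \<inter> {w\<in>space tp.Om. \<not> tp.okn (v # e # p') w}) \<le>
    tp.Om.prob ((E \<inter> {w\<in>space tp.Om. \<not> tp.okn (e # p') w}) \<union> (E2 \<inter> {w\<in>space tp.Om. \<not> tp.okn (v # e # p') w}))"
    by (rule tp.Om.finite_measure_mono) (use Es E2s m1 in \<open>auto simp: E2_def\<close>)
  also have "\<dots> \<le> tp.Om.prob (E \<inter> {w\<in>space tp.Om. \<not> tp.okn (e # p') w}) + tp.Om.prob (E2 \<inter> {w\<in>space tp.Om. \<not> tp.okn (v # e # p') w})"
    by (rule measure_Un_le) (use Es E2s m1 in auto)
  also have "\<dots> \<le> 2 * tp.epsn * tp.Om.prob E" using 1 2 4 by linarith
  finally show ?case unfolding pe .
next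
  case 7 show ?case by (rule eps2)
next
  case 8 show ?case using epsn_le by simp
qed

section \<open>Reaching a given site with probability at least one half\<close>

definition sV :: "site \<Rightarrow> label set" where "sV c = {(fst c, snd c, 0), (fst c, snd c, 1)}"
text \<open>Failures are controlled only on \<open>xp.R\<close>, where the root succeeds; elsewhere
  the set is put to be empty.\<close>

definition sF :: "(label \<Rightarrow> 'a sample) \<Rightarrow> label set" where
  "sF w = (if w \<in> xp.R then xp.failed w else {})"
definition sD :: "(label \<Rightarrow> 'a sample) \<Rightarrow> site set" where "sD w = {c. sV c \<inter> sF w \<noteq> {}}"
text \<open>Good blocks at all levels around both the site and the origin: this places both in cores
  that eventually coincide.\<close>

definition good :: "site \<Rightarrow> (label \<Rightarrow> 'a sample) set" where
  "good z = {w\<in>xp.R. \<forall>k. \<not> badblk (sD w) k ((par ^^ k) z) \<and> \<not> badblk (sD w) k (0, 0)}"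

lemma R_space: "xp.R \<subseteq> space tp.Om" unfolding xp.R_def by blast

text \<open>With 162 * (2 * epsn) <= 1/2 the bound is doubly exponential in \<open>k\<close>; since
  k + 1 <= 2 ^ k it is weakened to a geometric one, which is easily summed.\<close>

lemma bad_prob: "tp.Om.prob {w\<in>xp.R. badblk (sD w) k c} \<le> (1/2) ^ (k + 1) / 81"
  and bad_event: "{w\<in>space tp.Om. badblk (sD w) k c} \<in> sets tp.Om"
proof -
  have F: "{w\<in>space tp.Om. v \<in> sF w} \<in> sets tp.Om" for v
  proof -
    have "{w\<in>space tp.Om. v \<in> sF w} = {w\<in>xp.R. v \<in> xp.failed w}" using R_space by (auto simp: sF_def)
    then show ?thesis using xp.failed_event by simp
  qed
  have W: "tp.Om.prob {w\<in>xp.R. W \<subseteq> sF w} \<le> (2 * tp.epsn) ^ card W" if "finite W" for W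
  proof -
    have "{w\<in>xp.R. W \<subseteq> sF w} = {w\<in>xp.R. W \<subseteq> xp.failed w}" by (auto simp: sF_def)
    then show ?thesis using xp.prob_failed_le[OF that] by simp
  qed
  have V: "finite (sV c) \<and> card (sV c) \<le> 2" for c by (simp add: sV_def)
  have st: "v \<in> sV c \<Longrightarrow> (fst v, fst (snd v)) = c" for v c by (auto simp: sV_def)
  have D: "c \<in> sD w \<longleftrightarrow> sV c \<inter> sF w \<noteq> {}" for c w by (simp add: sD_def)
  note P = tp.Om.prob_badblk_le[where V=sV and st="\<lambda>v. (fst v, fst (snd v))" and F=sF and D=sD and R=xp.R and \<epsilon>="2 * tp.epsn" and k=k and c=c,
      OF V st D xp.R_events F W]
  show "{w\<in>space tp.Om. badblk (sD w) k c} \<in> sets tp.Om" by (rule P(2); (assumption | rule eps2))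
  have "tp.Om.prob {w\<in>xp.R. badblk (sD w) k c} \<le> (162 * (2 * tp.epsn)) ^ (2 ^ k) / 81" by (rule P(1); (assumption | rule eps2))
  also have "\<dots> \<le> (1/2) ^ (2 ^ k) / 81"
  proof (intro divide_right_mono power_mono)
    show "162 * (2 * tp.epsn) \<le> 1/2" using epsn_le by linarith
    show "0 \<le> 162 * (2 * tp.epsn)" by (rule mult_nonneg_nonneg[OF _ eps2]) simp
  qed simp
  also have "\<dots> \<le> (1/2) ^ (k + 1) / 81"
    using less_exp[of k] by (intro divide_right_mono power_decreasing) (simp_all add: Suc_le_eq)
  finally show "tp.Om.prob {w\<in>xp.R. badblk (sD w) k c} \<le> (1/2) ^ (k + 1) / 81" .
qed

lemma good_event: "good z \<in> sets tp.Om"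
proof -
  have "good z = xp.R - (\<Union>k. {w\<in>space tp.Om. badblk (sD w) k ((par ^^ k) z)} \<union> {w\<in>space tp.Om. badblk (sD w) k (0, 0)})"
    unfolding good_def using R_space by auto
  also have "\<dots> \<in> sets tp.Om"
    by (intro sets.Diff sets.countable_UN xp.R_events) (use bad_event in \<open>blast intro: sets.Un\<close>)
  finally show ?thesis .
qed

text \<open>Summing over the levels for both sites gives 2/81, and the root fails with probability
  at most epsn.\<close>

lemma good_prob: "1/2 \<le> tp.Om.prob (good z)"
proof -
  define A where "A k = {w\<in>xp.R. badblk (sD w) k ((par ^^ k) z)} \<union> {w\<in>xp.R. badblk (sD w) k (0, 0)}" for k
  have Rb: "{w\<in>xp.R. badblk (sD w) k c} \<in> sets tp.Om" for k c
  proof -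
    have "{w\<in>xp.R. badblk (sD w) k c} = xp.R \<inter> {w\<in>space tp.Om. badblk (sD w) k c}" using R_space by auto
    then show ?thesis using bad_event xp.R_events by simp
  qed
  have As: "A k \<in> sets tp.Om" for k unfolding A_def using Rb by blast
  have Ap: "tp.Om.prob (A k) \<le> (1/2) ^ k * (1/81)" for k
  proof -
    have "tp.Om.prob (A k) \<le> tp.Om.prob {w\<in>xp.R. badblk (sD w) k ((par ^^ k) z)} + tp.Om.prob {w\<in>xp.R. badblk (sD w) k (0, 0)}"
      unfolding A_def by (rule measure_Un_le[OF Rb Rb])
    also have "\<dots> \<le> (1/2) ^ (k + 1) / 81 + (1/2) ^ (k + 1) / 81" by (intro add_mono bad_prob)
    finally show ?thesis by simp
  qed
  have sg: "summable (\<lambda>k. (1/2 :: real) ^ k * (1/81))" by (intro summable_mult2 summable_geometric) simp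
  have sA: "summable (\<lambda>k. tp.Om.prob (A k))"
    by (rule summable_comparison_test'[OF sg, of 0]) (use Ap in auto)
  have "tp.Om.prob (\<Union>k. A k) \<le> (\<Sum>k. tp.Om.prob (A k))"
    by (rule tp.Om.finite_measure_subadditive_countably) (use As sA in auto)
  also have "\<dots> \<le> (\<Sum>k. (1/2) ^ k * (1/81))" by (rule suminf_le[OF Ap sA sg])
  also have "\<dots> = 2/81" by (subst suminf_mult2[symmetric]) (simp_all add: suminf_geometric summable_geometric)
  finally have U: "tp.Om.prob (\<Union>k. A k) \<le> 2/81" .
  define N where "N = {w\<in>space tp.Om. \<not> tp.okn [(0, 0, 0)] w}"
  have "N = space tp.Om - {w\<in>space tp.Om. tp.okn [(0, 0, 0)] w}" by (auto simp: N_def)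
  then have Ns: "N \<in> sets tp.Om" using sets.compl_sets[OF okn_event[of "[(0, 0, 0)]"]] by simp
  have Us: "(\<Union>k. A k) \<in> sets tp.Om" by (rule sets.countable_UN) (use As in auto)
  have "space tp.Om \<subseteq> good z \<union> N \<union> (\<Union>k. A k)"
    unfolding good_def A_def xp.R_def N_def by auto
  from tp.Om.finite_measure_mono[OF this sets.Un[OF sets.Un[OF good_event Ns] Us]]
  have "1 \<le> tp.Om.prob (good z \<union> N \<union> (\<Union>k. A k))" unfolding tp.Om.prob_space .
  also have "\<dots> \<le> tp.Om.prob (good z \<union> N) + tp.Om.prob (\<Union>k. A k)"
    by (rule measure_Un_le[OF sets.Un[OF good_event Ns] Us])
  also have "tp.Om.prob (good z \<union> N) \<le> tp.Om.prob (good z) + tp.Om.prob N"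
    by (rule measure_Un_le[OF good_event Ns])
  finally show ?thesis using U tp.root_step[folded N_def] epsn_le by linarith
qed

definition lv :: "(label \<Rightarrow> 'a sample) \<Rightarrow> label set" where "lv w = {v. \<exists>p. xp.live w v p}"

lemma lv_nbv: "u \<in> lv w \<Longrightarrow> v \<in> nbv u \<Longrightarrow> v \<notin> xp.failed w \<Longrightarrow> v \<in> lv w"
  unfolding lv_def using xp.live_neighbour by blast

lemma sV_nbv: "(fst c, snd c, 1) \<in> nbv (fst c, snd c, 0)" "(fst c, snd c, 0) \<in> nbv (fst c, snd c, 1)" by auto

lemma sV_lv:
  assumes "u \<in> lv w" "v \<in> nbv u" "v \<in> sV c" "c \<notin> sD w" "w \<in> xp.R"
  shows "sV c \<subseteq> lv w"
proof -
  have nf: "x \<notin> xp.failed w" if "x \<in> sV c" for x using assms(4,5) that by (auto simp: sD_def sF_def)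
  have v: "v \<in> lv w" using lv_nbv[OF assms(1,2) nf[OF assms(3)]] .
  have "v = (fst c, snd c, 0) \<or> v = (fst c, snd c, 1)" using assms(3) by (simp add: sV_def)
  then show ?thesis
  proof
    assume v0: "v = (fst c, snd c, 0)"
    have "(fst c, snd c, 1) \<in> lv w" using lv_nbv[OF v] sV_nbv(1)[of c] nf[of "(fst c, snd c, 1)"] unfolding v0 by (simp add: sV_def)
    then show ?thesis using v v0 by (simp add: sV_def)
  next
    assume v0: "v = (fst c, snd c, 1)"
    have "(fst c, snd c, 0) \<in> lv w" using lv_nbv[OF v] sV_nbv(2)[of c] nf[of "(fst c, snd c, 0)"] unfolding v0 by (simp add: sV_def)
    then show ?thesis using v v0 by (simp add: sV_def)
  qed
qed

text \<open>The lattice edges behind the square grid of sites: to the right or up from a vertex of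
  class 0, to the left or down from one of class 1. A site without failed vertices is entered
  through one vertex and then taken completely.\<close>

lemma sV_step:
  assumes "adj4 c c'" "c' \<notin> sD w" "sV c \<subseteq> lv w" "w \<in> xp.R"
  shows "sV c' \<subseteq> lv w"
proof -
  obtain i j i' j' where c: "c = (i, j)" "c' = (i', j')" by (cases c; cases c')
  have A: "(i, j, 0) \<in> lv w" "(i, j, 1) \<in> lv w" using assms(3) by (auto simp: sV_def c)
  have "i' = i + 1 \<and> j' = j \<or> i' = i - 1 \<and> j' = j \<or> i' = i \<and> j' = j + 1 \<or> i' = i \<and> j' = j - 1"
    using assms(1) by (simp add: adj4_def c) linarith
  then show ?thesis
  proof (elim disjE conjE)
    assume e: "i' = i + 1" "j' = j"
    show ?thesis by (rule sV_lv[OF A(1), of "(i + 1, j, 1)"]) (use assms e in \<open>auto simp: c sV_def\<close>)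
  next
    assume e: "i' = i - 1" "j' = j"
    show ?thesis by (rule sV_lv[OF A(2), of "(i - 1, j, 0)"]) (use assms e in \<open>auto simp: c sV_def\<close>)
  next
    assume e: "i' = i" "j' = j + 1"
    show ?thesis by (rule sV_lv[OF A(1), of "(i, j + 1, 1)"]) (use assms e in \<open>auto simp: c sV_def\<close>)
  next
    assume e: "i' = i" "j' = j - 1"
    show ?thesis by (rule sV_lv[OF A(2), of "(i, j - 1, 0)"]) (use assms e in \<open>auto simp: c sV_def\<close>)
  qed
qed

lemma sV_link:
  assumes "(c, c') \<in> good_link (sD w)" "sV c \<subseteq> lv w" "w \<in> xp.R"
  shows "sV c' \<subseteq> lv w"
  using assms(1) unfolding good_link_def
proof (induction rule: rtrancl_induct)
  case base show ?case by (rule assms(2))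
next
  case (step y z)
  then have "adj4 y z" "z \<notin> sD w" by auto
  then show ?case using sV_step step(3) assms(3) by blast
qed

lemma par_zero: "(par ^^ k) (0, 0) = (0, 0)"
  by (induction k) (auto simp: par_def)

text \<open>The origin lies in the core of block (0, 0) at every level, and from some level on so
  does \<open>z\<close>. Cores are linked through sites without failures, and they have at least 2 ^
  k sites, so infinitely many vertices are live.\<close>

lemma good_live:
  assumes w: "w \<in> good z"
  shows "(fst z, snd z, 0) \<in> lv w" "infinite (lv w)" "w \<in> xp.R"
proof -
  show R: "w \<in> xp.R" using w by (simp add: good_def)
  have b0: "\<not> badblk (sD w) k (0, 0)" "\<not> badblk (sD w) k ((par ^^ k) z)" for k using w by (auto simp: good_def)
  have "(0, 0) \<notin> sD w" using b0(1)[of 0] by simp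
  moreover have "(0, 0, 0) \<in> lv w" unfolding lv_def using xp.live_root by blast
  ultimately have base: "sV (0, 0) \<subseteq> lv w"
  proof -
    assume a: "(0, 0) \<notin> sD w" "(0, 0, 0) \<in> lv w"
    have "(0, 0, 1) \<notin> xp.failed w" using a(1) R by (auto simp: sD_def sF_def sV_def)
    then have "(0, 0, 1) \<in> lv w" by (intro lv_nbv[OF a(2)]) auto
    then show ?thesis using a(2) by (simp add: sV_def)
  qed
  have zero_core: "(0, 0) \<in> core (sD w) k (0, 0)" for k
    using core_mem[of "sD w" "(0, 0)" k] b0(1) by (simp add: par_zero)
  have core_lv: "sV c \<subseteq> lv w" if "c \<in> core (sD w) k (0, 0)" for c k
    by (rule sV_link[OF core_linked[OF b0(1) b0(1) _ zero_core that] base R]) simp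
  obtain k0 where k0: "\<forall>k\<ge>k0. (par ^^ k) z = (0, 0)" using par_iterate_zero by blast
  have "z \<in> core (sD w) k0 ((par ^^ k0) z)" by (rule core_mem) (rule b0(2))
  then have "sV z \<subseteq> lv w" using core_lv k0 by simp
  then show "(fst z, snd z, 0) \<in> lv w" by (simp add: sV_def)
  show "infinite (lv w)"
  proof
    assume f: "finite (lv w)"
    define k where "k = card (lv w)"
    have cc: "finite (core (sD w) k (0, 0))" "2 ^ k \<le> card (core (sD w) k (0, 0))" using card_core[OF b0(1)] by blast+
    have inj: "inj_on (\<lambda>c. (fst c, snd c, 0 :: nat)) (core (sD w) k (0, 0))" by (auto simp: inj_on_def prod_eq_iff)
    have "(\<lambda>c. (fst c, snd c, 0 :: nat)) ` core (sD w) k (0, 0) \<subseteq> lv w" using core_lv[of _ k] by (auto simp: sV_def)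
    from card_mono[OF f this] have "2 ^ k \<le> k" using cc(2) card_image[OF inj] by (simp add: k_def)
    then show False using less_exp[of k] by simp
  qed
qed

section \<open>The tree of spheres in one strip\<close>

definition actp :: "(label \<Rightarrow> 'a sample) \<Rightarrow> label list set" where
  "actp w = {\<gamma>. \<exists>v p. xp.live w v p \<and> (\<gamma> = ex p \<or> (tl p \<noteq> [] \<and> \<gamma> = tl (ex p)))}"

lemma live_form:
  assumes "xp.live w v p"
  shows "p \<noteq> [] \<and> hd p = v \<and> isvert v \<and> ex p \<noteq> [] \<and> hd (ex p) = v"
proof -
  have p: "vpath nbv (0, 0, 0) p" "hd p = v" using xp.live_path[OF assms] by blast+
  have ne: "p \<noteq> []" by (rule vpath_ne[OF p(1)])
  have "v \<in> set p" using ne p(2) hd_in_set by metis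
  then show ?thesis using ne p ex_ne[OF ne] vpath_isvert[OF p(1)] by blast
qed

lemma live_tl:
  assumes "xp.live w v p" "tl p \<noteq> []"
  obtains u q where "p = v # u # q" "v \<in> nbv u" "xp.live w u (u # q)" "ex p = v # edg u v # ex (u # q)" "v \<notin> set (u # q)"
proof -
  have l: "vpath nbv (0, 0, 0) p" "hd p = v" "xp.live w (hd (tl p)) (tl p)" using xp.live_path[OF assms(1)] assms(2) by blast+
  obtain u q where p: "p = v # u # q" using l(2) assms(2) vpath_ne[OF l(1)] by (cases p rule: ex.cases) auto
  show thesis by (rule that[of u q]) (use l p in auto)
qed

lemma actp_cases:
  assumes "\<gamma> \<in> actp w"
  obtains (vertex) v p where "xp.live w v p" "\<gamma> = ex p" "hd \<gamma> = v" "isvert v"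
  | (edge) v u q where "xp.live w v (v # u # q)" "xp.live w u (u # q)" "v \<in> nbv u" "v \<notin> set (u # q)"
     "\<gamma> = edg u v # ex (u # q)" "ex (v # u # q) = v # \<gamma>" "\<not> isvert (hd \<gamma>)"
proof -
  obtain v p where a: "xp.live w v p" "\<gamma> = ex p \<or> (tl p \<noteq> [] \<and> \<gamma> = tl (ex p))" using assms unfolding actp_def by blast
  from a(2) show thesis
  proof
    assume "\<gamma> = ex p"
    then show thesis using vertex[of v p] a(1) live_form[OF a(1)] by blast
  next
    assume t: "tl p \<noteq> [] \<and> \<gamma> = tl (ex p)"
    obtain u q where u: "p = v # u # q" "v \<in> nbv u" "xp.live w u (u # q)" "ex p = v # edg u v # ex (u # q)" "v \<notin> set (u # q)"
      by (rule live_tl[OF a(1)]) (use t in auto)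
    show thesis by (rule edge[of v u q]) (use a(1) u t nbv_props[OF u(2)] in auto)
  qed
qed

lemma live_actp: "xp.live w v p \<Longrightarrow> ex p \<in> actp w"
  unfolding actp_def by blast

lemma actp_ne: "\<gamma> \<in> actp w \<Longrightarrow> \<gamma> \<noteq> []"
  by (erule actp_cases) (use live_form in auto)

lemma actp_tl:
  assumes "\<gamma> \<in> actp w" "tl \<gamma> \<noteq> []"
  shows "tl \<gamma> \<in> actp w"
  using assms(1)
proof (cases rule: actp_cases)
  case (vertex v p)
  have "tl p \<noteq> []" using assms(2) vertex(2) by (cases p rule: ex.cases) auto
  then show ?thesis unfolding actp_def using vertex(1,2) by blast
next
  case (edge v u q)
  then show ?thesis using live_actp[OF edge(2)] by simp
qed

lemma actp_okn:
  assumes "\<gamma> \<in> actp w" "w \<in> xp.R"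
  shows "tp.okn \<gamma> w"
proof -
  have ok: "tp.okn (ex p) w" if "xp.live w v p" for v p
  proof (rule xp.live_ok[OF that])
    show "tp.okn (ex [(0, 0, 0)]) w" using assms(2) unfolding xp.R_def by blast
  qed
  from assms(1) show ?thesis
  proof (cases rule: actp_cases)
    case (vertex v p) then show ?thesis using ok by blast
  next
    case (edge v u q)
    have "tp.okn (v # \<gamma>) w" using ok[OF edge(1)] edge(6) by simp
    then show ?thesis using tp.okn_Cons_props(1)[OF actp_ne[OF assms(1)]] by blast
  qed
qed

text \<open>For an edge node, its two ends could only compete if each were reached through the
  other; but a vertex does not occur twice on its own path.\<close>

lemma actp_unique:
  assumes "\<gamma> \<in> actp w" "\<gamma>' \<in> actp w" "hd \<gamma> = hd \<gamma>'"
  shows "\<gamma> = \<gamma>'"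
  using assms(1)
proof (cases rule: actp_cases)
  case v1: (vertex v p)
  from assms(2) show ?thesis
  proof (cases rule: actp_cases)
    case (vertex v' p')
    then show ?thesis using xp.live_unique[of w v p p'] v1 assms(3) by simp
  next
    case edge then show ?thesis using v1 assms(3) by simp
  qed
next
  case e1: (edge v u q)
  from assms(2) show ?thesis
  proof (cases rule: actp_cases)
    case vertex then show ?thesis using e1 assms(3) by simp
  next
    case e2: (edge v' u' q')
    have e: "edg u v = edg u' v'" using assms(3) e1(5) e2(5) by simp
    have "{u, v} = {u', v'}" using nbv_props[OF e1(3)] nbv_props[OF e2(3)] e by metis
    then have "v = v' \<and> u = u' \<or> v = u' \<and> u = v'" by (auto simp: doubleton_eq_iff)
    then show ?thesis
    proof
      assume a: "v = v' \<and> u = u'"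
      then have "v # u # q = v' # u' # q'" using xp.live_unique[of w v "v # u # q" "v' # u' # q'"] e1(1) e2(1) by simp
      then show ?thesis using e1(5) e2(5) by simp
    next
      assume a: "v = u' \<and> u = v'"
      then have "v # u # q = u' # q'" using xp.live_unique[of w v "v # u # q" "u' # q'"] e1(1) e2(2) by simp
      then have "u \<in> set (u' # q')" by (metis list.set_intros(1) list.set_intros(2))
      then show ?thesis using e2(4) a by simp
    qed
  qed
qed

lemma actp_event: "{w\<in>xp.R. \<gamma> \<in> actp w} \<in> sets tp.Om"
proof -
  have "{w\<in>xp.R. \<gamma> \<in> actp w} = (\<Union>vp\<in>{vp :: label \<times> label list. \<gamma> = ex (snd vp) \<or> (tl (snd vp) \<noteq> [] \<and> \<gamma> = tl (ex (snd vp)))}. {w\<in>xp.R. xp.live w (fst vp) (snd vp)})"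
    unfolding actp_def by force
  also have "\<dots> \<in> sets tp.Om" using xp.live_event by (intro sets.countable_UN') auto
  finally show ?thesis .
qed

text \<open>The empty list marks nodes that carry no sphere of the tree, including all nodes off
  \<open>xp.R\<close>. An edge node whose next vertex failed is among them.\<close>

definition tpath :: "(label \<Rightarrow> 'a sample) \<Rightarrow> label \<Rightarrow> label list" where
  "tpath w l = (if w \<in> xp.R \<and> (\<exists>\<gamma>\<in>actp w. hd \<gamma> = l) then (SOME \<gamma>. \<gamma> \<in> actp w \<and> hd \<gamma> = l) else [])"

lemma tpath_iff:
  assumes "\<gamma> \<noteq> []"
  shows "tpath w l = \<gamma> \<longleftrightarrow> w \<in> xp.R \<and> \<gamma> \<in> actp w \<and> hd \<gamma> = l"
proof (cases "w \<in> xp.R \<and> (\<exists>\<gamma>\<in>actp w. hd \<gamma> = l)")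
  case True
  then have "\<exists>\<gamma>. \<gamma> \<in> actp w \<and> hd \<gamma> = l" by blast
  from someI_ex[OF this] have s: "tpath w l \<in> actp w \<and> hd (tpath w l) = l" unfolding tpath_def using True by simp
  then show ?thesis using True actp_unique by metis
next
  case False
  then have "tpath w l = []" unfolding tpath_def by (rule if_not_P)
  then show ?thesis using False assms by blast
qed

definition rr :: "(label \<Rightarrow> 'a sample) \<Rightarrow> label \<Rightarrow> nat \<Rightarrow> real" where
  "rr w l i = (if tpath w l \<noteq> [] \<and> tp.idx (tpath w l) w = i then tp.rad (tpath w l) w else 0)"

lemma rr_measurable: "(\<lambda>w. rr w l i) \<in> borel_measurable tp.Om"
proof -
  have tm: "(\<lambda>w. tpath w l) \<in> tp.Om \<rightarrow>\<^sub>M count_space UNIV"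
  proof (rule measurable_count_space_eq_countable[THEN iffD2])
    have ne: "(\<lambda>w. tpath w l) -` {\<gamma>} \<inter> space tp.Om \<in> sets tp.Om" if "\<gamma> \<noteq> []" for \<gamma>
    proof -
      have "(\<lambda>w. tpath w l) -` {\<gamma>} \<inter> space tp.Om = (if hd \<gamma> = l then {w\<in>xp.R. \<gamma> \<in> actp w} else {})"
      proof (cases "hd \<gamma> = l")
        case True
        show ?thesis unfolding if_P[OF True]
          by (intro set_eqI) (use tpath_iff[OF that] R_space True in \<open>simp add: vimage_def; blast\<close>)
      next
        case False
        show ?thesis unfolding if_not_P[OF False]
          by (intro set_eqI) (use tpath_iff[OF that] False in \<open>simp add: vimage_def\<close>)
      qed
      then show ?thesis using actp_event by simp
    qed
    moreover have "(\<lambda>w. tpath w l) -` {[]} \<inter> space tp.Om \<in> sets tp.Om"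
    proof -
      have "(\<lambda>w. tpath w l) -` {[]} \<inter> space tp.Om = space tp.Om - (\<Union>\<gamma>\<in>{\<gamma>. \<gamma> \<noteq> []}. (\<lambda>w. tpath w l) -` {\<gamma>} \<inter> space tp.Om)" by auto
      also have "\<dots> \<in> sets tp.Om" using ne by (intro sets.Diff sets.top sets.countable_UN') auto
      finally show ?thesis .
    qed
    ultimately have "(\<lambda>w. tpath w l) -` {\<gamma>} \<inter> space tp.Om \<in> sets tp.Om" for \<gamma> by (cases "\<gamma> = []") auto
    then show "(\<lambda>w. tpath w l) \<in> space tp.Om \<rightarrow> UNIV \<and> (\<forall>a\<in>UNIV. (\<lambda>w. tpath w l) -` {a} \<inter> space tp.Om \<in> sets tp.Om)" by simp
  qed simp
  have g: "(\<lambda>w. if \<gamma> \<noteq> [] \<and> tp.idx \<gamma> w = i then tp.rad \<gamma> w else 0) \<in> borel_measurable tp.Om" for \<gamma>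
  proof (cases "\<gamma> = []")
    case False
    then have [measurable]: "tp.idx \<gamma> \<in> tp.Om \<rightarrow>\<^sub>M count_space UNIV" "tp.rad \<gamma> \<in> borel_measurable tp.Om"
      using tp.st_measurable by blast+
    show ?thesis by measurable
  qed simp
  show ?thesis unfolding rr_def by (rule measurable_compose_countable[OF g tm])
qed

lemma rr_active:
  assumes "rr w l i \<noteq> 0"
  obtains \<gamma> where "\<gamma> \<in> actp w" "w \<in> xp.R" "hd \<gamma> = l" "tp.idx \<gamma> w = i" "rr w l i = tp.rad \<gamma> w" "tp.okn \<gamma> w"
    "snd (w l) i = tp.pos \<gamma> w" "\<gamma> \<noteq> []"
proof -
  have t: "tpath w l \<noteq> []" "tp.idx (tpath w l) w = i" "rr w l i = tp.rad (tpath w l) w"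
    using assms by (auto simp: rr_def split: if_splits)
  have a: "w \<in> xp.R" "tpath w l \<in> actp w" "hd (tpath w l) = l" using tpath_iff[OF t(1)] by blast+
  have "snd (w l) i = tp.pos (tpath w l) w" unfolding tp.pos_def t(2) a(3) ..
  then show thesis by (rule that[OF a(2,1,3) t(2,3) actp_okn[OF a(2,1)] _ t(1)])
qed

lemma actp_rr:
  assumes "\<gamma> \<in> actp w" "w \<in> xp.R"
  shows "rr w (hd \<gamma>) (tp.idx \<gamma> w) = tp.rad \<gamma> w"
proof -
  have "tpath w (hd \<gamma>) = \<gamma>" using tpath_iff[OF actp_ne[OF assms(1)], of w "hd \<gamma>"] assms by blast
  then show ?thesis using actp_ne[OF assms(1)] by (simp add: rr_def)
qed

lemma rr_bounds: "0 \<le> rr w l i" "rr w l i \<le> 51/50" "rr w l i \<noteq> 0 \<Longrightarrow> snd (w l) i \<in> Qn l \<and> 49/50 \<le> rr w l i"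
proof -
  have "rr w l i = 0 \<or> (49/50 \<le> rr w l i \<and> rr w l i \<le> 51/50 \<and> snd (w l) i \<in> Qn l)"
  proof (cases "rr w l i = 0")
    case False
    obtain \<gamma> where g: "\<gamma> \<in> actp w" "w \<in> xp.R" "hd \<gamma> = l" "tp.idx \<gamma> w = i" "rr w l i = tp.rad \<gamma> w" "tp.okn \<gamma> w"
      "snd (w l) i = tp.pos \<gamma> w" "\<gamma> \<noteq> []" by (rule rr_active[OF False])
    show ?thesis using tp.okn_props(2-4)[OF g(8,6)] unfolding g(3,5,7) by simp
  qed simp
  then show "0 \<le> rr w l i" "rr w l i \<le> 51/50" "rr w l i \<noteq> 0 \<Longrightarrow> snd (w l) i \<in> Qn l \<and> 49/50 \<le> rr w l i" by auto
qed

text \<open>The place where the distance clauses of \<open>suc\<close> and \<open>cand\<close> are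
  used. Around a vertex only its own block matters. Around an edge node there are also the block
  before it, whose other points \<open>cand\<close> avoids, and the block after it, whose success
  requires distance from the edge point.\<close>

lemma active_inactive:
  assumes a: "rr w l i \<noteq> 0" and b: "rr w l' i' = 0" "i' < fst (w l')" "snd (w l') i' \<in> Yb l'"
  shows "51/50 \<le> dist (snd (w l) i) (snd (w l') i')"
proof (rule ccontr)
  assume "\<not> ?thesis"
  then have d: "dist (snd (w l) i) (snd (w l') i') < 51/50" by simp
  obtain \<gamma> where g: "\<gamma> \<in> actp w" "w \<in> xp.R" "hd \<gamma> = l" "tp.idx \<gamma> w = i" "rr w l i = tp.rad \<gamma> w" "tp.okn \<gamma> w"
    "snd (w l) i = tp.pos \<gamma> w" "\<gamma> \<noteq> []" by (rule rr_active[OF a])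
  have x: "snd (w l) i \<in> Qn l" using rr_bounds(3)[OF a] by blast
  have ys: "snd (w l') i' \<in> strip" using b(3) Yb_strip by blast
  have same: False if "l' = l"
  proof -
    have "i' \<noteq> i" using a b(1) that by auto
    then show False using tp.okn_props(5)[OF g(8,6), of i'] b(2) d g that by simp
  qed
  from g(1) show False
  proof (cases rule: actp_cases)
    case (vertex v p)
    have "snd (w l') i' \<in> Yb l" by (rule near_vertex[OF x _ ys d]) (use vertex g in simp)
    then show False using Yb_disjoint[OF b(3)] same by blast
  next
    case (edge v u q)
    have "l' = l \<or> l' \<in> nbn l" by (rule near_edge[OF x _ ys d b(3)]) (use edge g in simp)
    moreover have "nbn (edg u v) = {u, v}" using nbv_props[OF edge(3)] by blast
    moreover have "edg u v = l" using edge(5) g(3) by simp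
    ultimately have "l' = u \<or> l' = v" using same by blast
    then show False
    proof
      assume l': "l' = u"
      define p where "p = ex (u # q)"
      have p: "p \<in> actp w" "p \<noteq> []" "hd p = u" using live_actp[OF edge(2)] live_form[OF edge(2)] by (simp_all add: p_def)
      have gp: "\<gamma> = edg u v # p" using edge(5) by (simp add: p_def)
      have "i' \<noteq> tp.idx p w"
      proof
        assume "i' = tp.idx p w"
        then have "rr w l' i' = tp.rad p w" using actp_rr[OF p(1) g(2)] p(3) l' by simp
        moreover have "49/50 \<le> tp.rad p w" by (rule tp.okn_props(3)[OF p(2) actp_okn[OF p(1) g(2)]])
        ultimately show False using b(1) by simp
      qed
      then show False using tp.okn_Cons_props(8)[OF p(2), of "edg u v" w i'] g(6,7) b(2) d p(3) l' unfolding gp by simp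
    next
      assume l': "l' = v"
      have "tp.okn (v # \<gamma>) w" using actp_okn[OF live_actp[OF edge(1)] g(2)] edge(6) by simp
      from tp.okn_Cons_props(9)[OF g(8) this, of i'] show False using b(2) d g(7) l' by simp
    qed
  qed
qed

text \<open>An edge node has just two neighbours: the predecessor and the successor on its path. By
  uniqueness of paths, a neighbour in use is therefore consecutive to it, and the radii were chosen
  to make such spheres touch.\<close>

lemma edge_touch:
  assumes g: "\<gamma> \<in> actp w" "\<gamma>' \<in> actp w" "w \<in> xp.R" and n: "hd \<gamma>' \<in> nbn (hd \<gamma>)" "\<not> isvert (hd \<gamma>)"
  shows "dist (tp.pos \<gamma> w) (tp.pos \<gamma>' w) = tp.rad \<gamma> w + tp.rad \<gamma>' w"
  using g(1)
proof (cases rule: actp_cases)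
  case (vertex v p) then show ?thesis using n(2) by simp
next
  case (edge v u q)
  have "nbn (edg u v) = {u, v}" using nbv_props[OF edge(3)] by blast
  then have "nbn (hd \<gamma>) = {u, v}" unfolding edge(5) list.sel(1) .
  then have "hd \<gamma>' = u \<or> hd \<gamma>' = v" using n(1) by blast
  then show ?thesis
  proof
    assume h: "hd \<gamma>' = u"
    have p: "ex (u # q) \<in> actp w" "ex (u # q) \<noteq> []" "hd (ex (u # q)) = u" using live_actp[OF edge(2)] live_form[OF edge(2)] by simp_all
    have e: "\<gamma>' = ex (u # q)" by (rule actp_unique[OF g(2) p(1)]) (use h p(3) in simp)
    show ?thesis using tp.okn_Cons_props(6)[OF p(2), of "edg u v" w] actp_okn[OF g(1,3)] unfolding e edge(5) by (simp add: dist_commute)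
  next
    assume h: "hd \<gamma>' = v"
    have p: "v # \<gamma> \<in> actp w" using live_actp[OF edge(1)] edge(6) by simp
    have e: "\<gamma>' = v # \<gamma>" by (rule actp_unique[OF g(2) p]) (use h in simp)
    show ?thesis using tp.okn_Cons_props(6)[OF actp_ne[OF g(1)] actp_okn[OF p g(3)]] unfolding e by simp
  qed
qed

lemma slab_hard:
  assumes "(l, i) \<noteq> (l', i')" "i < fst (w l)" "i' < fst (w l')" "snd (w l) i \<in> Yb l" "snd (w l') i' \<in> Yb l'"
  shows "rr w l i + rr w l' i' \<le> dist (snd (w l) i) (snd (w l') i')"
proof -
  consider "rr w l i = 0" "rr w l' i' = 0" | "rr w l i \<noteq> 0" "rr w l' i' = 0" | "rr w l i = 0" "rr w l' i' \<noteq> 0" | "rr w l i \<noteq> 0" "rr w l' i' \<noteq> 0" by blast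
  then show ?thesis
  proof cases
    case 1 then show ?thesis by simp
  next
    case 2
    have "51/50 \<le> dist (snd (w l) i) (snd (w l') i')" using active_inactive[OF 2 assms(3,5)] .
    then show ?thesis using 2 rr_bounds(2)[of w l i] by simp
  next
    case 3
    have "51/50 \<le> dist (snd (w l') i') (snd (w l) i)" using active_inactive[OF 3(2,1) assms(2,4)] .
    then show ?thesis using 3 rr_bounds(2)[of w l' i'] by (simp add: dist_commute)
  next
    case 4
    obtain \<gamma> where g: "\<gamma> \<in> actp w" "w \<in> xp.R" "hd \<gamma> = l" "tp.idx \<gamma> w = i" "rr w l i = tp.rad \<gamma> w" "tp.okn \<gamma> w"
      "snd (w l) i = tp.pos \<gamma> w" "\<gamma> \<noteq> []" by (rule rr_active[OF 4(1)])
    obtain \<gamma>' where g': "\<gamma>' \<in> actp w" "w \<in> xp.R" "hd \<gamma>' = l'" "tp.idx \<gamma>' w = i'" "rr w l' i' = tp.rad \<gamma>' w" "tp.okn \<gamma>' w"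
      "snd (w l') i' = tp.pos \<gamma>' w" "\<gamma>' \<noteq> []" by (rule rr_active[OF 4(2)])
    have ne: "l \<noteq> l'"
    proof
      assume "l = l'"
      then have "\<gamma> = \<gamma>'" using actp_unique[OF g(1) g'(1)] g(3) g'(3) by simp
      then show False using assms(1) g g' by simp
    qed
    have x: "snd (w l) i \<in> Qn l" "snd (w l') i' \<in> Qn l'" using rr_bounds(3) 4 by blast+
    show ?thesis
    proof (cases "l' \<in> nbn l")
      case False
      show ?thesis using Qn_far[OF x ne False] rr_bounds(2)[of w l i] rr_bounds(2)[of w l' i'] by simp
    next
      case True
      show ?thesis
      proof (cases "isvert l")
        case False
        show ?thesis using edge_touch[OF g(1) g'(1) g(2)] True False g g' by simp
      next
        case v: True
        have "\<not> isvert l'" using nbn_isnode[OF True] v by blast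
        then show ?thesis using edge_touch[OF g'(1) g(1) g(2)] nbn_sym[OF True] g g' by (simp add: dist_commute add.commute)
      qed
    qed
  qed
qed

definition tree :: "(label \<Rightarrow> 'a sample) \<Rightarrow> 'a set" where
  "tree w = (\<Union>\<gamma>\<in>actp w. cball (tp.pos \<gamma> w) (tp.rad \<gamma> w))"

lemma tree_connected:
  assumes "w \<in> xp.R" "\<gamma> \<in> actp w"
  shows "connected_component (tree w) (tp.pos [(0, 0, 0)] w) (tp.pos \<gamma> w)"
  using assms(2)
proof (induction \<gamma>)
  case (Cons v p)
  have ok: "tp.okn (v # p) w" by (rule actp_okn[OF Cons.prems assms(1)])
  have r1: "0 \<le> tp.rad (v # p) w" using tp.okn_props(3)[OF _ ok] by simp
  have B1: "cball (tp.pos (v # p) w) (tp.rad (v # p) w) \<subseteq> tree w" unfolding tree_def by (rule UN_upper[OF Cons.prems])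
  show ?case
  proof (cases "p = []")
    case True
    have "v = (0, 0, 0)"
      using Cons.prems
    proof (cases rule: actp_cases)
      case (vertex v' p')
      have "p' = [v]" using vertex(2) True by (cases p' rule: ex.cases) auto
      then show ?thesis using xp.live_path(1)[OF vertex(1)] by simp
    next
      case (edge v' u q)
      then show ?thesis using True live_form[OF edge(2)] by simp
    qed
    then show ?thesis using True B1 r1 by (auto simp: connected_component_refl_eq)
  next
    case False
    have pa: "p \<in> actp w" using actp_tl[OF Cons.prems] False by simp
    have okp: "tp.okn p w" by (rule actp_okn[OF pa assms(1)])
    have r2: "0 \<le> tp.rad p w" using tp.okn_props(3)[OF False okp] by simp
    have B2: "cball (tp.pos p w) (tp.rad p w) \<subseteq> tree w" unfolding tree_def by (rule UN_upper[OF pa])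
    have "cball (tp.pos p w) (tp.rad p w) \<inter> cball (tp.pos (v # p) w) (tp.rad (v # p) w) \<noteq> {}"
      by (rule cballs_meet) (use tp.okn_Cons_props(6)[OF False ok] r1 r2 in auto)
    then have "connected (cball (tp.pos p w) (tp.rad p w) \<union> cball (tp.pos (v # p) w) (tp.rad (v # p) w))"
      by (intro connected_Un) auto
    then have "connected_component (tree w) (tp.pos p w) (tp.pos (v # p) w)"
      unfolding connected_component_def using B1 B2 r1 r2
      by (intro exI[of _ "cball (tp.pos p w) (tp.rad p w) \<union> cball (tp.pos (v # p) w) (tp.rad (v # p) w)"]) auto
    then show ?thesis using Cons.IH[OF pa] connected_component_trans by blast
  qed
qed (use actp_ne in blast)

text \<open>All centres are connected to the root, and a bounded region meets only finitely many
  blocks, whereas infinitely many vertices are live.\<close>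

lemma tree_unbounded:
  assumes w: "w \<in> good z"
  shows "\<not> bounded (connected_component_set (tree w) (tp.pos [(0, 0, 0)] w))"
proof
  assume "bounded (connected_component_set (tree w) (tp.pos [(0, 0, 0)] w))"
  then obtain K where K: "\<And>y. y \<in> connected_component_set (tree w) (tp.pos [(0, 0, 0)] w) \<Longrightarrow> norm y \<le> K" unfolding bounded_iff by blast
  obtain n :: nat where n: "K \<le> real n" using real_arch_simple by blast
  have "lv w \<subseteq> lbox (4 * n + 12)"
  proof
    fix v assume "v \<in> lv w"
    then obtain p where p: "xp.live w v p" by (auto simp: lv_def)
    have g: "ex p \<in> actp w" "ex p \<noteq> []" "hd (ex p) = v" using live_actp[OF p] live_form[OF p] by auto
    have "tp.pos (ex p) w \<in> Yb v" using tp.okn_props(2)[OF g(2) actp_okn[OF g(1) good_live(3)[OF w]]] g(3) Qn_Yb by blast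
    moreover have "norm (tp.pos (ex p) w) \<le> real n"
      using K[of "tp.pos (ex p) w"] tree_connected[OF good_live(3)[OF w] g(1)] n by simp
    ultimately show "v \<in> lbox (4 * n + 12)" by (rule Yb_lbox)
  qed
  then show False using good_live(2)[OF w] finite_subset[OF _ lbox_finite] by blast
qed

end

section \<open>The sphere process\<close>

text \<open>At least m values occur iff some m active indices carry pairwise different values, a
  countable union of events. Values are counted rather than indices, because a configuration is a
  set.\<close>

lemma card_image_event:
  fixes f :: "'i \<Rightarrow> 'w \<Rightarrow> 'b::{second_countable_topology, t2_space}"
  assumes I: "countable I" and a: "\<And>i. i \<in> I \<Longrightarrow> Measurable.pred M (a i)"
    and f: "\<And>i. i \<in> I \<Longrightarrow> f i \<in> borel_measurable M"
    and fin: "\<And>w. w \<in> space M \<Longrightarrow> finite {f i w |i. i \<in> I \<and> a i w}"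
  shows "{w\<in>space M. card {f i w |i. i \<in> I \<and> a i w} = n} \<in> sets M"
proof -
  define S where "S w = {f i w |i. i \<in> I \<and> a i w}" for w
  define E where "E m = (\<Union>F\<in>{F. finite F \<and> F \<subseteq> I \<and> card F = m}. {w\<in>space M. \<forall>i\<in>F. a i w \<and> (\<forall>j\<in>F. i \<noteq> j \<longrightarrow> f i w \<noteq> f j w)})" for m
  have E: "E m \<in> sets M" for m
    unfolding E_def
  proof (rule sets.countable_UN'')
    show "countable {F. finite F \<and> F \<subseteq> I \<and> card F = m}"
      by (rule countable_subset[OF _ countable_Collect_finite_subset[OF I]]) blast
    fix F assume F: "F \<in> {F. finite F \<and> F \<subseteq> I \<and> card F = m}"
    have Fi: "finite F" "\<And>i. i \<in> F \<Longrightarrow> i \<in> I" using F by auto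
    have q: "{w\<in>space M. i \<noteq> j \<longrightarrow> f i w \<noteq> f j w} \<in> sets M" if ij: "i \<in> F" "j \<in> F" for i j
    proof -
      have [measurable]: "f i \<in> borel_measurable M" "f j \<in> borel_measurable M" using f Fi ij by auto
      show ?thesis by measurable
    qed
    have p: "{w\<in>space M. a i w} \<in> sets M" if "i \<in> F" for i using a[OF Fi(2)[OF that]] by (simp add: pred_def)
    show "{w\<in>space M. \<forall>i\<in>F. a i w \<and> (\<forall>j\<in>F. i \<noteq> j \<longrightarrow> f i w \<noteq> f j w)} \<in> sets M"
    proof (rule sets.sets_Collect_finite_All[OF sets.sets_Collect_conj Fi(1)])
      fix i assume i: "i \<in> F"
      show "{w\<in>space M. a i w} \<in> sets M" by (rule p[OF i])
      show "{w\<in>space M. \<forall>j\<in>F. i \<noteq> j \<longrightarrow> f i w \<noteq> f j w} \<in> sets M"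
        by (rule sets.sets_Collect_finite_All[OF q[OF i] Fi(1)])
    qed
  qed
  have iff: "w \<in> E m \<longleftrightarrow> m \<le> card (S w)" if w: "w \<in> space M" for w m
  proof
    assume "w \<in> E m"
    then obtain F where F0: "F \<in> {F. finite F \<and> F \<subseteq> I \<and> card F = m}"
      "w \<in> {w\<in>space M. \<forall>i\<in>F. a i w \<and> (\<forall>j\<in>F. i \<noteq> j \<longrightarrow> f i w \<noteq> f j w)}"
      unfolding E_def by (rule UN_E)
    have F: "F \<subseteq> I" "card F = m" using F0(1) by auto
    have Fa: "a i w" if "i \<in> F" for i using F0(2) that by simp
    have Fn: "f i w \<noteq> f j w" if "i \<in> F" "j \<in> F" "i \<noteq> j" for i j using F0(2) that by simp
    have "(\<lambda>i. f i w) ` F \<subseteq> S w"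
    proof
      fix y assume "y \<in> (\<lambda>i. f i w) ` F"
      then obtain i where i: "i \<in> F" "y = f i w" by (rule imageE)
      then show "y \<in> S w" unfolding S_def using F(1) Fa[OF i(1)] by (intro CollectI exI[of _ i]) auto
    qed
    moreover have inj: "inj_on (\<lambda>i. f i w) F"
    proof (rule inj_onI)
      fix i j assume "i \<in> F" "j \<in> F" "f i w = f j w"
      then show "i = j" using Fn[of i j] by (cases "i = j") simp_all
    qed
    have "finite (S w)" using fin[OF w] by (simp only: S_def)
    ultimately have "card ((\<lambda>i. f i w) ` F) \<le> card (S w)" by (intro card_mono)
    then show "m \<le> card (S w)" using card_image[OF inj] F(2) by simp
  next
    assume m: "m \<le> card (S w)"
    obtain T where T: "T \<subseteq> S w" "card T = m" "finite T" using obtain_subset_with_card_n[OF m] by blast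
    have Si: "S w = (\<lambda>i. f i w) ` {i\<in>I. a i w}" by (simp only: S_def image_Collect)
    obtain F where F: "F \<subseteq> {i\<in>I. a i w}" "inj_on (\<lambda>i. f i w) F" "T = (\<lambda>i. f i w) ` F"
      using T(1)[unfolded Si subset_image_inj] by (elim exE conjE)
    have c: "finite F" "card F = m" using T(2,3) unfolding F(3) by (simp_all add: finite_image_iff[OF F(2)] card_image[OF F(2)])
    show "w \<in> E m" unfolding E_def
    proof (rule UN_I)
      show "F \<in> {F. finite F \<and> F \<subseteq> I \<and> card F = m}" using c F(1) by auto
      have "a i w" "\<And>j. j \<in> F \<Longrightarrow> i \<noteq> j \<Longrightarrow> f i w \<noteq> f j w" if "i \<in> F" for i
        using that F(1) inj_onD[OF F(2), of i] by auto
      then show "w \<in> {w\<in>space M. \<forall>i\<in>F. a i w \<and> (\<forall>j\<in>F. i \<noteq> j \<longrightarrow> f i w \<noteq> f j w)}" using w by simp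
    qed
  qed
  have "{w\<in>space M. card (S w) = n} = E n - E (Suc n)"
  proof (rule set_eqI)
    fix w
    have "w \<in> E m \<Longrightarrow> w \<in> space M" for m using sets.sets_into_space[OF E] by blast
    then show "w \<in> {w\<in>space M. card (S w) = n} \<longleftrightarrow> w \<in> E n - E (Suc n)"
      using iff[of w n] iff[of w "Suc n"] by (cases "w \<in> space M") auto
  qed
  then show ?thesis using E unfolding S_def by simp
qed

text \<open>Radii are not bounded in advance, but a configuration has only finitely many centres in
  \<open>A\<close>, so the counts on A x [-m, m] are eventually equal to the centre count.\<close>

lemma centre_count_measurable:
  assumes A: "A \<in> sets borel" "bounded A"
  shows "(\<lambda>S. centre_count S A) \<in> (sphere_config_space :: ('a::euclidean_space \<times> real) set measure) \<rightarrow>\<^sub>M count_space UNIV"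
proof -
  define C where "C m = A \<times> {- real m..real m}" for m :: nat
  have C: "C m \<in> sets borel" "bounded (C m)" for m
    unfolding C_def using A by (auto simp: borel_prod[symmetric] intro: bounded_Times)
  have ev: "\<exists>M. \<forall>m\<ge>M. config_count S (C m) = centre_count S A" if S: "S \<in> sphere_configs" for S
  proof -
    have f: "finite {p\<in>S. fst p \<in> A}" using configsD(2)[OF S A(2)] .
    obtain K where K0: "\<forall>x\<in>snd ` {p\<in>S. fst p \<in> A}. norm x \<le> K"
      using finite_imp_bounded[OF finite_imageI[OF f, of snd]] unfolding bounded_iff by blast
    have K: "\<bar>snd p\<bar> \<le> K" if "p \<in> {p\<in>S. fst p \<in> A}" for p
      using bspec[OF K0 imageI[OF that]] by simp
    obtain M :: nat where M: "K \<le> real M" using real_arch_simple by blast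
    have "S \<inter> C m = {p\<in>S. fst p \<in> A}" if m: "M \<le> m" for m
    proof -
      have "- real m \<le> snd p \<and> snd p \<le> real m" if "p \<in> S" "fst p \<in> A" for p
      proof -
        have "\<bar>snd p\<bar> \<le> K" using K[of p] that by simp
        moreover have "real M \<le> real m" using m by simp
        ultimately show ?thesis using M by linarith
      qed
      then show ?thesis unfolding C_def by (auto simp: mem_Times_iff)
    qed
    then show ?thesis unfolding config_count_def centre_count_def by (intro exI[of _ M]) simp
  qed
  have "{S\<in>sphere_configs. centre_count S A = k} \<in> sets (sphere_config_space :: ('a \<times> real) set measure)" for k
  proof -
    have "{S\<in>sphere_configs. centre_count S A = k} = (\<Union>M. \<Inter>m\<in>{M..}. {S\<in>sphere_configs. config_count S (C m) = k})"
    proof (intro equalityI subsetI)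
      fix S assume "S \<in> {S\<in>sphere_configs. centre_count S A = k}"
      then show "S \<in> (\<Union>M. \<Inter>m\<in>{M..}. {S\<in>sphere_configs. config_count S (C m) = k})" using ev[of S] by auto
    next
      fix S assume "S \<in> (\<Union>M. \<Inter>m\<in>{M..}. {S\<in>sphere_configs. config_count S (C m) = k})"
      then obtain M where M: "\<And>m. M \<le> m \<Longrightarrow> S \<in> sphere_configs \<and> config_count S (C m) = k" by auto
      then have S: "S \<in> sphere_configs" by blast
      obtain M' where "\<And>m. M' \<le> m \<Longrightarrow> config_count S (C m) = centre_count S A" using ev[OF S] by blast
      from this[of "max M M'"] M[of "max M M'"] show "S \<in> {S\<in>sphere_configs. centre_count S A = k}" by simp
    qed
    also have "\<dots> \<in> sets sphere_config_space"
      using count_event[OF C] by (intro sets.countable_UN sets.countable_INT'') auto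
    finally show ?thesis .
  qed
  then show ?thesis
    by (intro measurable_count_space_eq_countable[THEN iffD2]) (auto simp: space_config vimage_def Int_def conj_commute)
qed

context slab
begin

section \<open>Tiling space by independent strips\<close>

definition gap :: real where "gap = 2 * (\<rho> + 3)"
definition KK :: "('a \<Rightarrow> int) set" where "KK = PiE rest (\<lambda>_. UNIV)"
definition shift :: "('a \<Rightarrow> int) \<Rightarrow> 'a" where "shift k = (\<Sum>b\<in>rest. (gap * real_of_int (k b)) *\<^sub>R b)"
definition Tl :: "('a \<Rightarrow> int) \<Rightarrow> label \<Rightarrow> 'a set" where "Tl k l = {y. y - shift k \<in> Yb l}"
abbreviation WW :: "(('a \<Rightarrow> int) \<Rightarrow> label \<Rightarrow> 'a sample) measure" where "WW \<equiv> PiM KK (\<lambda>_. tp.Om)"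
text \<open>Keeping only points inside their blocks makes the configuration locally finite and hard
  for every sample, without exceptional null sets.\<close>

definition cfg :: "(('a \<Rightarrow> int) \<Rightarrow> label \<Rightarrow> 'a sample) \<Rightarrow> ('a \<times> real) set" where
  "cfg W = {(shift k + snd (W k l) i, rr (W k) l i) |k l i. k \<in> KK \<and> i < fst (W k l) \<and> snd (W k l) i \<in> Yb l}"

lemma gap6: "6 < gap" using rho0 by (simp add: gap_def)

lemma KK_countable: "countable KK" unfolding KK_def by (intro countable_PiE rest) auto

lemma shift_inner: "b \<in> rest \<Longrightarrow> shift k \<bullet> b = gap * real_of_int (k b)" "shift k \<bullet> b1 = 0" "shift k \<bullet> b2 = 0"
proof -
  have *: "shift k \<bullet> c = (\<Sum>b\<in>rest. if b = c then gap * real_of_int (k b) else 0)" if "c \<in> Basis" for c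
    unfolding shift_def inner_sum_left using rest(6) that by (intro sum.cong) (auto simp: inner_Basis)
  show "b \<in> rest \<Longrightarrow> shift k \<bullet> b = gap * real_of_int (k b)" using *[of b] rest(1,6) by auto
  show "shift k \<bullet> b1 = 0" using *[OF b12(1)] rest(1,2) by simp
  show "shift k \<bullet> b2 = 0" using *[OF b12(2)] rest(1,3) by simp
qed

definition slb :: "'a \<Rightarrow> 'a \<Rightarrow> int" where
  "slb y = (\<lambda>b\<in>rest. \<lfloor>(y \<bullet> b + \<rho> + 3) / gap\<rfloor>)"

lemma strip_iff:
  assumes "k \<in> KK" shows "y - shift k \<in> strip \<longleftrightarrow> k = slb y"
proof
  assume s: "y - shift k \<in> strip"
  show "k = slb y"
  proof (rule PiE_ext[of k rest "\<lambda>_. UNIV"])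
    show "k \<in> PiE rest (\<lambda>_. UNIV)" using assms by (simp add: KK_def)
    show "slb y \<in> PiE rest (\<lambda>_. UNIV)" by (simp add: slb_def)
    fix b assume b: "b \<in> rest"
    have "- (\<rho> + 3) \<le> (y - shift k) \<bullet> b" "(y - shift k) \<bullet> b < \<rho> + 3" using s b by (auto simp: strip_def)
    then have e: "gap * real_of_int (k b) \<le> y \<bullet> b + \<rho> + 3" "y \<bullet> b + \<rho> + 3 < gap * (real_of_int (k b) + 1)"
      unfolding inner_diff_left shift_inner(1)[OF b] by (simp_all add: gap_def algebra_simps)
    have "\<lfloor>(y \<bullet> b + \<rho> + 3) / gap\<rfloor> = k b"
      using e gap6 by (intro floor_unique) (simp_all add: field_simps)
    then show "k b = slb y b" using b by (simp add: slb_def)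
  qed
next
  assume k: "k = slb y"
  show "y - shift k \<in> strip"
    unfolding strip_def
  proof (intro CollectI ballI)
    fix b assume b: "b \<in> rest"
    define f where "f = real_of_int \<lfloor>(y \<bullet> b + \<rho> + 3) / gap\<rfloor>"
    have "f \<le> (y \<bullet> b + \<rho> + 3) / gap" "(y \<bullet> b + \<rho> + 3) / gap < f + 1" unfolding f_def by linarith+
    then have "gap * f \<le> y \<bullet> b + \<rho> + 3" "y \<bullet> b + \<rho> + 3 < gap * f + gap" using gap6 by (simp_all add: field_simps)
    moreover have "(y - shift k) \<bullet> b = y \<bullet> b - gap * f"
      unfolding inner_diff_left shift_inner(1)[OF b] k using b by (simp add: slb_def f_def)
    ultimately show "- (\<rho> + 3) \<le> (y - shift k) \<bullet> b \<and> (y - shift k) \<bullet> b < \<rho> + 3" by (simp add: gap_def)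
  qed
qed

lemma slb_KK: "slb y \<in> KK" by (simp add: slb_def KK_def)

lemma Tl_disjoint:
  assumes "k \<in> KK" "k' \<in> KK" "y \<in> Tl k l" "y \<in> Tl k' l'" shows "k = k' \<and> l = l'"
proof -
  have y: "y - shift k \<in> Yb l" "y - shift k' \<in> Yb l'" using assms(3,4) by (auto simp: Tl_def)
  have "y - shift k \<in> strip" "y - shift k' \<in> strip" using y Yb_strip by blast+
  then have k: "k = k'" using strip_iff assms(1,2) by metis
  then show ?thesis using Yb_disjoint[OF y(1)] y(2) by simp
qed

lemma Tl_cover: "\<exists>k\<in>KK. \<exists>l. y \<in> Tl k l"
proof -
  have "y - shift (slb y) \<in> strip" using strip_iff[OF slb_KK] by simp
  from Yb_cover[OF this] show ?thesis using slb_KK by (auto simp: Tl_def)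
qed

lemma slb_bound:
  assumes "norm y \<le> real n" "b \<in> rest" shows "\<bar>slb y b\<bar> \<le> int n + 1"
proof -
  have b: "\<bar>y \<bullet> b\<bar> \<le> real n" using Basis_le_norm[of b y] assms rest(6) by auto
  have g: "1 \<le> gap" "\<rho> + 3 \<le> gap" using gap6 rho0 by (simp_all add: gap_def)
  have "(y \<bullet> b + \<rho> + 3) \<le> (real n + 1) * gap"
  proof -
    have "real n * 1 \<le> real n * gap" using g by (intro mult_left_mono) auto
    then show ?thesis using b g by (simp add: algebra_simps abs_le_iff)
  qed
  moreover have "- ((real n + 1) * gap) \<le> y \<bullet> b + \<rho> + 3"
  proof -
    have "real n * 1 \<le> (real n + 1) * gap" using g by (intro mult_mono) auto
    then show ?thesis using b rho0 by (simp add: abs_le_iff)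
  qed
  ultimately have "(y \<bullet> b + \<rho> + 3) / gap \<le> real n + 1" "- (real n + 1) \<le> (y \<bullet> b + \<rho> + 3) / gap"
    using g by (simp_all add: field_simps)
  then show ?thesis using assms(2) unfolding slb_def by (simp add: abs_le_iff) linarith
qed

lemma Tl_finite:
  assumes "bounded A" shows "finite {kl. fst kl \<in> KK \<and> Tl (fst kl) (snd kl) \<inter> A \<noteq> {}}"
proof -
  obtain c where c: "\<And>y. y \<in> A \<Longrightarrow> norm y \<le> c" using assms by (auto simp: bounded_iff)
  obtain n :: nat where n: "c \<le> real n" using real_arch_simple by blast
  have "bounded (strip \<inter> {y. \<bar>y \<bullet> b1\<bar> \<le> real n \<and> \<bar>y \<bullet> b2\<bar> \<le> real n})" by (rule strip_bounded)
  then obtain c' where c': "\<And>y. y \<in> strip \<inter> {y. \<bar>y \<bullet> b1\<bar> \<le> real n \<and> \<bar>y \<bullet> b2\<bar> \<le> real n} \<Longrightarrow> norm y \<le> c'" unfolding bounded_iff by blast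
  obtain n' :: nat where n': "c' \<le> real n'" using real_arch_simple by blast
  have "{kl. fst kl \<in> KK \<and> Tl (fst kl) (snd kl) \<inter> A \<noteq> {}} \<subseteq> PiE rest (\<lambda>_. {- (int n + 1)..int n + 1}) \<times> lbox (4 * n' + 12)"
  proof
    fix kl :: "('a \<Rightarrow> int) \<times> label" assume "kl \<in> {kl. fst kl \<in> KK \<and> Tl (fst kl) (snd kl) \<inter> A \<noteq> {}}"
    then obtain y where k: "fst kl \<in> KK" and y: "y \<in> A" "y - shift (fst kl) \<in> Yb (snd kl)" by (auto simp: Tl_def)
    have yn: "norm y \<le> real n" using c[OF y(1)] n by simp
    have s: "y - shift (fst kl) \<in> strip" using y(2) Yb_strip by blast
    have ks: "fst kl = slb y" using s strip_iff[OF k] by simp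
    have "\<bar>y \<bullet> b1\<bar> \<le> real n" "\<bar>y \<bullet> b2\<bar> \<le> real n" using Basis_le_norm[of b1 y] Basis_le_norm[of b2 y] b12 yn by auto
    then have "norm (y - shift (fst kl)) \<le> c'" using s by (intro c') (simp add: inner_diff_left shift_inner)
    then have "snd kl \<in> lbox (4 * n' + 12)" using y(2) n' by (intro Yb_lbox) auto
    moreover have "fst kl \<in> PiE rest (\<lambda>_. {- (int n + 1)..int n + 1})"
      unfolding ks
    proof (rule PiE_I)
      fix b assume "b \<in> rest"
      then show "slb y b \<in> {- (int n + 1)..int n + 1}" using slb_bound[OF yn, of b] by (simp add: abs_le_iff)
    qed (simp add: slb_def)
    ultimately show "kl \<in> PiE rest (\<lambda>_. {- (int n + 1)..int n + 1}) \<times> lbox (4 * n' + 12)" by (cases kl) simp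
  qed
  then show ?thesis by (rule finite_subset) (intro finite_cartesian_product finite_PiE rest lbox_finite; simp)
qed

lemma cfg_finite:
  assumes "bounded A" shows "finite {p\<in>cfg W. fst p \<in> A}"
proof -
  define F where "F = {kl. fst kl \<in> KK \<and> Tl (fst kl) (snd kl) \<inter> A \<noteq> {}}"
  have f: "finite (SIGMA kl:F. {..<fst (W (fst kl) (snd kl))})" using Tl_finite[OF assms] by (simp add: F_def)
  have "{p\<in>cfg W. fst p \<in> A} \<subseteq> (\<lambda>x. (shift (fst (fst x)) + snd (W (fst (fst x)) (snd (fst x))) (snd x), rr (W (fst (fst x))) (snd (fst x)) (snd x))) ` (SIGMA kl:F. {..<fst (W (fst kl) (snd kl))})"
  proof
    fix p assume "p \<in> {p\<in>cfg W. fst p \<in> A}"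
    then obtain k l i where x: "p = (shift k + snd (W k l) i, rr (W k) l i)" "k \<in> KK" "i < fst (W k l)" "snd (W k l) i \<in> Yb l" "fst p \<in> A"
      by (auto simp: cfg_def)
    have "shift k + snd (W k l) i \<in> Tl k l \<inter> A" using x by (simp add: Tl_def)
    then have "(k, l) \<in> F" using x(2) by (auto simp: F_def)
    then show "p \<in> (\<lambda>x. (shift (fst (fst x)) + snd (W (fst (fst x)) (snd (fst x))) (snd x), rr (W (fst (fst x))) (snd (fst x)) (snd x))) ` (SIGMA kl:F. {..<fst (W (fst kl) (snd kl))})"
      using x by (intro image_eqI[of _ _ "((k, l), i)"]) auto
  qed
  then show ?thesis using finite_surj[OF f] by blast
qed

lemma cfg_configs: "cfg W \<in> sphere_configs"
  unfolding sphere_configs_def using cfg_finite[of _ W] rr_bounds(1) by (auto simp: cfg_def)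

lemma W_comp:
  assumes "k \<in> KK"
  shows "(\<lambda>W. W k) \<in> WW \<rightarrow>\<^sub>M tp.Om" "(\<lambda>W. W k l) \<in> WW \<rightarrow>\<^sub>M tp.B l"
    "(\<lambda>W. snd (W k l) i) \<in> borel_measurable WW" "(\<lambda>W. fst (W k l)) \<in> WW \<rightarrow>\<^sub>M count_space UNIV"
    "(\<lambda>W. rr (W k) l i) \<in> borel_measurable WW"
proof -
  show 1: "(\<lambda>W. W k) \<in> WW \<rightarrow>\<^sub>M tp.Om" using assms by (rule measurable_component_singleton)
  have "(\<lambda>w. w l) \<in> tp.Om \<rightarrow>\<^sub>M tp.B l" by (rule measurable_component_singleton) simp
  from measurable_compose[OF 1 this] show 2: "(\<lambda>W. W k l) \<in> WW \<rightarrow>\<^sub>M tp.B l" .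
  show "(\<lambda>W. snd (W k l) i) \<in> borel_measurable WW" by (rule measurable_compose[OF 2 tp.pt_measurable])
  show "(\<lambda>W. fst (W k l)) \<in> WW \<rightarrow>\<^sub>M count_space UNIV" by (rule measurable_compose[OF 2 tp.N_measurable])
  show "(\<lambda>W. rr (W k) l i) \<in> borel_measurable WW" by (rule measurable_compose[OF 1 rr_measurable])
qed

sublocale WW: prob_space WW by (rule prob_space_PiM) (rule tp.Om.prob_space_axioms)

lemma cfg_measurable: "cfg \<in> WW \<rightarrow>\<^sub>M sphere_config_space"
  unfolding sphere_config_space_def
proof (rule measurable_measure_of)
  show "{{S\<in>sphere_configs. config_count S C = k} |C k. C \<in> sets borel \<and> bounded C} \<subseteq> Pow (sphere_configs :: ('a \<times> real) set set)" by auto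
  show "cfg \<in> space WW \<rightarrow> sphere_configs" using cfg_configs by blast
  fix y :: "('a \<times> real) set set" assume "y \<in> {{S\<in>sphere_configs. config_count S C = k} |C k. C \<in> sets borel \<and> bounded C}"
  then obtain C n where y: "y = {S\<in>sphere_configs. config_count S C = n}" and C: "C \<in> sets borel" "bounded C" by blast
  define I where "I = KK \<times> (UNIV :: (label \<times> nat) set)"
  define f where "f x W = (shift (fst x) + snd (W (fst x) (fst (snd x))) (snd (snd x)), rr (W (fst x)) (fst (snd x)) (snd (snd x)))"
    for x :: "('a \<Rightarrow> int) \<times> label \<times> nat" and W :: "('a \<Rightarrow> int) \<Rightarrow> label \<Rightarrow> 'a sample"
  define a where "a x W \<longleftrightarrow> snd (snd x) < fst (W (fst x) (fst (snd x))) \<and> snd (W (fst x) (fst (snd x))) (snd (snd x)) \<in> Yb (fst (snd x)) \<and> f x W \<in> C"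
    for x :: "('a \<Rightarrow> int) \<times> label \<times> nat" and W :: "('a \<Rightarrow> int) \<Rightarrow> label \<Rightarrow> 'a sample"
  have S: "cfg W \<inter> C = {f x W |x. x \<in> I \<and> a x W}" for W
  proof (intro equalityI subsetI)
    fix p assume "p \<in> cfg W \<inter> C"
    then obtain k l i where x: "p = (shift k + snd (W k l) i, rr (W k) l i)" "k \<in> KK" "i < fst (W k l)" "snd (W k l) i \<in> Yb l" "p \<in> C"
      by (auto simp: cfg_def)
    then show "p \<in> {f x W |x. x \<in> I \<and> a x W}"
      by (intro CollectI exI[of _ "(k, l, i)"]) (simp add: I_def f_def a_def)
  next
    fix p assume "p \<in> {f x W |x. x \<in> I \<and> a x W}"
    then obtain x where x: "x \<in> I" "a x W" "p = f x W" by blast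
    have "p \<in> cfg W" unfolding cfg_def x(3) f_def
      by (intro CollectI exI[of _ "fst x"] exI[of _ "fst (snd x)"] exI[of _ "snd (snd x)"]) (use x in \<open>auto simp: I_def a_def\<close>)
    then show "p \<in> cfg W \<inter> C" using x by (simp add: a_def)
  qed
  have fm: "f x \<in> borel_measurable WW" if "x \<in> I" for x
  proof -
    have k: "fst x \<in> KK" using that by (auto simp: I_def)
    note W_comp(3,5)[OF k, measurable]
    show ?thesis unfolding f_def by measurable
  qed
  have "{W\<in>space WW. card {f x W |x. x \<in> I \<and> a x W} = n} \<in> sets WW"
  proof (rule card_image_event[OF _ _ fm])
    show "countable I" unfolding I_def by (intro countable_SIGMA KK_countable) auto
    fix x assume x: "x \<in> I"
    have k: "fst x \<in> KK" using x by (auto simp: I_def)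
    note W_comp(3,4)[OF k, measurable] fm[OF x, measurable] C(1)[measurable]
    show "Measurable.pred WW (a x)" unfolding a_def by measurable
  next
    fix W
    show "finite {f x W |x. x \<in> I \<and> a x W}" unfolding S[symmetric] by (rule configsD(3)[OF cfg_configs C(2)])
  qed auto
  moreover have "cfg -` y \<inter> space WW = {W\<in>space WW. card {f x W |x. x \<in> I \<and> a x W} = n}"
    unfolding y S[symmetric] using cfg_configs by (auto simp: config_count_def)
  ultimately show "cfg -` y \<inter> space WW \<in> sets WW" by simp
qed

text \<open>Within one strip this is \<open>slab_hard\<close>. For different strips with at least
  one positive radius, that centre is within \<rho> of the axis plane in each orthogonal coordinate
  and the other within \<rho> + 3. Since \<open>gap\<close> is 2 * \<rho> + 6, they are at least 3
  apart, more than two maximal radii.\<close>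

lemma cfg_hard:
  assumes "p \<in> cfg W" "q \<in> cfg W" "p \<noteq> q"
  shows "snd p + snd q \<le> dist (fst p) (fst q)"
proof -
  obtain k l i where p: "p = (shift k + snd (W k l) i, rr (W k) l i)" "k \<in> KK" "i < fst (W k l)" "snd (W k l) i \<in> Yb l"
    using assms(1) by (auto simp: cfg_def)
  obtain k' l' i' where q: "q = (shift k' + snd (W k' l') i', rr (W k') l' i')" "k' \<in> KK" "i' < fst (W k' l')" "snd (W k' l') i' \<in> Yb l'"
    using assms(2) by (auto simp: cfg_def)
  show ?thesis
  proof (cases "k = k'")
    case True
    have "(l, i) \<noteq> (l', i')" using assms(3) p q True by auto
    from slab_hard[OF this, of "W k"] show ?thesis using p q True by simp
  next
    case k: False
    show ?thesis
    proof (cases "snd p = 0 \<and> snd q = 0")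
      case False
      obtain b where b: "b \<in> rest" "k b \<noteq> k' b" using k PiE_ext[of k rest "\<lambda>_. UNIV" k'] p(2) q(2) by (auto simp: KK_def)
      have x: "\<bar>snd (W k l) i \<bullet> b\<bar> \<le> \<rho> + 3" "\<bar>snd (W k' l') i' \<bullet> b\<bar> \<le> \<rho> + 3"
        using p(4) q(4) Yb_strip[of l] Yb_strip[of l'] b(1) by (force simp: strip_def)+
      have "\<bar>snd (W k l) i \<bullet> b\<bar> \<le> \<rho> \<or> \<bar>snd (W k' l') i' \<bullet> b\<bar> \<le> \<rho>"
      proof (cases "rr (W k) l i = 0")
        case True
        then have "rr (W k') l' i' \<noteq> 0" using False p(1) q(1) by simp
        from rr_bounds(3)[OF this] show ?thesis using Qn_rest[of "snd (W k' l') i'" l' b] b(1) by blast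
      next
        case False
        from rr_bounds(3)[OF this] show ?thesis using Qn_rest[of "snd (W k l) i" l b] b(1) by blast
      qed
      then have xx: "\<bar>snd (W k l) i \<bullet> b\<bar> + \<bar>snd (W k' l') i' \<bullet> b\<bar> \<le> 2 * \<rho> + 3" using x by linarith
      have "1 \<le> \<bar>real_of_int (k b) - real_of_int (k' b)\<bar>" using b(2) by linarith
      then have "gap * 1 \<le> gap * \<bar>real_of_int (k b) - real_of_int (k' b)\<bar>" using gap6 by (intro mult_left_mono) auto
      then have g: "gap \<le> \<bar>gap * real_of_int (k b) - gap * real_of_int (k' b)\<bar>"
        using gap6 by (simp add: right_diff_distrib[symmetric] abs_mult)
      have "(fst p - fst q) \<bullet> b = (gap * real_of_int (k b) - gap * real_of_int (k' b)) + (snd (W k l) i \<bullet> b - snd (W k' l') i' \<bullet> b)"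
        unfolding p(1) q(1) by (simp add: inner_diff_left inner_add_left shift_inner(1)[OF b(1)])
      then have "3 \<le> \<bar>(fst p - fst q) \<bullet> b\<bar>" using g xx by (simp add: gap_def)
      also have "\<dots> \<le> norm (fst p - fst q)" using b(1) rest(6) by (intro Basis_le_norm) auto
      finally show ?thesis using rr_bounds(2)[of "W k" l i] rr_bounds(2)[of "W k'" l' i'] p(1) q(1) by (simp add: dist_norm)
    qed simp
  qed
qed

text \<open>Transfers the infinite tree of one strip to an unbounded cluster of the whole
  configuration, with a centre near the copy of site \<open>z\<close> in that strip.\<close>

lemma good_cluster:
  assumes k: "k \<in> KK" and g: "W k \<in> good z"
  obtains p where "p \<in> cfg W" "unb (cfg W) p" "dist (fst p) (shift k + ctr (fst z, snd z, 0)) \<le> \<rho> + 1"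
proof -
  have R: "W k \<in> xp.R" by (rule good_live(3)[OF g])
  obtain \<pi> where pl: "xp.live (W k) (fst z, snd z, 0) \<pi>" using good_live(1)[OF g] by (auto simp: lv_def)
  define \<gamma> where "\<gamma> = ex \<pi>"
  have ga: "\<gamma> \<in> actp (W k)" "\<gamma> \<noteq> []" "hd \<gamma> = (fst z, snd z, 0)" unfolding \<gamma>_def using live_actp[OF pl] live_form[OF pl] by auto
  have in_cfg: "(shift k + tp.pos \<delta> (W k), tp.rad \<delta> (W k)) \<in> cfg W \<and> tp.pos \<delta> (W k) \<in> Qn (hd \<delta>) \<and> 0 \<le> tp.rad \<delta> (W k)"
    if d: "\<delta> \<in> actp (W k)" for \<delta>
  proof -
    note O = tp.okn_props[OF actp_ne[OF d] actp_okn[OF d R]]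
    have "snd (W k (hd \<delta>)) (tp.idx \<delta> (W k)) \<in> Yb (hd \<delta>)" using O(2) Qn_Yb unfolding tp.pos_def by blast
    then show ?thesis unfolding cfg_def using k O(1,2,3) actp_rr[OF d R] tp.pos_def[of \<delta> "W k"]
      by (intro conjI CollectI exI[of _ k] exI[of _ "hd \<delta>"] exI[of _ "tp.idx \<delta> (W k)"]) auto
  qed
  define p where "p = (shift k + tp.pos \<gamma> (W k), tp.rad \<gamma> (W k))"
  have p: "p \<in> cfg W" "tp.pos \<gamma> (W k) \<in> Qn (fst z, snd z, 0)" using in_cfg[OF ga(1)] ga(3) by (simp_all add: p_def)
  define T where "T = connected_component_set (tree (W k)) (tp.pos [(0, 0, 0)] (W k))"
  have "(+) (shift k) ` T \<subseteq> connected_component_set (occupied (cfg W)) (fst p)"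
  proof (rule connected_component_maximal)
    have "tp.pos \<gamma> (W k) \<in> T" unfolding T_def using tree_connected[OF R ga(1)] by simp
    then show "fst p \<in> (+) (shift k) ` T" by (simp add: p_def)
    show "connected ((+) (shift k) ` T)" unfolding T_def by (intro connected_continuous_image continuous_intros) simp
    show "(+) (shift k) ` T \<subseteq> occupied (cfg W)"
    proof
      fix y assume "y \<in> (+) (shift k) ` T"
      then obtain t where t: "t \<in> T" "y = shift k + t" by blast
      have "t \<in> tree (W k)" using t(1) connected_component_subset unfolding T_def by blast
      then obtain \<delta> where d: "\<delta> \<in> actp (W k)" "t \<in> cball (tp.pos \<delta> (W k)) (tp.rad \<delta> (W k))" by (auto simp: tree_def)
      then show "y \<in> occupied (cfg W)" unfolding occupied_def t(2)
        using in_cfg[OF d(1)] by (intro UN_I[of "(shift k + tp.pos \<delta> (W k), tp.rad \<delta> (W k))"]) auto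
    qed
  qed
  moreover have "\<not> bounded ((+) (shift k) ` T)"
  proof
    assume "bounded ((+) (shift k) ` T)"
    from bounded_translation[OF this, of "- shift k"] have "bounded T" by (simp add: image_image)
    then show False using tree_unbounded[OF g] by (simp add: T_def)
  qed
  ultimately have u: "unb (cfg W) p" unfolding unb_def using bounded_subset by blast
  have "dist (fst p) (shift k + ctr (fst z, snd z, 0)) \<le> \<rho> + 1"
  proof (rule power2_le_imp_le)
    define c where "c = ctr (fst z, snd z, 0)"
    define x where "x = tp.pos \<gamma> (W k)"
    have "x \<in> cell \<rho> c" using p(2) by (simp add: Qn_def x_def c_def split: if_splits)
    then have "((x - c) \<bullet> b1)\<^sup>2 \<le> hs\<^sup>2" "((x - c) \<bullet> b2)\<^sup>2 \<le> hs\<^sup>2" "nT (x - c) \<le> \<rho>\<^sup>2"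
      by (auto simp: cell_def hs_def abs_le_square_iff[symmetric])
    then have "(norm (x - c))\<^sup>2 \<le> hs\<^sup>2 + hs\<^sup>2 + \<rho>\<^sup>2" unfolding norm_split by linarith
    also have "\<dots> \<le> (\<rho> + 1)\<^sup>2" using rho0 by (simp add: hs_def power2_eq_square algebra_simps)
    finally show "(dist (fst p) (shift k + ctr (fst z, snd z, 0)))\<^sup>2 \<le> (\<rho> + 1)\<^sup>2"
      by (simp add: p_def dist_norm x_def c_def)
  qed (use rho0 in simp)
  with p(1) u show thesis by (rule that)
qed

text \<open>Given all other points, a resampled point hits a given one with probability 0. Without
  this, coinciding points would be counted only once in the set \<open>cfg W\<close>.\<close>

lemma block_distinct: "AE s in tp.B l. \<forall>i<fst s. \<forall>j<fst s. i \<noteq> j \<longrightarrow> snd s i \<noteq> snd s j"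
proof -
  interpret pb: pblock "Ub l" "mb l" by (rule tp.pblock)
  have sU[measurable_cong]: "sets (Ub l) = sets borel" by (rule Ub_sets)
  note tp.pt_measurable[of _ l, measurable] tp.N_measurable[of l, measurable]
  have z: "AE s in tp.B l. \<not> (i < fst s \<and> snd s i = snd s j)" if ij: "i \<noteq> j" for i j
  proof -
    let ?P = "PiM UNIV (\<lambda>_::nat. Ub l)"
    have m: "Measurable.pred (tp.B l) (\<lambda>s. i < fst s \<and> snd s i = snd s j)" by measurable
    define g where "g s = (indicator {s\<in>space (tp.B l). i < fst s \<and> snd s i = snd s j} s :: ennreal)" for s
    have gm: "g \<in> borel_measurable (tp.B l)" unfolding g_def using m by (intro borel_measurable_indicator) (simp add: pred_def)
    define h where "h x = (indicator {x\<in>space ?P. x i = x j} x :: ennreal)" for x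
    have hE: "{x\<in>space ?P. x i = x j} \<in> sets ?P"
    proof -
      have [measurable]: "(\<lambda>x. x i) \<in> borel_measurable ?P" "(\<lambda>x. x j) \<in> borel_measurable ?P"
        using measurable_component_singleton[of i UNIV "\<lambda>_. Ub l"] measurable_component_singleton[of j UNIV "\<lambda>_. Ub l"]
        by (simp_all cong: measurable_cong_sets)
      show ?thesis by measurable
    qed
    have "(\<integral>\<^sup>+s. g s \<partial>tp.B l) = (\<integral>\<^sup>+N. (\<integral>\<^sup>+x. g (N, x) \<partial>?P) \<partial>measure_pmf (pois (mb l)))" by (rule pb.nn_integral_blk[OF gm])
    also have "\<dots> = 0"
    proof (cases "mb l = 0")
      case True
      then have "(\<integral>\<^sup>+N. (\<integral>\<^sup>+x. g (N, x) \<partial>?P) \<partial>measure_pmf (pois (mb l))) = (\<integral>\<^sup>+x. g (0, x) \<partial>?P)"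
        by (simp add: pois_def nn_integral_return_pmf)
      also have "\<dots> = 0" by (simp add: g_def)
      finally show ?thesis .
    next
      case False
      have pt0: "emeasure (Ub l) {y} = 0" for y
      proof -
        have "ennreal (mb l) * emeasure (Ub l) {y} = ennreal lam * emeasure lborel ({y} \<inter> Yb l)" by (rule Ub_emeasure) simp
        also have "emeasure lborel ({y} \<inter> Yb l) \<le> emeasure lborel {y}" by (intro emeasure_mono) auto
        finally have "ennreal (mb l) * emeasure (Ub l) {y} = 0" by (simp add: mult_left_mono)
        then show ?thesis using False mb_nonneg[of l] by auto
      qed
      have "(\<integral>\<^sup>+x. h x \<partial>?P) = (\<integral>\<^sup>+x. (\<integral>\<^sup>+s. h (fun_upd x i s) \<partial>Ub l) \<partial>?P)"
        by (rule nn_integral_PiM_update) (use Ub_prob hE in \<open>auto simp: h_def\<close>)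
      also have "\<dots> \<le> (\<integral>\<^sup>+x. (\<integral>\<^sup>+s. indicator {x j} s \<partial>Ub l) \<partial>?P)"
        using ij by (intro nn_integral_mono) (auto simp: h_def indicator_def)
      also have "\<dots> = 0" using pt0 sU by simp
      finally have h0: "(\<integral>\<^sup>+x. h x \<partial>?P) = 0" by simp
      have "(\<integral>\<^sup>+x. g (N, x) \<partial>?P) \<le> (\<integral>\<^sup>+x. h x \<partial>?P)" for N
        by (intro nn_integral_mono) (auto simp: g_def h_def indicator_def)
      then have "(\<integral>\<^sup>+x. g (N, x) \<partial>?P) = 0" for N using h0 by simp
      then show ?thesis by simp
    qed
    finally have "AE s in tp.B l. g s = 0" using gm by (simp add: nn_integral_0_iff_AE)
    then show ?thesis by (rule AE_mp) (rule AE_I2, simp add: g_def indicator_def split: if_splits)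
  qed
  have "AE s in tp.B l. \<forall>i j. i \<noteq> j \<longrightarrow> \<not> (i < fst s \<and> snd s i = snd s j)"
    unfolding AE_all_countable using z by auto
  then show ?thesis by (rule AE_mp) (rule AE_I2, blast)
qed

lemma all_distinct: "AE W in WW. \<forall>k\<in>KK. \<forall>l. \<forall>i<fst (W k l). \<forall>j<fst (W k l). i \<noteq> j \<longrightarrow> snd (W k l) i \<noteq> snd (W k l) j"
proof (rule AE_ball_countable[OF KK_countable, THEN iffD2], rule ballI, rule AE_all_countable[THEN iffD2], rule allI)
  fix k l assume k: "k \<in> KK"
  have "AE w in tp.Om. \<forall>i<fst (w l). \<forall>j<fst (w l). i \<noteq> j \<longrightarrow> snd (w l) i \<noteq> snd (w l) j"
    by (rule AE_PiM_component[where P="\<lambda>s. \<forall>i<fst s. \<forall>j<fst s. i \<noteq> j \<longrightarrow> snd s i \<noteq> snd s j", OF tp.B_prob UNIV_I block_distinct])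
  then show "AE W in WW. \<forall>i<fst (W k l). \<forall>j<fst (W k l). i \<noteq> j \<longrightarrow> snd (W k l) i \<noteq> snd (W k l) j"
    by (rule AE_PiM_component[where P="\<lambda>w. \<forall>i<fst (w l). \<forall>j<fst (w l). i \<noteq> j \<longrightarrow> snd (w l) i \<noteq> snd (w l) j", rotated 2]) (auto intro: tp.Om.prob_space_axioms k)
qed

definition loc :: "('a \<Rightarrow> int) \<Rightarrow> label \<Rightarrow> 'a set \<Rightarrow> 'a set" where "loc k l A = {x\<in>Yb l. shift k + x \<in> A}"

lemma centre_count_cfg:
  assumes d: "\<forall>k\<in>KK. \<forall>l. \<forall>i<fst (W k l). \<forall>j<fst (W k l). i \<noteq> j \<longrightarrow> snd (W k l) i \<noteq> snd (W k l) j"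
    and K: "finite K" "K \<subseteq> KK" "finite L" "\<And>k l. k \<in> KK \<Longrightarrow> Tl k l \<inter> A \<noteq> {} \<Longrightarrow> k \<in> K \<and> l \<in> L"
  shows "centre_count (cfg W) A = (\<Sum>k\<in>K. \<Sum>l\<in>L. card {i. i < fst (W k l) \<and> snd (W k l) i \<in> loc k l A})"
proof -
  define I where "I = (SIGMA kl:K \<times> L. {i. i < fst (W (fst kl) (snd kl)) \<and> snd (W (fst kl) (snd kl)) i \<in> loc (fst kl) (snd kl) A})"
  define f where "f x = (shift (fst (fst x)) + snd (W (fst (fst x)) (snd (fst x))) (snd x), rr (W (fst (fst x))) (snd (fst x)) (snd x))" for x
  have "{p\<in>cfg W. fst p \<in> A} = f ` I"
  proof (intro equalityI subsetI)
    fix p assume "p \<in> {p\<in>cfg W. fst p \<in> A}"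
    then obtain k l i where x: "p = (shift k + snd (W k l) i, rr (W k) l i)" "k \<in> KK" "i < fst (W k l)" "snd (W k l) i \<in> Yb l" "fst p \<in> A"
      by (auto simp: cfg_def)
    have "shift k + snd (W k l) i \<in> Tl k l \<inter> A" using x by (simp add: Tl_def)
    then have "k \<in> K \<and> l \<in> L" using K(4)[OF x(2), of l] by blast
    then show "p \<in> f ` I" using x by (intro image_eqI[of _ _ "((k, l), i)"]) (auto simp: f_def I_def loc_def)
  next
    fix p assume "p \<in> f ` I"
    then obtain x where x: "x \<in> I" "p = f x" by blast
    obtain k l i where xe: "x = ((k, l), i)" by (cases x) (metis prod.exhaust)
    have y: "k \<in> KK" "i < fst (W k l)" "snd (W k l) i \<in> Yb l" "shift k + snd (W k l) i \<in> A"
      using x(1) K(2) unfolding xe I_def loc_def by auto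
    have pe: "p = (shift k + snd (W k l) i, rr (W k) l i)" unfolding x(2) xe f_def by simp
    have "p \<in> cfg W" unfolding cfg_def pe by (intro CollectI exI[of _ k] exI[of _ l] exI[of _ i] conjI refl y(1-3))
    then show "p \<in> {p\<in>cfg W. fst p \<in> A}" using y(4) unfolding pe by simp
  qed
  moreover have "inj_on f I"
  proof (rule inj_onI)
    fix x y assume xy: "x \<in> I" "y \<in> I" "f x = f y"
    obtain k l i where xe: "x = ((k, l), i)" by (cases x) (metis prod.exhaust)
    obtain k' l' i' where ye: "y = ((k', l'), i')" by (cases y) (metis prod.exhaust)
    have a: "k \<in> KK" "k' \<in> KK" "i < fst (W k l)" "i' < fst (W k' l')" "snd (W k l) i \<in> Yb l" "snd (W k' l') i' \<in> Yb l'"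
      using xy(1,2) K(2) unfolding xe ye I_def loc_def by auto
    have e: "shift k + snd (W k l) i = shift k' + snd (W k' l') i'" using xy(3) unfolding xe ye f_def by simp
    have "shift k + snd (W k l) i \<in> Tl k l" "shift k + snd (W k l) i \<in> Tl k' l'" unfolding Tl_def using a(5,6) by (simp, simp add: e)
    then have kl: "k = k'" "l = l'" using Tl_disjoint[OF a(1,2)] by blast+
    have "snd (W k l) i = snd (W k l) i'" "i' < fst (W k l)" using e a(4) kl by simp_all
    then have "i = i'" using d a(1,3) by blast
    then show "x = y" using kl xe ye by simp
  qed
  ultimately have "centre_count (cfg W) A = card I" unfolding centre_count_def by (simp add: card_image)
  also have "\<dots> = (\<Sum>kl\<in>K \<times> L. card {i. i < fst (W (fst kl) (snd kl)) \<and> snd (W (fst kl) (snd kl)) i \<in> loc (fst kl) (snd kl) A})"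
    unfolding I_def using K by (intro card_SigmaI) auto
  also have "\<dots> = (\<Sum>k\<in>K. \<Sum>l\<in>L. card {i. i < fst (W k l) \<and> snd (W k l) i \<in> loc k l A})"
    by (simp add: sum.cartesian_product split_beta')
  finally show ?thesis .
qed

lemma loc_borel: "A \<in> sets borel \<Longrightarrow> loc k l A \<in> sets borel"
proof -
  assume [measurable]: "A \<in> sets borel"
  have "{x\<in>space borel. x \<in> Yb l \<and> shift k + x \<in> A} \<in> sets borel" by measurable
  then show ?thesis by (simp add: loc_def)
qed

lemma loc_measure:
  assumes A: "A \<in> sets borel"
  shows "measure lborel (loc k l A) = measure lborel (A \<inter> Tl k l)"
proof -
  have "loc k l A = (+) (shift k) -` (A \<inter> Tl k l)" by (auto simp: loc_def Tl_def)
  moreover have Tb: "A \<inter> Tl k l \<in> sets borel"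
  proof -
    note A[measurable]
    have "{x\<in>space borel. x \<in> A \<and> x - shift k \<in> Yb l} \<in> sets borel" by measurable
    then show ?thesis by (simp add: Tl_def Int_def)
  qed
  ultimately have "emeasure lborel (A \<inter> Tl k l) = emeasure lborel (loc k l A)"
    using emeasure_distr[of "(+) (shift k)" lborel borel "A \<inter> Tl k l"] by (simp add: lborel_distr_plus)
  then show ?thesis by (simp add: measure_def)
qed

text \<open>Only finitely many blocks meet the bounded sets. Their Poisson counts are superposed,
  over the labels of a strip and then over strips, and the means add up to \<open>lam\<close> times
  the volume because the translated blocks tile space.\<close>

lemma cfg_poisson_counts:
  assumes A: "\<And>j. j < n \<Longrightarrow> A j \<in> sets borel \<and> bounded (A j)" and disj: "disjoint_family_on A {..<n}"
  shows "poisson_counts (distr WW sphere_config_space cfg) n (\<lambda>j S. centre_count S (A j)) (\<lambda>j. lam * measure lborel (A j))"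
proof -
  define F where "F = {kl. fst kl \<in> KK \<and> Tl (fst kl) (snd kl) \<inter> (\<Union>j<n. A j) \<noteq> {}}"
  have Ff: "finite F" unfolding F_def using A by (intro Tl_finite bounded_UN) auto
  define K L where "K = fst ` F" and "L = snd ` F"
  have KL: "finite K" "K \<subseteq> KK" "finite L" using Ff by (auto simp: K_def L_def F_def)
  have KL4: "k \<in> K \<and> l \<in> L" if "k \<in> KK" "Tl k l \<inter> A j \<noteq> {}" "j < n" for k l j
  proof -
    have "(k, l) \<in> F" using that by (auto simp: F_def)
    then show ?thesis unfolding K_def L_def by (metis fst_conv snd_conv image_eqI)
  qed
  have blk: "poisson_counts (tp.B l) n (\<lambda>j s. cnt (\<lambda>j. loc k l (A j)) (fst s) j (snd s)) (\<lambda>j. lam * measure lborel (A j \<inter> Tl k l))" for k l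
  proof -
    interpret pb: pblock "Ub l" "mb l" by (rule tp.pblock)
    have lb: "loc k l (A j) \<in> sets (Ub l)" if "j < n" for j using loc_borel A that Ub_sets by blast
    have ld: "disjoint_family_on (\<lambda>j. loc k l (A j)) {..<n}" using disj by (auto simp: disjoint_family_on_def loc_def)
    have mean: "mb l * measure (Ub l) (loc k l (A j)) = lam * measure lborel (A j \<inter> Tl k l)" if "j < n" for j
    proof -
      have Aj: "A j \<in> sets borel" using A that by blast
      have "loc k l (A j) \<inter> Yb l = loc k l (A j)" by (auto simp: loc_def)
      then show ?thesis using Ub_measure[OF loc_borel[OF Aj], of l k l] loc_measure[OF Aj, of k l] by simp
    qed
    show ?thesis unfolding poisson_counts_def
    proof (intro conjI allI impI)
      fix j assume j: "j < n"
      show "0 \<le> lam * measure lborel (A j \<inter> Tl k l)" using lam0 by (intro mult_nonneg_nonneg measure_nonneg) simp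
      show "(\<lambda>s. cnt (\<lambda>j. loc k l (A j)) (fst s) j (snd s)) \<in> tp.B l \<rightarrow>\<^sub>M count_space UNIV"
        by (rule pb.cnt_blk_measurable[of n "\<lambda>j. loc k l (A j)"]) (use lb ld j in auto)
    next
      fix c
      have "measure (tp.B l) {s\<in>space (tp.B l). \<forall>j<n. cnt (\<lambda>j. loc k l (A j)) (fst s) j (snd s) = c j} =
        (\<Prod>j<n. pmf (pois (mb l * measure (Ub l) (loc k l (A j)))) (c j))"
        by (rule pb.counts_blk) (use lb ld in auto)
      also have "\<dots> = (\<Prod>j<n. pmf (pois (lam * measure lborel (A j \<inter> Tl k l))) (c j))"
        by (intro prod.cong refl) (use mean in simp)
      finally show "measure (tp.B l) {s\<in>space (tp.B l). \<forall>j<n. cnt (\<lambda>j. loc k l (A j)) (fst s) j (snd s) = c j} =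
        (\<Prod>j<n. pmf (pois (lam * measure lborel (A j \<inter> Tl k l))) (c j))" .
    qed
  qed
  have slabc: "poisson_counts tp.Om n (\<lambda>j w. \<Sum>l\<in>L. cnt (\<lambda>j. loc k l (A j)) (fst (w l)) j (snd (w l))) (\<lambda>j. \<Sum>l\<in>L. lam * measure lborel (A j \<inter> Tl k l))" for k
    by (rule poisson_counts_superpose[OF tp.B_prob KL(3) subset_UNIV blk])
  have all: "poisson_counts WW n (\<lambda>j W. \<Sum>k\<in>K. \<Sum>l\<in>L. cnt (\<lambda>j. loc k l (A j)) (fst (W k l)) j (snd (W k l))) (\<lambda>j. \<Sum>k\<in>K. \<Sum>l\<in>L. lam * measure lborel (A j \<inter> Tl k l))"
    by (rule poisson_counts_superpose[OF tp.Om.prob_space_axioms KL(1,2) slabc])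
  have mean: "(\<Sum>k\<in>K. \<Sum>l\<in>L. lam * measure lborel (A j \<inter> Tl k l)) = lam * measure lborel (A j)" if j: "j < n" for j
  proof -
    have Aj: "A j \<in> sets borel" "bounded (A j)" using A j by blast+
    have Tb: "A j \<inter> Tl k l \<in> sets borel" for k l
    proof -
      note Aj(1)[measurable]
      have "{x\<in>space borel. x \<in> A j \<and> x - shift k \<in> Yb l} \<in> sets borel" by measurable
      then show ?thesis by (simp add: Tl_def Int_def)
    qed
    have "A j = (\<Union>kl\<in>K \<times> L. A j \<inter> Tl (fst kl) (snd kl))"
    proof (intro equalityI subsetI)
      fix y assume y: "y \<in> A j"
      obtain k l where kl: "k \<in> KK" "y \<in> Tl k l" using Tl_cover by blast
      then have "k \<in> K \<and> l \<in> L" using KL4[OF kl(1) _ j, of l] y by blast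
      then show "y \<in> (\<Union>kl\<in>K \<times> L. A j \<inter> Tl (fst kl) (snd kl))" using y kl by (intro UN_I[of "(k, l)"]) auto
    qed auto
    then have "measure lborel (A j) = measure lborel (\<Union>kl\<in>K \<times> L. A j \<inter> Tl (fst kl) (snd kl))" by simp
    also have "\<dots> = (\<Sum>kl\<in>K \<times> L. measure lborel (A j \<inter> Tl (fst kl) (snd kl)))"
    proof (rule measure_finite_Union)
      show "disjoint_family_on (\<lambda>kl. A j \<inter> Tl (fst kl) (snd kl)) (K \<times> L)"
        unfolding disjoint_family_on_def
      proof (intro ballI impI)
        fix x y assume xy: "x \<in> K \<times> L" "y \<in> K \<times> L" "x \<noteq> y"
        have kk: "fst x \<in> KK" "fst y \<in> KK" using xy(1,2) KL(2) by auto
        have ne: "\<not> (fst x = fst y \<and> snd x = snd y)" using xy(3) by (metis prod_eqI)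
        have "z \<notin> Tl (fst x) (snd x) \<or> z \<notin> Tl (fst y) (snd y)" for z
          using Tl_disjoint[OF kk, of z "snd x" "snd y"] ne by blast
        then show "(A j \<inter> Tl (fst x) (snd x)) \<inter> (A j \<inter> Tl (fst y) (snd y)) = {}" by blast
      qed
      fix x assume "x \<in> K \<times> L"
      have "emeasure lborel (A j \<inter> Tl (fst x) (snd x)) < \<infinity>"
        by (rule emeasure_bounded_finite[OF bounded_subset[OF Aj(2)]]) auto
      then show "emeasure lborel (A j \<inter> Tl (fst x) (snd x)) \<noteq> \<infinity>" by simp
    qed (use KL Tb in auto)
    also have "\<dots> = (\<Sum>k\<in>K. \<Sum>l\<in>L. measure lborel (A j \<inter> Tl k l))" by (simp add: sum.cartesian_product split_beta')
    finally show ?thesis by (simp add: sum_distrib_left)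
  qed
  have ccm: "(\<lambda>S. centre_count S (A j)) \<in> sphere_config_space \<rightarrow>\<^sub>M count_space UNIV" if "j < n" for j
    using centre_count_measurable A that by blast
  show ?thesis unfolding poisson_counts_def
  proof (intro conjI allI impI)
    fix j assume j: "j < n"
    show "0 \<le> lam * measure lborel (A j)" using lam0 by (intro mult_nonneg_nonneg measure_nonneg) simp
    show "(\<lambda>S. centre_count S (A j)) \<in> distr WW sphere_config_space cfg \<rightarrow>\<^sub>M count_space UNIV" using ccm[OF j] by simp
  next
    fix c :: "nat \<Rightarrow> nat"
    have E: "{S\<in>space sphere_config_space. \<forall>j<n. centre_count S (A j) = c j} \<in> sets sphere_config_space"
      by (rule counts_event) (rule ccm)
    define E1 where "E1 = cfg -` {S\<in>space sphere_config_space. \<forall>j<n. centre_count S (A j) = c j} \<inter> space WW"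
    define E2 where "E2 = {W\<in>space WW. \<forall>j<n. (\<Sum>k\<in>K. \<Sum>l\<in>L. cnt (\<lambda>j. loc k l (A j)) (fst (W k l)) j (snd (W k l))) = c j}"
    have "measure (distr WW sphere_config_space cfg) {S\<in>space sphere_config_space. \<forall>j<n. centre_count S (A j) = c j} = measure WW E1"
      unfolding E1_def by (rule measure_distr[OF cfg_measurable E])
    also have "\<dots> = measure WW E2"
    proof (rule measure_eq_AE)
      show "E1 \<in> sets WW" unfolding E1_def by (rule measurable_sets[OF cfg_measurable E])
      show "E2 \<in> sets WW" unfolding E2_def by (rule counts_event) (use all in \<open>auto simp: poisson_counts_def\<close>)
      show "AE W in WW. W \<in> E1 \<longleftrightarrow> W \<in> E2"
        using all_distinct
      proof eventually_elim
        case (elim W)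
        have "centre_count (cfg W) (A j) = (\<Sum>k\<in>K. \<Sum>l\<in>L. cnt (\<lambda>j. loc k l (A j)) (fst (W k l)) j (snd (W k l)))" if j: "j < n" for j
          unfolding cnt_def by (rule centre_count_cfg[OF elim KL KL4[OF _ _ j]])
        then show ?case unfolding E1_def E2_def using cfg_configs[of W] by (auto simp: space_config)
      qed
    qed
    also have "\<dots> = (\<Prod>j<n. pmf (pois (\<Sum>k\<in>K. \<Sum>l\<in>L. lam * measure lborel (A j \<inter> Tl k l))) (c j))"
      unfolding E2_def using all by (simp add: poisson_counts_def)
    also have "\<dots> = (\<Prod>j<n. pmf (pois (lam * measure lborel (A j))) (c j))"
      by (intro prod.cong refl) (use mean in simp)
    finally show "measure (distr WW sphere_config_space cfg) {S\<in>space (distr WW sphere_config_space cfg). \<forall>j<n. centre_count S (A j) = c j} =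
      (\<Prod>j<n. pmf (pois (lam * measure lborel (A j))) (c j))" by simp
  qed
qed

lemma cfg_poisson: "poisson_sphere_process (distr WW sphere_config_space cfg)"
  unfolding poisson_sphere_process_def
proof (intro exI[of _ lam] conjI allI impI lam0)
  fix n :: nat and A :: "nat \<Rightarrow> 'a set"
  assume A: "(\<forall>i<n. A i \<in> sets lborel \<and> bounded (A i)) \<and> disjoint_family_on A {..<n}"
  have P: "prob_space (distr WW sphere_config_space cfg)" by (rule WW.prob_space_distr[OF cfg_measurable])
  have pc: "poisson_counts (distr WW sphere_config_space cfg) n (\<lambda>j S. centre_count S (A j)) (\<lambda>j. lam * measure lborel (A j))"
    by (rule cfg_poisson_counts) (use A in auto)
  show "prob_space.indep_vars (distr WW sphere_config_space cfg) (\<lambda>_. count_space UNIV) (\<lambda>i S. centre_count S (A i)) {..<n}"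
    by (rule poisson_counts_indep(1)[OF P pc])
  fix i k assume i: "i < n"
  have "0 \<le> lam * measure lborel (A i)" using lam0 by (intro mult_nonneg_nonneg measure_nonneg) simp
  then show "measure (distr WW sphere_config_space cfg) {S\<in>space (distr WW sphere_config_space cfg). centre_count S (A i) = k} =
    (lam * measure lborel (A i)) ^ k / fact k * exp (- (lam * measure lborel (A i)))"
    using poisson_counts_indep(2)[OF P pc i, of k] by (simp only: pmf_pois)
qed

end

section \<open>Density of the unbounded clusters\<close>

text \<open>The upper bound 1 for the ratio keeps the lower limit finite, so the estimate survives
  \<open>real_of_ereal\<close>.\<close>

lemma lower_density_bound:
  fixes A :: "'a::euclidean_space set"
  assumes A: "A \<in> sets lebesgue"
    and ev: "eventually (\<lambda>r::real. c \<le> measure lebesgue (A \<inter> ball 0 r) / measure lebesgue (ball (0::'a) r)) at_top"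
  shows "c \<le> lower_density A"
proof -
  define f where "f r = measure lebesgue (A \<inter> ball 0 r) / measure lebesgue (ball (0::'a) r)" for r :: real
  define L where "L = Liminf at_top (\<lambda>r. ereal (f r))"
  have f1: "f r \<le> 1" for r
  proof -
    have "measure lebesgue (A \<inter> ball 0 r) \<le> measure lebesgue (ball (0::'a) r)"
      by (intro measure_mono_fmeasurable) (use A in auto)
    moreover have "0 \<le> measure lebesgue (ball (0::'a) r)" by (rule measure_nonneg)
    ultimately show ?thesis unfolding f_def by (intro divide_le_eq_1[THEN iffD2]) auto
  qed
  have 1: "ereal c \<le> L" unfolding L_def by (rule Liminf_bounded) (use ev in \<open>simp add: f_def\<close>)
  have "L \<le> Limsup at_top (\<lambda>r. ereal (f r))" unfolding L_def by (rule Liminf_le_Limsup) simp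
  also have "\<dots> \<le> 1" by (rule Limsup_bounded) (simp add: f1)
  finally have 2: "L \<le> 1" .
  have "c \<le> real_of_ereal L" using 1 2 by (cases L) auto
  then show ?thesis unfolding lower_density_def L_def f_def .
qed

context slab
begin

definition bz :: 'a where "bz = (SOME b. b \<in> rest)"

lemma bz: "bz \<in> rest"
proof -
  have "rest \<noteq> {}" using mm43 by (auto simp: mm_def)
  then have "\<exists>b. b \<in> rest" by blast
  then show ?thesis unfolding bz_def by (rule someI_ex)
qed

text \<open>A group consists of \<open>n\<close> consecutive strips in the direction
  \<open>bz\<close>. Its copies of one site lie within gap * n of each other, and the strips are
  independent, so all of them miss the site with probability at most 2 ^ -n.\<close>

definition slt :: "nat \<Rightarrow> ('a \<Rightarrow> int) \<Rightarrow> nat \<Rightarrow> 'a \<Rightarrow> int" where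
  "slt n g t = g(bz := int n * g bz + int t)"
definition grp :: "nat \<Rightarrow> ('a \<Rightarrow> int) \<Rightarrow> ('a \<Rightarrow> int) set" where "grp n g = slt n g ` {..<n}"

lemma KK_upd: "g \<in> KK \<Longrightarrow> g(bz := c) \<in> KK"
  unfolding KK_def using bz by (auto simp: PiE_iff extensional_def)

lemma grp_KK: "g \<in> KK \<Longrightarrow> grp n g \<subseteq> KK"
  using KK_upd by (auto simp: grp_def slt_def)

lemma grp_card: "finite (grp n g)" "card (grp n g) = n"
proof -
  have "inj_on (slt n g) {..<n}"
  proof (rule inj_onI)
    fix x y assume "slt n g x = slt n g y"
    then have "slt n g x bz = slt n g y bz" by simp
    then show "x = y" by (simp add: slt_def)
  qed
  then show "card (grp n g) = n" unfolding grp_def by (simp add: card_image)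
qed (simp add: grp_def)

lemma grp_disjoint:
  assumes "k \<in> grp n g" "k \<in> grp n g'" shows "g = g'"
proof -
  obtain t t' where t: "t < n" "t' < n" "k = slt n g t" "k = slt n g' t'" using assms by (auto simp: grp_def)
  have e: "slt n g t b = slt n g' t' b" for b using t(3,4) by simp
  have "int n * g bz + int t = int n * g' bz + int t'" using e[of bz] by (simp add: slt_def)
  then have "(int n * g bz + int t) div int n = (int n * g' bz + int t') div int n" by simp
  then have "g bz = g' bz" using t(1,2) by simp
  moreover have "g b = g' b" if "b \<noteq> bz" for b using e[of b] that by (simp add: slt_def)
  ultimately show ?thesis by (intro ext) (metis)
qed

lemma slab_grp:
  assumes "0 < n" shows "k \<in> grp n (k(bz := k bz div int n))"
proof -
  have "k = slt n (k(bz := k bz div int n)) (nat (k bz mod int n))"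
    using assms by (simp add: slt_def fun_eq_iff)
  moreover have "nat (k bz mod int n) < n" using assms by (simp add: nat_less_iff)
  ultimately show ?thesis unfolding grp_def by blast
qed

lemma grp_shift:
  assumes "k \<in> grp n g" "k' \<in> grp n g" shows "dist (shift k) (shift k') \<le> gap * real n"
proof -
  obtain t t' where t: "t < n" "t' < n" "k = slt n g t" "k' = slt n g t'" using assms by (auto simp: grp_def)
  have "shift k - shift k' = (\<Sum>b\<in>rest. (gap * (real_of_int (k b) - real_of_int (k' b))) *\<^sub>R b)"
    by (simp add: shift_def sum_subtractf[symmetric] scaleR_diff_left[symmetric] right_diff_distrib)
  also have "\<dots> = (\<Sum>b\<in>rest. if b = bz then (gap * (real t - real t')) *\<^sub>R bz else 0)"
    by (intro sum.cong refl) (simp add: t slt_def)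
  also have "\<dots> = (gap * (real t - real t')) *\<^sub>R bz" using rest(1) bz by simp
  finally have "norm (shift k - shift k') = \<bar>gap * (real t - real t')\<bar>" using bz rest(6) by (simp add: subset_iff)
  also have "\<dots> = gap * \<bar>real t - real t'\<bar>" using gap6 by (simp add: abs_mult)
  also have "\<dots> \<le> gap * real n" using t(1,2) gap6 by (intro mult_left_mono) auto
  finally show ?thesis by (simp add: dist_norm)
qed

definition Zs :: "nat \<Rightarrow> site set" where "Zs N = {- int N..int N} \<times> {- int N..int N}"
definition Gs :: "nat \<Rightarrow> ('a \<Rightarrow> int) set" where "Gs N = PiE rest (\<lambda>_. {- int N..int N})"

lemma card_symmetric: "card {- int N..int N} = 2 * N + 1"
  unfolding card_atLeastAtMost_int by arith

lemma Zs: "finite (Zs N)" "card (Zs N) = (2 * N + 1)\<^sup>2"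
  unfolding Zs_def card_cartesian_product card_symmetric power2_eq_square by simp_all

lemma Gs: "finite (Gs N)" "card (Gs N) = (2 * N + 1) ^ mm" "Gs N \<subseteq> KK"
  unfolding Gs_def KK_def using rest(1) card_symmetric[of N] by (auto simp: card_PiE mm_def finite_PiE simp del: card_atLeastAtMost_int)

definition badg :: "('a \<Rightarrow> int) set \<Rightarrow> site \<Rightarrow> (('a \<Rightarrow> int) \<Rightarrow> label \<Rightarrow> 'a sample) \<Rightarrow> bool" where
  "badg J z W \<longleftrightarrow> (\<forall>k\<in>J. W k \<notin> good z)"

text \<open>Sites within one group are dependent; collected into one bounded variable per group,
  they leave independent summands for Hoeffding's inequality.\<close>

definition nbad :: "nat \<Rightarrow> ('a \<Rightarrow> int) set \<Rightarrow> (('a \<Rightarrow> int) \<Rightarrow> label \<Rightarrow> 'a sample) \<Rightarrow> real" where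
  "nbad N J W = (\<Sum>z\<in>Zs N. if badg J z W then 1 else 0)"

lemma badg_measurable:
  assumes "finite J" "J \<subseteq> I"
  shows "{W\<in>space (PiM I (\<lambda>_. tp.Om)). badg J z W} \<in> sets (PiM I (\<lambda>_. tp.Om))"
  unfolding badg_def
proof (rule sets.sets_Collect_finite_All[OF _ assms(1)])
  fix k assume "k \<in> J"
  then have m: "(\<lambda>W. W k) \<in> PiM I (\<lambda>_. tp.Om) \<rightarrow>\<^sub>M tp.Om" using assms(2) by (intro measurable_component_singleton) auto
  have "{W\<in>space (PiM I (\<lambda>_. tp.Om)). W k \<notin> good z} = space (PiM I (\<lambda>_. tp.Om)) - (\<lambda>W. W k) -` good z \<inter> space (PiM I (\<lambda>_. tp.Om))" by auto
  then show "{W\<in>space (PiM I (\<lambda>_. tp.Om)). W k \<notin> good z} \<in> sets (PiM I (\<lambda>_. tp.Om))"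
    using measurable_sets[OF m good_event[of z]] by auto
qed

lemma nbad_measurable: "finite J \<Longrightarrow> J \<subseteq> I \<Longrightarrow> nbad N J \<in> borel_measurable (PiM I (\<lambda>_. tp.Om))"
  unfolding nbad_def using badg_measurable by (intro borel_measurable_sum measurable_If) auto

lemma badg_prob:
  assumes "g \<in> KK" shows "WW.prob {W\<in>space WW. badg (grp n g) z W} \<le> (1/2) ^ n"
proof -
  interpret P: product_prob_space "\<lambda>_. tp.Om" KK by (rule product_prob_spaceI) (rule tp.Om.prob_space_axioms)
  define X where "X = space tp.Om - good z"
  have X: "X \<in> sets tp.Om" unfolding X_def using good_event by blast
  have pX: "tp.Om.prob X \<le> 1/2" unfolding X_def using tp.Om.prob_compl[OF good_event[of z]] good_prob[of z] by simp
  have "{W\<in>space WW. badg (grp n g) z W} = {W\<in>space WW. \<forall>k\<in>grp n g. W k \<in> X}"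
  proof -
    have "W k \<in> space tp.Om" if "W \<in> space WW" "k \<in> grp n g" for W k
      using that grp_KK[OF assms, of n] by (auto simp: space_PiM)
    then show ?thesis unfolding badg_def X_def by auto
  qed
  then have "emeasure WW {W\<in>space WW. badg (grp n g) z W} = (\<Prod>k\<in>grp n g. emeasure tp.Om X)"
    using P.emeasure_PiM_Collect[OF grp_KK[OF assms] grp_card(1), of n "\<lambda>_. X"] X by simp
  also have "\<dots> = ennreal (tp.Om.prob X ^ n)" by (simp add: tp.Om.emeasure_eq_measure grp_card(2) ennreal_power)
  finally have "WW.prob {W\<in>space WW. badg (grp n g) z W} = tp.Om.prob X ^ n" by (simp add: measure_def)
  also have "\<dots> \<le> (1/2) ^ n" using pX by (intro power_mono) auto
  finally show ?thesis .
qed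

lemma coord_indep: "WW.indep_vars (\<lambda>_. tp.Om) (\<lambda>k W. W k) KK"
proof (rule WW.indep_vars_iff_distr_eq_PiM'[THEN iffD2])
  have "slb 0 \<in> KK" by (rule slb_KK)
  then show "KK \<noteq> {}" by blast
  show c: "(\<lambda>W. W k) \<in> WW \<rightarrow>\<^sub>M tp.Om" if "k \<in> KK" for k by (rule W_comp(1)[OF that])
  have "distr WW WW (\<lambda>W. \<lambda>k\<in>KK. W k) = distr WW WW (\<lambda>W. W)"
    by (rule distr_cong) (auto simp: space_PiM PiE_restrict)
  also have "\<dots> = WW" by simp
  also have "WW = PiM KK (\<lambda>k. distr WW tp.Om (\<lambda>W. W k))"
    by (intro PiM_cong refl distr_PiM_component[symmetric] tp.Om.prob_space_axioms)
  finally show "distr WW WW (\<lambda>W. \<lambda>k\<in>KK. W k) = PiM KK (\<lambda>k. distr WW tp.Om (\<lambda>W. W k))" .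
qed

lemma nbad_indep:
  "WW.indep_vars (\<lambda>_. borel) (\<lambda>g. nbad N (grp n g)) (Gs N)"
proof -
  have "WW.indep_vars (\<lambda>g. PiM (grp n g) (\<lambda>_. tp.Om)) (\<lambda>g W. restrict (\<lambda>k. W k) (grp n g)) (Gs N)"
    by (rule WW.indep_vars_restrict[OF coord_indep])
       (use Gs(3) grp_KK grp_disjoint in \<open>blast, auto simp: disjoint_family_on_def\<close>)
  then have "WW.indep_vars (\<lambda>_. borel) (\<lambda>g W. nbad N (grp n g) (restrict (\<lambda>k. W k) (grp n g))) (Gs N)"
    by (rule WW.indep_vars_compose2) (intro nbad_measurable grp_card(1) order_refl)
  moreover have "nbad N (grp n g) (restrict (\<lambda>k. W k) (grp n g)) = nbad N (grp n g) W" for g W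
    by (simp add: nbad_def badg_def)
  ultimately show ?thesis by simp
qed

lemma nbad_bounds: "0 \<le> nbad N J W" "nbad N J W \<le> real (card (Zs N))"
proof -
  show "0 \<le> nbad N J W" unfolding nbad_def by (intro sum_nonneg) auto
  have "nbad N J W \<le> (\<Sum>z\<in>Zs N. 1)" unfolding nbad_def by (intro sum_mono) auto
  then show "nbad N J W \<le> real (card (Zs N))" by simp
qed

text \<open>The mean is at most \<delta> times the number of pairs, and the deviation allowed is the
  same amount. With ranges q = card (Zs N) the exponent is -2 * G * \<delta> ^ 2 for G = card (Gs N)
  >= N groups, hence a bound that is geometric in \<open>N\<close>.\<close>

lemma few_bad_prob:
  fixes n :: nat
  defines "\<delta> \<equiv> (1/2 :: real) ^ n"
  shows "WW.prob {W\<in>space WW. 2 * \<delta> * real (card (Gs N)) * real (card (Zs N)) \<le> (\<Sum>g\<in>Gs N. nbad N (grp n g) W)}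
     \<le> exp (- 2 * \<delta>\<^sup>2) ^ N"
proof -
  define q where "q = real (card (Zs N))"
  define G where "G = real (card (Gs N))"
  have q: "0 < q" by (simp add: q_def Zs)
  have GN: "real N \<le> G"
  proof -
    have "N \<le> 2 * N + 1" by simp
    also have "\<dots> = (2 * N + 1) ^ 1" by simp
    also have "\<dots> \<le> (2 * N + 1) ^ mm" using mm43 by (intro power_increasing) auto
    finally show ?thesis unfolding G_def Gs(2) of_nat_le_iff .
  qed
  have G: "0 < G" by (simp add: G_def Gs)
  have dl: "0 < \<delta>" by (simp add: \<delta>_def)
  interpret H: Hoeffding_ineq WW "Gs N" "\<lambda>g. nbad N (grp n g)" "\<lambda>_. 0" "\<lambda>_. q" "\<Sum>g\<in>Gs N. WW.expectation (nbad N (grp n g))"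
  proof unfold_locales
    show "finite (Gs N)" by (rule Gs)
    show "WW.indep_vars (\<lambda>_. borel) (\<lambda>g. nbad N (grp n g)) (Gs N)" by (rule nbad_indep)
    show "AE W in WW. nbad N (grp n g) W \<in> {0..q}" for g using nbad_bounds by (simp add: q_def)
  qed
  have ex: "WW.expectation (nbad N (grp n g)) \<le> q * \<delta>" if g: "g \<in> Gs N" for g
  proof -
    have gK: "g \<in> KK" using g Gs(3) by blast
    have E: "{W\<in>space WW. badg (grp n g) z W} \<in> sets WW" for z by (rule badg_measurable[OF grp_card(1) grp_KK[OF gK]])
    have ind: "(if badg (grp n g) z W then 1 else 0 :: real) = indicator {W\<in>space WW. badg (grp n g) z W} W" if "W \<in> space WW" for z W
      using that by (simp add: indicator_def)
    have "WW.expectation (nbad N (grp n g)) = (\<integral>W. (\<Sum>z\<in>Zs N. indicator {W\<in>space WW. badg (grp n g) z W} W) \<partial>WW)"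
      unfolding nbad_def by (intro Bochner_Integration.integral_cong refl sum.cong ind)
    also have "\<dots> = (\<Sum>z\<in>Zs N. \<integral>W. indicator {W\<in>space WW. badg (grp n g) z W} W \<partial>WW)"
      by (intro Bochner_Integration.integral_sum integrable_real_indicator E) (simp add: less_top[symmetric])
    also have "\<dots> = (\<Sum>z\<in>Zs N. WW.prob {W\<in>space WW. badg (grp n g) z W})"
      by (intro sum.cong refl) (simp add: Int_absorb2 sets.sets_into_space[OF E])
    also have "\<dots> \<le> (\<Sum>z\<in>Zs N. \<delta>)" unfolding \<delta>_def by (intro sum_mono badg_prob gK)
    finally show ?thesis by (simp add: q_def)
  qed
  have mu: "(\<Sum>g\<in>Gs N. WW.expectation (nbad N (grp n g))) \<le> G * (q * \<delta>)"
    using sum_mono[of "Gs N" _ "\<lambda>_. q * \<delta>", OF ex] by (simp add: G_def)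
  have sq: "(\<Sum>g\<in>Gs N. (q - 0)\<^sup>2) = G * q\<^sup>2" by (simp add: G_def)
  define S where "S = {W\<in>space WW. (\<Sum>g\<in>Gs N. WW.expectation (nbad N (grp n g))) + G * (q * \<delta>) \<le> (\<Sum>g\<in>Gs N. nbad N (grp n g) W)}"
  have "WW.prob S \<le> exp (- 2 * (G * (q * \<delta>))\<^sup>2 / (\<Sum>g\<in>Gs N. (q - 0)\<^sup>2))"
    unfolding S_def by (rule H.Hoeffding_ineq_ge) (use G q dl in \<open>auto simp: G_def[symmetric]\<close>)
  also have "- 2 * (G * (q * \<delta>))\<^sup>2 / (\<Sum>g\<in>Gs N. (q - 0)\<^sup>2) = G * (- 2 * \<delta>\<^sup>2)"
    unfolding sq using G q by (simp add: power2_eq_square field_simps)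
  also have "exp (G * (- 2 * \<delta>\<^sup>2)) \<le> exp (real N * (- 2 * \<delta>\<^sup>2))"
    using mult_right_mono[OF GN, of "2 * \<delta>\<^sup>2"] by simp
  also have "\<dots> = exp (- 2 * \<delta>\<^sup>2) ^ N" by (rule exp_of_nat_mult)
  finally have S: "WW.prob S \<le> exp (- 2 * \<delta>\<^sup>2) ^ N" .
  have "WW.prob {W\<in>space WW. 2 * \<delta> * real (card (Gs N)) * real (card (Zs N)) \<le> (\<Sum>g\<in>Gs N. nbad N (grp n g) W)} \<le> WW.prob S"
  proof (rule WW.finite_measure_mono)
    show "{W\<in>space WW. 2 * \<delta> * real (card (Gs N)) * real (card (Zs N)) \<le> (\<Sum>g\<in>Gs N. nbad N (grp n g) W)} \<subseteq> S"
      unfolding S_def G_def[symmetric] q_def[symmetric] using mu by (auto simp: algebra_simps)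
    have "(\<lambda>W. \<Sum>g\<in>Gs N. nbad N (grp n g) W) \<in> borel_measurable WW"
      using Gs(3)[of N] grp_KK by (intro borel_measurable_sum nbad_measurable grp_card(1)) blast
    then show "S \<in> sets WW" unfolding S_def by measurable
  qed
  then show ?thesis using S by linarith
qed

lemma few_bad:
  "AE W in WW. eventually (\<lambda>N. (\<Sum>g\<in>Gs N. nbad N (grp n g) W) < 2 * (1/2) ^ n * real (card (Gs N)) * real (card (Zs N))) sequentially"
proof -
  define A where "A N = {W\<in>space WW. 2 * (1/2) ^ n * real (card (Gs N)) * real (card (Zs N)) \<le> (\<Sum>g\<in>Gs N. nbad N (grp n g) W)}" for N
  have A: "A N \<in> sets WW" for N
  proof -
    have "(\<lambda>W. \<Sum>g\<in>Gs N. nbad N (grp n g) W) \<in> borel_measurable WW"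
      using Gs(3)[of N] grp_KK by (intro borel_measurable_sum nbad_measurable grp_card(1)) blast
    then show ?thesis unfolding A_def by measurable
  qed
  have "AE W in WW. eventually (\<lambda>N. W \<in> space WW - A N) sequentially"
  proof (rule borel_cantelli_AE1)
    show "A N \<in> sets WW" for N by (rule A)
    show "emeasure WW (A N) < \<infinity>" for N by (simp add: WW.emeasure_eq_measure)
    have "norm (exp (- 2 * ((1/2 :: real) ^ n)\<^sup>2)) < 1" by simp
    then have "summable (\<lambda>N. exp (- 2 * ((1/2 :: real) ^ n)\<^sup>2) ^ N)" by (rule summable_geometric)
    then show "summable (\<lambda>N. WW.prob (A N))"
      by (rule summable_comparison_test'[of _ 0]) (use few_bad_prob[of n] in \<open>simp add: A_def\<close>)
  qed
  then show ?thesis by (rule AE_mp) (rule AE_I2, intro impI, elim eventually_mono, auto simp: A_def not_le)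
qed

text \<open>Inverts the linear map sending site (i, j) to the planar point (2.1 * (i - j), -3.642 *
  (i + j)), where 2.1 = 2 * 1.05 and 3.642 = 6 * 0.607, and rounds down.\<close>

definition zs :: "'a \<Rightarrow> site" where
  "zs y = (\<lfloor>(y \<bullet> b1 / (21/10) - y \<bullet> b2 / (3642/1000)) / 2\<rfloor>, \<lfloor>(- (y \<bullet> b2 / (3642/1000)) - y \<bullet> b1 / (21/10)) / 2\<rfloor>)"

text \<open>Bounds the l1 distance to the copy of the associated site: 3 and 8 for the planar
  coordinates, \<rho> + 3 for each of the others.\<close>

definition C1 :: real where "C1 = 11 + real mm * (\<rho> + 3)"
definition vc :: "site \<Rightarrow> 'a" where "vc z = ctr (fst z, snd z, 0)"

lemma vc_inner:
  "vc z \<bullet> b1 = 21/10 * (real_of_int (fst z) - real_of_int (snd z))" "vc z \<bullet> b2 = - (3642/1000) * (real_of_int (fst z) + real_of_int (snd z))"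
  "b \<in> rest \<Longrightarrow> vc z \<bullet> b = 0"
proof -
  define x y where "x = real_of_int (fst z)" and "y = real_of_int (snd z)"
  have 1: "vc z \<bullet> b1 = 105/100 * real_of_int (na (fst z, snd z, 0))" "vc z \<bullet> b2 = 607/1000 * real_of_int (nb (fst z, snd z, 0))"
    by (simp_all add: vc_def ctr_def inner_add_left del: na.simps nb.simps)
  have 2: "real_of_int (na (fst z, snd z, 0)) = 2 * (x - y)" "real_of_int (nb (fst z, snd z, 0)) = - 6 * (x + y)"
    by (simp_all add: oa_def ob_def x_def y_def)
  show "vc z \<bullet> b1 = 21/10 * (real_of_int (fst z) - real_of_int (snd z))" "vc z \<bullet> b2 = - (3642/1000) * (real_of_int (fst z) + real_of_int (snd z))"
    unfolding 1 2 x_def[symmetric] y_def[symmetric] by linarith+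
  show "b \<in> rest \<Longrightarrow> vc z \<bullet> b = 0" by (simp add: vc_def ctr_rest)
qed

lemma cell_dist: "dist y (shift (slb y) + vc (zs y)) \<le> C1"
proof -
  define x where "x = y - (shift (slb y) + vc (zs y))"
  define s where "s = (y \<bullet> b1 / (21/10) - y \<bullet> b2 / (3642/1000)) / 2"
  define t where "t = (- (y \<bullet> b2 / (3642/1000)) - y \<bullet> b1 / (21/10)) / 2"
  define i j where "i = real_of_int \<lfloor>s\<rfloor>" and "j = real_of_int \<lfloor>t\<rfloor>"
  have ij: "i \<le> s" "s < i + 1" "j \<le> t" "t < j + 1" unfolding i_def j_def by linarith+
  have y: "y \<bullet> b1 = 21/10 * (s - t)" "y \<bullet> b2 = - (3642/1000) * (s + t)" unfolding s_def t_def by (simp_all add: field_simps)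
  have z: "real_of_int (fst (zs y)) = i" "real_of_int (snd (zs y)) = j" unfolding zs_def i_def j_def s_def t_def by simp_all
  define p q where "p = s - i" and "q = t - j"
  have pq: "0 \<le> p" "p < 1" "0 \<le> q" "q < 1" using ij unfolding p_def q_def by simp_all
  have st: "s = i + p" "t = j + q" by (simp_all add: p_def q_def)
  have e: "x \<bullet> b1 = 21/10 * (p - q)" "x \<bullet> b2 = - (3642/1000) * (p + q)"
    unfolding x_def inner_diff_left inner_add_left shift_inner vc_inner z y st by (simp_all only: add_0) algebra+
  have "\<bar>p - q\<bar> \<le> 1" "\<bar>p + q\<bar> \<le> 2" using pq by (simp_all add: abs_le_iff)
  then have 1: "\<bar>x \<bullet> b1\<bar> \<le> 3" and 2: "\<bar>x \<bullet> b2\<bar> \<le> 8"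
    unfolding e abs_mult by simp_all
  have 3: "\<bar>x \<bullet> b\<bar> \<le> \<rho> + 3" if b: "b \<in> rest" for b
  proof -
    have "y - shift (slb y) \<in> strip" using strip_iff[OF slb_KK] by simp
    then have "- (\<rho> + 3) \<le> (y - shift (slb y)) \<bullet> b \<and> (y - shift (slb y)) \<bullet> b < \<rho> + 3" using b by (simp add: strip_def)
    moreover have "x \<bullet> b = (y - shift (slb y)) \<bullet> b" unfolding x_def using vc_inner(3)[OF b] by (simp add: inner_diff_left inner_add_left)
    ultimately show ?thesis by (simp add: abs_le_iff)
  qed
  have "norm x \<le> (\<Sum>b\<in>Basis. \<bar>x \<bullet> b\<bar>)" by (rule norm_le_l1)
  also have "\<dots> = \<bar>x \<bullet> b1\<bar> + \<bar>x \<bullet> b2\<bar> + (\<Sum>b\<in>rest. \<bar>x \<bullet> b\<bar>)" by (rule sum_Basis)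
  also have "(\<Sum>b\<in>rest. \<bar>x \<bullet> b\<bar>) \<le> (\<Sum>b\<in>rest. \<rho> + 3)" by (rule sum_mono) (rule 3)
  finally show ?thesis using 1 2 by (simp add: C1_def mm_def x_def dist_norm)
qed

text \<open>The distance to the copy of the site in any strip of the group, plus \<rho> + 1 to a
  centre of the cluster there, plus 1 for a strict inequality.\<close>

definition Dn :: "nat \<Rightarrow> real" where "Dn n = C1 + gap * real n + \<rho> + 2"

lemma Dn_pos: "0 < Dn n"
proof -
  have "0 \<le> real mm * (\<rho> + 3)" by (intro mult_nonneg_nonneg) (use rho0 in auto)
  moreover have "0 \<le> gap * real n" by (intro mult_nonneg_nonneg) (use gap6 in auto)
  ultimately show ?thesis using rho0 unfolding Dn_def C1_def by linarith
qed

text \<open>If some strip of the group reached the site of \<open>y\<close>, a cluster centre would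
  be within reach of \<open>y\<close>. The second conclusion is for covering: missed points lie in
  balls indexed by bad pairs of a group and a site.\<close>

lemma not_halo_bad:
  assumes n: "0 < n" and a: "Dn n \<le> a" and y: "y \<notin> halo a (cfg W)"
  defines "g \<equiv> (slb y)(bz := slb y bz div int n)"
  shows "badg (grp n g) (zs y) W" "dist (shift (slt n g 0) + vc (zs y)) y \<le> Dn n"
proof -
  have kg: "slb y \<in> grp n g" unfolding g_def by (rule slab_grp[OF n])
  have gK: "g \<in> KK" unfolding g_def by (rule KK_upd[OF slb_KK])
  have d: "dist (shift k + vc (zs y)) y \<le> C1 + gap * real n" if k: "k \<in> grp n g" for k
  proof -
    have "dist (shift k + vc (zs y)) (shift (slb y) + vc (zs y)) \<le> gap * real n"
      using grp_shift[OF k kg] by (simp add: dist_norm)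
    then show ?thesis using cell_dist[of y] dist_triangle[of "shift k + vc (zs y)" y "shift (slb y) + vc (zs y)"]
      by (simp add: dist_commute)
  qed
  have "slt n g 0 \<in> grp n g" unfolding grp_def using n by blast
  from d[OF this] show "dist (shift (slt n g 0) + vc (zs y)) y \<le> Dn n" using rho0 by (simp add: Dn_def)
  show "badg (grp n g) (zs y) W"
    unfolding badg_def
  proof (intro ballI notI)
    fix k assume k: "k \<in> grp n g" and gd: "W k \<in> good (zs y)"
    have kK: "k \<in> KK" using grp_KK[OF gK] k by blast
    obtain p where p: "p \<in> cfg W" "unb (cfg W) p" "dist (fst p) (shift k + ctr (fst (zs y), snd (zs y), 0)) \<le> \<rho> + 1"
      by (rule good_cluster[where k=k and W=W and z="zs y", OF kK gd])
    have "dist (fst p) y \<le> \<rho> + 1 + (C1 + gap * real n)"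
      using p(3) d[OF k] dist_triangle[of "fst p" y "shift k + vc (zs y)"] by (simp add: vc_def)
    moreover have "0 \<le> snd p" using configsD(1)[OF cfg_configs p(1)] .
    ultimately have "dist (fst p) y < snd p + a" using a by (simp add: Dn_def)
    moreover have "0 < a" using Dn_pos[of n] a by linarith
    ultimately show False using y p(1,2) unfolding halo_iff[OF cfg_configs \<open>0 < a\<close>] by blast
  qed
qed

lemma zs_bound:
  assumes "norm y \<le> real M" shows "zs y \<in> Zs (M + 1)"
proof -
  have b: "\<bar>y \<bullet> b1\<bar> \<le> real M" "\<bar>y \<bullet> b2\<bar> \<le> real M" using Basis_le_norm[of b1 y] Basis_le_norm[of b2 y] b12 assms by auto
  have e: "\<bar>(y \<bullet> b1 / (21/10) - y \<bullet> b2 / (3642/1000)) / 2\<bar> \<le> real M" "\<bar>(- (y \<bullet> b2 / (3642/1000)) - y \<bullet> b1 / (21/10)) / 2\<bar> \<le> real M"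
    using b by (simp_all add: abs_le_iff field_simps)
  have f: "- int (M + 1) \<le> \<lfloor>t\<rfloor> \<and> \<lfloor>t\<rfloor> \<le> int (M + 1)" if "\<bar>t\<bar> \<le> real M" for t :: real using that by linarith
  show ?thesis unfolding zs_def Zs_def using f[OF e(1)] f[OF e(2)] by auto
qed

lemma gs_bound:
  assumes "norm y \<le> real M" "0 < n" shows "(slb y)(bz := slb y bz div int n) \<in> Gs (M + 1)"
  unfolding Gs_def
proof (rule PiE_I)
  fix b assume b: "b \<in> rest"
  have "\<bar>slb y b\<bar> \<le> int M + 1" by (rule slb_bound[OF assms(1) b])
  moreover have "\<bar>m div int n\<bar> \<le> \<bar>m\<bar>" for m
  proof -
    define q r where "q = m div int n" and "r = m mod int n"
    have n1: "1 \<le> int n" using assms(2) by simp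
    have m: "m = int n * q + r" "0 \<le> r" "r < int n" using n1 by (simp_all add: q_def r_def)
    show ?thesis
    proof (cases "0 \<le> q")
      case True
      have "1 * q \<le> int n * q" using n1 True by (rule mult_right_mono)
      then show ?thesis using m True unfolding q_def[symmetric] by linarith
    next
      case False
      have "int n * (q + 1) \<le> 1 * (q + 1)" using n1 False by (intro mult_right_mono_neg) auto
      then have "m < q + 1" using m by (simp add: algebra_simps)
      then show ?thesis using False unfolding q_def[symmetric] by linarith
    qed
  qed
  ultimately have "\<bar>slb y bz div int n\<bar> \<le> int M + 1 \<or> b \<noteq> bz" using order_trans by blast
  then have "\<bar>((slb y)(bz := slb y bz div int n)) b\<bar> \<le> int M + 1"
    using \<open>\<bar>slb y b\<bar> \<le> int M + 1\<close> by (cases "b = bz") simp_all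
  then show "((slb y)(bz := slb y bz div int n)) b \<in> {- int (M + 1)..int (M + 1)}"
    by (simp add: abs_le_iff)
next
  fix b assume "b \<notin> rest"
  then show "((slb y)(bz := slb y bz div int n)) b = undefined" using bz by (auto simp: slb_def)
qed

text \<open>An upper bound for the missed proportion of a large ball: a fraction 2 * 2 ^ -n of at
  most (4 * R) ^ d pairs is bad, each accounting for a ball of radius \<open>Dn n\<close>, relative
  to a ball of radius \<open>R\<close>.\<close>

definition qq :: "nat \<Rightarrow> real" where "qq n = 2 * (1/2) ^ n * (4 * Dn n) ^ (mm + 2)"

lemma halo_dense:
  assumes n: "0 < n" and ev: "eventually (\<lambda>N. (\<Sum>g\<in>Gs N. nbad N (grp n g) W) < 2 * (1/2) ^ n * real (card (Gs N)) * real (card (Zs N))) sequentially"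
    and a: "Dn n \<le> a"
  shows "1 - qq n \<le> lower_density (nbhd (unbounded_clusters (cfg W)) a)"
proof -
  define Hl where "Hl = halo a (cfg W)"
  have oH: "open Hl" unfolding Hl_def by (rule open_halo)
  obtain N0 where N0: "\<And>N. N0 \<le> N \<Longrightarrow> (\<Sum>g\<in>Gs N. nbad N (grp n g) W) < 2 * (1/2) ^ n * real (card (Gs N)) * real (card (Zs N))"
    using ev unfolding eventually_sequentially by blast
  define v where "v = unit_ball_vol (real DIM('a))"
  have v: "0 < v" by (simp add: v_def)
  have "1 - qq n \<le> measure lebesgue (Hl \<inter> ball 0 R) / measure lebesgue (ball (0::'a) R)" if R: "real N0 + 3 \<le> R" for R
  proof -
    \<comment> \<open>With N = M + 1 <= R + 2 the factor 2 * N + 1 is at most 2 * R + 5, hence at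
      most 4 * R for R >= 3.\<close>
    define M where "M = nat \<lceil>R\<rceil>"
    have M: "R \<le> real M" "real M \<le> R + 1" using R unfolding M_def by linarith+
    define N where "N = M + 1"
    have NN: "N0 \<le> N" using M(1) R unfolding N_def by linarith
    define I where "I = {x\<in>Gs N \<times> Zs N. badg (grp n (fst x)) (snd x) W}"
    have fI: "finite I" unfolding I_def using Gs(1) Zs(1) by simp
    define c where "c x = cball (shift (slt n (fst x) 0) + vc (snd x)) (Dn n)" for x
    have "ball 0 R - Hl \<subseteq> (\<Union>x\<in>I. c x)"
    proof
      fix y assume y: "y \<in> ball 0 R - Hl"
      then have yn: "norm y \<le> real M" and yh: "y \<notin> halo a (cfg W)" using M by (auto simp: Hl_def)
      let ?g = "(slb y)(bz := slb y bz div int n)"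
      note nb = not_halo_bad[OF n a yh]
      have "?g \<in> Gs N" "zs y \<in> Zs N" unfolding N_def using gs_bound[OF yn n] zs_bound[OF yn] by auto
      then have "(?g, zs y) \<in> I" using nb(1) by (simp add: I_def)
      moreover have "y \<in> c (?g, zs y)" using nb(2) by (simp add: c_def)
      ultimately show "y \<in> (\<Union>x\<in>I. c x)" by (rule UN_I)
    qed
    then have "measure lborel (ball 0 R - Hl) \<le> measure lborel (\<Union>x\<in>I. c x)"
    proof (rule measure_mono_fmeasurable)
      show "ball 0 R - Hl \<in> sets lborel" using oH by simp
      have "compact (\<Union>x\<in>I. c x)" unfolding c_def using fI by (intro compact_UN) auto
      then show "(\<Union>x\<in>I. c x) \<in> fmeasurable lborel" by (rule fmeasurable_compact)
    qed
    also have "\<dots> \<le> (\<Sum>x\<in>I. measure lborel (c x))" by (rule measure_UNION_le[OF fI]) (simp add: c_def)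
    also have "\<dots> = real (card I) * (v * Dn n ^ DIM('a))"
      using Dn_pos[of n] by (simp add: c_def content_cball v_def)
    also have "real (card I) = (\<Sum>g\<in>Gs N. nbad N (grp n g) W)"
    proof -
      have "(\<Sum>g\<in>Gs N. nbad N (grp n g) W) = (\<Sum>x\<in>Gs N \<times> Zs N. if badg (grp n (fst x)) (snd x) W then 1 else 0)"
        unfolding nbad_def by (simp add: sum.cartesian_product split_beta')
      also have "\<dots> = (\<Sum>x\<in>I. 1)" unfolding I_def using Gs(1) Zs(1) by (intro sum.inter_filter[symmetric]) simp
      finally show ?thesis by simp
    qed
    also have "(\<Sum>g\<in>Gs N. nbad N (grp n g) W) * (v * Dn n ^ DIM('a)) \<le> (2 * (1/2) ^ n * real (card (Gs N)) * real (card (Zs N))) * (v * Dn n ^ DIM('a))"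
      using N0[OF NN] v Dn_pos[of n] by (intro mult_right_mono) auto
    finally have 1: "measure lborel (ball 0 R - Hl) \<le> 2 * (1/2) ^ n * (real (card (Gs N)) * real (card (Zs N))) * (v * Dn n ^ DIM('a))" by (simp add: mult.assoc)
    have cGZ: "real (card (Gs N)) * real (card (Zs N)) = (2 * real N + 1) ^ (mm + 2)"
      by (simp only: Gs(2) Zs(2) of_nat_power of_nat_add of_nat_mult of_nat_numeral of_nat_1 power_add)
    have "(2 * real N + 1) ^ (mm + 2) \<le> (4 * R) ^ (mm + 2)" using M R unfolding N_def by (intro power_mono) auto
    then have "2 * (1/2) ^ n * (real (card (Gs N)) * real (card (Zs N))) * (v * Dn n ^ DIM('a)) \<le> 2 * (1/2) ^ n * (4 * R) ^ (mm + 2) * (v * Dn n ^ DIM('a))"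
      unfolding cGZ using v Dn_pos[of n] by (intro mult_right_mono mult_left_mono) simp_all
    also have "\<dots> = qq n * (v * R ^ (mm + 2))" by (simp add: qq_def mm_dim power_mult_distrib mult_ac)
    finally have 2: "measure lborel (ball 0 R - Hl) \<le> qq n * (v * R ^ (mm + 2))" using 1 by linarith
    define B where "B = measure lborel (ball (0::'a) R)"
    have R0: "0 < R" using R by simp
    have B: "B = v * R ^ (mm + 2)" unfolding B_def v_def using R0 content_ball[of R "0::'a"] by (simp add: mm_dim)
    have B0: "0 < B" unfolding B using v R0 by simp
    have split: "B = measure lborel (Hl \<inter> ball 0 R) + measure lborel (ball 0 R - Hl)"
    proof -
      have fb: "ball (0::'a) R \<in> fmeasurable lborel"
        using emeasure_bounded_finite[OF bounded_ball[of "0::'a" R]] by (simp add: fmeasurable_def)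
      have "measure lborel (ball 0 R - (Hl \<inter> ball 0 R)) = B - measure lborel (Hl \<inter> ball 0 R)"
        unfolding B_def by (rule measurable_measure_Diff) (use fb oH in auto)
      moreover have "ball 0 R - (Hl \<inter> ball 0 R) = ball 0 R - Hl" by blast
      ultimately show ?thesis by simp
    qed
    have "B - qq n * B \<le> measure lborel (Hl \<inter> ball 0 R)" using 2 split unfolding B[symmetric] by linarith
    then have "1 - qq n \<le> measure lborel (Hl \<inter> ball 0 R) / B" using B0 by (simp add: field_simps)
    moreover have "measure lebesgue (Hl \<inter> ball 0 R) = measure lborel (Hl \<inter> ball 0 R)" "measure lebesgue (ball (0::'a) R) = B"
      unfolding B_def using oH by (simp_all add: measure_completion)
    ultimately show ?thesis by simp
  qed
  then have "eventually (\<lambda>R. 1 - qq n \<le> measure lebesgue (Hl \<inter> ball 0 R) / measure lebesgue (ball (0::'a) R)) at_top"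
    unfolding eventually_at_top_linorder by blast
  from lower_density_bound[OF _ this] oH show ?thesis unfolding Hl_def halo_def by simp
qed

text \<open>An exponential beats a polynomial: with r ^ d = 1/2 the whole expression is twice the
  d-th power of r ^ n times a linear function of n.\<close>

lemma qq_lim: "qq \<longlonglongrightarrow> 0"
proof -
  define d where "d = mm + 2"
  define r where "r = root d (1/2)"
  have d: "0 < d" by (simp add: d_def)
  have r: "0 \<le> r" "r < 1" "r ^ d = 1/2" using d by (simp_all add: r_def)
  have "(\<lambda>n. of_nat n * r ^ n) \<longlonglongrightarrow> (0::real)" by (rule powser_times_n_limit_0) (use r in simp)
  moreover have "(\<lambda>n. r ^ n) \<longlonglongrightarrow> 0" by (rule LIMSEQ_realpow_zero[OF r(1,2)])
  ultimately have "(\<lambda>n. 2 * (4 * (C1 + \<rho> + 2) * r ^ n + 4 * gap * (of_nat n * r ^ n)) ^ d) \<longlonglongrightarrow> 2 * (4 * (C1 + \<rho> + 2) * 0 + 4 * gap * 0) ^ d"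
    by (intro tendsto_intros) (use r in auto)
  moreover have "qq n = 2 * (4 * (C1 + \<rho> + 2) * r ^ n + 4 * gap * (of_nat n * r ^ n)) ^ d" for n
  proof -
    have "(1/2 :: real) ^ n = (r ^ n) ^ d" unfolding r(3)[symmetric] by (simp add: power_mult[symmetric] mult.commute)
    then have "qq n = 2 * (r ^ n) ^ d * (4 * Dn n) ^ d" by (simp only: qq_def d_def[symmetric])
    also have "\<dots> = 2 * (r ^ n * (4 * Dn n)) ^ d" by (simp only: power_mult_distrib mult.assoc)
    also have "r ^ n * (4 * Dn n) = 4 * (C1 + \<rho> + 2) * r ^ n + 4 * gap * (of_nat n * r ^ n)" by (simp add: Dn_def algebra_simps)
    finally show ?thesis .
  qed
  ultimately have "qq \<longlonglongrightarrow> 2 * (4 * (C1 + \<rho> + 2) * 0 + 4 * gap * 0) ^ d" by presburger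
  moreover have "2 * (4 * (C1 + \<rho> + 2) * 0 + 4 * gap * 0) ^ d = 0" using d by simp
  ultimately show ?thesis by (simp only:)
qed

abbreviation PP :: "('a \<times> real) set measure" where "PP \<equiv> distr WW sphere_config_space cfg"

lemma PP_prob: "prob_space PP" by (rule WW.prob_space_distr[OF cfg_measurable])

lemma PP_hard: "hard_sphere_process PP"
  unfolding hard_sphere_process_def
proof (rule AE_distr_iff[OF cfg_measurable, THEN iffD2])
  show "{S\<in>space sphere_config_space. \<forall>p\<in>S. \<forall>q\<in>S. p \<noteq> q \<longrightarrow> dist (fst p) (fst q) \<ge> snd p + snd q} \<in> sets (sphere_config_space :: ('a \<times> real) set measure)"
    using hard_event unfolding space_config .
  show "AE W in WW. \<forall>p\<in>cfg W. \<forall>q\<in>cfg W. p \<noteq> q \<longrightarrow> dist (fst p) (fst q) \<ge> snd p + snd q"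
    using cfg_hard by (intro AE_I2) blast
qed

lemma PP_radius: "AE S in PP. \<forall>p\<in>S. snd p \<le> 51/50"
proof (rule AE_distr_iff[OF cfg_measurable, THEN iffD2])
  show "{S\<in>space sphere_config_space. \<forall>p\<in>S. snd p \<le> 51/50} \<in> sets (sphere_config_space :: ('a \<times> real) set measure)"
    using radius_event unfolding space_config .
  show "AE W in WW. \<forall>p\<in>cfg W. snd p \<le> 51/50"
    using rr_bounds(2) by (intro AE_I2) (auto simp: cfg_def)
qed

text \<open>Groups of two strips suffice: 2 * (1/2) ^ 2 = 1/2, so almost surely not every pair of a
  group and a site is bad, and a single good strip already yields an unbounded cluster.\<close>

lemma PP_percolates: "AE S in PP. percolates S"
proof (rule AE_distr_iff[OF cfg_measurable, THEN iffD2])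
  show "{S\<in>space sphere_config_space. percolates S} \<in> sets (sphere_config_space :: ('a \<times> real) set measure)"
    using percolates_event unfolding space_config .
  show "AE W in WW. percolates (cfg W)"
    using few_bad[of 2]
  proof eventually_elim
    case (elim W)
    then obtain N where N: "(\<Sum>g\<in>Gs N. nbad N (grp 2 g) W) < 2 * (1/2) ^ 2 * real (card (Gs N)) * real (card (Zs N))"
      unfolding eventually_sequentially by blast
    have "2 * (1/2) ^ 2 * real (card (Gs N)) * real (card (Zs N)) \<le> real (card (Gs N)) * real (card (Zs N))" by (simp add: power2_eq_square)
    also have "\<dots> = (\<Sum>g\<in>Gs N. \<Sum>z\<in>Zs N. 1)" by simp
    finally have lt: "(\<Sum>g\<in>Gs N. nbad N (grp 2 g) W) < (\<Sum>g\<in>Gs N. \<Sum>z\<in>Zs N. 1)" using N by linarith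
    have "\<exists>g\<in>Gs N. \<exists>z\<in>Zs N. \<not> badg (grp 2 g) z W"
    proof (rule ccontr)
      assume c: "\<not> ?thesis"
      have "(\<Sum>g\<in>Gs N. nbad N (grp 2 g) W) = (\<Sum>g\<in>Gs N. \<Sum>z\<in>Zs N. 1)"
        unfolding nbad_def by (intro sum.cong refl) (use c in auto)
      then show False using lt by simp
    qed
    then obtain g z k where g: "g \<in> Gs N" "k \<in> grp 2 g" "W k \<in> good z" unfolding badg_def by blast
    have kK: "k \<in> KK" using g(1,2) Gs(3)[of N] grp_KK by blast
    obtain p where "p \<in> cfg W" "unb (cfg W) p" by (rule good_cluster[where k=k and W=W and z=z, OF kK g(3)])
    then show ?case unfolding percolates_iff_unb[OF cfg_configs] by blast
  qed
qed

text \<open>For a >= Dn n the lower density is almost surely at least 1 - qq n, so its mean lies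
  between this and 1. Measurability in the configuration is essential here for the integral to have
  its intended value.\<close>

lemma PP_density: "((\<lambda>a::real. integral\<^sup>L PP (\<lambda>S. lower_density (nbhd (unbounded_clusters S) a))) \<longlongrightarrow> 1) at_top"
proof (rule tendstoI)
  interpret PP: prob_space PP by (rule PP_prob)
  define f where "f a S = lower_density (nbhd (unbounded_clusters S) a)" for a :: real and S :: "('a \<times> real) set"
  have fm: "f a \<in> borel_measurable sphere_config_space" if "0 < a" for a
    unfolding f_def by (rule measurable_lower_density[OF that])
  have bd: "0 \<le> f a S" "f a S \<le> 1" for a S
  proof -
    have "open (nbhd (unbounded_clusters S) a)" unfolding nbhd_def by (intro open_UN) auto
    then have "nbhd (unbounded_clusters S) a \<in> sets lebesgue" by simp
    then show "0 \<le> f a S" "f a S \<le> 1" unfolding f_def by (rule lower_density_ge_0, rule lower_density_le_1)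
  qed
  have int: "integrable PP (f a)" if "0 < a" for a
    by (rule PP.integrable_const_bound[where B=1]) (use bd fm[OF that] in auto)
  fix e :: real assume e: "0 < e"
  have "eventually (\<lambda>n. qq n < e) sequentially" by (rule order_tendstoD(2)[OF qq_lim e])
  then have "eventually (\<lambda>n. qq n < e \<and> 0 < n) sequentially" using eventually_gt_at_top[of 0] by eventually_elim simp
  then obtain n where n: "qq n < e" "0 < n" using eventually_happens by fastforce
  have "dist (integral\<^sup>L PP (f a)) 1 < e" if a: "Dn n \<le> a" for a
  proof -
    have a0: "0 < a" using Dn_pos[of n] a by linarith
    have "AE S in PP. 1 - qq n \<le> f a S"
    proof (rule AE_distr_iff[OF cfg_measurable, THEN iffD2])
      show "{S\<in>space sphere_config_space. 1 - qq n \<le> f a S} \<in> sets (sphere_config_space :: ('a \<times> real) set measure)"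
        using fm[OF a0] by measurable
      show "AE W in WW. 1 - qq n \<le> f a (cfg W)"
        using few_bad[of n]
      proof eventually_elim
        case (elim W)
        show ?case unfolding f_def by (rule halo_dense[OF n(2) elim a])
      qed
    qed
    then have "1 - qq n \<le> integral\<^sup>L PP (f a)" by (rule PP.integral_ge_const[OF int[OF a0]])
    moreover have "integral\<^sup>L PP (f a) \<le> 1" by (rule PP.integral_le_const[OF int[OF a0]]) (use bd in auto)
    ultimately show ?thesis using n(1) by (simp add: dist_real_def)
  qed
  then show "eventually (\<lambda>a. dist (integral\<^sup>L PP (\<lambda>S. lower_density (nbhd (unbounded_clusters S) a))) 1 < e) at_top"
    unfolding eventually_at_top_linorder f_def by blast
qed

end

theorem theorem2:
  assumes "CARD('n::finite) \<ge> 45"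
  shows "\<exists>P :: ((real^'n) \<times> real) set measure.
           prob_space P \<and> sets P = sets sphere_config_space \<and>
           poisson_sphere_process P \<and> hard_sphere_process P \<and>
           (AE S in P. percolates S) \<and>
           ((\<lambda>a::real. integral\<^sup>L P (\<lambda>S. lower_density (nbhd (unbounded_clusters S) a))) \<longlongrightarrow> 1) at_top \<and>
           (\<exists>K::real. AE S in P. \<forall>p\<in>S. snd p \<le> K)"
proof -
  have dim: "45 \<le> DIM(real^'n)" using assms by simp
  then have "\<not> card (Basis :: (real^'n) set) \<le> 1" by simp
  then obtain c1 c2 :: "real^'n" where c: "c1 \<in> Basis" "c2 \<in> Basis" "c1 \<noteq> c2"
    using card_le_Suc0_iff_eq[of "Basis :: (real^'n) set"] by auto
  interpret plane c1 c2 by (unfold_locales) (use c dim in auto)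
  obtain \<rho> lam :: real where rl: "0 < \<rho>" "0 < lam" "lam * measure lborel (ball (0::real^'n) (51/50)) \<le> 11/100000"
    "\<And>c c' x r. (12128/10000)\<^sup>2 \<le> ((c' - c) \<bullet> c1)\<^sup>2 + ((c' - c) \<bullet> c2)\<^sup>2 \<Longrightarrow>
      ((c' - c) \<bullet> c1)\<^sup>2 + ((c' - c) \<bullet> c2)\<^sup>2 \<le> (1214/1000)\<^sup>2 \<Longrightarrow> nT (c' - c) = 0 \<Longrightarrow> x \<in> cell \<rho> c \<Longrightarrow>
      49/50 \<le> r \<Longrightarrow> r \<le> 51/50 \<Longrightarrow>
      16 \<le> lam * measure lborel {y\<in>cell \<rho> c'. 49/50 \<le> dist x y - r \<and> dist x y - r \<le> 51/50}"
    using cell_constants by blast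
  interpret slab c1 c2 \<rho> lam
    by (intro slab.intro slab_axioms.intro plane_axioms) (rule rl(1), rule rl(2), rule rl(3), rule rl(4))
  show ?thesis
  proof (intro exI[of _ PP] conjI)
    show "\<exists>K. AE S in PP. \<forall>p\<in>S. snd p \<le> K" by (rule exI[of _ "51/50"]) (rule PP_radius)
    show "sets PP = sets sphere_config_space" by simp
  qed (rule PP_prob cfg_poisson PP_hard PP_percolates PP_density)+
qed

end
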